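(* Let $\Gamma$ be an arbitrary Brauer tree and let $A_\Gamma$ be a basic Brauer tree algebra whose tree is $\Gamma$. Up to graded Morita equivalence and rescaling there is a unique grading on $A_\Gamma$.
   Context: $k$ is an algebraically closed field of positive characteristic; algebras are finite dimensional over $k$, modules are left modules. A Brauer tree $\Gamma$ of type $(m,n)$ is a finite connected tree with $n$ edges, with a cyclic ordering of the edges adjacent to each vertex (counter-clockwise in a planar embedding), and a distinguished exceptional vertex with multiplicity a positive integer $m$. A symmetric algebra is a Brauer tree algebra of $\Gamma$ if its simple modules $S_j$ correspond to the edges $j$ of $\Gamma$ and, for the projective cover $P_j$ of $S_j$, $\mathrm{rad}\,P_j/\mathrm{soc}\,P_j$ is a direct sum of two (possibly zero) uniserial modules $U_v,U_w$, where $v,w$ are the vertices of $j$, and for $u\in\{v,w\}$ with cyclic ordering $j=j_0,j_1,\dots,j_r$ of the edges at $u$ the composition factors of $U_u$ from the top are $S_{j_1},\dots,S_{j_r},S_{j_0},S_{j_1},\dots$, ending with $S_{j_r}$, of total number $m(r+1)-1$ if $u$ is exceptional and $r$ otherwise. $A_\Gamma$ is the basic Brauer tree algebra of $\Gamma$ over $k$. A grading on an algebra $A$ is a decomposition $A=\bigoplus_{i\in\mathbb Z}A_i$ with $A_iA_j\subseteq A_{i+j}$; gradings correspond to homomorphisms of algebraic groups $\pi:\mathbf G_m\to\mathrm{Aut}(A)$, where $x\in\mathbf G_m=k^*$ acts on $A_i$ as multiplication by $x^i$, and one writes $(A,\pi)$. Let $P_1,\dots,P_r$ be the projective indecomposable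 $A$-modules up to isomorphism, graded with tops in degree $0$. Two gradings $(A,\pi)$ and $(A,\pi')$ of a basic algebra $A$ are graded Morita equivalent if there are integers $d_1,\dots,d_r$ such that the graded algebras $(A,\pi')$ and $\mathrm{Endgr}_{(A,\pi)}(\bigoplus_{i=1}^r P_i\langle d_i\rangle)^{op}$ are isomorphic; here $M\langle d\rangle_j=M_{d+j}$ and $\mathrm{Endgr}(M)=\bigoplus_{l\in\mathbb Z}\mathrm{Hom}(M,M\langle l\rangle)$, with $\mathrm{Hom}$ the degree-preserving homomorphisms. Rescaling means dividing each degree by the same integer.
   Formalization: Uniqueness is stated for gradings not graded Morita equivalent to the trivial grading (everything in degree 0), which rescaling cannot make nontrivial; such a nontrivial grading is shown to exist, and rescaling may divide by a negative integer. *)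

theory Defs
  imports
    "HOL-Algebra.Module"
    "HOL-Algebra.QuotRing"
    "HOL-Combinatorics.Orbits"
    "HOL-Computational_Algebra.Polynomial"
begin

section \<open>Brauer trees\<close>

text \<open>Edges are two-element sets of vertices (a tree has no multiple edges). The cyclic ordering of
  the edges at \<open>v\<close> is given by the successor map \<open>next_edge \<Gamma> v\<close>.\<close>

record 'v brauer_tree =
  vertices :: "'v set"
  edges :: "'v set set"
  next_edge :: "'v \<Rightarrow> 'v set \<Rightarrow> 'v set"
  exceptional :: 'v
  multiplicity :: nat

definition incident :: "'v brauer_tree \<Rightarrow> 'v \<Rightarrow> 'v set set" where
  "incident \<Gamma> v = {e \<in> edges \<Gamma>. v \<in> e}"

definition walk :: "'v brauer_tree \<Rightarrow> 'v list \<Rightarrow> bool" where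
  "walk \<Gamma> p \<longleftrightarrow> p \<noteq> [] \<and> set p \<subseteq> vertices \<Gamma> \<and> successively (\<lambda>x y. {x, y} \<in> edges \<Gamma>) p"

definition graph_cycle :: "'v brauer_tree \<Rightarrow> 'v list \<Rightarrow> bool" where
  "graph_cycle \<Gamma> p \<longleftrightarrow> walk \<Gamma> p \<and> distinct p \<and> length p \<ge> 3 \<and> {last p, hd p} \<in> edges \<Gamma>"

locale brauer_tree =
  fixes \<Gamma> :: "'v brauer_tree"
  assumes finite_vertices: "finite (vertices \<Gamma>)"
    and edges_nonempty: "edges \<Gamma> \<noteq> {}"
    and edge_ends: "e \<in> edges \<Gamma> \<Longrightarrow>
      \<exists>v w. v \<in> vertices \<Gamma> \<and> w \<in> vertices \<Gamma> \<and> v \<noteq> w \<and> e = {v, w}"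
    and connected: "\<lbrakk>v \<in> vertices \<Gamma>; w \<in> vertices \<Gamma>\<rbrakk> \<Longrightarrow> \<exists>p. walk \<Gamma> p \<and> hd p = v \<and> last p = w"
    and acyclic: "\<not> graph_cycle \<Gamma> p"
    and cyclic_ordering: "v \<in> vertices \<Gamma> \<Longrightarrow> cyclic_on (next_edge \<Gamma> v) (incident \<Gamma> v)"
    and exceptional_vertex: "exceptional \<Gamma> \<in> vertices \<Gamma>"
    and multiplicity_pos: "multiplicity \<Gamma> \<ge> 1"

definition vertex_mult :: "'v brauer_tree \<Rightarrow> 'v \<Rightarrow> nat" where
  "vertex_mult \<Gamma> u = (if u = exceptional \<Gamma> then multiplicity \<Gamma> else 1)"

text \<open>If \<open>j = j\<^sub>0, j\<^sub>1, \<dots>, j\<^sub>r\<close> is the cyclic ordering at \<open>u\<close> (so that \<open>u\<close> has valency \<open>r + 1\<close>), this is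
  the list \<open>j\<^sub>1, \<dots>, j\<^sub>r, j\<^sub>0, j\<^sub>1, \<dots>, j\<^sub>r\<close> of length \<open>m (r + 1) - 1\<close>, with \<open>m = 1\<close> unless \<open>u\<close> is
  exceptional.\<close>

definition factor_edges :: "'v brauer_tree \<Rightarrow> 'v set \<Rightarrow> 'v \<Rightarrow> 'v set list" where
  "factor_edges \<Gamma> j u =
     map (\<lambda>i. (next_edge \<Gamma> u ^^ i) j) [1..<vertex_mult \<Gamma> u * card (incident \<Gamma> u)]"


section \<open>Left modules\<close>

text \<open>The library's \<open>module\<close> locale needs a commutative ring of scalars, so left modules are
  introduced here, reusing the library's record. Its fields \<open>mult\<close> and \<open>one\<close> carry no meaning for
  a module.\<close>

locale left_module = abelian_group M for M :: "('a::ring_1, 'b) module" (structure) +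
  assumes smult_closed: "x \<in> carrier M \<Longrightarrow> a \<odot> x \<in> carrier M"
    and smult_l_distr: "x \<in> carrier M \<Longrightarrow> (a + b) \<odot> x = a \<odot> x \<oplus> b \<odot> x"
    and smult_r_distr: "\<lbrakk>x \<in> carrier M; y \<in> carrier M\<rbrakk> \<Longrightarrow> a \<odot> (x \<oplus> y) = a \<odot> x \<oplus> a \<odot> y"
    and smult_assoc: "x \<in> carrier M \<Longrightarrow> (a * b) \<odot> x = a \<odot> (b \<odot> x)"
    and smult_one: "x \<in> carrier M \<Longrightarrow> 1 \<odot> x = x"

definition regular_module :: "('a::ring_1, 'a) module" where
  "regular_module = \<lparr>carrier = UNIV, monoid.mult = undefined, one = undefined,
     zero = 0, add = (+), module.smult = (*)\<rparr>"

definition submod :: "'b set \<Rightarrow> ('a, 'b) module \<Rightarrow> bool" where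
  "submod N M \<longleftrightarrow> additive_subgroup N M \<and> (\<forall>a. \<forall>x\<in>N. a \<odot>\<^bsub>M\<^esub> x \<in> N)"

definition restr :: "('a, 'b) module \<Rightarrow> 'b set \<Rightarrow> ('a, 'b) module" where
  "restr M N = M\<lparr>carrier := N\<rparr>"

definition quot :: "('a, 'b) module \<Rightarrow> 'b set \<Rightarrow> ('a, 'b set) module" where
  "quot M N = \<lparr>carrier = a_rcosets\<^bsub>M\<^esub> N, monoid.mult = undefined, one = undefined,
     zero = N, add = set_add M, module.smult = (\<lambda>a X. \<Union>x\<in>X. N +>\<^bsub>M\<^esub> (a \<odot>\<^bsub>M\<^esub> x))\<rparr>"

definition mod_hom :: "('a, 'b) module \<Rightarrow> ('a, 'c) module \<Rightarrow> ('b \<Rightarrow> 'c) set" where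
  "mod_hom M N = {f \<in> carrier M \<rightarrow> carrier N.
     (\<forall>x\<in>carrier M. \<forall>y\<in>carrier M. f (x \<oplus>\<^bsub>M\<^esub> y) = f x \<oplus>\<^bsub>N\<^esub> f y) \<and>
     (\<forall>a. \<forall>x\<in>carrier M. f (a \<odot>\<^bsub>M\<^esub> x) = a \<odot>\<^bsub>N\<^esub> f x)}"

definition mod_iso :: "('a, 'b) module \<Rightarrow> ('a, 'c) module \<Rightarrow> bool" where
  "mod_iso M N \<longleftrightarrow> (\<exists>f\<in>mod_hom M N. bij_betw f (carrier M) (carrier N))"

definition simple_mod :: "('a::ring_1, 'b) module \<Rightarrow> bool" where
  "simple_mod M \<longleftrightarrow> left_module M \<and> carrier M \<noteq> {\<zero>\<^bsub>M\<^esub>} \<and>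
     (\<forall>N. submod N M \<longrightarrow> N = {\<zero>\<^bsub>M\<^esub>} \<or> N = carrier M)"

definition maximal_submod :: "'b set \<Rightarrow> ('a, 'b) module \<Rightarrow> bool" where
  "maximal_submod N M \<longleftrightarrow> submod N M \<and> N \<noteq> carrier M \<and>
     (\<forall>N'. submod N' M \<and> N \<subseteq> N' \<longrightarrow> N' = N \<or> N' = carrier M)"

definition mod_rad :: "('a, 'b) module \<Rightarrow> 'b set" where
  "mod_rad M = carrier M \<inter> \<Inter>{N. maximal_submod N M}"

text \<open>The sum of all simple submodules, i.e. the smallest submodule containing them.\<close>

definition mod_soc :: "('a::ring_1, 'b) module \<Rightarrow> 'b set" where
  "mod_soc M = \<Inter>{N. submod N M \<and> (\<forall>T. submod T M \<and> simple_mod (restr M T) \<longrightarrow> T \<subseteq> N)}"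

definition internal_direct_sum :: "('a, 'b) module \<Rightarrow> 'b set \<Rightarrow> 'b set \<Rightarrow> bool" where
  "internal_direct_sum M U W \<longleftrightarrow> submod U M \<and> submod W M \<and>
     U <+>\<^bsub>M\<^esub> W = carrier M \<and> U \<inter> W = {\<zero>\<^bsub>M\<^esub>}"

text \<open>The zero module is uniserial.\<close>

definition uniserial :: "('a::ring_1, 'b) module \<Rightarrow> bool" where
  "uniserial M \<longleftrightarrow> left_module M \<and>
     (\<forall>N N'. submod N M \<and> submod N' M \<longrightarrow> N \<subseteq> N' \<or> N' \<subseteq> N)"

definition composition_factors_from_top ::
  "('a, 'b) module \<Rightarrow> ('a, 'c) module list \<Rightarrow> bool" where
  "composition_factors_from_top M Ts \<longleftrightarrow>
     (\<exists>C. C 0 = carrier M \<and> C (length Ts) = {\<zero>\<^bsub>M\<^esub>} \<and> (\<forall>i\<le>length Ts. submod (C i) M) \<and>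
       (\<forall>i<length Ts. C (Suc i) \<subseteq> C i \<and> mod_iso (quot (restr M (C i)) (C (Suc i))) (Ts ! i)))"

definition direct_sum :: "nat \<Rightarrow> (nat \<Rightarrow> ('a, 'b) module) \<Rightarrow> ('a, nat \<Rightarrow> 'b) module" where
  "direct_sum r M = \<lparr>carrier = (\<Pi>\<^sub>E i\<in>{..<r}. carrier (M i)),
     monoid.mult = undefined, one = undefined,
     zero = (\<lambda>i\<in>{..<r}. \<zero>\<^bsub>M i\<^esub>),
     add = (\<lambda>x y. \<lambda>i\<in>{..<r}. x i \<oplus>\<^bsub>M i\<^esub> y i),
     module.smult = (\<lambda>a x. \<lambda>i\<in>{..<r}. a \<odot>\<^bsub>M i\<^esub> x i)\<rparr>"

text \<open>Finitely generated projective modules: direct summands of free modules of finite rank.\<close>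

definition projective :: "('a::ring_1, 'b) module \<Rightarrow> bool" where
  "projective P \<longleftrightarrow> left_module P \<and>
     (\<exists>n U W. internal_direct_sum (direct_sum n (\<lambda>_. regular_module)) U W \<and>
       mod_iso P (restr (direct_sum n (\<lambda>_. regular_module)) U))"

definition indecomposable :: "('a::ring_1, 'b) module \<Rightarrow> bool" where
  "indecomposable M \<longleftrightarrow> left_module M \<and> carrier M \<noteq> {\<zero>\<^bsub>M\<^esub>} \<and>
     (\<forall>U W. internal_direct_sum M U W \<longrightarrow> U = {\<zero>\<^bsub>M\<^esub>} \<or> W = {\<zero>\<^bsub>M\<^esub>})"

definition projective_cover :: "('a::ring_1, 'b) module \<Rightarrow> ('a, 'c) module \<Rightarrow> bool" where
  "projective_cover P S \<longleftrightarrow> projective P \<and>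
     (\<exists>f\<in>mod_hom P S. f ` carrier P = carrier S \<and>
       (\<forall>N. submod N P \<and> N <+>\<^bsub>P\<^esub> a_kernel P S f = carrier P \<longrightarrow> N = carrier P))"

text \<open>Every projective indecomposable module over a finite dimensional algebra is isomorphic to a
  left ideal, so it is enough to list those whose carrier consists of ring elements.\<close>

definition projective_indecomposables :: "nat \<Rightarrow> (nat \<Rightarrow> ('a::ring_1, 'a) module) \<Rightarrow> bool" where
  "projective_indecomposables r P \<longleftrightarrow>
     (\<forall>i<r. projective (P i) \<and> indecomposable (P i)) \<and>
     (\<forall>i<r. \<forall>j<r. mod_iso (P i) (P j) \<longrightarrow> i = j) \<and>
     (\<forall>Q :: ('a, 'a) module. projective Q \<and> indecomposable Q \<longrightarrow> (\<exists>i<r. mod_iso Q (P i)))"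


section \<open>Brauer tree algebras\<close>

locale fd_algebra = vector_space scale
  for scale :: "'k::field \<Rightarrow> 'a::ring_1 \<Rightarrow> 'a" +
  assumes scale_mult_left: "scale c x * y = scale c (x * y)"
    and scale_mult_right: "x * scale c y = scale c (x * y)"
    and finite_dimensional: "\<exists>B. finite B \<and> span B = UNIV"

text \<open>\<open>A\<close> is isomorphic, as a bimodule, to its \<open>k\<close>-dual with \<open>(a f b) y = f (b y a)\<close>.\<close>

definition symmetric_algebra :: "('k::field \<Rightarrow> 'a::ring_1 \<Rightarrow> 'a) \<Rightarrow> bool" where
  "symmetric_algebra scale \<longleftrightarrow> fd_algebra scale \<and>
     (\<exists>\<psi>. bij_betw \<psi> UNIV {f. Vector_Spaces.linear scale (*) f} \<and>
       (\<forall>x y z. \<psi> (x + y) z = \<psi> x z + \<psi> y z) \<and>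
       (\<forall>c x y. \<psi> (scale c x) y = c * \<psi> x y) \<and>
       (\<forall>a x b y. \<psi> (a * x * b) y = \<psi> x (b * y * a)))"

text \<open>In the regular module every indecomposable summand occurs with multiplicity one.\<close>

definition basic_algebra :: "('k::field \<Rightarrow> 'a::ring_1 \<Rightarrow> 'a) \<Rightarrow> bool" where
  "basic_algebra scale \<longleftrightarrow> fd_algebra scale \<and>
     (\<exists>r (P :: nat \<Rightarrow> ('a, 'a) module). (\<forall>i<r. indecomposable (P i)) \<and>
       (\<forall>i<r. \<forall>j<r. mod_iso (P i) (P j) \<longrightarrow> i = j) \<and>
       mod_iso (regular_module :: ('a, 'a) module) (direct_sum r P))"

text \<open>A simple module is isomorphic to a quotient of the regular module, hence to one whose carrier
  consists of subsets of the algebra. The condition \<open>mod_soc (P j) \<subseteq> mod_rad (P j)\<close> makes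
  \<open>rad P\<^sub>j / soc P\<^sub>j\<close> meaningful; it excludes simple projectives, i.e. only the field itself in the
  case of one edge and multiplicity one.\<close>

definition brauer_tree_algebra ::
  "('k::field \<Rightarrow> 'a::ring_1 \<Rightarrow> 'a) \<Rightarrow> 'v brauer_tree \<Rightarrow> bool" where
  "brauer_tree_algebra scale \<Gamma> \<longleftrightarrow> symmetric_algebra scale \<and>
     (\<exists>(S :: 'v set \<Rightarrow> ('a, 'a set) module) (P :: 'v set \<Rightarrow> ('a, 'a) module).
       (\<forall>j\<in>edges \<Gamma>. simple_mod (S j)) \<and>
       (\<forall>i\<in>edges \<Gamma>. \<forall>j\<in>edges \<Gamma>. mod_iso (S i) (S j) \<longrightarrow> i = j) \<and>
       (\<forall>T :: ('a, 'a set) module. simple_mod T \<longrightarrow> (\<exists>j\<in>edges \<Gamma>. mod_iso T (S j))) \<and>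
       (\<forall>j\<in>edges \<Gamma>. projective_cover (P j) (S j) \<and> mod_soc (P j) \<subseteq> mod_rad (P j) \<and>
         (let H = quot (restr (P j) (mod_rad (P j))) (mod_soc (P j)) in
          \<forall>v w. j = {v, w} \<longrightarrow>
            (\<exists>U. internal_direct_sum H (U v) (U w) \<and>
              (\<forall>u\<in>{v, w}. uniserial (restr H (U u)) \<and>
                composition_factors_from_top (restr H (U u)) (map S (factor_edges \<Gamma> j u)))))))"


section \<open>Gradings and graded Morita equivalence\<close>

definition grading :: "('k::field \<Rightarrow> 'a::ring_1 \<Rightarrow> 'a) \<Rightarrow> (int \<Rightarrow> 'a set) \<Rightarrow> bool" where
  "grading scale G \<longleftrightarrow> (\<forall>i. module.subspace scale (G i)) \<and>
     (\<forall>x. \<exists>!f. (\<forall>i. f i \<in> G i) \<and> finite {i. f i \<noteq> 0} \<and> x = (\<Sum>i | f i \<noteq> 0. f i)) \<and>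
     (\<forall>i j. \<forall>x\<in>G i. \<forall>y\<in>G j. x * y \<in> G (i + j))"

definition trivial_grading :: "int \<Rightarrow> 'a::zero set" where
  "trivial_grading i = (if i = 0 then UNIV else {0})"

text \<open>Gradings of a left module over an algebra graded by \<open>G\<close>.\<close>

definition module_grading ::
  "(int \<Rightarrow> 'a set) \<Rightarrow> ('a::ring_1, 'b) module \<Rightarrow> (int \<Rightarrow> 'b set) \<Rightarrow> bool" where
  "module_grading G M Q \<longleftrightarrow> left_module M \<and> (\<forall>i. additive_subgroup (Q i) M) \<and>
     (\<forall>x\<in>carrier M. \<exists>!f. (\<forall>i. f i \<in> Q i) \<and> finite {i. f i \<noteq> \<zero>\<^bsub>M\<^esub>} \<and>
        x = (\<Oplus>\<^bsub>M\<^esub>i\<in>{i. f i \<noteq> \<zero>\<^bsub>M\<^esub>}. f i)) \<and>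
     (\<forall>i j. \<forall>a\<in>G i. \<forall>x\<in>Q j. a \<odot>\<^bsub>M\<^esub> x \<in> Q (i + j))"

text \<open>The degree \<open>j\<close> part of the top \<open>M / rad M\<close> is the image of \<open>Q j\<close>.\<close>

definition top_in_degree_0 :: "('a, 'b) module \<Rightarrow> (int \<Rightarrow> 'b set) \<Rightarrow> bool" where
  "top_in_degree_0 M Q \<longleftrightarrow> (\<forall>j. j \<noteq> 0 \<longrightarrow> Q j \<subseteq> mod_rad M)"

definition shift :: "(int \<Rightarrow> 'b set) \<Rightarrow> int \<Rightarrow> int \<Rightarrow> 'b set" where
  "shift Q d j = Q (d + j)"

definition direct_sum_grading :: "nat \<Rightarrow> (nat \<Rightarrow> int \<Rightarrow> 'b set) \<Rightarrow> int \<Rightarrow> (nat \<Rightarrow> 'b) set" where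
  "direct_sum_grading r Q j = (\<Pi>\<^sub>E i\<in>{..<r}. Q i j)"

definition graded_hom ::
  "('a, 'b) module \<Rightarrow> (int \<Rightarrow> 'b set) \<Rightarrow> ('a, 'c) module \<Rightarrow> (int \<Rightarrow> 'c set) \<Rightarrow> ('b \<Rightarrow> 'c) set" where
  "graded_hom M Q N R = {f \<in> mod_hom M N \<inter> extensional (carrier M). \<forall>j. f ` Q j \<subseteq> R j}"

text \<open>The sum of the spaces \<open>Hom(M, M\<langle>l\<rangle>)\<close> is formed inside the endomorphism algebra of the
  ungraded module \<open>M\<close>, where it is direct.\<close>

definition endgr ::
  "('k \<Rightarrow> 'a \<Rightarrow> 'a) \<Rightarrow> ('a::ring_1, 'b) module \<Rightarrow> (int \<Rightarrow> 'b set) \<Rightarrow> ('k, 'b \<Rightarrow> 'b) module" where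
  "endgr scale M Q = \<lparr>
     carrier = {f \<in> mod_hom M M \<inter> extensional (carrier M).
       \<exists>L h. finite L \<and> (\<forall>l\<in>L. h l \<in> graded_hom M Q M (shift Q l)) \<and>
         (\<forall>x\<in>carrier M. f x = (\<Oplus>\<^bsub>M\<^esub>l\<in>L. h l x))},
     monoid.mult = compose (carrier M),
     one = (\<lambda>x\<in>carrier M. x),
     zero = (\<lambda>x\<in>carrier M. \<zero>\<^bsub>M\<^esub>),
     add = (\<lambda>f g. \<lambda>x\<in>carrier M. f x \<oplus>\<^bsub>M\<^esub> g x),
     module.smult = (\<lambda>c f. \<lambda>x\<in>carrier M. scale c 1 \<odot>\<^bsub>M\<^esub> f x)\<rparr>"

definition endgr_degree :: "('a, 'b) module \<Rightarrow> (int \<Rightarrow> 'b set) \<Rightarrow> int \<Rightarrow> ('b \<Rightarrow> 'b) set" where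
  "endgr_degree M Q l = graded_hom M Q M (shift Q l)"

definition op_algebra :: "('k, 'b) module \<Rightarrow> ('k, 'b) module" where
  "op_algebra E = E\<lparr>monoid.mult := (\<lambda>x y. y \<otimes>\<^bsub>E\<^esub> x)\<rparr>"

definition algebra_of :: "('k \<Rightarrow> 'a::ring_1 \<Rightarrow> 'a) \<Rightarrow> ('k, 'a) module" where
  "algebra_of scale = \<lparr>carrier = UNIV, monoid.mult = (*), one = 1, zero = 0, add = (+),
     module.smult = scale\<rparr>"

definition graded_algebra_iso ::
  "('k, 'b) module \<Rightarrow> (int \<Rightarrow> 'b set) \<Rightarrow> ('k, 'c) module \<Rightarrow> (int \<Rightarrow> 'c set) \<Rightarrow> bool" where
  "graded_algebra_iso A G B H \<longleftrightarrow>
     (\<exists>\<phi>\<in>ring_iso A B. (\<forall>c. \<forall>x\<in>carrier A. \<phi> (c \<odot>\<^bsub>A\<^esub> x) = c \<odot>\<^bsub>B\<^esub> \<phi> x) \<and> (\<forall>l. \<phi> ` G l = H l))"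

definition graded_morita_equivalent ::
  "('k::field \<Rightarrow> 'a::ring_1 \<Rightarrow> 'a) \<Rightarrow> (int \<Rightarrow> 'a set) \<Rightarrow> (int \<Rightarrow> 'a set) \<Rightarrow> bool" where
  "graded_morita_equivalent scale G G' \<longleftrightarrow>
     (\<exists>r (P :: nat \<Rightarrow> ('a, 'a) module) Q (d :: nat \<Rightarrow> int).
       projective_indecomposables r P \<and>
       (\<forall>i<r. module_grading G (P i) (Q i) \<and> top_in_degree_0 (P i) (Q i)) \<and>
       (let M = direct_sum r P; R = direct_sum_grading r (\<lambda>i. shift (Q i) (d i)) in
        graded_algebra_iso (algebra_of scale) G'
          (op_algebra (endgr scale M R)) (endgr_degree M R)))"

text \<open>\<open>G\<^sub>0\<close> arises from \<open>G\<close> by dividing each degree by the integer \<open>c\<close>.\<close>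

definition rescaling :: "int \<Rightarrow> (int \<Rightarrow> 'a::zero set) \<Rightarrow> (int \<Rightarrow> 'a set) \<Rightarrow> bool" where
  "rescaling c G G\<^sub>0 \<longleftrightarrow> c \<noteq> 0 \<and> (\<forall>i. \<not> c dvd i \<longrightarrow> G i = {0}) \<and> (\<forall>i. G\<^sub>0 i = G (c * i))"

end

theory Submission
  imports Defs
begin

text \<open>
  Homogeneous elements of nonzero degree are nilpotent, so the primitive idempotents can be chosen
  in degree \<open>0\<close>, and then also the arrows of the quiver, one for every pair of a
  vertex and an edge at it, can be chosen homogeneous. The paths around the vertices form a basis,
  and after rescaling the arrows the multiplication table depends on the tree alone; hence two
  gradings whose arrows have the same degrees differ by an automorphism. At an edge the two maximal
  paths around its endpoints span the same socle, so the degree of a full turn is a constant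
  \<open>c\<close> around the exceptional vertex and \<open>m * c\<close> around every other vertex. Since the graph
  is a tree, the degrees of the arrows are determined by \<open>c\<close> up to shifting the projective
  modules, that is, up to graded Morita equivalence, and they are \<open>c\<close> times those for
  \<open>c = 1\<close>. The last grading is not equivalent to the trivial one because the socle has
  degree \<open>m\<close>, which no shift changes.
\<close>


section \<open>Idempotents in finite dimensional algebras\<close>

text \<open>The definition of a Brauer tree algebra speaks of abstract modules up to isomorphism,
  and the submodules it provides need not be homogeneous. Everything is therefore turned into left
  ideals. Algebraic closedness makes the algebra modulo its radical a product of copies of the
  field, recorded by characters \<chi>; projective covers become ideals \<open>A e\<close>, and
  their uniserial pieces become chains of left ideals between socle and radical. Homogeneous
  components are located in these chains through idempotents. That this suffices, and that products
  of arrows around different vertices vanish, rests on one fact: an edge recurs before the end of a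
  maximal path only around an exceptional vertex of multiplicity above 1, and there is at most one
  such vertex. The symmetrizing form makes the socle explicit by elements representing the
  characters; its symmetry shows that the maximal paths around one vertex have a common socle
  coefficient, which a root of suitable order removes. The trivial grading belongs to
  \<open>c = 0\<close>, where division by \<open>c\<close> is impossible; hence its exclusion in the
  statement.\<close>

context fd_algebra
begin

lemma ex_finite_basis: "\<exists>B. finite B \<and> independent B \<and> span B = UNIV"
proof -
  obtain C where C: "finite C" "span C = UNIV" using finite_dimensional by blast
  obtain B where B: "B \<subseteq> C" "independent B" "C \<subseteq> span B"
    using maximal_independent_subset[of C] by blast
  have "span C \<subseteq> span B" using B(3) by (rule span_minimal) simp
  moreover have "finite B" using B(1) C(1) by (rule finite_subset)
  ultimately show ?thesis using B(2) C(2) by auto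
qed

text \<open>One basis is fixed because \<open>finite_dimensional_vector_space\<close> takes it as a
  parameter; the sublocale relation below then makes \<open>dim\<close> available.\<close>

definition fd_basis :: "'a set" where
  "fd_basis = (SOME B. finite B \<and> independent B \<and> span B = UNIV)"

lemma fd_basis: "finite fd_basis \<and> independent fd_basis \<and> span fd_basis = UNIV"
  unfolding fd_basis_def by (rule someI_ex) (rule ex_finite_basis)

end

sublocale fd_algebra \<subseteq> finite_dimensional_vector_space scale fd_basis
  by unfold_locales (use fd_basis in auto)

section \<open>Polynomials evaluated at an element of the algebra\<close>

context fd_algebra
begin

lemma scale_one_mult: "scale c 1 * x = scale c x" "x * scale c 1 = scale c x"
  using scale_mult_left[of c 1 x] scale_mult_right[of x c 1] by simp_all

definition ev :: "'a \<Rightarrow> 'k poly \<Rightarrow> 'a" where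
  "ev y p = (\<Sum>i\<le>degree p. scale (coeff p i) (y ^ i))"

lemma ev_0 [simp]: "ev y 0 = 0"
  by (simp add: ev_def)

lemma ev_pCons: "ev y (pCons a p) = scale a 1 + y * ev y p"
proof (cases "p = 0")
  case False
  have "ev y (pCons a p) = (\<Sum>i\<le>Suc (degree p). scale (coeff (pCons a p) i) (y ^ i))"
    using False by (simp add: ev_def)
  also have "\<dots> = scale a 1 + (\<Sum>i\<le>degree p. scale (coeff p i) (y * y ^ i))"
    by (subst sum.atMost_Suc_shift) simp
  finally show ?thesis by (simp add: ev_def sum_distrib_left scale_mult_right)
qed (simp add: ev_def)

lemma ev_add: "ev y (p + q) = ev y p + ev y q"
  by (induction p q rule: poly_induct2) (simp_all add: ev_pCons scale_left_distrib algebra_simps)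

lemma ev_smult: "ev y (smult c p) = scale c (ev y p)"
  by (induction p) (simp_all add: ev_pCons scale_right_distrib scale_mult_right)

lemma ev_mult: "ev y (p * q) = ev y p * ev y q"
  by (induction p)
    (simp_all add: ev_pCons ev_add ev_smult distrib_right scale_one_mult scale_mult_left mult.assoc)

lemma ev_commute: "ev y p * y = y * ev y p"
proof -
  have "ev y [:0, 1:] = y" by (simp add: ev_pCons)
  then show ?thesis by (metis ev_mult mult.commute)
qed

lemma ev_monom: "ev y (monom 1 n) = y ^ n"
  by (induction n) (simp_all add: monom_Suc ev_pCons monom_0)

lemma ev_sum: "finite I \<Longrightarrow> ev y (\<Sum>i\<in>I. f i) = (\<Sum>i\<in>I. ev y (f i))"
  by (induction I rule: finite_induct) (simp_all add: ev_add)

text \<open>More powers of \<open>y\<close> than the dimension satisfy a linear relation. Since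
  \<open>dependent\<close> refers to a set of vectors, coinciding powers are treated apart; there
  X^i - X^j annihilates \<open>y\<close>.\<close>

lemma ex_annihilating_poly: "\<exists>p. p \<noteq> 0 \<and> ev y p = 0"
proof -
  let ?n = "dim (UNIV :: 'a set)"
  show ?thesis
  proof (cases "inj_on (\<lambda>i. y ^ i) {..?n}")
    case True
    have "card ((\<lambda>i. y ^ i) ` {..?n}) > ?n"
      using True by (simp add: card_image)
    then have "dependent ((\<lambda>i. y ^ i) ` {..?n})"
      using independent_card_le_dim[of "(\<lambda>i. y ^ i) ` {..?n}" UNIV] by auto
    then obtain S u where S: "finite S" "S \<subseteq> (\<lambda>i. y ^ i) ` {..?n}" "(\<Sum>v\<in>S. scale (u v) v) = 0"
      and "\<exists>v\<in>S. u v \<noteq> 0"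
      unfolding dependent_explicit by blast
    then obtain v where v: "v \<in> S" "u v \<noteq> 0" by blast
    obtain I where I: "I \<subseteq> {..?n}" "S = (\<lambda>i. y ^ i) ` I" using S(2) by (meson subset_imageE)
    have fin: "finite I" using I(1) finite_subset by blast
    have inj: "inj_on (\<lambda>i. y ^ i) I" using True I(1) inj_on_subset by blast
    define p where "p = (\<Sum>i\<in>I. smult (u (y ^ i)) (monom 1 i))"
    have "ev y p = (\<Sum>v\<in>S. scale (u v) v)"
      unfolding I(2) p_def using inj by (simp add: sum.reindex ev_sum fin ev_smult ev_monom)
    moreover obtain i where i: "i \<in> I" "v = y ^ i" using v I by auto
    then have "coeff p i = u v"
      unfolding p_def coeff_sum using fin by (simp add: if_distrib sum.delta' cong: if_cong)
    ultimately show ?thesis using v S(3) by (metis coeff_0)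
  next
    case False
    then obtain i j where "y ^ i = y ^ j" "i \<noteq> j" by (auto simp: inj_on_def)
    then have "ev y (monom 1 i + smult (-1) (monom 1 j)) = 0" by (simp only: ev_add ev_smult ev_monom) simp
    moreover have "coeff (monom 1 i + smult (-1) (monom 1 j)) i = (1 :: 'k)" using \<open>i \<noteq> j\<close> by simp
    ultimately show ?thesis by (metis coeff_0 zero_neq_one)
  qed
qed

text \<open>Split an annihilating polynomial as X^n q with q(0) nonzero. Then y^n q(y) = 0 can be
  solved for y^n, and the factor \<open>g\<close>, a polynomial in \<open>y\<close>, commutes with
  \<open>y\<close>.\<close>

lemma ex_power_stable:
  fixes y :: 'a
  shows "\<exists>n g. y ^ n = y ^ Suc n * g \<and> g * y = y * g"
proof -
  obtain p where p: "p \<noteq> 0" "ev y p = 0" using ex_annihilating_poly by blast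
  obtain q where q: "p = [:- 0, 1:] ^ order 0 p * q" "\<not> [:- 0, 1:] dvd q"
    using order_decomp[OF p(1)] by blast
  define n where "n = order 0 p"
  obtain c q' where c: "q = pCons c q'" by (cases q)
  have "c \<noteq> 0" using q(2) c by (auto simp: dvd_def)
  have "ev y [:0, 1:] = y" by (simp add: ev_pCons)
  then have pow: "ev y ([:0, 1:] ^ n) = y ^ n"
    by (induction n) (simp_all add: ev_mult ev_pCons one_pCons)
  have "0 = y ^ n * (scale c 1 + y * ev y q')"
    using q(1) p(2) c by (metis ev_mult ev_pCons minus_zero n_def pow)
  then have eq: "scale c (y ^ n) = - (y ^ Suc n * ev y q')"
    by (simp add: distrib_left scale_one_mult eq_neg_iff_add_eq_0 power_Suc2 mult.assoc del: power_Suc)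
  define g where "g = scale (- inverse c) (ev y q')"
  have "y ^ n = scale (inverse c) (scale c (y ^ n))" using \<open>c \<noteq> 0\<close> by simp
  also have "\<dots> = y ^ Suc n * g"
    unfolding eq g_def by (simp add: scale_mult_right scale_minus_left scale_minus_right)
  finally have "y ^ n = y ^ Suc n * g" .
  moreover have "g * y = y * g" by (simp add: g_def scale_mult_left scale_mult_right ev_commute)
  ultimately show ?thesis by blast
qed

end

section \<open>Fitting's lemma and primitive idempotents\<close>

lemma power_mult_commute:
  fixes g y :: "'a::monoid_mult"
  assumes "g * y = y * g"
  shows "g ^ m * y ^ n = y ^ n * g ^ m"
proof -
  have *: "g * y ^ n = y ^ n * g"
  proof (induction n)
    case (Suc n)
    have "g * y ^ Suc n = (g * y) * y ^ n" by (simp add: mult.assoc)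
    also have "\<dots> = y * (g * y ^ n)" by (simp add: assms mult.assoc)
    finally show ?case by (simp add: Suc mult.assoc)
  qed simp
  show ?thesis
  proof (induction m)
    case (Suc m)
    have "g ^ Suc m * y ^ n = g * (g ^ m * y ^ n)" by (simp add: mult.assoc)
    also have "\<dots> = (g * y ^ n) * g ^ m" by (simp add: Suc mult.assoc)
    finally show ?case by (simp add: * mult.assoc)
  qed simp
qed

context fd_algebra
begin

text \<open>Iterating y^n = y^(n+1) g gives y^n = y^(2n) g^n, so y^n g^n is idempotent and acts as
  the identity on y^n. The exponent is a successor so that one factor \<open>y\<close> can be split
  off when an inverse of \<open>y\<close> is extracted.\<close>

lemma ex_fitting_idempotent:
  fixes y :: 'a
  shows "\<exists>m g. g * y = y * g \<and> (y ^ Suc m * g ^ Suc m) * (y ^ Suc m * g ^ Suc m) = y ^ Suc m * g ^ Suc m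
     \<and> y ^ Suc m * (y ^ Suc m * g ^ Suc m) = y ^ Suc m"
proof -
  obtain m g where m: "y ^ m = y ^ Suc m * g" and c: "g * y = y * g" using ex_power_stable by blast
  define n where "n = Suc m"
  have "y ^ n = y * y ^ m" by (simp add: n_def)
  also have "\<dots> = y * (y ^ Suc m * g)" by (rule arg_cong[OF m])
  also have "\<dots> = y ^ Suc n * g" by (simp add: n_def mult.assoc)
  finally have ng: "y ^ n = y ^ Suc n * g" .
  have *: "y ^ n = y ^ (n + k) * g ^ k" for k
  proof (induction k)
    case (Suc k)
    have "y ^ (n + k) = y ^ k * y ^ n" by (simp only: add.commute power_add)
    also have "\<dots> = y ^ k * (y ^ Suc n * g)" by (rule arg_cong[OF ng])
    also have "\<dots> = y ^ (n + Suc k) * g"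
      by (simp add: power_add[symmetric] mult.assoc[symmetric] add.commute del: power_Suc)
    finally have q: "y ^ (n + k) = y ^ (n + Suc k) * g" .
    have "y ^ n = (y ^ (n + Suc k) * g) * g ^ k" unfolding q[symmetric] by (rule Suc)
    then show ?case by (simp only: mult.assoc power_Suc)
  qed simp
  have st: "y ^ n * (y ^ n * g ^ n) = y ^ n"
    using *[of n] by (simp add: power_add mult.assoc)
  have "(y ^ n * g ^ n) * (y ^ n * g ^ n) = y ^ n * (g ^ n * y ^ n) * g ^ n" by (simp only: mult.assoc)
  also have "\<dots> = y ^ n * (y ^ n * g ^ n) * g ^ n" by (simp only: power_mult_commute[OF c])
  also have "\<dots> = y ^ n * g ^ n" by (simp only: st)
  finally have "(y ^ n * g ^ n) * (y ^ n * g ^ n) = y ^ n * g ^ n" .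
  with st c show ?thesis unfolding n_def by metis
qed

end

definition prim_idem :: "'a::ring_1 \<Rightarrow> bool" where
  "prim_idem f \<longleftrightarrow> f * f = f \<and> f \<noteq> 0 \<and> (\<forall>x. x * x = x \<and> f * x = x \<and> x * f = x \<longrightarrow> x = 0 \<or> x = f)"

definition nilp :: "'a::ring_1 \<Rightarrow> bool" where
  "nilp x \<longleftrightarrow> (\<exists>n. x ^ n = 0)"

lemma nilp_idem_zero: "nilp x \<Longrightarrow> x * x = x \<Longrightarrow> x = (0::'a::ring_1)"
proof -
  assume n: "nilp x" and i: "x * x = x"
  have "x ^ Suc n = x" for n by (induction n) (simp_all add: i)
  with n show "x = 0" unfolding nilp_def by (metis mult_zero_right power_Suc)
qed

context fd_algebra
begin

text \<open>The Fitting idempotent of \<open>y\<close> lies in the corner of \<open>f\<close>, so it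
  is 0 or \<open>f\<close>. In the first case \<open>y\<close> is nilpotent; in the second, y^m g^n
  cut down to the corner is an inverse. Thus \<open>f A f\<close> is a local ring whose non-units
  are nilpotent.\<close>

lemma prim_idem_corner_cases:
  fixes f :: 'a
  assumes f: "prim_idem f" and y: "f * y = y" "y * f = y"
  shows "nilp y \<or> (\<exists>z. f * z = z \<and> z * f = z \<and> y * z = f \<and> z * y = f)"
proof -
  have ff: "f * f = f" using f by (simp add: prim_idem_def)
  obtain m g where c: "g * y = y * g"
    and i0: "(y ^ Suc m * g ^ Suc m) * (y ^ Suc m * g ^ Suc m) = y ^ Suc m * g ^ Suc m"
    and s0: "y ^ Suc m * (y ^ Suc m * g ^ Suc m) = y ^ Suc m" using ex_fitting_idempotent by blast
  define n where Suc: "n = Suc m"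
  note i = i0[folded Suc] and s = s0[folded Suc]
    let ?e = "y ^ n * g ^ n"
    have fy: "f * y ^ n = y ^ n" "y ^ n * f = y ^ n" unfolding Suc
      by (simp add: y mult.assoc[symmetric]) (simp only: power_Suc2 mult.assoc y)
    have e2: "?e = g ^ n * y ^ n" by (simp only: power_mult_commute[OF c])
    have fe: "f * ?e = ?e" by (simp add: fy mult.assoc[symmetric])
    have fe': "?e * f = ?e" unfolding e2 by (simp add: fy mult.assoc)
    then consider "?e = 0" | "?e = f" using f fe i unfolding prim_idem_def by blast
    then show ?thesis
    proof cases
      case 1
      then show ?thesis using s unfolding nilp_def by (metis mult_zero_right)
    next
      case 2
      define z where "z = y ^ m * g ^ n"
      have z1: "y * z = f" using 2 unfolding z_def Suc by (simp add: mult.assoc)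
      have "z = g ^ n * y ^ m" unfolding z_def by (simp only: power_mult_commute[OF c])
      then have "z * y = g ^ n * y ^ n" unfolding Suc by (simp only: power_Suc2 mult.assoc)
      then have z3: "z * y = f" using 2 e2 by simp
      have "y * (f * z * f) = f" by (simp add: mult.assoc[symmetric] y z1 ff)
      moreover have "(f * z * f) * y = f" by (simp add: mult.assoc y z3 ff)
      moreover have "f * (f * z * f) = f * z * f" by (simp add: mult.assoc[symmetric] ff)
      moreover have "(f * z * f) * f = f * z * f" by (simp add: mult.assoc ff)
      ultimately show ?thesis by blast
    qed
qed

end


section \<open>Characters of a basic algebra\<close>

text \<open>The last nonzero element among the y^m f is annihilated by \<open>y\<close> on both
  sides.\<close>

lemma nilp_kills:
  assumes n: "nilp y" and f: "f \<noteq> 0" "f * f = f" "f * y = y" "y * f = (y::'a::ring_1)"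
  shows "\<exists>w. w \<noteq> 0 \<and> f * w = w \<and> w * f = w \<and> y * w = 0 \<and> w * y = 0"
proof -
  obtain n where "y ^ n = 0" using n by (auto simp: nilp_def)
  then have "y ^ n * f = 0" by simp
  then obtain m where m: "y ^ Suc m * f = 0" "y ^ m * f \<noteq> 0"
    using f(1) by (induction n) auto
  have c: "f * y ^ m = y ^ m * f"
    using power_commuting_commutes[of y f m] f by simp
  have "y * (y ^ m * f) = 0" using m(1) by (simp add: mult.assoc)
  moreover have "y ^ Suc m * f = y ^ Suc m" by (simp only: power_Suc2 mult.assoc f)
  then have "y ^ m * y = 0" using m(1) by (simp only: power_Suc2)
  then have "(y ^ m * f) * y = 0" by (simp add: mult.assoc f)
  moreover have "f * (y ^ m * f) = y ^ m * f" "y ^ m * f * f = y ^ m * f"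
    by (simp only: c mult.assoc[symmetric]) (simp_all only: mult.assoc f(2))
  ultimately show ?thesis using m(2) by blast
qed

section \<open>The local ring at a primitive idempotent\<close>

definition corner :: "'a::ring_1 \<Rightarrow> 'a set" where
  "corner f = {y. f * y = y \<and> y * f = y}"

text \<open>For primitive \<open>f\<close> these are the non-units of the local ring
  \<open>f A f\<close>, that is, its radical.\<close>

definition corner_nil :: "'a::ring_1 \<Rightarrow> 'a set" where
  "corner_nil f = {y \<in> corner f. nilp y}"

context fd_algebra
begin

text \<open>A unit of the corner annihilates no nonzero \<open>w\<close> with f w = w, whereas a
  nilpotent element does. Closure of the nilpotent elements under products and sums, not evident
  without commutativity, is derived from this one-sided test.\<close>

lemma corner_nil_iff_left:
  fixes f :: 'a
  assumes f: "prim_idem f" and y: "y \<in> corner f"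
  shows "y \<in> corner_nil f \<longleftrightarrow> (\<exists>w. w \<noteq> 0 \<and> f * w = w \<and> y * w = 0)"
proof
  assume "y \<in> corner_nil f"
  then show "\<exists>w. w \<noteq> 0 \<and> f * w = w \<and> y * w = 0"
    using nilp_kills[of y f] f by (auto simp: corner_nil_def corner_def prim_idem_def)
next
  assume "\<exists>w. w \<noteq> 0 \<and> f * w = w \<and> y * w = 0"
  then obtain w where w: "w \<noteq> 0" "f * w = w" "y * w = 0" by blast
  { fix z assume "z * y = f"
    then have "f * w = z * (y * w)" by (simp add: mult.assoc[symmetric])
    then have False using w by simp }
  then show "y \<in> corner_nil f"
    using prim_idem_corner_cases[OF f, of y] y by (auto simp: corner_nil_def corner_def)
qed

lemma corner_mult: "f * f = f \<Longrightarrow> x \<in> corner f \<Longrightarrow> y \<in> corner f \<Longrightarrow> x * y \<in> corner f"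
  by (auto simp: corner_def mult.assoc[symmetric]) (auto simp: mult.assoc)

lemma corner_nil_mult_left:
  fixes f :: 'a
  assumes f: "prim_idem f" and x: "x \<in> corner f" and y: "y \<in> corner_nil f"
  shows "x * y \<in> corner_nil f"
proof -
  have y': "y \<in> corner f" using y by (simp add: corner_nil_def)
  then obtain w where "w \<noteq> 0" "f * w = w" "y * w = 0"
    using corner_nil_iff_left[OF f, of y] y by auto
  then have "\<exists>w. w \<noteq> 0 \<and> f * w = w \<and> x * y * w = 0" by (metis mult.assoc mult_zero_right)
  then show ?thesis using corner_nil_iff_left[OF f, of "x * y"] corner_mult[OF _ x y'] f
    by (auto simp: prim_idem_def)
qed

text \<open>If x + y had an inverse \<open>z\<close>, then z x would kill some nonzero
  \<open>w\<close>, so z y would fix \<open>w\<close>, which a nilpotent element cannot do.\<close>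

lemma corner_nil_add:
  fixes f :: 'a
  assumes f: "prim_idem f" and x: "x \<in> corner_nil f" and y: "y \<in> corner_nil f"
  shows "x + y \<in> corner_nil f"
proof (rule ccontr)
  assume n: "\<not> ?thesis"
  have ff: "f * f = f" "f \<noteq> 0" using f by (auto simp: prim_idem_def)
  have c: "x \<in> corner f" "y \<in> corner f" using x y by (auto simp: corner_nil_def)
  then have "x + y \<in> corner f" by (simp add: corner_def distrib_left distrib_right)
  then obtain z where z: "z \<in> corner f" "z * (x + y) = f"
    using prim_idem_corner_cases[OF f, of "x + y"] n by (auto simp: corner_def corner_nil_def)
  have zx: "z * x \<in> corner_nil f" and zy: "z * y \<in> corner_nil f"
    using corner_nil_mult_left[OF f z(1)] x y by auto
  obtain w where w: "w \<noteq> 0" "f * w = w" "z * x * w = 0"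
    using corner_nil_iff_left[OF f, of "z * x"] zx by (auto simp: corner_nil_def)
  have "z * y * w = w"
    using arg_cong[OF z(2), of "\<lambda>u. u * w"] w(2,3) by (simp add: distrib_left distrib_right)
  then have "(z * y) ^ k * w = w" for k by (induction k) (simp_all add: mult.assoc)
  then show False using zy w(1) by (auto simp: corner_nil_def nilp_def) (metis mult_zero_left)
qed

lemma corner_nil_scale: "y \<in> corner_nil f \<Longrightarrow> scale c y \<in> corner_nil f"
proof -
  assume y: "y \<in> corner_nil f"
  then obtain n where "y ^ n = 0" by (auto simp: corner_nil_def nilp_def)
  moreover have "(scale c y) ^ k = scale (c ^ k) (y ^ k)" for k
    by (induction k) (simp_all add: scale_mult_left scale_mult_right)
  ultimately have "(scale c y) ^ n = 0" by simp
  then show ?thesis using y by (auto simp: corner_nil_def nilp_def corner_def scale_mult_left scale_mult_right)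
qed

lemma corner_nil_0: "0 \<in> corner_nil f"
  by (auto simp: corner_nil_def corner_def nilp_def intro: exI[of _ 1])

lemma corner_nil_sum:
  fixes f :: 'a
  assumes f: "prim_idem f" and "\<And>i. i \<in> S \<Longrightarrow> g i \<in> corner_nil f"
  shows "(\<Sum>i\<in>S. g i) \<in> corner_nil f"
  using assms(2) by (induction S rule: infinite_finite_induct) (auto simp: corner_nil_0 corner_nil_add[OF f])

lemma idem_not_corner_nil: "prim_idem f \<Longrightarrow> f \<notin> corner_nil f"
  using nilp_idem_zero[of f] by (auto simp: corner_nil_def prim_idem_def)

end

section \<open>Characters over an algebraically closed field\<close>

locale ac_algebra = fd_algebra scale for scale :: "'k::alg_closed_field \<Rightarrow> 'a::ring_1 \<Rightarrow> 'a"
begin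

text \<open>A polynomial p of least degree with p(y) f = 0 has a root c, and p = (X - c) q. By
  minimality q(y) f is nonzero, and y - c f annihilates it. So the residue field of the corner is
  the base field.\<close>

lemma ex_eigenvalue:
  assumes f: "prim_idem f" and y: "y \<in> corner f"
  shows "\<exists>c. y - scale c f \<in> corner_nil f"
proof -
  have ff: "f * f = f" "f \<noteq> 0" and fy: "f * y = y" "y * f = y" using f y by (auto simp: prim_idem_def corner_def)
  let ?P = "\<lambda>p. p \<noteq> 0 \<and> ev y p * f = 0"
  have "\<exists>p. ?P p" using ex_annihilating_poly[of y] by auto
  then obtain p where p: "?P p" and min: "\<And>q. degree q < degree p \<Longrightarrow> \<not> ?P q"
    using exists_least_iff[of "\<lambda>n. \<exists>p. ?P p \<and> degree p = n"] by metis
  have "degree p > 0"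
  proof (rule ccontr)
    assume "\<not> degree p > 0"
    then obtain c where c: "p = [:c:]" using degree_eq_zeroE by blast
    then have "scale c f = 0" "c \<noteq> 0" using p by (auto simp: ev_pCons scale_one_mult)
    then show False using ff by simp
  qed
  then obtain c where "poly p c = 0" using alg_closed_imp_poly_has_root by blast
  then obtain q where q: "p = [:-c, 1:] * q" by (auto simp: poly_eq_0_iff_dvd dvd_def)
  have "q \<noteq> 0" using p q by auto
  then have "degree p = degree [:-c, 1:] + degree q" unfolding q by (rule degree_mult_eq[rotated]) simp
  then have "degree q < degree p" by simp
  then have w: "ev y q * f \<noteq> 0" using min \<open>q \<noteq> 0\<close> by blast
  have com: "f * ev y q = ev y q * f"
    by (induction q) (simp_all add: ev_pCons distrib_left distrib_right scale_one_mult,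
       metis fy mult.assoc)
  have "ev y [:-c, 1:] = y - scale c 1" by (simp add: ev_pCons scale_minus_left)
  then have "ev y p = (y - scale c 1) * ev y q" unfolding q ev_mult by (simp only:)
  then have "(y - scale c 1) * (ev y q * f) = 0"
    using p by (simp only: mult.assoc[symmetric])
  moreover have fw: "f * (ev y q * f) = ev y q * f" by (simp only: com[symmetric] mult.assoc[symmetric] ff)
  ultimately have "(y - scale c f) * (ev y q * f) = 0"
    by (simp add: left_diff_distrib scale_mult_left scale_one_mult)
  moreover have "y - scale c f \<in> corner f"
    using fy ff by (simp add: corner_def left_diff_distrib right_diff_distrib scale_mult_left scale_mult_right)
  ultimately show ?thesis using corner_nil_iff_left[OF f, of "y - scale c f"] w fw by blast
qed

end

definition (in fd_algebra) left_ideal :: "'a set \<Rightarrow> bool" where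
  "left_ideal L \<longleftrightarrow> subspace L \<and> (\<forall>a. \<forall>x\<in>L. a * x \<in> L)"

text \<open>What algebraic closedness and basicness provide for the module theory: modulo its
  radical the algebra is a product of copies of the field, with projections \<open>\<chi> i\<close>.
  The last assumption is Nakayama's lemma for the common kernel of the characters, which identifies
  that kernel as the radical.\<close>

locale split_algebra = fd_algebra scale for scale :: "'k::field \<Rightarrow> 'a::ring_1 \<Rightarrow> 'a" +
  fixes I :: "'i set" and \<chi> :: "'i \<Rightarrow> 'a \<Rightarrow> 'k"
  assumes finite_I: "finite I"
    and chi_add: "i \<in> I \<Longrightarrow> \<chi> i (x + y) = \<chi> i x + \<chi> i y"
    and chi_scale: "i \<in> I \<Longrightarrow> \<chi> i (scale c x) = c * \<chi> i x"
    and chi_mult: "i \<in> I \<Longrightarrow> \<chi> i (x * y) = \<chi> i x * \<chi> i y"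
    and chi_one: "i \<in> I \<Longrightarrow> \<chi> i 1 = 1"
    and ex_idempotents: "\<exists>f. (\<forall>i\<in>I. \<forall>k\<in>I. f i * f k = (if i = k then f i else 0)) \<and> (\<Sum>i\<in>I. f i) = 1 \<and>
      (\<forall>i\<in>I. \<forall>k\<in>I. \<chi> i (f k) = (if i = k then 1 else 0))"
    and nakayama: "left_ideal L \<Longrightarrow> L \<subseteq> span {x * y | x y. (\<forall>i\<in>I. \<chi> i x = 0) \<and> y \<in> L} \<Longrightarrow> L = {0}"

text \<open>The assumption \<open>noniso\<close> says in terms of elements that the left ideals
  generated by \<open>f i\<close> and \<open>f k\<close> are not isomorphic.\<close>

locale basic_idems = ac_algebra scale for scale :: "'k::alg_closed_field \<Rightarrow> 'a::ring_1 \<Rightarrow> 'a" +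
  fixes I :: "'i set" and f :: "'i \<Rightarrow> 'a"
  assumes fin: "finite I"
    and prim: "i \<in> I \<Longrightarrow> prim_idem (f i)"
    and orth: "i \<in> I \<Longrightarrow> k \<in> I \<Longrightarrow> i \<noteq> k \<Longrightarrow> f i * f k = 0"
    and sum_one: "(\<Sum>i\<in>I. f i) = 1"
    and noniso: "i \<in> I \<Longrightarrow> k \<in> I \<Longrightarrow> i \<noteq> k \<Longrightarrow> f i * x * f k = x \<Longrightarrow> f k * y * f i = y \<Longrightarrow>
      x * y = f i \<Longrightarrow> y * x \<noteq> f k"
begin

lemma idem: "i \<in> I \<Longrightarrow> f i * f i = f i"
  using prim by (simp add: prim_idem_def)

text \<open>If \<open>x * y\<close> were a unit of the corner, then \<open>x\<close> would have a
  right inverse \<open>w\<close>, and \<open>w * x\<close> would be a nonzero idempotent in the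
  corner of \<open>f k\<close>, hence equal to \<open>f k\<close>. This contradicts
  \<open>noniso\<close>.\<close>

lemma off_diag:
  assumes ik: "i \<in> I" "k \<in> I" "i \<noteq> k" and x: "f i * x * f k = x" and y: "f k * y * f i = y"
  shows "x * y \<in> corner_nil (f i)"
proof (rule ccontr)
  have x': "f i * x = x" "x * f k = x" using x idem ik by (metis mult.assoc)+
  have y': "f k * y = y" "y * f i = y" using y idem ik by (metis mult.assoc)+
  assume n: "x * y \<notin> corner_nil (f i)"
  have c: "f i * (x * y) = x * y" "x * y * f i = x * y"
    using x' y' by (simp_all add: mult.assoc[symmetric]) (simp add: mult.assoc y')
  then obtain z where z: "x * y * z = f i" "f i * z = z" "z * f i = z"
    using prim_idem_corner_cases[OF prim[OF ik(1)] c] n by (auto simp: corner_nil_def corner_def)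
  define w where "w = y * z"
  have w: "x * w = f i" "f k * w = w" "w * f i = w"
    using z y' by (simp_all add: w_def mult.assoc[symmetric]) (simp add: mult.assoc z)
  have e1: "(w * x) * (w * x) = w * x"
    using w x' by (metis mult.assoc)
  have e2: "f k * (w * x) = w * x" "w * x * f k = w * x" using w x' by (metis mult.assoc)+
  have "w * x \<noteq> 0"
  proof
    assume "w * x = 0"
    then have "x * (w * x) * w = 0" by simp
    then have "f i * f i = 0" using w by (metis mult.assoc)
    then show False using prim[OF ik(1)] unfolding prim_idem_def by metis
  qed
  then have "w * x = f k" using prim[OF ik(2)] e1 e2 by (auto simp: prim_idem_def)
  moreover have "f k * w * f i = w" using w by (metis mult.assoc)
  ultimately show False using noniso[OF ik x, of w] w by blast
qed

text \<open>The class of \<open>f i * a * f i\<close> in the residue field of the local ring at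
  \<open>f i\<close>.\<close>

definition ch :: "'i \<Rightarrow> 'a \<Rightarrow> 'k" where
  "ch i a = (SOME c. f i * a * f i - scale c (f i) \<in> corner_nil (f i))"

lemma compress_corner: "i \<in> I \<Longrightarrow> f i * a * f i \<in> corner (f i)"
  using idem by (simp add: corner_def mult.assoc) (simp add: mult.assoc[symmetric])

lemma ch: "i \<in> I \<Longrightarrow> f i * a * f i - scale (ch i a) (f i) \<in> corner_nil (f i)"
  unfolding ch_def by (rule someI_ex) (rule ex_eigenvalue[OF prim compress_corner])

text \<open>With two different values a nonzero multiple of the idempotent \<open>f i\<close> would
  be nilpotent.\<close>

lemma ch_unique:
  assumes i: "i \<in> I" and c: "f i * a * f i - scale c (f i) \<in> corner_nil (f i)"
  shows "ch i a = c"
proof (rule ccontr)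
  assume ne: "ch i a \<noteq> c"
  have "(f i * a * f i - scale c (f i)) + scale (-1) (f i * a * f i - scale (ch i a) (f i)) \<in> corner_nil (f i)"
    by (intro corner_nil_add[OF prim] corner_nil_scale c ch i)
  also have "(f i * a * f i - scale c (f i)) + scale (-1) (f i * a * f i - scale (ch i a) (f i)) = scale (ch i a - c) (f i)"
    by (simp add: scale_left_diff_distrib scale_right_diff_distrib scale_minus_left)
  finally have "scale (inverse (ch i a - c)) (scale (ch i a - c) (f i)) \<in> corner_nil (f i)"
    by (rule corner_nil_scale)
  then show False using ne idem_not_corner_nil[OF prim[OF i]] by simp
qed

text \<open>Insert 1 = sum of the \<open>f k\<close> between \<open>a\<close> and \<open>b\<close>.
  The terms with \<open>k\<close> different from \<open>i\<close> are nilpotent by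
  \<open>off_diag\<close>, so modulo nilpotent elements only f i a f i b f i remains. This is where
  pairwise non-isomorphic summands matter.\<close>

lemma ch_mult:
  assumes i: "i \<in> I"
  shows "ch i (a * b) = ch i a * ch i b"
proof (rule ch_unique[OF i])
  let ?F = "f i" and ?l = "ch i a" and ?m = "ch i b"
  have p: "prim_idem ?F" by (rule prim[OF i])
  have ii: "f i * f i = f i" by (rule idem[OF i])
  define u where "u = f i * a * f i - scale ?l ?F"
  define v where "v = f i * b * f i - scale ?m ?F"
  have uv: "u \<in> corner_nil ?F" "v \<in> corner_nil ?F" using ch i by (auto simp: u_def v_def)
  then have uc: "u \<in> corner ?F" "v \<in> corner ?F" by (auto simp: corner_nil_def)
  have "f i * (a * b) * f i = f i * a * (\<Sum>k\<in>I. f k) * b * f i" by (simp add: sum_one mult.assoc)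
  also have "\<dots> = (\<Sum>k\<in>I. f i * a * f k * b * f i)"
    by (simp add: sum_distrib_left sum_distrib_right)
  also have "\<dots> = f i * a * f i * b * f i + (\<Sum>k\<in>I-{i}. f i * a * f k * b * f i)"
    by (rule sum.remove[OF fin i])
  finally have eq: "f i * (a * b) * f i = f i * a * f i * b * f i + (\<Sum>k\<in>I-{i}. f i * a * f k * b * f i)" .
  have s: "(\<Sum>k\<in>I-{i}. f i * a * f k * b * f i) \<in> corner_nil ?F"
  proof (rule corner_nil_sum[OF p])
    fix k assume k: "k \<in> I - {i}"
    have "(f i * a * f k) * (f k * b * f i) \<in> corner_nil ?F"
      using k i idem by (intro off_diag[of i k]) (auto simp: mult.assoc, auto simp: mult.assoc[symmetric])
    also have "(f i * a * f k) * (f k * b * f i) = f i * a * f k * b * f i"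
      using idem k by (simp add: mult.assoc) (simp add: mult.assoc[symmetric])
    finally show "f i * a * f k * b * f i \<in> corner_nil ?F" .
  qed
  have "f i * a * f i * b * f i = (f i * a * f i) * (f i * b * f i)"
    using ii by (simp add: mult.assoc) (simp add: mult.assoc[symmetric])
  also have "\<dots> = (u + scale ?l ?F) * (v + scale ?m ?F)" by (simp add: u_def v_def)
  also have "\<dots> = u * v + scale ?m u + scale ?l v + scale (?l * ?m) ?F"
    using uc ii by (simp add: distrib_left distrib_right scale_mult_left scale_mult_right corner_def algebra_simps)
  finally have "f i * (a * b) * f i - scale (?l * ?m) ?F = (u * v + scale ?m u + scale ?l v) + (\<Sum>k\<in>I-{i}. f i * a * f k * b * f i)"
    using eq by simp
  also have "\<dots> \<in> corner_nil ?F"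
    by (intro corner_nil_add[OF p] corner_nil_scale s uv corner_nil_mult_left[OF p] uc)
  finally show "f i * (a * b) * f i - scale (?l * ?m) ?F \<in> corner_nil ?F" .
qed

lemma ch_add: assumes i: "i \<in> I" shows "ch i (a + b) = ch i a + ch i b"
proof (rule ch_unique[OF i])
  have "(f i * a * f i - scale (ch i a) (f i)) + (f i * b * f i - scale (ch i b) (f i)) \<in> corner_nil (f i)"
    by (intro corner_nil_add[OF prim] ch i)
  then show "f i * (a + b) * f i - scale (ch i a + ch i b) (f i) \<in> corner_nil (f i)"
    by (simp add: distrib_left distrib_right scale_left_distrib algebra_simps)
qed

lemma ch_scale: assumes i: "i \<in> I" shows "ch i (scale c a) = c * ch i a"
proof (rule ch_unique[OF i])
  have "scale c (f i * a * f i - scale (ch i a) (f i)) \<in> corner_nil (f i)"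
    by (intro corner_nil_scale ch i)
  then show "f i * scale c a * f i - scale (c * ch i a) (f i) \<in> corner_nil (f i)"
    by (simp add: scale_right_diff_distrib scale_mult_left scale_mult_right)
qed

lemma ch_idem: assumes i: "i \<in> I" "k \<in> I" shows "ch i (f k) = (if i = k then 1 else 0)"
  by (rule ch_unique[OF i(1)]) (use orth i idem corner_nil_0 in auto)

lemma ch_one: assumes i: "i \<in> I" shows "ch i 1 = 1"
  by (rule ch_unique[OF i]) (use idem i corner_nil_0 in auto)

text \<open>Let R be the common kernel of the characters and \<open>M\<close> a largest left ideal
  properly inside \<open>L\<close>. For \<open>v\<close> in \<open>L\<close> outside
  \<open>M\<close> with f i v = v, the ideal A v + M is all of \<open>L\<close>, whereas R v + M
  misses \<open>v\<close> and so equals \<open>M\<close>. Hence R L lies in \<open>M\<close>,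
  although it spans \<open>L\<close>.\<close>

lemma nakayama:
  assumes L: "left_ideal L" and sub: "L \<subseteq> span {x * y | x y. (\<forall>i\<in>I. ch i x = 0) \<and> y \<in> L}"
  shows "L = {0}"
proof (rule ccontr)
  assume "L \<noteq> {0}"
  have sL: "subspace L" and mL: "\<And>a x. x \<in> L \<Longrightarrow> a * x \<in> L" using L by (auto simp: left_ideal_def)
  let ?R = "{x. \<forall>i\<in>I. ch i x = 0}"
  let ?P = "\<lambda>M. left_ideal M \<and> M \<subset> L"
  have "?P {0}" using \<open>L \<noteq> {0}\<close> subspace_0[OF sL] by (auto simp: left_ideal_def)
  moreover have "dim M \<le> dim L" if "?P M" for M using that by (intro dim_subset) auto
  ultimately obtain M where M: "?P M" and max: "\<And>N. ?P N \<Longrightarrow> dim N \<le> dim M"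
    using ex_has_greatest_nat[of ?P "{0}" dim "Suc (dim L)"] by (metis less_Suc_eq_le)
  have sM: "subspace M" and mM: "\<And>a x. x \<in> M \<Longrightarrow> a * x \<in> M" using M by (auto simp: left_ideal_def)
  have max': "N = M" if "left_ideal N" "M \<subseteq> N" "N \<subset> L" for N
    using subspace_dim_equal[of M N] sM that max[of N] by (auto simp: left_ideal_def)
  obtain v0 where v0: "v0 \<in> L" "v0 \<notin> M" using M by blast
  have "v0 = (\<Sum>i\<in>I. f i * v0)" by (simp add: sum_one flip: sum_distrib_right)
  then obtain i where i: "i \<in> I" "f i * v0 \<notin> M" using v0(2) subspace_sum[OF sM, of I] by metis
  define v where "v = f i * v0"
  have v: "v \<in> L" "v \<notin> M" "f i * v = v"
    using i v0 mL idem by (auto simp: v_def mult.assoc[symmetric])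
  define E where "E = (\<lambda>S. {x * v + l | x l. x \<in> S \<and> l \<in> M})"
  have idl: "left_ideal (E S)" if "subspace S" "\<And>a x. x \<in> S \<Longrightarrow> a * x \<in> S" for S
    unfolding left_ideal_def E_def
  proof (intro conjI subspaceI allI ballI)
    show "0 \<in> {x * v + l | x l. x \<in> S \<and> l \<in> M}"
      using subspace_0[OF sM] subspace_0[OF that(1)] by force
  next
    fix x y assume "x \<in> {x * v + l | x l. x \<in> S \<and> l \<in> M}" "y \<in> {x * v + l | x l. x \<in> S \<and> l \<in> M}"
    then obtain a l b m where "x = a * v + l" "y = b * v + m" "a \<in> S" "b \<in> S" "l \<in> M" "m \<in> M" by blast
    then have "x + y = (a + b) * v + (l + m)" "a + b \<in> S" "l + m \<in> M"
      using subspace_add[OF sM] subspace_add[OF that(1)] by (auto simp: algebra_simps)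
    then show "x + y \<in> {x * v + l | x l. x \<in> S \<and> l \<in> M}" by blast
  next
    fix c x assume "x \<in> {x * v + l | x l. x \<in> S \<and> l \<in> M}"
    then obtain a l where "x = a * v + l" "a \<in> S" "l \<in> M" by blast
    then have "scale c x = scale c a * v + scale c l" "scale c a \<in> S" "scale c l \<in> M"
      using subspace_scale[OF sM] subspace_scale[OF that(1)] by (auto simp: scale_right_distrib scale_mult_left)
    then show "scale c x \<in> {x * v + l | x l. x \<in> S \<and> l \<in> M}" by blast
  next
    fix b x assume "x \<in> {x * v + l | x l. x \<in> S \<and> l \<in> M}"
    then obtain a l where "x = a * v + l" "a \<in> S" "l \<in> M" by blast
    then have "b * x = b * a * v + b * l" "b * a \<in> S" "b * l \<in> M"
      using mM that(2) by (auto simp: distrib_left mult.assoc)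
    then show "b * x \<in> {x * v + l | x l. x \<in> S \<and> l \<in> M}" by blast
  qed
  have sub_L: "E S \<subseteq> L" for S
    using M v(1) mL subspace_add[OF sL] unfolding E_def by blast
  have sub_M: "M \<subseteq> E S" if "subspace S" for S
    using subspace_0[OF that] unfolding E_def by force
  have "v = 1 * v + 0" "0 \<in> M" using subspace_0[OF sM] by auto
  then have vE: "v \<in> E UNIV" unfolding E_def by blast
  have top: "E UNIV = L"
  proof (rule ccontr)
    assume "E UNIV \<noteq> L"
    then have "E UNIV \<subset> L" using sub_L by blast
    then have "E UNIV = M" using idl[of UNIV] sub_M[of UNIV] by (intro max') auto
    then show False using vE v(2) by simp
  qed
  have sR: "subspace ?R"
    using ch_add ch_scale by (auto simp: subspace_def) (metis add_0 ch_scale mult_zero_left scale_zero_left)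
  have mR: "a * x \<in> ?R" "x * a \<in> ?R" if "x \<in> ?R" for a x using that ch_mult by auto
  let ?N = "E ?R"
  \<comment> \<open>Otherwise \<open>v\<close> would be fixed modulo \<open>M\<close> by
    \<open>f i * x * f i\<close>, which is nilpotent because \<open>ch i x = 0\<close>.\<close>
  have vN: "v \<notin> ?N"
  proof
    assume "v \<in> ?N"
    then obtain x l where x: "x \<in> ?R" "l \<in> M" "v = x * v + l" unfolding E_def by blast
    define y where "y = f i * x * f i"
    have "y \<in> corner_nil (f i)" using ch[OF i(1), of x] x(1) i(1) by (simp add: y_def)
    then obtain n where n: "y ^ n = 0" by (auto simp: corner_nil_def nilp_def)
    have "v = y * v + f i * l"
      using arg_cong[OF x(3), of "\<lambda>u. f i * u"] v(3) by (simp add: y_def distrib_left mult.assoc)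
    then have d: "v - y * v \<in> M" using mM[OF x(2)] by (metis add_diff_cancel_left')
    have "v - y ^ k * v \<in> M" for k
    proof (induction k)
      case 0 then show ?case using subspace_0[OF sM] by simp
    next
      case (Suc k)
      have "v - y ^ Suc k * v = (v - y * v) + y * (v - y ^ k * v)"
        by (simp add: right_diff_distrib mult.assoc)
      then show ?case using subspace_add[OF sM d mM[OF Suc, of y]] by (simp only:)
    qed
    from this[of n] show False using n v(2) by simp
  qed
  have "?N \<subset> L" using sub_L[of ?R] vN v(1) by blast
  then have NM: "?N = M" by (intro max' idl[OF sR mR(1)] sub_M[OF sR])
  have "{x * y | x y. x \<in> ?R \<and> y \<in> L} \<subseteq> M"
  proof clarify
    fix x y assume x: "\<forall>i\<in>I. ch i x = 0" and "y \<in> L"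
    then obtain a l where y: "y = a * v + l" "l \<in> M" using top unfolding E_def by blast
    have "x * y = (x * a) * v + x * l" by (simp add: y distrib_left mult.assoc)
    moreover have "x * a \<in> ?R" using mR(2)[of x a] x by blast
    ultimately have "x * y \<in> ?N" using mM[OF y(2)] unfolding E_def by blast
    then show "x * y \<in> M" using NM by blast
  qed
  then have "span {x * y | x y. x \<in> ?R \<and> y \<in> L} \<subseteq> M" by (rule span_minimal[OF _ sM])
  then show False using sub M by auto
qed

lemma split_algebra: "split_algebra scale I ch"
proof unfold_locales
  show "\<exists>f. (\<forall>i\<in>I. \<forall>k\<in>I. f i * f k = (if i = k then f i else 0)) \<and> (\<Sum>i\<in>I. f i) = 1 \<and>
      (\<forall>i\<in>I. \<forall>k\<in>I. ch i (f k) = (if i = k then 1 else 0))"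
    by (intro exI[of _ f]) (auto simp: idem orth sum_one ch_idem)
qed (use fin ch_add ch_scale ch_mult ch_one nakayama in auto)

end


section \<open>Modules\<close>

context left_module
begin

lemma smult_zero_right [simp]: "a \<odot> \<zero> = \<zero>"
proof -
  have "a \<odot> \<zero> \<oplus> a \<odot> \<zero> = a \<odot> \<zero>"
    using smult_r_distr[of \<zero> \<zero> a] by simp
  then show ?thesis using smult_closed[of \<zero> a] add.l_cancel_one by blast
qed

lemma smult_zero_left [simp]: "x \<in> carrier M \<Longrightarrow> 0 \<odot> x = \<zero>"
proof -
  assume x: "x \<in> carrier M"
  have "0 \<odot> x \<oplus> 0 \<odot> x = 0 \<odot> x"
    using smult_l_distr[of x 0 0] x by simp
  then show ?thesis using smult_closed[of x 0] x add.l_cancel_one by blast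
qed

lemma smult_uminus: "x \<in> carrier M \<Longrightarrow> (- a) \<odot> x = \<ominus> (a \<odot> x)"
proof -
  assume x: "x \<in> carrier M"
  have "(- a) \<odot> x \<oplus> a \<odot> x = \<zero>" using smult_l_distr[of x "-a" a] x by simp
  then show ?thesis using smult_closed x by (metis minus_equality)
qed

lemma smult_minus: "x \<in> carrier M \<Longrightarrow> y \<in> carrier M \<Longrightarrow> a \<odot> (x \<ominus> y) = a \<odot> x \<ominus> a \<odot> y"
  using smult_uminus[of y 1] smult_one[of y] smult_r_distr[of x "(-1) \<odot> y" a]
    smult_assoc[of y a "-1"] smult_uminus[of y a] smult_closed
  by (simp add: a_minus_def)

lemma minus_eq_zero_iff: "x \<in> carrier M \<Longrightarrow> y \<in> carrier M \<Longrightarrow> x \<ominus> y = \<zero> \<longleftrightarrow> x = y"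
  using minus_equality[of x "\<ominus> y"] minus_minus[of y] by (auto simp: a_minus_def r_neg)

lemma submodI:
  assumes "N \<subseteq> carrier M" "\<zero> \<in> N" "\<And>x y. x \<in> N \<Longrightarrow> y \<in> N \<Longrightarrow> x \<oplus> y \<in> N" "\<And>a x. x \<in> N \<Longrightarrow> a \<odot> x \<in> N"
  shows "submod N M"
  unfolding submod_def
proof (intro conjI allI ballI assms)
  show "additive_subgroup N M"
  proof (intro additive_subgroup.intro subgroup.intro)
    fix x assume x: "x \<in> N"
    then have "inv\<^bsub>add_monoid M\<^esub> x = (-1) \<odot> x"
      using smult_uminus[of x 1] smult_one[of x] assms(1) by (auto simp: a_inv_def)
    then show "inv\<^bsub>add_monoid M\<^esub> x \<in> N" using assms(4) x by simp
  qed (use assms in auto)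
qed

lemma submodD:
  assumes "submod N M"
  shows "N \<subseteq> carrier M" "\<zero> \<in> N" "x \<in> N \<Longrightarrow> y \<in> N \<Longrightarrow> x \<oplus> y \<in> N" "x \<in> N \<Longrightarrow> a \<odot> x \<in> N"
    "x \<in> N \<Longrightarrow> \<ominus> x \<in> N" "x \<in> N \<Longrightarrow> y \<in> N \<Longrightarrow> x \<ominus> y \<in> N"
proof -
  interpret N: additive_subgroup N M using assms by (simp add: submod_def)
  show "N \<subseteq> carrier M" "\<zero> \<in> N" "x \<in> N \<Longrightarrow> y \<in> N \<Longrightarrow> x \<oplus> y \<in> N" "x \<in> N \<Longrightarrow> a \<odot> x \<in> N"
    using assms N.a_subset N.zero_closed N.a_closed by (auto simp: submod_def)
  have m: "\<ominus> x \<in> N" if "x \<in> N" for x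
  proof -
    have "x \<in> carrier M" using that N.a_subset by blast
    then have "\<ominus> x = (-1) \<odot> x" using smult_uminus[of x 1] smult_one by simp
    then show ?thesis using that assms by (auto simp: submod_def)
  qed
  then show "x \<in> N \<Longrightarrow> \<ominus> x \<in> N" .
  show "x \<in> N \<Longrightarrow> y \<in> N \<Longrightarrow> x \<ominus> y \<in> N" using m N.a_closed by (simp add: a_minus_def)
qed

lemma submod_carrier: "submod (carrier M) M"
  by (rule submodI) (auto simp: smult_closed)

lemma submod_zero: "submod {\<zero>} M"
  by (rule submodI) (auto simp: smult_closed)

lemma left_module_restr:
  assumes N: "submod N M"
  shows "left_module (restr M N)"
proof -
  note D = submodD[OF N]
  have s: "\<And>x. x \<in> N \<Longrightarrow> x \<in> carrier M" using D(1) by blast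
  have "abelian_group (restr M N)"
  proof (rule abelian_groupI, goal_cases)
    case (6 x)
    then show ?case using D(5)[of x] s by (auto simp: restr_def l_neg intro!: bexI[of _ "\<ominus> x"])
  qed (use D s in \<open>auto simp: restr_def a_ac\<close>)
  then show ?thesis
    by (intro left_module.intro left_module_axioms.intro)
      (use D s smult_l_distr smult_r_distr smult_assoc smult_one in \<open>auto simp: restr_def\<close>)
qed

lemma submod_restr_iff:
  assumes N: "submod N M"
  shows "submod K (restr M N) \<longleftrightarrow> submod K M \<and> K \<subseteq> N"
proof -
  interpret R: left_module "restr M N" by (rule left_module_restr[OF N])
  have c: "carrier (restr M N) = N" "\<zero>\<^bsub>restr M N\<^esub> = \<zero>" "add (restr M N) = add M"
    "module.smult (restr M N) = module.smult M" by (auto simp: restr_def)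
  show ?thesis
  proof
    assume K: "submod K (restr M N)"
    show "submod K M \<and> K \<subseteq> N"
      using R.submodD[OF K] submodD[OF N] unfolding c by (intro conjI submodI) auto
  next
    assume K: "submod K M \<and> K \<subseteq> N"
    then have K': "submod K M" by blast
    show "submod K (restr M N)"
      using submodD[OF K'] K by (intro R.submodI) (auto simp: c)
  qed
qed

end

section \<open>Homomorphisms and direct decompositions\<close>

locale module_hom' = M: left_module M + N: left_module N
  for M :: "('a::ring_1, 'b) module" and N :: "('a, 'c) module" +
  fixes f
  assumes hom: "f \<in> mod_hom M N"
begin

lemma closed: "x \<in> carrier M \<Longrightarrow> f x \<in> carrier N"
  and add: "x \<in> carrier M \<Longrightarrow> y \<in> carrier M \<Longrightarrow> f (x \<oplus>\<^bsub>M\<^esub> y) = f x \<oplus>\<^bsub>N\<^esub> f y"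
  and smult: "x \<in> carrier M \<Longrightarrow> f (a \<odot>\<^bsub>M\<^esub> x) = a \<odot>\<^bsub>N\<^esub> f x"
  using hom by (auto simp: mod_hom_def)

lemma zero: "f \<zero>\<^bsub>M\<^esub> = \<zero>\<^bsub>N\<^esub>"
  using smult[of "\<zero>\<^bsub>M\<^esub>" 0] closed[of "\<zero>\<^bsub>M\<^esub>"] by simp

lemma minus: "x \<in> carrier M \<Longrightarrow> y \<in> carrier M \<Longrightarrow> f (x \<ominus>\<^bsub>M\<^esub> y) = f x \<ominus>\<^bsub>N\<^esub> f y"
  using add[of x "(-1) \<odot>\<^bsub>M\<^esub> y"] smult[of y "-1"] M.smult_uminus[of y 1] M.smult_one N.smult_uminus[of "f y" 1]
    N.smult_one closed M.smult_closed by (simp add: a_minus_def)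

lemma submod_image: assumes K: "submod K M" shows "submod (f ` K) N"
proof (rule N.submodI)
  note D = M.submodD[OF K]
  show "f ` K \<subseteq> carrier N" using D(1) closed by blast
  show "\<zero>\<^bsub>N\<^esub> \<in> f ` K" using D(2) zero by (metis imageI)
  fix x y assume "x \<in> f ` K" "y \<in> f ` K"
  then obtain u v where "u \<in> K" "v \<in> K" "x = f u" "y = f v" by blast
  then show "x \<oplus>\<^bsub>N\<^esub> y \<in> f ` K" using D(1,3) add[of u v] by (metis imageI subsetD)
next
  note D = M.submodD[OF K]
  fix a x assume "x \<in> f ` K"
  then obtain u where "u \<in> K" "x = f u" by blast
  then show "a \<odot>\<^bsub>N\<^esub> x \<in> f ` K" using D(1,4) smult[of u a] by (metis imageI subsetD)
qed

lemma submod_vimage: assumes K: "submod K N" shows "submod {x \<in> carrier M. f x \<in> K} M"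
  using N.submodD[OF K] by (intro M.submodI) (auto simp: closed add smult zero M.smult_closed)

lemma inj_iff: "inj_on f (carrier M) \<longleftrightarrow> (\<forall>x\<in>carrier M. f x = \<zero>\<^bsub>N\<^esub> \<longrightarrow> x = \<zero>\<^bsub>M\<^esub>)"
proof
  assume "inj_on f (carrier M)"
  then show "\<forall>x\<in>carrier M. f x = \<zero>\<^bsub>N\<^esub> \<longrightarrow> x = \<zero>\<^bsub>M\<^esub>" using zero by (metis M.zero_closed inj_onD)
next
  assume z: "\<forall>x\<in>carrier M. f x = \<zero>\<^bsub>N\<^esub> \<longrightarrow> x = \<zero>\<^bsub>M\<^esub>"
  show "inj_on f (carrier M)"
  proof (rule inj_onI)
    fix x y assume "x \<in> carrier M" "y \<in> carrier M" "f x = f y"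
    then show "x = y" using z minus[of x y] closed by (metis M.minus_closed M.minus_eq_zero_iff N.minus_eq_zero_iff)
  qed
qed

end

lemma mod_hom_compose: "f \<in> mod_hom M N \<Longrightarrow> g \<in> mod_hom N K \<Longrightarrow> (\<lambda>x. g (f x)) \<in> mod_hom M K"
  unfolding mod_hom_def by (auto simp: Pi_iff)

lemma mod_hom_inv:
  assumes M: "left_module M" and f: "f \<in> mod_hom M N" and b: "bij_betw f (carrier M) (carrier N)"
  shows "inv_into (carrier M) f \<in> mod_hom N M"
proof -
  interpret left_module M by fact
  let ?g = "inv_into (carrier M) f"
  have g: "?g y \<in> carrier M" "f (?g y) = y" if "y \<in> carrier N" for y
    using b that by (auto simp: bij_betw_def inv_into_into f_inv_into_f)
  have fg: "?g (f x) = x" if "x \<in> carrier M" for x using b that by (simp add: bij_betw_def)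
  have fc: "f x \<in> carrier N" and fa: "f (x \<oplus>\<^bsub>M\<^esub> y) = f x \<oplus>\<^bsub>N\<^esub> f y" and fs: "f (a \<odot>\<^bsub>M\<^esub> x) = a \<odot>\<^bsub>N\<^esub> f x"
    if "x \<in> carrier M" "y \<in> carrier M" for x y a using f that by (auto simp: mod_hom_def)
  have "?g (x \<oplus>\<^bsub>N\<^esub> y) = ?g x \<oplus>\<^bsub>M\<^esub> ?g y" if "x \<in> carrier N" "y \<in> carrier N" for x y
    using fa[of "?g x" "?g y"] fg[of "?g x \<oplus>\<^bsub>M\<^esub> ?g y"] g that by simp
  moreover have "?g (a \<odot>\<^bsub>N\<^esub> x) = a \<odot>\<^bsub>M\<^esub> ?g x" if "x \<in> carrier N" for a x
    using fs[of "?g x" "?g x" a] fg[of "a \<odot>\<^bsub>M\<^esub> ?g x"] g smult_closed that by simp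
  ultimately show ?thesis using g by (auto simp: mod_hom_def)
qed

lemma mod_iso_sym: "left_module M \<Longrightarrow> mod_iso M N \<Longrightarrow> mod_iso N M"
  unfolding mod_iso_def using bij_betw_inv_into mod_hom_inv by (elim bexE) (rule bexI)

lemma mod_iso_trans: "mod_iso M N \<Longrightarrow> mod_iso N K \<Longrightarrow> mod_iso M K"
  unfolding mod_iso_def
proof (elim bexE)
  fix f g assume "f \<in> mod_hom M N" "bij_betw f (carrier M) (carrier N)" "g \<in> mod_hom N K" "bij_betw g (carrier N) (carrier K)"
  then show "\<exists>f\<in>mod_hom M K. bij_betw f (carrier M) (carrier K)"
    using bij_betw_trans[of f _ _ g] mod_hom_compose[of f M N g K] by (auto simp: comp_def)
qed

lemma set_add_eq: "A <+>\<^bsub>M\<^esub> B = (\<Union>a\<in>A. \<Union>b\<in>B. {a \<oplus>\<^bsub>M\<^esub> b})"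
  by (simp add: set_add_def set_mult_def)

lemma internal_direct_sum_image:
  assumes M: "left_module M" and N: "left_module N" and f: "f \<in> mod_hom M N" and b: "bij_betw f (carrier M) (carrier N)"
    and d: "internal_direct_sum M U W"
  shows "internal_direct_sum N (f ` U) (f ` W)"
proof -
  interpret module_hom' M N f using M N f by (simp add: module_hom'_def module_hom'_axioms_def)
  have U: "submod U M" and W: "submod W M" and UW: "U <+>\<^bsub>M\<^esub> W = carrier M" "U \<inter> W = {\<zero>\<^bsub>M\<^esub>}"
    using d by (auto simp: internal_direct_sum_def)
  note D = M.submodD[OF U] M.submodD[OF W]
  have ad: "f (u \<oplus>\<^bsub>M\<^esub> w) = f u \<oplus>\<^bsub>N\<^esub> f w" if "u \<in> U" "w \<in> W" for u w
    using D(1,7) that by (intro add) auto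
  have "f ` U <+>\<^bsub>N\<^esub> f ` W = (\<Union>u\<in>U. \<Union>w\<in>W. {f u \<oplus>\<^bsub>N\<^esub> f w})"
    by (simp add: set_add_eq)
  also have "\<dots> = f ` (U <+>\<^bsub>M\<^esub> W)"
    by (simp add: set_add_eq image_UN ad)
  also have "\<dots> = carrier N" using UW(1) b by (simp add: bij_betw_def)
  finally have "f ` U <+>\<^bsub>N\<^esub> f ` W = carrier N" .
  moreover have "f ` U \<inter> f ` W = f ` (U \<inter> W)"
    using b D(1,7) by (intro inj_on_image_Int[symmetric, of _ "carrier M"]) (auto simp: bij_betw_def)
  then have "f ` U \<inter> f ` W = {\<zero>\<^bsub>N\<^esub>}" by (simp add: UW zero)
  ultimately show ?thesis using submod_image U W by (simp add: internal_direct_sum_def)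
qed

lemma indecomposable_iso:
  assumes M: "left_module M" and i: "mod_iso M N" and N: "indecomposable N"
  shows "indecomposable M"
proof -
  have lN: "left_module N" using N by (simp add: indecomposable_def)
  obtain f where f: "f \<in> mod_hom M N" "bij_betw f (carrier M) (carrier N)" using i by (auto simp: mod_iso_def)
  interpret module_hom' M N f using M lN f by (simp add: module_hom'_def module_hom'_axioms_def)
  have inj: "inj_on f (carrier M)" using f by (simp add: bij_betw_def)
  have z: "X = {\<zero>\<^bsub>M\<^esub>}" if "submod X M" "f ` X = {\<zero>\<^bsub>N\<^esub>}" for X
  proof -
    have "\<forall>x\<in>X. x = \<zero>\<^bsub>M\<^esub>" using that M.submodD(1)[OF that(1)] inj inj_iff by blast
    then show ?thesis using M.submodD(2)[OF that(1)] by blast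
  qed
  have "carrier M \<noteq> {\<zero>\<^bsub>M\<^esub>}"
    using N f zero by (auto simp: indecomposable_def bij_betw_def)
  moreover have "U = {\<zero>\<^bsub>M\<^esub>} \<or> W = {\<zero>\<^bsub>M\<^esub>}" if "internal_direct_sum M U W" for U W
  proof -
    have "f ` U = {\<zero>\<^bsub>N\<^esub>} \<or> f ` W = {\<zero>\<^bsub>N\<^esub>}"
      using internal_direct_sum_image[OF M lN f that] N unfolding indecomposable_def by blast
    then show ?thesis using z[of U] z[of W] that unfolding internal_direct_sum_def by blast
  qed
  ultimately show ?thesis using M by (simp add: indecomposable_def)
qed

section \<open>Left ideals generated by idempotents\<close>

definition ideal_module :: "'a set \<Rightarrow> ('a::ring_1, 'a) module" where
  "ideal_module L = restr regular_module L"

lemma ideal_module_simps [simp]: "carrier (ideal_module L) = L" "\<zero>\<^bsub>ideal_module L\<^esub> = 0"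
  "x \<oplus>\<^bsub>ideal_module L\<^esub> y = x + y" "a \<odot>\<^bsub>ideal_module L\<^esub> x = a * x"
  by (simp_all add: ideal_module_def restr_def regular_module_def)

lemma regular_module_simps [simp]: "carrier regular_module = UNIV" "\<zero>\<^bsub>regular_module\<^esub> = 0"
  "x \<oplus>\<^bsub>regular_module\<^esub> y = x + y" "a \<odot>\<^bsub>regular_module\<^esub> x = a * (x::'a::ring_1)"
  by (simp_all add: regular_module_def)

lemma left_module_regular: "left_module (regular_module :: ('a::ring_1, 'a) module)"
proof -
  have "abelian_group (regular_module :: ('a, 'a) module)"
    by (rule abelian_groupI) (auto simp: algebra_simps intro: exI[of _ "- _"])
  then show ?thesis
    by (intro left_module.intro left_module_axioms.intro) (auto simp: algebra_simps)
qed

lemma submod_regular: "submod L (regular_module :: ('a::ring_1, 'a) module) \<longleftrightarrow>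
  0 \<in> L \<and> (\<forall>x\<in>L. \<forall>y\<in>L. x + y \<in> L) \<and> (\<forall>a. \<forall>x\<in>L. a * x \<in> L)"
  using left_module.submodI[OF left_module_regular, of L] left_module.submodD[OF left_module_regular, of L]
  by auto

text \<open>For an idempotent \<open>e\<close> this is the left ideal \<open>A e\<close>; the
  fixed-point form turns membership into an equation.\<close>

abbreviation peirce :: "'a::ring_1 \<Rightarrow> ('a, 'a) module" where
  "peirce e \<equiv> ideal_module {x. x * e = x}"

lemma submod_peirce: "submod {x. x * e = x} (regular_module :: ('a::ring_1, 'a) module)"
  by (simp add: submod_regular distrib_right mult.assoc)

lemma left_module_peirce: "left_module (peirce e)"
  unfolding ideal_module_def
  by (rule left_module.left_module_restr[OF left_module_regular submod_peirce])

lemma left_module_direct_sum: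
  assumes "\<And>i. i < r \<Longrightarrow> left_module (P i)"
  shows "left_module (direct_sum r P)"
proof -
  have "abelian_group (direct_sum r P)"
  proof (rule abelian_groupI, goal_cases)
    case (1 x y)
    then show ?case using assms by (auto simp: direct_sum_def PiE_iff left_module_def abelian_group.axioms abelian_monoid.a_closed)
  next
    case 2
    then show ?case using assms by (auto simp: direct_sum_def PiE_iff left_module_def abelian_group.axioms abelian_monoid.zero_closed)
  next
    case (3 x y z)
    then show ?case using assms by (auto simp: direct_sum_def PiE_iff left_module_def abelian_group.axioms abelian_monoid.a_assoc intro!: restrict_ext)
  next
    case (4 x y)
    then show ?case using assms by (auto simp: direct_sum_def PiE_iff left_module_def abelian_group.axioms abelian_monoid.a_comm intro!: restrict_ext)
  next
    case (5 x)
    then show ?case using assms by (auto simp: direct_sum_def PiE_iff left_module_def abelian_group.axioms abelian_monoid.l_zero extensional_def fun_eq_iff)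
  next
    case (6 x)
    then show ?case using assms
      by (intro bexI[of _ "\<lambda>i\<in>{..<r}. \<ominus>\<^bsub>P i\<^esub> x i"])
        (auto simp: direct_sum_def PiE_iff left_module_def abelian_group.axioms abelian_group.l_neg abelian_group.a_inv_closed intro!: restrict_ext)
  qed
  then show ?thesis
    by (intro left_module.intro left_module_axioms.intro)
      (auto simp: direct_sum_def PiE_iff extensional_def fun_eq_iff assms left_module.smult_closed
        left_module.smult_l_distr left_module.smult_r_distr left_module.smult_assoc left_module.smult_one)
qed

lemma right_mult_mod_hom:
  assumes "x * g = (x :: 'a::ring_1)"
  shows "(\<lambda>y. y * x) \<in> mod_hom (peirce e) (peirce g)"
  using assms by (auto simp: mod_hom_def mult.assoc distrib_right)

lemma peirce_iso:
  fixes e g x y :: "'a::ring_1"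
  assumes "e * x = x" "x * g = x" "g * y = y" "y * e = y" "x * y = e" "y * x = g"
  shows "mod_iso (peirce e) (peirce g)"
proof -
  have "bij_betw (\<lambda>u. u * x) {u. u * e = u} {u. u * g = u}"
    by (rule bij_betwI[where g = "\<lambda>u. u * y"]) (auto simp: mult.assoc assms)
  then show ?thesis unfolding mod_iso_def
    by (intro bexI[OF _ right_mult_mod_hom[OF assms(2)]]) simp
qed

lemma submod_peirce_iff:
  "submod L (peirce e) \<longleftrightarrow> submod L regular_module \<and> (\<forall>x\<in>L. x * e = (x :: 'a::ring_1))"
  unfolding ideal_module_def
  by (subst left_module.submod_restr_iff[OF left_module_regular submod_peirce]) blast

text \<open>An idempotent \<open>x\<close> of the corner splits \<open>A f\<close> into
  \<open>A x\<close> and the elements killed by \<open>x\<close> on the right, which form A (f -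
  x).\<close>

lemma indecomposable_imp_prim_idem:
  fixes f :: "'a::ring_1"
  assumes f: "f * f = f" and ind: "indecomposable (peirce f)"
  shows "prim_idem f"
  unfolding prim_idem_def
proof (intro conjI allI impI)
  show "f * f = f" by fact
  show "f \<noteq> 0" using ind by (auto simp: indecomposable_def)
  fix x assume "x * x = x \<and> f * x = x \<and> x * f = x"
  then have x: "x * x = x" "f * x = x" "x * f = x" by auto
  let ?U = "{y. y * x = y}" and ?W = "{y. y * f = y \<and> y * x = 0}"
  have "internal_direct_sum (peirce f) ?U ?W"
    unfolding internal_direct_sum_def
  proof (intro conjI)
    have a: "y * f = y" if "y * x = y" for y using that x by (metis mult.assoc)
    show "submod ?U (peirce f)" "submod ?W (peirce f)"
      using a by (auto simp: submod_peirce_iff submod_regular distrib_right mult.assoc)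
    show "?U \<inter> ?W = {\<zero>\<^bsub>peirce f\<^esub>}" by auto
    show "?U <+>\<^bsub>peirce f\<^esub> ?W = carrier (peirce f)"
    proof (intro equalityI subsetI)
      fix y assume "y \<in> carrier (peirce f)"
      then have y: "y * f = y" by simp
      have "y = y * x + (y - y * x)" by simp
      moreover have "y * x \<in> ?U" by (simp add: mult.assoc x)
      moreover have "y - y * x \<in> ?W" by (simp add: left_diff_distrib mult.assoc x y)
      ultimately show "y \<in> ?U <+>\<^bsub>peirce f\<^esub> ?W" unfolding set_add_eq ideal_module_simps by blast
    qed (use a in \<open>auto simp: set_add_eq distrib_right\<close>)
  qed
  then consider "?U = {0}" | "?W = {0}" using ind by (auto simp: indecomposable_def)
  then show "x = 0 \<or> x = f"
  proof cases
    case 1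
    have "x \<in> ?U" using x by simp
    then show ?thesis unfolding 1 by simp
  next
    case 2
    have "f - x \<in> ?W" using x f by (simp add: left_diff_distrib)
    then show ?thesis unfolding 2 by simp
  qed
qed

text \<open>Write f = u + w along the decomposition. Comparing components of u f = u and w f = w
  gives u w = 0, w u = 0 and u u = u, so \<open>u\<close> is an idempotent of the corner. The
  summand that contains \<open>f\<close> is everything.\<close>

lemma prim_idem_imp_indecomposable:
  fixes f :: "'a::ring_1"
  assumes f: "prim_idem f"
  shows "indecomposable (peirce f)"
  unfolding indecomposable_def
proof (intro conjI allI impI)
  have ff: "f * f = f" "f \<noteq> 0" using f by (auto simp: prim_idem_def)
  show "left_module (peirce f)" by (rule left_module_peirce)
  show "carrier (peirce f) \<noteq> {\<zero>\<^bsub>peirce f\<^esub>}" using ff by auto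
  fix U W assume d: "internal_direct_sum (peirce f) U W"
  have U: "x + y \<in> U" "x - y \<in> U" "a * x \<in> U" "x * f = x" if "x \<in> U" "y \<in> U" for a x y
    using d that left_module.submodD[OF left_module_regular, of U]
    by (auto simp: internal_direct_sum_def submod_peirce_iff submod_regular) (metis diff_conv_add_uminus mult_minus1)
  have W: "x + y \<in> W" "x - y \<in> W" "a * x \<in> W" "x * f = x" if "x \<in> W" "y \<in> W" for a x y
    using d that left_module.submodD[OF left_module_regular, of W]
    by (auto simp: internal_direct_sum_def submod_peirce_iff submod_regular) (metis diff_conv_add_uminus mult_minus1)
  have UW: "x = 0" if "x \<in> U" "x \<in> W" for x using d that by (auto simp: internal_direct_sum_def)
  have "f \<in> U <+>\<^bsub>peirce f\<^esub> W" using d ff by (simp add: internal_direct_sum_def)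
  then obtain u w where uw: "u \<in> U" "w \<in> W" "f = u + w" by (auto simp: set_add_eq)
  have uf: "u * f = u" "w * f = w" using U W uw by auto
  have "u = u * u + u * w" using uf(1) uw(3) by (simp add: distrib_left)
  then have "u - u * u = u * w" by (metis add_diff_cancel_left')
  moreover have "u - u * u \<in> U" "u * w \<in> W" using U W uw by auto
  ultimately have "u * w = 0" using UW by metis
  then have uu: "u * u = u" using \<open>u = u * u + u * w\<close> by simp
  have "w = w * u + w * w" using uf(2) uw(3) by (simp add: distrib_left)
  then have "w - w * w = w * u" by (metis add_diff_cancel_right')
  moreover have "w - w * w \<in> W" "w * u \<in> U" using U W uw by auto
  ultimately have "w * u = 0" using UW by metis
  then have "f * u = u" using uw(3) uu by (simp add: distrib_right)
  then have "u = 0 \<or> u = f" using f uu uf unfolding prim_idem_def by blast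
  then show "U = {\<zero>\<^bsub>peirce f\<^esub>} \<or> W = {\<zero>\<^bsub>peirce f\<^esub>}"
  proof
    assume "u = 0"
    then have "f \<in> W" using uw by simp
    then have "x \<in> W" if "x \<in> U" for x using W(3)[of f f x] U(4)[of x x] that by simp
    then have "U \<subseteq> {0}" using UW by blast
    moreover have "0 \<in> U" using U(2)[OF uw(1) uw(1)] by simp
    ultimately show ?thesis by auto
  next
    assume "u = f"
    then have "f \<in> U" using uw by simp
    then have "x \<in> U" if "x \<in> W" for x using U(3)[of f f x] W(4)[of x x] that by simp
    then have "W \<subseteq> {0}" using UW by blast
    moreover have "0 \<in> W" using W(2)[OF uw(2) uw(2)] by simp
    ultimately show ?thesis by auto
  qed
qed

text \<open>The components of the image of 1 in the summands of the regular module, pulled back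
  along the isomorphism, are orthogonal idempotents with sum 1, and \<open>A (f i)\<close> is
  isomorphic to the i-th summand. Pairwise non-isomorphic summands then yield
  \<open>noniso\<close>.\<close>

lemma basic_algebra_idems:
  fixes scale :: "'k::alg_closed_field \<Rightarrow> 'a::ring_1 \<Rightarrow> 'a"
  assumes "basic_algebra scale"
  shows "\<exists>(r :: nat) f. basic_idems scale {..<r} f"
proof -
  obtain r and P :: "nat \<Rightarrow> ('a, 'a) module" where fd: "fd_algebra scale"
    and ind: "\<And>i. i < r \<Longrightarrow> indecomposable (P i)"
    and inj: "\<And>i j. i < r \<Longrightarrow> j < r \<Longrightarrow> mod_iso (P i) (P j) \<Longrightarrow> i = j"
    and iso: "mod_iso (regular_module :: ('a, 'a) module) (direct_sum r P)"
    using assms unfolding basic_algebra_def by metis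
  have lm: "left_module (P i)" if "i < r" for i using ind[OF that] by (simp add: indecomposable_def)
  obtain F where F: "F \<in> mod_hom (regular_module :: ('a, 'a) module) (direct_sum r P)"
    and bij: "bij_betw F UNIV (carrier (direct_sum r P))"
    using iso by (auto simp: mod_iso_def)
  have Fadd: "F (x + y) = F x \<oplus>\<^bsub>direct_sum r P\<^esub> F y" and Fsm: "F (a * x) = a \<odot>\<^bsub>direct_sum r P\<^esub> F x"
    and Fc: "F x \<in> carrier (direct_sum r P)" for a x y using F by (auto simp: mod_hom_def)
  have injF: "inj F" using bij by (simp add: bij_betw_def)
  define c where "c = F 1"
  have cc: "c i \<in> carrier (P i)" if "i < r" for i using Fc[of 1] that by (auto simp: c_def direct_sum_def PiE_iff)
  \<comment> \<open>Linearity over the algebra forces \<open>F\<close> to multiply the components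
    \<open>c i\<close> of the image of 1.\<close>
  have Fi: "F a i = a \<odot>\<^bsub>P i\<^esub> c i" if "i < r" for a i
    using Fsm[of a 1] that by (simp add: c_def direct_sum_def)
  have Fext: "F a = (\<lambda>k\<in>{..<r}. a \<odot>\<^bsub>P k\<^esub> c k)" for a
    using Fsm[of a 1] by (simp add: c_def direct_sum_def)
  define inc where "inc i p = (\<lambda>k\<in>{..<r}. if k = i then p else \<zero>\<^bsub>P k\<^esub>)" for i p
  have incc: "inc i p \<in> carrier (direct_sum r P)" if "i < r" "p \<in> carrier (P i)" for i p
    using that lm by (auto simp: inc_def direct_sum_def left_module_def abelian_group_def abelian_monoid.zero_closed)
  define f where "f i = inv_into UNIV F (inc i (c i))" for i
  have Ff: "F (f i) = inc i (c i)" if "i < r" for i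
    unfolding f_def using incc[OF that cc[OF that]] bij by (intro f_inv_into_f) (auto simp: bij_betw_def)
  have Faf: "F (a * f i) = inc i (a \<odot>\<^bsub>P i\<^esub> c i)" if "i < r" for a i
    using Ff[OF that] that left_module.smult_zero_right[OF lm]
    by (auto simp: Fsm inc_def direct_sum_def intro!: restrict_ext)
  have orth: "f i * f k = (if i = k then f i else 0)" if "i < r" "k < r" for i k
  proof -
    have "f i \<odot>\<^bsub>P k\<^esub> c k = (if i = k then c k else \<zero>\<^bsub>P k\<^esub>)"
      using Fi[OF that(2), of "f i"] Ff[OF that(1)] that by (auto simp: inc_def)
    then have "F (f i * f k) = F (if i = k then f i else 0)"
      using that Ff left_module.smult_zero_left[OF lm cc] by (auto simp: Faf Fext[of 0] inc_def intro!: restrict_ext)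
    then show ?thesis using injF by (auto dest: injD)
  qed
  have mi: "mod_iso (peirce (f i)) (P i)" if i: "i < r" for i
  proof -
    interpret P: left_module "P i" by (rule lm[OF i])
    have h: "(\<lambda>y. y \<odot>\<^bsub>P i\<^esub> c i) \<in> mod_hom (peirce (f i)) (P i)"
      using cc[OF i] P.smult_closed P.smult_l_distr P.smult_assoc by (auto simp: mod_hom_def)
    interpret module_hom' "peirce (f i)" "P i" "\<lambda>y. y \<odot>\<^bsub>P i\<^esub> c i"
      using h left_module_peirce lm[OF i] by (simp add: module_hom'_def module_hom'_axioms_def)
    have "bij_betw (\<lambda>y. y \<odot>\<^bsub>P i\<^esub> c i) (carrier (peirce (f i))) (carrier (P i))"
      unfolding bij_betw_def
    proof (intro conjI equalityI subsetI)
      show "inj_on (\<lambda>y. y \<odot>\<^bsub>P i\<^esub> c i) (carrier (peirce (f i)))"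
        unfolding inj_iff
      proof (intro ballI impI)
        fix y assume "y \<in> carrier (peirce (f i))" and z: "y \<odot>\<^bsub>P i\<^esub> c i = \<zero>\<^bsub>P i\<^esub>"
        then have y: "y * f i = y" by simp
        have "F y = inc i \<zero>\<^bsub>P i\<^esub>" using Faf[OF i, of y] z y by simp
        also have "\<dots> = F 0" using left_module.smult_zero_left[OF lm cc] by (auto simp: inc_def Fext[of 0] intro!: restrict_ext)
        finally show "y = \<zero>\<^bsub>peirce (f i)\<^esub>" using injF by (simp add: inj_eq)
      qed
    next
      fix p assume p: "p \<in> carrier (P i)"
      define y where "y = inv_into UNIV F (inc i p)"
      have Fy: "F y = inc i p" unfolding y_def using incc[OF i p] bij by (intro f_inv_into_f) (auto simp: bij_betw_def)
      then have yc: "y \<odot>\<^bsub>P i\<^esub> c i = p" using Fi[OF i, of y] i by (simp add: inc_def)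
      then have "F (y * f i) = F y" using Faf[OF i] Fy by simp
      then have "y * f i = y" using injF by (simp add: inj_eq)
      then show "p \<in> (\<lambda>y. y \<odot>\<^bsub>P i\<^esub> c i) ` carrier (peirce (f i))" using yc by force
    qed (use closed in auto)
    then show ?thesis using h by (auto simp: mod_iso_def)
  qed
  have "basic_idems scale {..<r} f"
  proof (intro basic_idems.intro ac_algebra.intro fd basic_idems_axioms.intro)
    fix i assume i: "i \<in> {..<r}"
    then show "prim_idem (f i)"
      using indecomposable_iso[OF left_module_peirce mi ind, of i] orth[of i i]
      by (intro indecomposable_imp_prim_idem) auto
    fix k assume k: "k \<in> {..<r}" and ne: "i \<noteq> k"
    show "f i * f k = 0" using orth[of i k] i k ne by simp
    fix x y assume x: "f i * x * f k = x" and y: "f k * y * f i = y" and xy: "x * y = f i"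
    have ii: "f i * f i = f i" "f k * f k = f k" using orth i k by auto
    show "y * x \<noteq> f k"
    proof
      assume yx: "y * x = f k"
      have "f i * x = x" "x * f k = x" "f k * y = y" "y * f i = y" using x y ii by (metis mult.assoc)+
      then have "mod_iso (peirce (f i)) (peirce (f k))" using xy yx by (intro peirce_iso)
      then have "mod_iso (P i) (P k)"
        using mod_iso_trans[OF mod_iso_sym[OF left_module_peirce mi]] mod_iso_trans mi i k by blast
      then show False using inj ne i k by auto
    qed
  next
    \<comment> \<open>Partial sums of the \<open>f i\<close> are mapped to truncations of the tuple
      \<open>c\<close>, so the full sum has the same image as 1.\<close>
    have s: "F (\<Sum>i<n. f i) = (\<lambda>k\<in>{..<r}. if k < n then c k else \<zero>\<^bsub>P k\<^esub>)" if "n \<le> r" for n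
      using that
    proof (induction n)
      case 0
      then show ?case using left_module.smult_zero_left[OF lm cc] by (auto simp: Fext[of 0] intro!: restrict_ext)
    next
      case (Suc n)
      have "F (\<Sum>i<Suc n. f i) = F (\<Sum>i<n. f i) \<oplus>\<^bsub>direct_sum r P\<^esub> F (f n)" by (simp add: Fadd)
      also have "\<dots> = (\<lambda>k\<in>{..<r}. if k < Suc n then c k else \<zero>\<^bsub>P k\<^esub>)"
        using Suc lm cc by (auto simp: Ff inc_def direct_sum_def left_module_def abelian_group_def
            abelian_monoid.l_zero abelian_monoid.r_zero abelian_monoid.zero_closed intro!: restrict_ext)
      finally show ?case .
    qed
    have "F (\<Sum>i<r. f i) = F 1" using s[of r] Fext[of 1] left_module.smult_one[OF lm cc] by (auto intro!: restrict_ext)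
    then show "(\<Sum>i<r. f i) = 1" using injF by (simp add: inj_eq)
  qed simp
  then show ?thesis by blast
qed


section \<open>Gradings and homogeneous idempotents\<close>

locale graded_algebra = fd_algebra scale for scale :: "'k::field \<Rightarrow> 'a::ring_1 \<Rightarrow> 'a" +
  fixes G :: "int \<Rightarrow> 'a set"
  assumes grading: "grading scale G"
begin

lemma subspace_G: "subspace (G l)"
  using grading by (simp add: grading_def)

lemma G_mult: "x \<in> G i \<Longrightarrow> y \<in> G j \<Longrightarrow> x * y \<in> G (i + j)"
  using grading by (simp add: grading_def)

lemmas G_0 = subspace_0[OF subspace_G] and G_add = subspace_add[OF subspace_G]
  and G_scale = subspace_scale[OF subspace_G] and G_diff = subspace_diff[OF subspace_G]
  and G_sum = subspace_sum[OF subspace_G]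

definition hcomp :: "'a \<Rightarrow> int \<Rightarrow> 'a" where
  "hcomp x = (THE f. (\<forall>i. f i \<in> G i) \<and> finite {i. f i \<noteq> 0} \<and> x = (\<Sum>i | f i \<noteq> 0. f i))"

lemma comp_all: "(\<forall>i. hcomp x i \<in> G i) \<and> finite {i. hcomp x i \<noteq> 0} \<and> x = (\<Sum>i | hcomp x i \<noteq> 0. hcomp x i)"
proof -
  have "\<exists>!f. (\<forall>i. f i \<in> G i) \<and> finite {i. f i \<noteq> 0} \<and> x = (\<Sum>i | f i \<noteq> 0. f i)"
    using grading unfolding grading_def by blast
  from theI'[OF this] show ?thesis unfolding hcomp_def .
qed

lemma comp_in: "hcomp x i \<in> G i" and finite_comp: "finite {i. hcomp x i \<noteq> 0}"
  and comp_sum: "x = (\<Sum>i | hcomp x i \<noteq> 0. hcomp x i)"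
  using comp_all[of x] by auto

lemma comp_sum': "finite S \<Longrightarrow> {i. hcomp x i \<noteq> 0} \<subseteq> S \<Longrightarrow> x = (\<Sum>i\<in>S. hcomp x i)"
  by (subst comp_sum, rule sum.mono_neutral_left) auto

lemma comp_unique:
  assumes "\<And>i. f i \<in> G i" "finite S" "\<And>i. i \<notin> S \<Longrightarrow> f i = 0" "x = (\<Sum>i\<in>S. f i)"
  shows "hcomp x = f"
proof -
  have s: "{i. f i \<noteq> 0} \<subseteq> S" using assms(3) by blast
  then have "finite {i. f i \<noteq> 0}" "x = (\<Sum>i | f i \<noteq> 0. f i)"
    using assms(2,4) finite_subset by (auto intro!: sum.mono_neutral_cong_right)
  moreover have "\<exists>!f. (\<forall>i. f i \<in> G i) \<and> finite {i. f i \<noteq> 0} \<and> x = (\<Sum>i | f i \<noteq> 0. f i)"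
    using grading by (simp add: grading_def)
  ultimately show ?thesis using comp_all[of x] assms(1) by blast
qed

lemma comp_add: "hcomp (x + y) i = hcomp x i + hcomp y i"
proof -
  let ?S = "{i. hcomp x i \<noteq> 0} \<union> {i. hcomp y i \<noteq> 0}"
  have f: "finite ?S" using finite_comp by simp
  have "hcomp (x + y) = (\<lambda>i. hcomp x i + hcomp y i)"
    using comp_sum'[OF f, of x] comp_sum'[OF f, of y]
    by (intro comp_unique[of _ ?S] G_add comp_in f) (auto simp: sum.distrib)
  then show ?thesis by simp
qed

lemma comp_homogeneous: "x \<in> G d \<Longrightarrow> hcomp x i = (if i = d then x else 0)"
proof -
  assume x: "x \<in> G d"
  have "hcomp x = (\<lambda>i. if i = d then x else 0)"
    by (rule comp_unique[of _ "{d}"]) (use x G_0 in auto)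
  then show ?thesis by simp
qed

lemma comp_0 [simp]: "hcomp 0 i = 0"
  using comp_homogeneous[OF G_0[of i], of i] by simp

lemma comp_sum_distrib: "hcomp (\<Sum>a\<in>S. g a) i = (\<Sum>a\<in>S. hcomp (g a) i)"
  by (induction S rule: infinite_finite_induct) (simp_all add: comp_add)

lemma comp_mult_left:
  assumes a: "a \<in> G d"
  shows "hcomp (a * x) i = a * hcomp x (i - d)"
proof -
  let ?S = "{i. hcomp x i \<noteq> 0}"
  have "a * x = (\<Sum>j\<in>?S. a * hcomp x j)" by (subst comp_sum[of x]) (simp add: sum_distrib_left)
  also have "\<dots> = (\<Sum>i\<in>(\<lambda>j. j + d) ` ?S. a * hcomp x (i - d))"
    by (subst sum.reindex) (auto intro: inj_onI)
  finally have eq: "a * x = (\<Sum>i\<in>(\<lambda>j. j + d) ` ?S. a * hcomp x (i - d))" .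
  have "hcomp (a * x) = (\<lambda>i. a * hcomp x (i - d))"
  proof (rule comp_unique[OF _ _ _ eq])
    fix i show "a * hcomp x (i - d) \<in> G i" using G_mult[OF a comp_in[of x "i - d"]] by simp
    assume "i \<notin> (\<lambda>j. j + d) ` ?S"
    then have "i - d \<notin> ?S" by force
    then show "a * hcomp x (i - d) = 0" by simp
  qed (use finite_comp in simp)
  then show ?thesis by simp
qed

lemma comp_mult_right:
  assumes a: "a \<in> G d"
  shows "hcomp (x * a) i = hcomp x (i - d) * a"
proof -
  let ?S = "{i. hcomp x i \<noteq> 0}"
  have "x * a = (\<Sum>j\<in>?S. hcomp x j * a)" by (subst comp_sum[of x]) (simp add: sum_distrib_right)
  also have "\<dots> = (\<Sum>i\<in>(\<lambda>j. j + d) ` ?S. hcomp x (i - d) * a)"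
    by (subst sum.reindex) (auto intro: inj_onI)
  finally have eq: "x * a = (\<Sum>i\<in>(\<lambda>j. j + d) ` ?S. hcomp x (i - d) * a)" .
  have "hcomp (x * a) = (\<lambda>i. hcomp x (i - d) * a)"
  proof (rule comp_unique[OF _ _ _ eq])
    fix i show "hcomp x (i - d) * a \<in> G i" using G_mult[OF comp_in[of x "i - d"] a] by simp
    assume "i \<notin> (\<lambda>j. j + d) ` ?S"
    then have "i - d \<notin> ?S" by force
    then show "hcomp x (i - d) * a = 0" by simp
  qed (use finite_comp in simp)
  then show ?thesis by simp
qed

text \<open>Comparing components of degree \<open>d\<close> in x = x 1 for homogeneous
  \<open>x\<close> shows that the degree 0 component of 1 is a right identity on homogeneous
  elements, hence on 1 itself.\<close>

lemma one_in_G0: "1 \<in> G 0"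
proof -
  have "x * hcomp 1 0 = x" if "x \<in> G d" for x d
    using comp_mult_left[OF that, of 1 d] comp_homogeneous[OF that, of d] by simp
  then have "hcomp 1 i * hcomp 1 0 = hcomp 1 i" for i using comp_in by blast
  then have "(\<Sum>i | hcomp 1 i \<noteq> 0. hcomp 1 i) * hcomp 1 0 = (\<Sum>i | hcomp 1 i \<noteq> 0. hcomp 1 i)"
    by (simp add: sum_distrib_right)
  then have "1 * hcomp 1 0 = 1" using comp_sum[of 1] by simp
  then show ?thesis using comp_in[of 1 0] by simp
qed

lemma G_disjoint: "x \<in> G i \<Longrightarrow> x \<in> G j \<Longrightarrow> x \<noteq> 0 \<Longrightarrow> i = j"
  using comp_homogeneous[of x i i] comp_homogeneous[of x j i] by (auto split: if_splits)

lemma homogeneous_power: "x \<in> G d \<Longrightarrow> x ^ n \<in> G (int n * d)"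
proof (induction n)
  case (Suc n)
  then show ?case using G_mult[of x d "x ^ n" "int n * d"] by (simp add: algebra_simps)
qed (simp add: one_in_G0)

text \<open>In an equation p(x) = 0 the terms have pairwise different degrees, as \<open>d\<close>
  is nonzero; so the leading term vanishes by itself.\<close>

lemma homogeneous_nilp:
  assumes x: "x \<in> G d" and d: "d \<noteq> 0"
  shows "nilp x"
proof -
  obtain p where p: "p \<noteq> 0" "ev x p = 0" using ex_annihilating_poly[of x] by blast
  define n where "n = degree p"
  have c: "hcomp (scale (coeff p i) (x ^ i)) (int n * d) = (if i = n then scale (coeff p i) (x ^ i) else 0)" for i
    using comp_homogeneous[OF G_scale[OF homogeneous_power[OF x, of i]], of "coeff p i" "int n * d"] d by auto
  have "0 = hcomp (ev x p) (int n * d)" using p(2) by simp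
  also have "\<dots> = scale (coeff p n) (x ^ n)"
    by (simp add: ev_def n_def[symmetric] comp_sum_distrib c)
  finally show ?thesis using p(1) by (auto simp: n_def nilp_def)
qed

end

section \<open>Lifting idempotents modulo the radical\<close>

lemma power_mult_distrib':
  fixes u v :: "'a::monoid_mult"
  assumes c: "u * v = v * u"
  shows "(u * v) ^ m = u ^ m * v ^ m"
proof (induction m)
  case (Suc m)
  have "(u * v) ^ Suc m = u * (v * u ^ m) * v ^ m" by (simp add: Suc mult.assoc)
  also have "v * u ^ m = u ^ m * v" using power_commuting_commutes[OF c] by simp
  finally show ?case by (simp add: mult.assoc)
qed simp

text \<open>Newton iteration for X^2 - X: with d = x^2 - x, the step x + d - 2 x d = 3 x^2 - 2 x^3
  turns the defect d into d^2 (4 d - 3), so the nilpotency exponent is halved. Only sums,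
  differences and products occur, which lets the iteration run inside a corner whose unit is not 1;
  \<open>Q\<close> carries the values of the characters along.\<close>

lemma lift_idempotent:
  fixes S :: "'a::ring_1 set"
  assumes S: "\<And>a b. a \<in> S \<Longrightarrow> b \<in> S \<Longrightarrow> a + b \<in> S" "\<And>a b. a \<in> S \<Longrightarrow> b \<in> S \<Longrightarrow> a - b \<in> S" "\<And>a b. a \<in> S \<Longrightarrow> b \<in> S \<Longrightarrow> a * b \<in> S"
    and x: "x \<in> S" "(x * x - x) ^ n = 0"
    and Q: "\<And>x. Q x \<Longrightarrow> Q (x + (x * x - x) - x * (x * x - x) - x * (x * x - x))" "Q x"
  shows "\<exists>e\<in>S. e * e = e \<and> Q e"
proof -
  have "\<exists>e\<in>S. e * e = e \<and> Q e" if "x \<in> S" "(x * x - x) ^ (2 ^ k) = 0" "Q x" for k x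
    using that
  proof (induction k arbitrary: x)
    case 0
    then show ?case by auto
  next
    case (Suc k)
    let ?d = "x * x - x"
    let ?y = "x + ?d - x * ?d - x * ?d"
    define w where "w = ?d + ?d + ?d + ?d - 1 - 1 - 1"
    have eq: "?y * ?y - ?y = (?d * ?d) * w"
      by (simp add: w_def algebra_simps)
    have dw: "?d * w = w * ?d" by (simp add: w_def distrib_left distrib_right left_diff_distrib right_diff_distrib)
    have "?d * ?d * w = w * (?d * ?d)" using dw by (metis mult.assoc)
    then have "(?y * ?y - ?y) ^ 2 ^ k = (?d * ?d) ^ 2 ^ k * w ^ 2 ^ k"
      unfolding eq by (rule power_mult_distrib')
    also have "(?d * ?d) ^ 2 ^ k = ?d ^ 2 ^ Suc k"
      by (simp only: power2_eq_square[symmetric] power_mult[symmetric] power_Suc)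
    finally have "(?y * ?y - ?y) ^ 2 ^ k = 0" using Suc.prems(2) by simp
    then show ?case using Suc.prems Q by (intro Suc.IH[of ?y] S) auto
  qed
  moreover have "(x * x - x) ^ (2 ^ n) = 0" 
    using x(2) power_add[of "x * x - x" n "2 ^ n - n"] less_exp[of n] by simp
  ultimately show ?thesis using x Q by blast
qed

context split_algebra
begin

text \<open>The Jacobson radical: its elements are nilpotent, and the quotient by it is a product of
  copies of the field.\<close>

definition rad :: "'a set" where
  "rad = {x. \<forall>i\<in>I. \<chi> i x = 0}"

lemma chi_0: "i \<in> I \<Longrightarrow> \<chi> i 0 = 0"
  using chi_scale[of i 0 0] by simp

lemma chi_diff: "i \<in> I \<Longrightarrow> \<chi> i (x - y) = \<chi> i x - \<chi> i y"
  using chi_add[of i "x - y" y] by simp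

lemma chi_sum: "i \<in> I \<Longrightarrow> \<chi> i (\<Sum>a\<in>S. g a) = (\<Sum>a\<in>S. \<chi> i (g a))"
  by (induction S rule: infinite_finite_induct) (simp_all add: chi_0 chi_add)

lemma chi_power: "i \<in> I \<Longrightarrow> \<chi> i (x ^ n) = \<chi> i x ^ n"
  by (induction n) (simp_all add: chi_one chi_mult)

lemma chi_nilp: "i \<in> I \<Longrightarrow> nilp x \<Longrightarrow> \<chi> i x = 0"
  using chi_power[of i x] chi_0 by (auto simp: nilp_def) (metis power_not_zero)

lemma subspace_rad: "subspace rad"
  by (auto simp: subspace_def rad_def chi_0 chi_add chi_scale)

lemma rad_mult: "x \<in> rad \<Longrightarrow> a * x \<in> rad" "x \<in> rad \<Longrightarrow> x * a \<in> rad"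
  by (auto simp: rad_def chi_mult)

text \<open>For \<open>n\<close> as in \<open>ex_power_stable\<close>, x^n = g x^(n+1) puts the left
  ideal A x^n inside its product with the radical, so it vanishes by Nakayama's lemma.\<close>

lemma rad_nilp:
  assumes x: "x \<in> rad"
  shows "nilp x"
proof -
  obtain n g where n: "x ^ n = x ^ Suc n * g" and g: "g * x = x * g" using ex_power_stable[of x] by blast
  let ?L = "{a * x ^ n | a. True}"
  have "left_ideal ?L"
    unfolding left_ideal_def subspace_def
    by (auto simp: mult.assoc[symmetric] scale_mult_left[symmetric] distrib_right[symmetric] intro: exI[of _ 0])
  moreover have "?L \<subseteq> {u * y | u y. (\<forall>i\<in>I. \<chi> i u = 0) \<and> y \<in> ?L}"
  proof clarify
    fix a
    have "x ^ n = g * x ^ Suc n" using n power_mult_commute[OF g, of 1 "Suc n"] by simp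
    then have "a * x ^ n = (a * g * x) * (1 * x ^ n)" by (simp add: mult.assoc)
    moreover have "\<forall>i\<in>I. \<chi> i (a * g * x) = 0" using x by (simp add: chi_mult rad_def)
    ultimately show "\<exists>u y. a * x ^ n = u * y \<and> (\<forall>i\<in>I. \<chi> i u = 0) \<and> y \<in> ?L" by blast
  qed
  ultimately have "?L = {0}" using nakayama[of ?L] span_superset by blast
  then have "1 * x ^ n = 0" by blast
  then show ?thesis by (auto simp: nilp_def)
qed

definition idem_family :: "('i \<Rightarrow> 'a) \<Rightarrow> bool" where
  "idem_family e \<longleftrightarrow> (\<forall>i\<in>I. \<forall>k\<in>I. e i * e k = (if i = k then e i else 0)) \<and> (\<Sum>i\<in>I. e i) = 1 \<and>
      (\<forall>i\<in>I. \<forall>k\<in>I. \<chi> i (e k) = (if i = k then 1 else 0))"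

text \<open>Components of nonzero degree are nilpotent, so a character sees only the component of
  degree 0.\<close>

lemma chi_hcomp_0:
  assumes "graded_algebra scale G" and i: "i \<in> I"
  shows "\<chi> i (graded_algebra.hcomp G x 0) = \<chi> i x"
proof -
  interpret G: graded_algebra scale G by fact
  let ?S = "insert 0 {j. G.hcomp x j \<noteq> 0}"
  have z: "\<chi> i (G.hcomp x j) = 0" if "j \<noteq> 0" for j
    by (rule chi_nilp[OF i G.homogeneous_nilp[OF G.comp_in that]])
  have "x = (\<Sum>j\<in>?S. G.hcomp x j)" by (rule G.comp_sum') (use G.finite_comp[of x] in auto)
  then have "\<chi> i x = (\<Sum>j\<in>?S. \<chi> i (G.hcomp x j))" using chi_sum[OF i, of "G.hcomp x" ?S] by simp
  also have "\<dots> = (\<Sum>j\<in>?S. if j = 0 then \<chi> i (G.hcomp x 0) else 0)" by (intro sum.cong refl) (simp add: z)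
  also have "\<dots> = \<chi> i (G.hcomp x 0)" using G.finite_comp[of x] by (subst sum.delta) auto
  finally show ?thesis by simp
qed

lemma hcomp_rad:
  assumes "graded_algebra scale G" and "x \<in> rad"
  shows "graded_algebra.hcomp G x d \<in> rad"
proof -
  interpret G: graded_algebra scale G by fact
  show ?thesis
  proof (cases "d = 0")
    case True
    then show ?thesis using chi_hcomp_0[OF assms(1)] assms(2) by (simp add: rad_def)
  next
    case False
    then show ?thesis using chi_nilp[OF _ G.homogeneous_nilp[OF G.comp_in]] by (simp add: rad_def)
  qed
qed

text \<open>The degree 0 components of a given family have the right character values but are
  idempotent only modulo the radical. They are corrected one at a time: with \<open>F\<close> the
  complement of the idempotents already found, the next one is lifted inside the degree 0 part of
  the corner of \<open>F\<close>, which keeps the family orthogonal. In the end 1 minus the sum is a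
  nilpotent idempotent, hence 0.\<close>

lemma homogeneous_idem_family:
  assumes "graded_algebra scale G"
  shows "\<exists>e. idem_family e \<and> (\<forall>i\<in>I. e i \<in> G 0)"
proof -
  interpret G: graded_algebra scale G by fact
  obtain f where f: "idem_family f" using ex_idempotents by (auto simp: idem_family_def)
  define h where "h i = G.hcomp (f i) 0" for i
  note chi_comp = chi_hcomp_0[OF assms]
  have "\<exists>e. (\<forall>i\<in>T. \<forall>k\<in>T. e i * e k = (if i = k then e i else 0)) \<and> (\<forall>k\<in>T. e k \<in> G 0) \<and>
      (\<forall>i\<in>I. \<forall>k\<in>T. \<chi> i (e k) = (if i = k then 1 else 0))" if "finite T" "T \<subseteq> I" for T
    using that
  proof (induction T rule: finite_induct)
    case empty
    then show ?case by auto
  next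
    case (insert t T)
    then obtain e where E: "(\<forall>i\<in>T. \<forall>k\<in>T. e i * e k = (if i = k then e i else 0)) \<and> (\<forall>k\<in>T. e k \<in> G 0) \<and>
      (\<forall>i\<in>I. \<forall>k\<in>T. \<chi> i (e k) = (if i = k then 1 else 0))" by blast
    have o: "\<And>i k. i \<in> T \<Longrightarrow> k \<in> T \<Longrightarrow> e i * e k = (if i = k then e i else 0)"
      and e0: "\<And>k. k \<in> T \<Longrightarrow> e k \<in> G 0"
      and ce: "\<And>i k. i \<in> I \<Longrightarrow> k \<in> T \<Longrightarrow> \<chi> i (e k) = (if i = k then 1 else 0)"
      using E by simp_all
    have tI: "t \<in> I" "t \<notin> T" using insert by auto
    define F where "F = 1 - (\<Sum>k\<in>T. e k)"
    have F0: "F \<in> G 0" unfolding F_def by (intro G.G_diff G.one_in_G0 G.G_sum e0)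
    have eF: "e k * F = 0" "F * e k = 0" if "k \<in> T" for k
    proof -
      have "(\<Sum>n\<in>T. e k * e n) = (\<Sum>n\<in>T. if k = n then e k else 0)"
        "(\<Sum>n\<in>T. e n * e k) = (\<Sum>n\<in>T. if k = n then e k else 0)"
        using o that by (auto intro!: sum.cong)
      then show "e k * F = 0" "F * e k = 0" using that insert(1)
        by (simp_all add: F_def right_diff_distrib left_diff_distrib sum_distrib_left sum_distrib_right)
    qed
    have FF: "F * F = F"
    proof -
      have "F * (\<Sum>k\<in>T. e k) = 0" using eF by (simp add: sum_distrib_left)
      moreover have "F * F = F * (1 - (\<Sum>k\<in>T. e k))" by (simp add: F_def)
      ultimately show ?thesis by (simp add: right_diff_distrib)
    qed
    have cF: "\<chi> i F = (if i \<in> T then 0 else 1)" if "i \<in> I" for i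
      using that ce insert(1) by (simp add: F_def chi_diff chi_one chi_sum cong: if_cong)
    define x where "x = F * h t * F"
    have cx: "\<chi> i x = (if i = t then 1 else 0)" if "i \<in> I" for i
      using f that tI by (auto simp: x_def chi_mult cF h_def chi_comp idem_family_def)
    let ?S = "{y \<in> G 0. F * y = y \<and> y * F = y}"
    let ?Q = "\<lambda>y. \<forall>i\<in>I. \<chi> i y = (if i = t then 1 else 0)"
    have "x * x - x \<in> rad" by (auto simp: rad_def chi_diff chi_mult cx)
    then obtain n where n: "(x * x - x) ^ n = 0" using rad_nilp by (auto simp: nilp_def)
    have xS: "x \<in> ?S"
      using G.G_mult[OF G.G_mult[OF F0 G.comp_in[of "f t" 0]] F0] FF
      by (auto simp: x_def h_def mult.assoc) (simp add: mult.assoc[symmetric])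
    have "\<exists>u\<in>?S. u * u = u \<and> ?Q u"
    proof (rule lift_idempotent[OF _ _ _ xS n])
      fix a b assume "a \<in> ?S" "b \<in> ?S"
      then show "a + b \<in> ?S" "a - b \<in> ?S" by (auto simp: distrib_left distrib_right left_diff_distrib right_diff_distrib G.G_add G.G_diff)
      show "a * b \<in> ?S" using \<open>a \<in> ?S\<close> \<open>b \<in> ?S\<close> G.G_mult[of a 0 b 0] by (auto simp: mult.assoc) (simp add: mult.assoc[symmetric])
    next
      fix y assume "?Q y"
      then show "?Q (y + (y * y - y) - y * (y * y - y) - y * (y * y - y))"
        by (auto simp: chi_add chi_diff chi_mult)
    qed (use cx in auto)
    then obtain u where u: "u \<in> G 0" "F * u = u" "u * F = u" "u * u = u" "?Q u" by blast
    have eu: "e k * u = 0" "u * e k = 0" if "k \<in> T" for k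
      using eF[OF that] u(2,3) by (metis mult.assoc mult_zero_left, metis mult.assoc mult_zero_right)
    show ?case
      by (rule exI[of _ "e(t := u)"]) (use tI o e0 ce u eu in auto)
  qed
  from this[OF finite_I subset_refl]
  obtain e where E: "(\<forall>i\<in>I. \<forall>k\<in>I. e i * e k = (if i = k then e i else 0)) \<and> (\<forall>k\<in>I. e k \<in> G 0) \<and>
      (\<forall>i\<in>I. \<forall>k\<in>I. \<chi> i (e k) = (if i = k then 1 else 0))" by blast
  have o: "\<And>i k. i \<in> I \<Longrightarrow> k \<in> I \<Longrightarrow> e i * e k = (if i = k then e i else 0)"
    and e0: "\<And>k. k \<in> I \<Longrightarrow> e k \<in> G 0"
    and ce: "\<And>i k. i \<in> I \<Longrightarrow> k \<in> I \<Longrightarrow> \<chi> i (e k) = (if i = k then 1 else 0)"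
    using E by simp_all
  have "1 - (\<Sum>k\<in>I. e k) \<in> rad"
    using finite_I ce by (auto simp: rad_def chi_diff chi_one chi_sum cong: if_cong)
  then have "nilp (1 - (\<Sum>k\<in>I. e k))" by (rule rad_nilp)
  moreover have "(\<Sum>k\<in>I. e k) * (\<Sum>k\<in>I. e k) = (\<Sum>k\<in>I. e k)"
    using finite_I o by (simp add: sum_distrib_left sum_distrib_right cong: if_cong sum.cong)
  then have "(1 - (\<Sum>k\<in>I. e k)) * (1 - (\<Sum>k\<in>I. e k)) = 1 - (\<Sum>k\<in>I. e k)"
    by (simp add: left_diff_distrib right_diff_distrib)
  ultimately have "1 - (\<Sum>k\<in>I. e k) = 0" by (rule nilp_idem_zero)
  then show ?thesis using o e0 ce by (intro exI[of _ e]) (auto simp: idem_family_def)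
qed

end


section \<open>Projective modules\<close>

lemma internal_direct_sum_projection:
  assumes M: "left_module M" and d: "internal_direct_sum M U W"
  shows "\<exists>p\<in>mod_hom M (restr M U). \<forall>u\<in>U. p u = u"
proof -
  interpret left_module M by fact
  have U: "submod U M" and W: "submod W M" and UW: "U <+>\<^bsub>M\<^esub> W = carrier M" "U \<inter> W = {\<zero>\<^bsub>M\<^esub>}"
    using d by (auto simp: internal_direct_sum_def)
  note DU = submodD[OF U] and DW = submodD[OF W]
  have cU: "u \<in> carrier M" if "u \<in> U" for u using DU(1) that by blast
  have cW: "w \<in> carrier M" if "w \<in> W" for w using DW(1) that by blast
  have uniq: "u = u'" if "u \<in> U" "u' \<in> U" "w \<in> W" "w' \<in> W" "u \<oplus>\<^bsub>M\<^esub> w = u' \<oplus>\<^bsub>M\<^esub> w'" for u u' w w'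
  proof -
    have c: "u \<in> carrier M" "u' \<in> carrier M" "w \<in> carrier M" "w' \<in> carrier M" using that cU cW by auto
    have "u \<ominus>\<^bsub>M\<^esub> u' = (u \<oplus>\<^bsub>M\<^esub> w) \<oplus>\<^bsub>M\<^esub> (\<ominus>\<^bsub>M\<^esub> w \<oplus>\<^bsub>M\<^esub> \<ominus>\<^bsub>M\<^esub> u')"
      using c by (simp add: a_minus_def a_assoc r_neg2)
    also have "\<dots> = (w' \<oplus>\<^bsub>M\<^esub> u') \<oplus>\<^bsub>M\<^esub> (\<ominus>\<^bsub>M\<^esub> u' \<oplus>\<^bsub>M\<^esub> \<ominus>\<^bsub>M\<^esub> w)"
      using that(5) c by (simp add: a_comm)
    also have "\<dots> = w' \<ominus>\<^bsub>M\<^esub> w"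
      using c by (simp add: a_minus_def a_assoc r_neg2)
    finally have "u \<ominus>\<^bsub>M\<^esub> u' = w' \<ominus>\<^bsub>M\<^esub> w" .
    then have "u \<ominus>\<^bsub>M\<^esub> u' \<in> U \<inter> W" using DU(6) DW(6) that by (metis IntI)
    then show ?thesis using UW(2) minus_eq_zero_iff cU that by simp
  qed
  define p where "p x = (THE u. u \<in> U \<and> (\<exists>w\<in>W. x = u \<oplus>\<^bsub>M\<^esub> w))" for x
  have p_eq: "p (u \<oplus>\<^bsub>M\<^esub> w) = u" if "u \<in> U" "w \<in> W" for u w
    unfolding p_def using that uniq by (intro the_equality) blast+
  have ex: "\<exists>u\<in>U. \<exists>w\<in>W. x = u \<oplus>\<^bsub>M\<^esub> w" if "x \<in> carrier M" for x
    using that unfolding UW(1)[symmetric] set_add_eq by blast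
  have "p x \<in> U" if "x \<in> carrier M" for x using ex[OF that] p_eq by auto
  moreover have "p (x \<oplus>\<^bsub>M\<^esub> y) = p x \<oplus>\<^bsub>M\<^esub> p y" if xy: "x \<in> carrier M" "y \<in> carrier M" for x y
  proof -
    obtain u w u' w' where *: "u \<in> U" "w \<in> W" "x = u \<oplus>\<^bsub>M\<^esub> w" "u' \<in> U" "w' \<in> W" "y = u' \<oplus>\<^bsub>M\<^esub> w'"
      using ex xy by meson
    then have "x \<oplus>\<^bsub>M\<^esub> y = (u \<oplus>\<^bsub>M\<^esub> u') \<oplus>\<^bsub>M\<^esub> (w \<oplus>\<^bsub>M\<^esub> w')" using cU cW by (simp add: a_ac)
    then show ?thesis using p_eq DU(3) DW(3) * by simp
  qed
  moreover have "p (a \<odot>\<^bsub>M\<^esub> x) = a \<odot>\<^bsub>M\<^esub> p x" if x: "x \<in> carrier M" for a x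
  proof -
    obtain u w where *: "u \<in> U" "w \<in> W" "x = u \<oplus>\<^bsub>M\<^esub> w" using ex[OF x] by blast
    then have "a \<odot>\<^bsub>M\<^esub> x = a \<odot>\<^bsub>M\<^esub> u \<oplus>\<^bsub>M\<^esub> a \<odot>\<^bsub>M\<^esub> w" using cU cW smult_r_distr by simp
    then show ?thesis using p_eq DU(4) DW(4) * by simp
  qed
  moreover have "p u = u" if "u \<in> U" for u using p_eq[OF that DW(2)] cU[OF that] by simp
  ultimately show ?thesis by (intro bexI[of _ p]) (auto simp: mod_hom_def restr_def)
qed

abbreviation free_module :: "nat \<Rightarrow> ('a::ring_1, nat \<Rightarrow> 'a) module" where
  "free_module n \<equiv> direct_sum n (\<lambda>_. regular_module)"

lemma left_module_free: "left_module (free_module n)"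
  by (rule left_module_direct_sum) (rule left_module_regular)

lemma projective_retract:
  assumes "projective P"
  shows "\<exists>n. \<exists>\<phi>\<in>mod_hom P (free_module n). \<exists>p\<in>mod_hom (free_module n) P. \<forall>x\<in>carrier P. p (\<phi> x) = x"
proof -
  have P: "left_module P" using assms by (simp add: projective_def)
  obtain n U W where d: "internal_direct_sum (free_module n) U W" and "mod_iso P (restr (free_module n) U)"
    using assms unfolding projective_def by metis
  then obtain g where g: "g \<in> mod_hom P (restr (free_module n) U)" "bij_betw g (carrier P) (carrier (restr (free_module n) U))"
    by (auto simp: mod_iso_def)
  obtain q where q: "q \<in> mod_hom (free_module n) (restr (free_module n) U)" "\<And>u. u \<in> U \<Longrightarrow> q u = u"
    using internal_direct_sum_projection[OF left_module_free d] by blast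
  have UF: "U \<subseteq> carrier (free_module n)"
    using d left_module.submodD(1)[OF left_module_free] by (auto simp: internal_direct_sum_def)
  have "g \<in> mod_hom P (free_module n)" using g(1) UF by (auto simp: mod_hom_def restr_def)
  moreover have "(\<lambda>x. inv_into (carrier P) g (q x)) \<in> mod_hom (free_module n) P"
    by (rule mod_hom_compose[OF q(1) mod_hom_inv[OF P g]])
  moreover have "inv_into (carrier P) g (q (g x)) = x" if "x \<in> carrier P" for x
  proof -
    have "g x \<in> U" using g(1) that by (auto simp: mod_hom_def restr_def)
    then show ?thesis using q(2) g(2) that by (simp add: bij_betw_def)
  qed
  ultimately show ?thesis
    by (intro exI[of _ n] bexI[of _ g] bexI[of _ "\<lambda>x. inv_into (carrier P) g (q x)"] ballI)
qed

text \<open>A tuple is the sum of its entries times the standard basis vectors. With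
  \<open>R\<close> the radical, this turns coordinates in the radical into membership in a submodule
  that contains all radical multiples.\<close>

lemma free_hom_in:
  fixes M :: "('a::ring_1, 'b) module"
  assumes h: "h \<in> mod_hom (free_module n) M" and M: "left_module M"
    and N: "\<zero>\<^bsub>M\<^esub> \<in> N" "\<And>x y. x \<in> N \<Longrightarrow> y \<in> N \<Longrightarrow> x \<oplus>\<^bsub>M\<^esub> y \<in> N"
    and R: "\<And>a s. a \<in> R \<Longrightarrow> s < n \<Longrightarrow> a \<odot>\<^bsub>M\<^esub> h (\<lambda>i\<in>{..<n}. if i = s then 1 else 0) \<in> N"
    and y: "y \<in> carrier (free_module n)" "\<And>s. s < n \<Longrightarrow> y s \<in> R"
  shows "h y \<in> N"
proof -
  interpret module_hom' "free_module n" M h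
    using h M left_module_free by (simp add: module_hom'_def module_hom'_axioms_def)
  have ind: "h (\<lambda>i\<in>{..<n}. if i < m then y i else 0) \<in> N" if "m \<le> n" for m
    using that
  proof (induction m)
    case 0
    have "(\<lambda>i\<in>{..<n}. if i < 0 then y i else 0) = \<zero>\<^bsub>free_module n\<^esub>" by (simp add: direct_sum_def)
    then show ?case using N(1) zero by metis
  next
    case (Suc m)
    let ?E = "\<lambda>i\<in>{..<n}. if i = m then 1 else 0" and ?y = "\<lambda>i\<in>{..<n}. if i < m then y i else 0"
    have c: "?E \<in> carrier (free_module n)" "?y \<in> carrier (free_module n)" by (auto simp: direct_sum_def)
    have eq: "(\<lambda>i\<in>{..<n}. if i < Suc m then y i else 0) = ?y \<oplus>\<^bsub>free_module n\<^esub> (y m \<odot>\<^bsub>free_module n\<^esub> ?E)"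
      by (auto simp: direct_sum_def less_Suc_eq intro!: restrict_ext)
    have q: "h (\<lambda>i\<in>{..<n}. if i < Suc m then y i else 0) = h ?y \<oplus>\<^bsub>M\<^esub> (y m \<odot>\<^bsub>M\<^esub> h ?E)"
      unfolding eq add[OF c(2) M.smult_closed[OF c(1)]] smult[OF c(1)] ..
    have h1: "h ?y \<in> N" using Suc.prems by (intro Suc.IH) simp
    have h2: "y m \<odot>\<^bsub>M\<^esub> h ?E \<in> N" using Suc.prems y(2) by (intro R) auto
    show ?case unfolding q by (rule N(2)[OF h1 h2])
  qed
  have yeq: "y = (\<lambda>i\<in>{..<n}. if i < n then y i else 0)"
    using y(1) by (auto simp: direct_sum_def PiE_iff extensional_def fun_eq_iff)
  show ?thesis by (subst yeq) (rule ind[OF order_refl])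
qed

lemma free_coordinate_hom: "s < n \<Longrightarrow> (\<lambda>x. x s) \<in> mod_hom (free_module n) regular_module"
  by (auto simp: mod_hom_def direct_sum_def)

text \<open>\<open>A f\<close> is a summand of the free module of rank one, with complement the
  elements killed by \<open>f\<close> on the right.\<close>

lemma projective_peirce:
  fixes f :: "'a::ring_1"
  assumes f: "f * f = f"
  shows "projective (peirce f)"
proof -
  let ?U = "{x \<in> carrier (free_module 1). x 0 * f = x 0}" and ?W = "{x \<in> carrier (free_module 1). x 0 * f = (0::'a)}"
  interpret F: left_module "free_module 1 :: ('a, nat \<Rightarrow> 'a) module" by (rule left_module_free)
  have U: "submod ?U (free_module 1)" 
    by (rule F.submodI) (auto simp: direct_sum_def distrib_right mult.assoc)
  have W: "submod ?W (free_module 1)"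
    by (rule F.submodI) (auto simp: direct_sum_def distrib_right mult.assoc)
  have d: "internal_direct_sum (free_module 1) ?U ?W"
    unfolding internal_direct_sum_def
  proof (intro conjI U W)
    show "?U \<inter> ?W = {\<zero>\<^bsub>free_module 1\<^esub>}"
      by (auto simp: direct_sum_def PiE_iff extensional_def fun_eq_iff)
    show "?U <+>\<^bsub>free_module 1\<^esub> ?W = carrier (free_module 1)"
    proof (intro equalityI subsetI)
      fix x :: "nat \<Rightarrow> 'a" assume x: "x \<in> carrier (free_module 1)"
      let ?u = "\<lambda>i\<in>{..<1}. x 0 * f" and ?w = "\<lambda>i\<in>{..<1}. x 0 - x 0 * f"
      have "x = ?u \<oplus>\<^bsub>free_module 1\<^esub> ?w" using x by (auto simp: direct_sum_def PiE_iff extensional_def fun_eq_iff)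
      moreover have "?u \<in> ?U" "?w \<in> ?W" by (auto simp: direct_sum_def mult.assoc f left_diff_distrib)
      ultimately show "x \<in> ?U <+>\<^bsub>free_module 1\<^esub> ?W" unfolding set_add_eq by blast
    qed (use F.a_closed in \<open>auto simp: set_add_eq\<close>)
  qed
  have "bij_betw (\<lambda>y. \<lambda>i\<in>{..<1}. y) {x. x * f = x} ?U"
    by (rule bij_betwI[where g = "\<lambda>x. x 0"]) (auto simp: direct_sum_def PiE_iff extensional_def fun_eq_iff)
  moreover have "(\<lambda>y. \<lambda>i\<in>{..<1}. y) \<in> mod_hom (peirce f) (restr (free_module 1) ?U)"
    by (auto simp: mod_hom_def restr_def direct_sum_def)
  ultimately have "mod_iso (peirce f) (restr (free_module 1) ?U)"
    unfolding mod_iso_def by (intro bexI) (auto simp: restr_def)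
  then show ?thesis unfolding projective_def using left_module_peirce d by blast
qed

section \<open>Indecomposable projective modules of a split algebra\<close>

locale idem_algebra = split_algebra scale I \<chi>
  for scale :: "'k::field \<Rightarrow> 'a::ring_1 \<Rightarrow> 'a" and I :: "'i set" and \<chi> +
  fixes e
  assumes idem_family: "idem_family e"
begin

lemma e_mult: "i \<in> I \<Longrightarrow> k \<in> I \<Longrightarrow> e i * e k = (if i = k then e i else 0)"
  and e_sum: "(\<Sum>i\<in>I. e i) = 1"
  and chi_e: "i \<in> I \<Longrightarrow> k \<in> I \<Longrightarrow> \<chi> i (e k) = (if i = k then 1 else 0)"
  using idem_family by (simp_all add: idem_family_def)

lemma e_ne_0: "i \<in> I \<Longrightarrow> e i \<noteq> 0"
  using chi_e[of i i] chi_0[of i] by auto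

lemma sum_e_left: "x = (\<Sum>i\<in>I. e i * x)"
  by (simp add: e_sum flip: sum_distrib_right)

lemma sum_e_right: "x = (\<Sum>i\<in>I. x * e i)"
  by (simp add: e_sum flip: sum_distrib_left)

text \<open>On an idempotent \<open>x\<close> of the corner, \<open>\<chi> i\<close> takes the value
  0 or 1 and the other characters vanish. So \<open>x\<close> or \<open>e i - x\<close> is an
  idempotent in the radical, hence nilpotent, hence 0.\<close>

lemma prim_e:
  assumes i: "i \<in> I"
  shows "prim_idem (e i)"
  unfolding prim_idem_def
proof (intro conjI allI impI)
  show "e i * e i = e i" "e i \<noteq> 0" using e_mult e_ne_0 i by auto
  fix x assume "x * x = x \<and> e i * x = x \<and> x * e i = x"
  then have x: "x * x = x" "e i * x = x" "x * e i = x" by auto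
  have k: "\<chi> k x = 0" if "k \<in> I" "k \<noteq> i" for k
    using arg_cong[OF x(2), of "\<chi> k"] that i by (simp add: chi_mult chi_e)
  have "\<chi> i x * \<chi> i x = \<chi> i x" using x(1) chi_mult i by metis
  then consider "\<chi> i x = 0" | "\<chi> i x = 1" by auto
  then show "x = 0 \<or> x = e i"
  proof cases
    case 1
    then have "x \<in> rad" using k by (auto simp: rad_def)
    then show ?thesis using rad_nilp nilp_idem_zero x(1) by blast
  next
    case 2
    then have "e i - x \<in> rad" using k i by (auto simp: rad_def chi_diff chi_e)
    moreover have "(e i - x) * (e i - x) = e i - x"
      using x e_mult i by (simp add: left_diff_distrib right_diff_distrib)
    ultimately have "e i - x = 0" using rad_nilp nilp_idem_zero by blast
    then show ?thesis by simp
  qed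
qed

lemma corner_unit:
  assumes i: "i \<in> I" and y: "e i * y = y" "y * e i = y" and c: "\<chi> i y \<noteq> 0"
  shows "\<exists>z. e i * z = z \<and> z * e i = z \<and> y * z = e i \<and> z * y = e i"
  using prim_idem_corner_cases[OF prim_e[OF i] y] chi_nilp[OF i] c by blast

lemma rad_iff_chi:
  assumes i: "i \<in> I" and a: "e i * a = a"
  shows "a \<in> rad \<longleftrightarrow> \<chi> i a = 0"
proof -
  have "\<chi> k a = 0" if "k \<in> I" "k \<noteq> i" for k
    using arg_cong[OF a, of "\<chi> k"] that i by (simp add: chi_mult chi_e)
  then show ?thesis using i by (auto simp: rad_def)
qed

text \<open>The coordinate \<open>\<phi> u s\<close> lies in \<open>e i A\<close> outside the
  radical, so its product with \<open>e i\<close> is a unit of the local corner. The coordinate map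
  followed by right multiplication with the inverse sends \<open>u\<close> to
  \<open>e i\<close>.\<close>

lemma hom_onto_peirce:
  assumes P: "\<phi> \<in> mod_hom P (free_module n)" "left_module P" and s: "s < n" and i: "i \<in> I"
    and u: "u \<in> carrier P" "e i \<odot>\<^bsub>P\<^esub> u = u" and nr: "\<phi> u s \<notin> rad"
  shows "\<exists>h\<in>mod_hom P (peirce (e i)). h u = e i"
proof -
  let ?f = "\<lambda>x. \<phi> x s"
  have f: "?f \<in> mod_hom P regular_module"
    by (rule mod_hom_compose[OF P(1) free_coordinate_hom[OF s]])
  have a: "e i * ?f u = ?f u" using f u by (auto simp: mod_hom_def dest!: spec[of _ "e i"] bspec[of _ _ u])
  have "\<chi> i (?f u) \<noteq> 0" using rad_iff_chi[OF i a] nr by blast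
  then have "\<chi> i (?f u * e i) \<noteq> 0" using i by (simp add: chi_mult chi_e)
  moreover have "e i * (?f u * e i) = ?f u * e i" "(?f u * e i) * e i = ?f u * e i"
    using a e_mult i by (simp_all add: mult.assoc[symmetric]) (simp add: mult.assoc)
  ultimately obtain z where z: "z * e i = z" "?f u * e i * z = e i" "e i * z = z"
    using corner_unit[OF i, of "?f u * e i"] by blast
  have "(\<lambda>x. ?f x * z) \<in> mod_hom P (peirce (e i))"
    using f z(1) by (auto simp: mod_hom_def mult.assoc distrib_right)
  moreover have "?f u * z = e i" using z by (simp add: mult.assoc)
  ultimately show ?thesis by (intro bexI[of _ "\<lambda>x. ?f x * z"])
qed

text \<open>Embed \<open>P\<close> as a retract of a free module. If all coordinates of
  \<open>u\<close> were in the radical, the retraction would write \<open>u\<close> as a combination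
  of radical multiples, hence as an element of \<open>N\<close>.\<close>

lemma projective_hom_onto_peirce:
  assumes P: "projective P" and i: "i \<in> I" and u: "u \<in> carrier P" "e i \<odot>\<^bsub>P\<^esub> u = u"
    and N: "submod N P" "\<And>x m. x \<in> rad \<Longrightarrow> m \<in> carrier P \<Longrightarrow> x \<odot>\<^bsub>P\<^esub> m \<in> N" "u \<notin> N"
  shows "\<exists>h\<in>mod_hom P (peirce (e i)). h u = e i"
proof -
  have lP: "left_module P" using P by (simp add: projective_def)
  obtain n \<phi> p where r: "\<phi> \<in> mod_hom P (free_module n)" "p \<in> mod_hom (free_module n) P" "\<And>x. x \<in> carrier P \<Longrightarrow> p (\<phi> x) = x"
    using projective_retract[OF P] by blast
  have "\<exists>s<n. \<phi> u s \<notin> rad"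
  proof (rule ccontr)
    assume "\<not> ?thesis"
    then have nr: "\<phi> u s \<in> rad" if "s < n" for s using that by blast
    have pc: "p \<in> carrier (free_module n) \<rightarrow> carrier P" using r(2) by (simp add: mod_hom_def)
    have "p (\<lambda>i\<in>{..<n}. if i = s then 1 else 0) \<in> carrier P" for s
      by (rule funcset_mem[OF pc]) (simp add: direct_sum_def)
    moreover have "\<phi> u \<in> carrier (free_module n)" using r(1) u(1) by (auto simp: mod_hom_def)
    ultimately have "p (\<phi> u) \<in> N"
      using left_module.submodD[OF lP N(1)] N(2) nr
      by (intro free_hom_in[OF r(2) lP, of N rad]) auto
    then show False using N(3) r(3) u(1) by simp
  qed
  then obtain s where "s < n" "\<phi> u s \<notin> rad" by blast
  then show ?thesis by (rule hom_onto_peirce[OF r(1) lP _ i u])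
qed

text \<open>If every coordinate of every element of \<open>Q\<close> lay in the radical, the left
  ideal spanned by the coordinates would be absorbed by the radical and vanish by Nakayama's lemma,
  so \<open>Q\<close> would be zero. Otherwise a homomorphism from \<open>Q\<close> onto
  \<open>A (e i)\<close> is split by y -> y u, and indecomposability leaves only this
  summand.\<close>

lemma projective_indecomposable_iso_peirce:
  assumes P: "projective Q" and ind: "indecomposable Q"
  shows "\<exists>i\<in>I. mod_iso Q (peirce (e i))"
proof -
  have lQ: "left_module Q" using P by (simp add: projective_def)
  interpret Q: left_module Q by fact
  obtain n \<phi> p where r: "\<phi> \<in> mod_hom Q (free_module n)" "p \<in> mod_hom (free_module n) Q" "\<And>x. x \<in> carrier Q \<Longrightarrow> p (\<phi> x) = x"
    using projective_retract[OF P] by blast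
  have fs: "(\<lambda>x. \<phi> x s) \<in> mod_hom Q regular_module" if "s < n" for s
    by (rule mod_hom_compose[OF r(1) free_coordinate_hom[OF that]])
  have "\<exists>x\<in>carrier Q. \<exists>s<n. \<phi> x s \<notin> rad"
  proof (rule ccontr)
    assume "\<not> ?thesis"
    then have inr: "\<phi> x s \<in> rad" if "x \<in> carrier Q" "s < n" for x s using that by blast
    define X where "X = {\<phi> x s | x s. x \<in> carrier Q \<and> s < n}"
    let ?L = "span X"
    have "a * x \<in> ?L" if "x \<in> ?L" for a x
      using that
    proof (induction rule: span_induct_alt)
      case base
      then show ?case using span_zero by simp
    next
      case (step c x y)
      obtain q s where q: "x = \<phi> q s" "q \<in> carrier Q" "s < n" using step(1) by (auto simp: X_def)
      have "a * x = \<phi> (a \<odot>\<^bsub>Q\<^esub> q) s" using fs[OF q(3)] q by (auto simp: mod_hom_def)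
      then have "a * x \<in> X" using q Q.smult_closed unfolding X_def by blast
      then show ?case using step(2) by (simp add: distrib_left scale_mult_right span_add span_scale span_base)
    qed
    then have L: "left_ideal ?L" by (simp add: left_ideal_def)
    let ?J = "span {x * y | x y. (\<forall>i\<in>I. \<chi> i x = 0) \<and> y \<in> ?L}"
    have "X \<subseteq> ?J"
    proof
      fix y assume "y \<in> X"
      then obtain q s where q: "y = \<phi> q s" "q \<in> carrier Q" "s < n" by (auto simp: X_def)
      have pc: "p z \<in> carrier Q" if "z \<in> carrier (free_module n)" for z using r(2) that by (auto simp: mod_hom_def)
      have "(\<lambda>x. \<phi> (p x) s) (\<phi> q) \<in> ?J"
      proof (rule free_hom_in[OF mod_hom_compose[OF r(2) fs[OF q(3)]] left_module_regular, of _ rad])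
        fix a t assume "a \<in> rad" "t < n"
        moreover have "(\<lambda>i\<in>{..<n}. if i = t then 1 else 0) \<in> carrier (free_module n)" by (auto simp: direct_sum_def)
        then have "\<phi> (p (\<lambda>i\<in>{..<n}. if i = t then 1 else 0)) s \<in> ?L" using pc q(3) by (intro span_base) (auto simp: X_def)
        ultimately show "a \<odot>\<^bsub>regular_module\<^esub> \<phi> (p (\<lambda>i\<in>{..<n}. if i = t then 1 else 0)) s \<in> ?J"
          by (intro span_base) (auto simp: rad_def)
      next
        show "\<phi> q \<in> carrier (free_module n)" using r(1) q(2) by (auto simp: mod_hom_def)
      qed (use inr q span_zero span_add in auto)
      then show "y \<in> ?J" using r(3) q by simp
    qed
    then have "?L \<subseteq> ?J" by (rule span_minimal) simp
    then have "?L = {0}" by (rule nakayama[OF L])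
    then have z: "\<phi> x s = 0" if "x \<in> carrier Q" "s < n" for x s using that span_base[of "\<phi> x s" X] unfolding X_def by blast
    have "x = \<zero>\<^bsub>Q\<^esub>" if x: "x \<in> carrier Q" for x
    proof -
      interpret module_hom' "free_module n" Q p
        using r lQ left_module_free by (simp add: module_hom'_def module_hom'_axioms_def)
      have "\<phi> x = \<zero>\<^bsub>free_module n\<^esub>"
        using r(1) x z[OF x] by (auto simp: mod_hom_def direct_sum_def PiE_iff extensional_def fun_eq_iff)
      then show ?thesis using r(3)[OF x] zero by simp
    qed
    then show False using ind by (auto simp: indecomposable_def)
  qed
  then obtain x s where x: "x \<in> carrier Q" "s < n" "\<phi> x s \<notin> rad" by blast
  have ef: "\<phi> (e i \<odot>\<^bsub>Q\<^esub> x) s = e i * \<phi> x s" for i using fs[OF x(2)] x(1) by (auto simp: mod_hom_def)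
  have "\<exists>i\<in>I. e i * \<phi> x s \<notin> rad"
    using x(3) sum_e_left[of "\<phi> x s"] subspace_sum[OF subspace_rad, of I "\<lambda>i. e i * \<phi> x s"] by metis
  then obtain i where i: "i \<in> I" "e i * \<phi> x s \<notin> rad" by blast
  define u where "u = e i \<odot>\<^bsub>Q\<^esub> x"
  have u: "u \<in> carrier Q" "e i \<odot>\<^bsub>Q\<^esub> u = u"
    using x i e_mult Q.smult_assoc[OF x(1), of "e i" "e i"] Q.smult_closed by (auto simp: u_def)
  have "\<phi> u s \<notin> rad" using ef i by (simp add: u_def)
  from hom_onto_peirce[OF r(1) lQ x(2) i(1) u this]
  obtain h where h: "h \<in> mod_hom Q (peirce (e i))" "h u = e i" by (elim bexE)
  interpret h: module_hom' Q "peirce (e i)" h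
    using h lQ left_module_peirce by (simp add: module_hom'_def module_hom'_axioms_def)
  have g: "(\<lambda>y. y \<odot>\<^bsub>Q\<^esub> u) \<in> mod_hom (peirce (e i)) Q"
    using u Q.smult_closed Q.smult_l_distr Q.smult_assoc by (auto simp: mod_hom_def)
  interpret g: module_hom' "peirce (e i)" Q "\<lambda>y. y \<odot>\<^bsub>Q\<^esub> u"
    using g lQ left_module_peirce by (simp add: module_hom'_def module_hom'_axioms_def)
  have hg: "h (y \<odot>\<^bsub>Q\<^esub> u) = y" if "y * e i = y" for y using h.smult[OF u(1), of y] h(2) that by simp
  let ?U = "(\<lambda>y. y \<odot>\<^bsub>Q\<^esub> u) ` carrier (peirce (e i))" and ?W = "{x \<in> carrier Q. h x \<in> {0}}"
  have "internal_direct_sum Q ?U ?W"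
    unfolding internal_direct_sum_def
  proof (intro conjI)
    show "submod ?U Q" by (rule g.submod_image[OF left_module.submod_carrier[OF left_module_peirce]])
    show "submod ?W Q" using h.submod_vimage[OF h.N.submod_zero] by simp
    show "?U \<inter> ?W = {\<zero>\<^bsub>Q\<^esub>}" using hg u(1) h.zero by (auto intro!: image_eqI[of _ _ 0])
    show "?U <+>\<^bsub>Q\<^esub> ?W = carrier Q"
    proof (intro equalityI subsetI)
      fix y assume y: "y \<in> carrier Q"
      let ?a = "h y \<odot>\<^bsub>Q\<^esub> u"
      have hy: "h y * e i = h y" using h.closed[OF y] by simp
      have a: "?a \<in> carrier Q" using u Q.smult_closed by simp
      have "y = ?a \<oplus>\<^bsub>Q\<^esub> (y \<ominus>\<^bsub>Q\<^esub> ?a)"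
        using y a by (simp add: a_minus_def Q.a_lcomm Q.r_neg)
      moreover have "?a \<in> ?U" using hy by auto
      moreover have "h (y \<ominus>\<^bsub>Q\<^esub> ?a) = \<zero>\<^bsub>peirce (e i)\<^esub>"
        using h.minus[OF y a] hg[OF hy] h.N.minus_eq_zero_iff h.closed[OF y] by simp
      then have "y \<ominus>\<^bsub>Q\<^esub> ?a \<in> ?W" using y a by simp
      ultimately show "y \<in> ?U <+>\<^bsub>Q\<^esub> ?W" unfolding set_add_eq by blast
    qed (use u Q.smult_closed in \<open>auto simp: set_add_eq\<close>)
  qed
  then have "?U = {\<zero>\<^bsub>Q\<^esub>} \<or> ?W = {\<zero>\<^bsub>Q\<^esub>}" using ind unfolding indecomposable_def by blast
  moreover have "?U \<noteq> {\<zero>\<^bsub>Q\<^esub>}"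
  proof
    assume "?U = {\<zero>\<^bsub>Q\<^esub>}"
    moreover have "e i \<odot>\<^bsub>Q\<^esub> u \<in> ?U" using e_mult i by auto
    ultimately have "u = \<zero>\<^bsub>Q\<^esub>" using u by simp
    then show False using h(2) h.zero e_ne_0[OF i(1)] by simp
  qed
  ultimately have W0: "?W = {\<zero>\<^bsub>Q\<^esub>}" by blast
  have "inj_on h (carrier Q)" unfolding h.inj_iff using W0 by auto
  moreover have "h ` carrier Q = carrier (peirce (e i))"
  proof (intro equalityI subsetI)
    fix y assume "y \<in> carrier (peirce (e i))"
    then have "h (y \<odot>\<^bsub>Q\<^esub> u) = y" "y \<odot>\<^bsub>Q\<^esub> u \<in> carrier Q" using hg u Q.smult_closed by auto
    then show "y \<in> h ` carrier Q" by (metis imageI)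
  qed (use h.closed in auto)
  ultimately have "mod_iso Q (peirce (e i))" using h(1) by (auto simp: mod_iso_def bij_betw_def)
  then show ?thesis using i(1) by blast
qed

text \<open>An isomorphism \<open>f\<close> would write \<open>e k\<close> as y (e i) f(e i), on
  which \<open>\<chi> k\<close> vanishes for \<open>k\<close> different from
  \<open>i\<close>.\<close>

lemma peirce_not_iso:
  assumes i: "i \<in> I" "k \<in> I" and iso: "mod_iso (peirce (e i)) (peirce (e k))"
  shows "i = k"
proof (rule ccontr)
  assume ne: "i \<noteq> k"
  obtain f where f: "f \<in> mod_hom (peirce (e i)) (peirce (e k))" and b: "bij_betw f {x. x * e i = x} {x. x * e k = x}"
    using iso by (auto simp: mod_iso_def)
  have fs: "f (a * x) = a * f x" "f x * e k = f x" if "x * e i = x" for a x using f that by (auto simp: mod_hom_def)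
  obtain y where y: "y * e i = y" "f y = e k" 
  proof -
    have "e k \<in> f ` {x. x * e i = x}" using b e_mult[of k k] i by (simp add: bij_betw_def)
    then show thesis using that by auto
  qed
  have "e k = y * f (e i)" using fs(1)[of "e i" y] y e_mult i by simp
  moreover have "f (e i) = e i * f (e i)" using fs(1)[of "e i" "e i"] e_mult i by simp
  ultimately have "\<chi> k (e k) = \<chi> k y * (\<chi> k (e i) * \<chi> k (f (e i)))" using i by (metis chi_mult)
  then show False using i ne by (simp add: chi_e)
qed

lemma projective_indecomposables_peirce:
  assumes j: "bij_betw j {..<r} I"
  shows "projective_indecomposables r (\<lambda>i. peirce (e (j i)))"
proof -
  have jI: "j i \<in> I" if "i < r" for i using j that by (auto simp: bij_betw_def)
  have "i = k" if "i < r" "k < r" "j i = j k" for i k using j that by (auto simp: bij_betw_def inj_on_def)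
  moreover have "\<exists>i<r. mod_iso Q (peirce (e (j i)))" if "projective Q" "indecomposable Q" for Q :: "('a, 'a) module"
    using projective_indecomposable_iso_peirce[OF that] j by (force simp: bij_betw_def)
  ultimately show ?thesis
    unfolding projective_indecomposables_def
    using jI e_mult peirce_not_iso by (auto intro!: projective_peirce prim_idem_imp_indecomposable prim_e)
qed

end


section \<open>Simple modules\<close>

lemma restr_simps [simp]: "carrier (restr M N) = N" "\<zero>\<^bsub>restr M N\<^esub> = \<zero>\<^bsub>M\<^esub>" "x \<oplus>\<^bsub>restr M N\<^esub> y = x \<oplus>\<^bsub>M\<^esub> y"
  "a \<odot>\<^bsub>restr M N\<^esub> x = a \<odot>\<^bsub>M\<^esub> x" "restr (restr M N) K = restr M K"
  by (simp_all add: restr_def)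

section \<open>Quotient modules\<close>

context left_module
begin

context
  fixes N assumes N: "submod N M"
begin

lemma coset_in: "x \<in> carrier M \<Longrightarrow> y \<in> N +> x \<longleftrightarrow> y \<in> carrier M \<and> y \<ominus> x \<in> N"
proof -
  assume x: "x \<in> carrier M"
  have sub: "n \<in> carrier M" if "n \<in> N" for n using submodD(1)[OF N] that by blast
  have "y = (y \<ominus> x) \<oplus> x" if "y \<in> carrier M" using that x by (simp add: a_minus_def a_assoc l_neg)
  moreover have "(n \<oplus> x) \<ominus> x = n" if "n \<in> N" for n using sub[OF that] x by (simp add: a_minus_def a_assoc r_neg)
  ultimately show ?thesis using sub x by (auto simp: a_r_coset_def r_coset_def)
qed

lemma minus_sym: "x \<in> carrier M \<Longrightarrow> y \<in> carrier M \<Longrightarrow> \<ominus> (x \<ominus> y) = y \<ominus> x"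
  by (simp add: a_minus_def minus_add a_comm)

lemma minus_trans: "x \<in> carrier M \<Longrightarrow> y \<in> carrier M \<Longrightarrow> z \<in> carrier M \<Longrightarrow> (x \<ominus> y) \<oplus> (y \<ominus> z) = x \<ominus> z"
  by (simp add: a_minus_def a_assoc r_neg1)

lemma coset_eq_iff: "x \<in> carrier M \<Longrightarrow> y \<in> carrier M \<Longrightarrow> N +> x = N +> y \<longleftrightarrow> x \<ominus> y \<in> N"
proof
  assume x: "x \<in> carrier M" and y: "y \<in> carrier M" and "N +> x = N +> y"
  moreover have "x \<in> N +> x" using x submodD(2)[OF N] by (simp add: coset_in a_minus_def r_neg)
  ultimately show "x \<ominus> y \<in> N" using coset_in[OF y] by auto
next
  assume x: "x \<in> carrier M" and y: "y \<in> carrier M" and xy: "x \<ominus> y \<in> N"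
  then have yx: "y \<ominus> x \<in> N" using submodD(5)[OF N] minus_sym by metis
  show "N +> x = N +> y"
    using minus_trans[OF _ x y] minus_trans[OF _ y x] submodD(3)[OF N _ xy] submodD(3)[OF N _ yx]
    by (auto simp: coset_in x y) metis+
qed

lemma coset_add: "x \<in> carrier M \<Longrightarrow> y \<in> carrier M \<Longrightarrow> (N +> x) <+>\<^bsub>M\<^esub> (N +> y) = N +> (x \<oplus> y)"
proof (intro equalityI subsetI)
  fix z assume x: "x \<in> carrier M" and y: "y \<in> carrier M" and "z \<in> (N +> x) <+>\<^bsub>M\<^esub> (N +> y)"
  then obtain a b where ab: "a \<in> N" "b \<in> N" "z = (a \<oplus> x) \<oplus> (b \<oplus> y)"
    by (auto simp: set_add_eq a_r_coset_def r_coset_def)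
  have c: "a \<in> carrier M" "b \<in> carrier M" using ab submodD(1)[OF N] by auto
  have "z = (a \<oplus> b) \<oplus> (x \<oplus> y)" using ab(3) c x y by (simp add: a_ac)
  then show "z \<in> N +> (x \<oplus> y)" using submodD(3)[OF N ab(1,2)] by (auto simp: a_r_coset_def r_coset_def)
next
  fix z assume x: "x \<in> carrier M" and y: "y \<in> carrier M" and "z \<in> N +> (x \<oplus> y)"
  then obtain a where a: "a \<in> N" "z = a \<oplus> (x \<oplus> y)" by (auto simp: a_r_coset_def r_coset_def)
  have c: "a \<in> carrier M" using a submodD(1)[OF N] by auto
  have "z = (a \<oplus> x) \<oplus> (\<zero> \<oplus> y)" using a(2) c x y by (simp add: a_ac)
  then show "z \<in> (N +> x) <+>\<^bsub>M\<^esub> (N +> y)" using a(1) submodD(2)[OF N] by (force simp: set_add_eq a_r_coset_def r_coset_def)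
qed

text \<open>In \<open>quot\<close> a scalar multiple is a union over all representatives. All of
  them give the same coset and there is at least one, so the union is that coset.\<close>

lemma coset_smult: "x \<in> carrier M \<Longrightarrow> a \<odot>\<^bsub>quot M N\<^esub> (N +> x) = N +> (a \<odot> x)"
proof -
  assume x: "x \<in> carrier M"
  have eq: "N +> (a \<odot> y) = N +> (a \<odot> x)" if y: "y \<in> N +> x" for y
    using that x smult_closed submodD(4)[OF N] by (auto simp: coset_in coset_eq_iff smult_minus[symmetric])
  have "x \<in> N +> x" using x submodD(2)[OF N] by (simp add: coset_in a_minus_def r_neg)
  then have ne: "N +> x \<noteq> {}" by blast
  have "a \<odot>\<^bsub>quot M N\<^esub> (N +> x) = (\<Union>y\<in>N +> x. N +> (a \<odot> y))" by (simp add: quot_def)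
  also have "\<dots> = (\<Union>y\<in>N +> x. N +> (a \<odot> x))" by (rule SUP_cong[OF refl]) (rule eq)
  also have "\<dots> = N +> (a \<odot> x)" using ne by (rule SUP_const)
  finally show ?thesis .
qed

lemma quot_hom: "(\<lambda>x. N +> x) \<in> mod_hom M (quot M N)"
proof -
  have "add (quot M N) = set_add M" by (simp add: quot_def)
  moreover have "carrier (quot M N) = a_rcosets N" by (simp add: quot_def)
  ultimately show ?thesis
    using coset_add coset_smult by (auto simp: mod_hom_def A_RCOSETS_def' intro!: bexI)
qed

lemma carrier_quot: "carrier (quot M N) = (\<lambda>x. N +> x) ` carrier M"
  by (auto simp: quot_def A_RCOSETS_def')

lemma zero_quot: "\<zero>\<^bsub>quot M N\<^esub> = N +> \<zero>" "N +> \<zero> = N"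
  using coset_in[OF zero_closed] submodD(1)[OF N] by (auto simp: quot_def a_minus_def)

lemma left_module_quot: "left_module (quot M N)"
proof -
  have a: "(N +> x) \<oplus>\<^bsub>quot M N\<^esub> (N +> y) = N +> (x \<oplus> y)" if "x \<in> carrier M" "y \<in> carrier M" for x y
    using coset_add[OF that] by (simp add: quot_def)
  have "abelian_group (quot M N)"
  proof (rule abelian_groupI, goal_cases)
    case (6 X)
    then obtain x where "x \<in> carrier M" "X = N +> x" by (auto simp: carrier_quot)
    then show ?case by (intro bexI[of _ "N +> (\<ominus> x)"]) (auto simp: a zero_quot(1) l_neg carrier_quot)
  qed (auto simp: carrier_quot a zero_quot(1) a_ac)
  then show ?thesis
    by (intro left_module.intro left_module_axioms.intro)
      (auto simp: carrier_quot a coset_smult smult_closed smult_l_distr smult_r_distr smult_assoc smult_one)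
qed

lemma coset_zero_iff: "x \<in> carrier M \<Longrightarrow> N +> x = \<zero>\<^bsub>quot M N\<^esub> \<longleftrightarrow> x \<in> N"
  unfolding zero_quot(1) using coset_eq_iff[of x \<zero>] minus_equality[of \<zero> \<zero>] by (simp add: a_minus_def)

end

end

context fd_algebra
begin

lemma scalar_central: "scale c 1 * a = a * scale c 1"
  by (simp add: scale_one_mult)

end

section \<open>Simple modules and characters\<close>

context idem_algebra
begin

text \<open>A line on which the algebra acts through \<open>\<chi> i\<close>. Being a line is
  expressed with the elements \<open>scale c 1\<close>, because a module over the algebra carries
  the action of the field only through them.\<close>

definition has_char :: "('a, 'b) module \<Rightarrow> 'i \<Rightarrow> bool" where
  "has_char S i \<longleftrightarrow> left_module S \<and> carrier S \<noteq> {\<zero>\<^bsub>S\<^esub>} \<and> (\<forall>a. \<forall>x\<in>carrier S. a \<odot>\<^bsub>S\<^esub> x = scale (\<chi> i a) 1 \<odot>\<^bsub>S\<^esub> x) \<and>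
     (\<forall>w\<in>carrier S. w \<noteq> \<zero>\<^bsub>S\<^esub> \<longrightarrow> (\<forall>x\<in>carrier S. \<exists>c. x = scale c 1 \<odot>\<^bsub>S\<^esub> w))"

lemma sub_chi_mult_e: "i \<in> I \<Longrightarrow> a * e i - scale (\<chi> i a) (e i) \<in> rad"
  by (auto simp: rad_def chi_diff chi_mult chi_scale chi_e)

lemma (in left_module) cyclic_submod: "w \<in> carrier M \<Longrightarrow> submod {a \<odot> w | a. True} M"
proof (rule submodI)
  assume w: "w \<in> carrier M"
  show "{a \<odot> w | a. True} \<subseteq> carrier M" using w smult_closed by blast
  show "\<zero> \<in> {a \<odot> w | a. True}" using smult_zero_left[OF w] by (metis (mono_tags, lifting) mem_Collect_eq)
  show "x \<oplus> y \<in> {a \<odot> w | a. True}" if "x \<in> {a \<odot> w | a. True}" "y \<in> {a \<odot> w | a. True}" for x y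
    using that smult_l_distr[OF w, symmetric] by blast
  show "a \<odot> x \<in> {a \<odot> w | a. True}" if "x \<in> {a \<odot> w | a. True}" for a x
    using that smult_assoc[OF w, symmetric] by blast
qed

text \<open>Choose \<open>v\<close> with w = e i v nonzero. The submodule of radical multiples of
  \<open>w\<close> is proper, since w = a w with \<open>a\<close> nilpotent would give w = 0; so it
  is zero, and each \<open>a\<close> acts on \<open>w\<close> as the scalar
  \<open>\<chi> i a\<close>. As \<open>w\<close> generates the module, the same holds
  everywhere.\<close>

lemma simple_has_char:
  fixes S :: "('a, 'b) module"
  assumes S: "simple_mod S"
  shows "\<exists>i\<in>I. has_char S i"
proof -
  interpret left_module S using S by (simp add: simple_mod_def)
  have simple: "N = {\<zero>\<^bsub>S\<^esub>} \<or> N = carrier S" if "submod N S" for N using S that by (simp add: simple_mod_def)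
  have ne: "carrier S \<noteq> {\<zero>\<^bsub>S\<^esub>}" using S by (simp add: simple_mod_def)
  then obtain v where v: "v \<in> carrier S" "v \<noteq> \<zero>\<^bsub>S\<^esub>" using zero_closed by blast
  have "\<exists>i\<in>I. e i \<odot>\<^bsub>S\<^esub> v \<noteq> \<zero>\<^bsub>S\<^esub>"
  proof (rule ccontr)
    assume n: "\<not> ?thesis"
    have "(\<Sum>i\<in>T. e i) \<odot>\<^bsub>S\<^esub> v = \<zero>\<^bsub>S\<^esub>" if "T \<subseteq> I" for T
      using finite_subset[OF that finite_I] that
      by (induction T rule: finite_induct) (use n v(1) smult_l_distr in auto)
    from this[OF subset_refl] show False using v smult_one by (simp add: e_sum)
  qed
  then obtain i where i: "i \<in> I" "e i \<odot>\<^bsub>S\<^esub> v \<noteq> \<zero>\<^bsub>S\<^esub>" by blast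
  define w where "w = e i \<odot>\<^bsub>S\<^esub> v"
  have w: "w \<in> carrier S" "w \<noteq> \<zero>\<^bsub>S\<^esub>" "e i \<odot>\<^bsub>S\<^esub> w = w"
    using i v smult_closed smult_assoc[OF v(1), of "e i" "e i"] e_mult by (auto simp: w_def)
  have rw: "x \<odot>\<^bsub>S\<^esub> w = \<zero>\<^bsub>S\<^esub>" if x: "x \<in> rad" for x
  proof -
    let ?N = "{a \<odot>\<^bsub>S\<^esub> w | a. a \<in> rad}"
    have "submod ?N S"
    proof (rule submodI)
      show "?N \<subseteq> carrier S" using w smult_closed by blast
      show "\<zero>\<^bsub>S\<^esub> \<in> ?N" using smult_zero_left[OF w(1)] subspace_0[OF subspace_rad] by force
      show "x \<oplus>\<^bsub>S\<^esub> y \<in> ?N" if "x \<in> ?N" "y \<in> ?N" for x y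
        using that smult_l_distr[OF w(1), symmetric] subspace_add[OF subspace_rad] by blast
      show "a \<odot>\<^bsub>S\<^esub> x \<in> ?N" if "x \<in> ?N" for a x
        using that smult_assoc[OF w(1), symmetric] rad_mult(1) by blast
    qed
    moreover have "?N \<noteq> carrier S"
    proof
      assume "?N = carrier S"
      then obtain a where a: "a \<in> rad" "w = a \<odot>\<^bsub>S\<^esub> w" using w(1) by blast
      obtain n where n: "a ^ n = 0" using rad_nilp[OF a(1)] by (auto simp: nilp_def)
      have "w = a ^ k \<odot>\<^bsub>S\<^esub> w" for k
      proof (induction k)
        case (Suc k)
        have "a ^ Suc k \<odot>\<^bsub>S\<^esub> w = a \<odot>\<^bsub>S\<^esub> (a ^ k \<odot>\<^bsub>S\<^esub> w)" using smult_assoc[OF w(1), of a "a ^ k"] by simp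
        then show ?case using Suc a(2) by simp
      qed (use w smult_one in simp)
      from this[of n] show False using n w by simp
    qed
    ultimately have "?N = {\<zero>\<^bsub>S\<^esub>}" using simple by blast
    then show ?thesis using x by blast
  qed
  have aw: "a \<odot>\<^bsub>S\<^esub> w = scale (\<chi> i a) 1 \<odot>\<^bsub>S\<^esub> w" for a
  proof -
    have "(a * e i) \<odot>\<^bsub>S\<^esub> w = (a * e i - scale (\<chi> i a) (e i) + scale (\<chi> i a) 1 * e i) \<odot>\<^bsub>S\<^esub> w"
      by (simp add: scale_one_mult)
    also have "\<dots> = (scale (\<chi> i a) 1 * e i) \<odot>\<^bsub>S\<^esub> w"
      using rw[OF sub_chi_mult_e[OF i(1), of a]] w(1) smult_closed by (simp add: smult_l_distr)
    finally show ?thesis using w by (simp add: smult_assoc)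
  qed
  have gen: "\<exists>c. x = scale c 1 \<odot>\<^bsub>S\<^esub> z" if z: "z \<in> carrier S" "z \<noteq> \<zero>\<^bsub>S\<^esub>" "\<And>a. a \<odot>\<^bsub>S\<^esub> z = scale (\<chi> i a) 1 \<odot>\<^bsub>S\<^esub> z" and x: "x \<in> carrier S" for z x
  proof -
    have "z \<in> {a \<odot>\<^bsub>S\<^esub> z | a. True}" using smult_one[OF z(1)] by (metis (mono_tags, lifting) mem_Collect_eq)
    then have "{a \<odot>\<^bsub>S\<^esub> z | a. True} = carrier S" using simple[OF cyclic_submod[OF z(1)]] z(2) by blast
    then obtain a where a: "x = a \<odot>\<^bsub>S\<^esub> z" using x by blast
    show ?thesis by (rule exI) (rule trans[OF a z(3)])
  qed
  have ax: "a \<odot>\<^bsub>S\<^esub> x = scale (\<chi> i a) 1 \<odot>\<^bsub>S\<^esub> x" if x: "x \<in> carrier S" for a x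
  proof -
    obtain c where c: "x = scale c 1 \<odot>\<^bsub>S\<^esub> w" using gen[OF w(1,2) aw x] by blast
    have "a \<odot>\<^bsub>S\<^esub> x = (scale c 1 * a) \<odot>\<^bsub>S\<^esub> w" unfolding c by (simp only: smult_assoc[OF w(1), symmetric] scalar_central)
    also have "\<dots> = (scale c 1 * scale (\<chi> i a) 1) \<odot>\<^bsub>S\<^esub> w" using aw[of a] by (simp only: smult_assoc[OF w(1)])
    also have "\<dots> = scale (\<chi> i a) 1 \<odot>\<^bsub>S\<^esub> x"
      unfolding c smult_assoc[OF w(1), symmetric] by (simp add: scale_one_mult mult.commute)
    finally show ?thesis .
  qed
  have "has_char S i" unfolding has_char_def using left_module_axioms ne ax gen by blast
  then show ?thesis using i(1) by blast
qed

lemma has_char_scalar_eq: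
  assumes S: "has_char S i" and w: "w \<in> carrier S" "w \<noteq> \<zero>\<^bsub>S\<^esub>" and c: "scale c 1 \<odot>\<^bsub>S\<^esub> w = \<zero>\<^bsub>S\<^esub>"
  shows "c = 0"
proof (rule ccontr)
  assume "c \<noteq> 0"
  interpret left_module S using S by (simp add: has_char_def)
  have "w = (scale (inverse c) 1 * scale c 1) \<odot>\<^bsub>S\<^esub> w" using w smult_one \<open>c \<noteq> 0\<close> by (simp add: scale_one_mult)
  also have "\<dots> = \<zero>\<^bsub>S\<^esub>" using c w smult_assoc by simp
  finally show False using w by simp
qed

text \<open>Nonzero vectors \<open>w\<close> and \<open>v\<close> of the two modules have the same
  annihilator, the kernel of \<open>\<chi> i\<close>, so a w -> a v is well defined and
  injective.\<close>

lemma has_char_iso: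
  fixes S :: "('a, 'b) module" and T :: "('a, 'c) module"
  assumes S: "has_char S i" and T: "has_char T i"
  shows "mod_iso S T"
proof -
  interpret S: left_module S using S by (simp add: has_char_def)
  interpret T: left_module T using T by (simp add: has_char_def)
  obtain w where w: "w \<in> carrier S" "w \<noteq> \<zero>\<^bsub>S\<^esub>" using S S.zero_closed unfolding has_char_def by blast
  obtain v where v: "v \<in> carrier T" "v \<noteq> \<zero>\<^bsub>T\<^esub>" using T T.zero_closed unfolding has_char_def by blast
  have Sw: "\<exists>a. x = a \<odot>\<^bsub>S\<^esub> w" if "x \<in> carrier S" for x using S w that unfolding has_char_def by blast
  have Tv: "\<exists>a. x = a \<odot>\<^bsub>T\<^esub> v" if "x \<in> carrier T" for x using T v that unfolding has_char_def by blast
  have zS: "a \<odot>\<^bsub>S\<^esub> w = \<zero>\<^bsub>S\<^esub> \<longleftrightarrow> \<chi> i a = 0" for a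
  proof -
    have "a \<odot>\<^bsub>S\<^esub> w = scale (\<chi> i a) 1 \<odot>\<^bsub>S\<^esub> w" using S w unfolding has_char_def by blast
    then show ?thesis using has_char_scalar_eq[OF S w] S.smult_zero_left[OF w(1)] by auto
  qed
  have zT: "a \<odot>\<^bsub>T\<^esub> v = \<zero>\<^bsub>T\<^esub> \<longleftrightarrow> \<chi> i a = 0" for a
  proof -
    have "a \<odot>\<^bsub>T\<^esub> v = scale (\<chi> i a) 1 \<odot>\<^bsub>T\<^esub> v" using T v unfolding has_char_def by blast
    then show ?thesis using has_char_scalar_eq[OF T v] T.smult_zero_left[OF v(1)] by auto
  qed
  have dS: "(a - b) \<odot>\<^bsub>S\<^esub> w = a \<odot>\<^bsub>S\<^esub> w \<ominus>\<^bsub>S\<^esub> b \<odot>\<^bsub>S\<^esub> w" for a b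
    using S.smult_l_distr[OF w(1), of a "-b"] S.smult_uminus[OF w(1)] by (simp add: a_minus_def)
  have dT: "(a - b) \<odot>\<^bsub>T\<^esub> v = a \<odot>\<^bsub>T\<^esub> v \<ominus>\<^bsub>T\<^esub> b \<odot>\<^bsub>T\<^esub> v" for a b
    using T.smult_l_distr[OF v(1), of a "-b"] T.smult_uminus[OF v(1)] by (simp add: a_minus_def)
  have eqST: "a \<odot>\<^bsub>S\<^esub> w = b \<odot>\<^bsub>S\<^esub> w \<longleftrightarrow> a \<odot>\<^bsub>T\<^esub> v = b \<odot>\<^bsub>T\<^esub> v" for a b
    using zS[of "a - b"] zT[of "a - b"] dS dT S.minus_eq_zero_iff T.minus_eq_zero_iff S.smult_closed[OF w(1)] T.smult_closed[OF v(1)] by metis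
  define f where "f x = (SOME a. a \<odot>\<^bsub>S\<^esub> w = x) \<odot>\<^bsub>T\<^esub> v" for x
  have f: "f (a \<odot>\<^bsub>S\<^esub> w) = a \<odot>\<^bsub>T\<^esub> v" for a
  proof -
    have "(SOME b. b \<odot>\<^bsub>S\<^esub> w = a \<odot>\<^bsub>S\<^esub> w) \<odot>\<^bsub>S\<^esub> w = a \<odot>\<^bsub>S\<^esub> w" by (rule someI) (rule refl)
    then show ?thesis unfolding f_def using eqST by blast
  qed
  have "f \<in> mod_hom S T"
    unfolding mod_hom_def
  proof (intro CollectI conjI ballI allI funcsetI)
    fix x assume "x \<in> carrier S"
    then obtain a where x: "x = a \<odot>\<^bsub>S\<^esub> w" using Sw by blast
    show "f x \<in> carrier T" using f T.smult_closed[OF v(1)] x by simp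
    show "f (b \<odot>\<^bsub>S\<^esub> x) = b \<odot>\<^bsub>T\<^esub> f x" for b
      using f[of "b * a"] f[of a] S.smult_assoc[OF w(1)] T.smult_assoc[OF v(1)] x by simp
    fix y assume "y \<in> carrier S"
    then obtain b where y: "y = b \<odot>\<^bsub>S\<^esub> w" using Sw by blast
    show "f (x \<oplus>\<^bsub>S\<^esub> y) = f x \<oplus>\<^bsub>T\<^esub> f y"
      using f[of "a + b"] f[of a] f[of b] S.smult_l_distr[OF w(1)] T.smult_l_distr[OF v(1)] x y by simp
  qed
  moreover have "bij_betw f (carrier S) (carrier T)"
    unfolding bij_betw_def
  proof (intro conjI inj_onI equalityI subsetI)
    fix x y assume "x \<in> carrier S" "y \<in> carrier S" "f x = f y"
    then show "x = y" using Sw f eqST by metis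
  next
    fix y assume "y \<in> carrier T"
    then show "y \<in> f ` carrier S" using Tv f S.smult_closed[OF w(1)] by (metis imageI)
  next
    fix y assume "y \<in> f ` carrier S"
    then show "y \<in> carrier T" using Sw f T.smult_closed[OF v(1)] by (metis imageE)
  qed
  ultimately show ?thesis by (auto simp: mod_iso_def)
qed

lemma has_char_iso_unique:
  fixes S :: "('a, 'b) module" and T :: "('a, 'c) module"
  assumes S: "has_char S i" and T: "has_char T k" and ik: "i \<in> I" "k \<in> I" and iso: "mod_iso S T"
  shows "i = k"
proof -
  interpret S: left_module S using S by (simp add: has_char_def)
  interpret T: left_module T using T by (simp add: has_char_def)
  obtain f where f: "f \<in> mod_hom S T" "bij_betw f (carrier S) (carrier T)" using iso by (auto simp: mod_iso_def)
  interpret module_hom' S T f using f by unfold_locales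
  obtain w where w: "w \<in> carrier S" "w \<noteq> \<zero>\<^bsub>S\<^esub>" using S S.zero_closed unfolding has_char_def by blast
  have fw: "f w \<in> carrier T" "f w \<noteq> \<zero>\<^bsub>T\<^esub>" using closed w inj_iff f(2) by (auto simp: bij_betw_def)
  have "e i \<odot>\<^bsub>S\<^esub> w = w" using S w ik S.smult_one chi_e unfolding has_char_def by (metis scale_one)
  then have "f w = e i \<odot>\<^bsub>T\<^esub> f w" using smult[OF w(1), of "e i"] by simp
  also have "\<dots> = scale (\<chi> k (e i)) 1 \<odot>\<^bsub>T\<^esub> f w" using T fw unfolding has_char_def by blast
  finally have "\<chi> k (e i) \<noteq> 0" using fw T.smult_zero_left by auto
  then show ?thesis using chi_e ik by (auto split: if_splits)
qed

text \<open>Take the quotient by the kernel of \<open>\<chi> i\<close>. Its elements are subsets of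
  the algebra, as in the completeness condition on simple modules in
  \<open>brauer_tree_algebra\<close>.\<close>

lemma ex_simple_with_char:
  assumes i: "i \<in> I"
  shows "\<exists>T :: ('a, 'a set) module. simple_mod T \<and> has_char T i"
proof -
  interpret R: left_module "regular_module :: ('a, 'a) module" by (rule left_module_regular)
  let ?N = "{a. \<chi> i a = 0}"
  have N: "submod ?N regular_module" using i by (auto simp: submod_regular chi_add chi_mult chi_0)
  let ?T = "quot regular_module ?N"
  let ?c = "\<lambda>x. ?N +>\<^bsub>regular_module\<^esub> x"
  interpret T: left_module ?T by (rule R.left_module_quot[OF N])
  have c: "carrier ?T = range ?c" using R.carrier_quot[OF N] by simp
  have sm: "a \<odot>\<^bsub>?T\<^esub> ?c x = ?c (a * x)" for a x using R.coset_smult[OF N, of x a] by simp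
  have z: "?c x = \<zero>\<^bsub>?T\<^esub> \<longleftrightarrow> \<chi> i x = 0" for x using R.coset_zero_iff[OF N, of x] by simp
  have eq: "?c x = ?c y \<longleftrightarrow> \<chi> i x = \<chi> i y" for x y
  proof -
    have "x \<ominus>\<^bsub>regular_module\<^esub> y = x - y"
      using R.smult_uminus[of y 1] by (simp add: a_minus_def)
    then show ?thesis using R.coset_eq_iff[OF N, of x y] i by (simp add: chi_diff)
  qed
  have one: "\<exists>a. ?c y = a \<odot>\<^bsub>?T\<^esub> ?c x" "\<exists>a. ?c y = scale a 1 \<odot>\<^bsub>?T\<^esub> ?c x" if "\<chi> i x \<noteq> 0" for x y
    using that i by (auto simp: sm eq chi_mult chi_scale chi_one scale_one_mult intro!: exI[of _ "\<chi> i y / \<chi> i x"] exI[of _ "scale (\<chi> i y / \<chi> i x) 1"])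
  have ne: "carrier ?T \<noteq> {\<zero>\<^bsub>?T\<^esub>}" using z[of 1] i chi_one by (metis c rangeI singletonD zero_neq_one)
  have "has_char ?T i"
    unfolding has_char_def using ne one(2) i by (auto simp: c sm eq chi_mult chi_scale chi_one z T.left_module_axioms)
  moreover have "simple_mod ?T"
    unfolding simple_mod_def
  proof (intro conjI allI impI)
    fix K assume K: "submod K ?T"
    note D = T.submodD[OF K]
    show "K = {\<zero>\<^bsub>?T\<^esub>} \<or> K = carrier ?T"
    proof (cases "K \<subseteq> {\<zero>\<^bsub>?T\<^esub>}")
      case False
      then obtain x where x: "?c x \<in> K" "\<chi> i x \<noteq> 0" using D(1) z unfolding c by blast
      then have "carrier ?T \<subseteq> K" unfolding c using one(1)[OF x(2)] D(4)[OF x(1)] by (metis image_subsetI)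
      then show ?thesis using D(1) by blast
    qed (use D(2) in blast)
  qed (use ne T.left_module_axioms in auto)
  ultimately show ?thesis by blast
qed

end

text \<open>Serves to pass from idempotents numbered by natural numbers to characters indexed by the
  edges of the tree.\<close>

lemma split_algebra_reindex:
  assumes s: "split_algebra scale I \<chi>" and g: "bij_betw g J I"
  shows "split_algebra scale J (\<lambda>j. \<chi> (g j))"
proof -
  interpret split_algebra scale I \<chi> by fact
  have gI: "g j \<in> I" if "j \<in> J" for j using g that by (auto simp: bij_betw_def)
  have inj: "inj_on g J" and im: "g ` J = I" using g by (auto simp: bij_betw_def)
  show ?thesis
  proof unfold_locales
    show "finite J" using g finite_I bij_betw_finite by blast
    obtain f where f: "idem_family f" using ex_idempotents by (auto simp: idem_family_def)
    have "(\<Sum>j\<in>J. f (g j)) = (\<Sum>i\<in>I. f i)" using g by (rule sum.reindex_bij_betw)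
    then show "\<exists>f. (\<forall>i\<in>J. \<forall>k\<in>J. f i * f k = (if i = k then f i else 0)) \<and> (\<Sum>i\<in>J. f i) = 1 \<and>
      (\<forall>i\<in>J. \<forall>k\<in>J. \<chi> (g i) (f k) = (if i = k then 1 else 0))"
      using f gI inj by (intro exI[of _ "\<lambda>j. f (g j)"]) (auto simp: idem_family_def inj_on_eq_iff)
    fix L assume "left_ideal L" "L \<subseteq> span {x * y | x y. (\<forall>i\<in>J. \<chi> (g i) x = 0) \<and> y \<in> L}"
    moreover have "(\<forall>i\<in>J. \<chi> (g i) x = 0) \<longleftrightarrow> (\<forall>i\<in>I. \<chi> i x = 0)" for x unfolding im[symmetric] by blast
    ultimately show "L = {0}" using nakayama by simp
  qed (use gI chi_add chi_scale chi_mult chi_one in auto)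
qed


section \<open>The socle and uniserial chains\<close>

text \<open>For a bimodule isomorphism \<psi>, the functional \<open>\<psi> 1\<close> is a
  symmetrizing form t: both \<psi> a y = t(y a) and \<psi> a y = t(a y) hold. Injectivity of \<psi>
  gives nondegeneracy, surjectivity the representation of every functional.\<close>

lemma symmetric_algebra_form:
  fixes scale :: "'k::field \<Rightarrow> 'a::ring_1 \<Rightarrow> 'a"
  assumes "symmetric_algebra scale"
  shows "\<exists>t. (\<forall>x y. t (x + y) = t x + t y) \<and> (\<forall>c x. t (scale c x) = c * t x) \<and> (\<forall>x y. t (x * y) = t (y * x)) \<and>
    (\<forall>x. (\<forall>y. t (y * x) = 0) \<longrightarrow> x = 0) \<and> (\<forall>f. Vector_Spaces.linear scale (*) f \<longrightarrow> (\<exists>x. \<forall>y. f y = t (y * x)))"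
proof -
  obtain \<psi> where bij: "bij_betw \<psi> UNIV {f. Vector_Spaces.linear scale (*) f}"
    and add: "\<And>x y z. \<psi> (x + y) z = \<psi> x z + \<psi> y z"
    and bi: "\<And>a x b y. \<psi> (a * x * b) y = \<psi> x (b * y * a)"
    using assms unfolding symmetric_algebra_def by blast
  define t where "t = \<psi> 1"
  have r: "\<psi> a y = t (y * a)" for a y using bi[of a 1 1 y] by (simp add: t_def)
  have l: "\<psi> b y = t (b * y)" for b y using bi[of 1 1 b y] by (simp add: t_def)
  have lin: "Vector_Spaces.linear scale (*) t" using bij unfolding t_def bij_betw_def by blast
  interpret t: Vector_Spaces.linear scale "(*)" t by fact
  have "x = 0" if "\<forall>y. t (y * x) = 0" for x
  proof -
    have "\<psi> 0 y = 0" for y using r[of 0 y] t.zero by simp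
    then have "\<psi> x = \<psi> 0" using that r by auto
    then show ?thesis using bij by (simp add: bij_betw_def inj_eq)
  qed
  moreover have "\<exists>x. \<forall>y. f y = t (y * x)" if "Vector_Spaces.linear scale (*) f" for f
  proof -
    have "f \<in> range \<psi>" using that bij by (simp add: bij_betw_def)
    then obtain x where "f = \<psi> x" by (elim rangeE)
    then show ?thesis by (intro exI[of _ x]) (simp add: r)
  qed
  moreover have "t (x * y) = t (y * x)" for x y using r[of x y] l[of x y] by simp
  ultimately show ?thesis using t.add t.scale by (intro exI[of _ t]) simp
qed

locale sym_idem_algebra = idem_algebra scale I \<chi> e
  for scale :: "'k::field \<Rightarrow> 'a::ring_1 \<Rightarrow> 'a" and I :: "'i set" and \<chi> e +
  fixes t :: "'a \<Rightarrow> 'k"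
  assumes t_add: "t (x + y) = t x + t y" and t_scale: "t (scale c x) = c * t x"
    and t_comm: "t (x * y) = t (y * x)" and t_nondeg: "(\<And>y. t (y * x) = 0) \<Longrightarrow> x = 0"
    and t_rep: "Vector_Spaces.linear scale (*) f \<Longrightarrow> \<exists>x. \<forall>y. f y = t (y * x)"
begin

lemma t_0 [simp]: "t 0 = 0"
  using t_scale[of 0 0] by simp

lemma t_diff: "t (x - y) = t x - t y"
  using t_add[of "x - y" y] by simp

lemma t_sum: "t (\<Sum>a\<in>S. g a) = (\<Sum>a\<in>S. t (g a))"
  by (induction S rule: infinite_finite_induct) (simp_all add: t_add)

text \<open>The element representing the character \<open>\<chi> i\<close> through the form. It
  spans the socle of \<open>A (e i)\<close> and is normalized by \<open>t (soc i) = 1\<close>,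
  independently of any choice of arrows.\<close>

definition soc :: "'i \<Rightarrow> 'a" where
  "soc i = (SOME s. \<forall>y. \<chi> i y = t (y * s))"

lemma t_soc:
  assumes i: "i \<in> I"
  shows "t (y * soc i) = \<chi> i y"
proof -
  have "Vector_Spaces.linear scale (*) (\<chi> i)"
    by unfold_locales (simp_all add: chi_add chi_scale i algebra_simps)
  from someI_ex[OF t_rep[OF this]] show ?thesis unfolding soc_def by metis
qed

text \<open>By nondegeneracy, since t(y x soc i) = \<chi> i (y x) = 0. For the product in the other
  order below, the symmetry of \<open>t\<close> first moves \<open>x\<close> to the front.\<close>

lemma rad_soc: "i \<in> I \<Longrightarrow> x \<in> rad \<Longrightarrow> x * soc i = 0"
  by (rule t_nondeg) (simp add: t_soc chi_mult rad_def flip: mult.assoc)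

lemma soc_rad: "i \<in> I \<Longrightarrow> x \<in> rad \<Longrightarrow> soc i * x = 0"
proof (rule t_nondeg)
  fix y assume "i \<in> I" "x \<in> rad"
  moreover have "t (y * (soc i * x)) = t ((x * y) * soc i)" using t_comm[of "y * soc i" x] by (simp add: mult.assoc)
  ultimately show "t (y * (soc i * x)) = 0" by (simp add: t_soc chi_mult rad_def)
qed

lemma e_soc: "i \<in> I \<Longrightarrow> k \<in> I \<Longrightarrow> e k * soc i = (if k = i then soc i else 0)"
proof -
  assume i: "i \<in> I" "k \<in> I"
  have "e k * soc i - (if k = i then soc i else 0) = 0"
    by (rule t_nondeg) (use i in \<open>simp add: right_diff_distrib t_diff t_soc chi_mult chi_e flip: mult.assoc\<close>)
  then show ?thesis by simp
qed

lemma soc_e: "i \<in> I \<Longrightarrow> k \<in> I \<Longrightarrow> soc i * e k = (if k = i then soc i else 0)"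
proof -
  assume i: "i \<in> I" "k \<in> I"
  have "t (y * (soc i * e k)) = t ((e k * y) * soc i)" for y using t_comm[of "y * soc i" "e k"] by (simp add: mult.assoc)
  then have "soc i * e k - (if k = i then soc i else 0) = 0"
    by (intro t_nondeg) (use i in \<open>simp add: right_diff_distrib t_diff t_soc chi_mult chi_e\<close>)
  then show ?thesis by simp
qed

lemma t_soc_1: "i \<in> I \<Longrightarrow> t (soc i) = 1"
  using t_soc[of i 1] by (simp add: chi_one)

lemma soc_ne_0: "i \<in> I \<Longrightarrow> soc i \<noteq> 0"
  using t_soc_1[of i] by auto

text \<open>As the radical kills \<open>x\<close>, the product of \<open>y * e k\<close> with
  \<open>x\<close> is \<open>\<chi> k y\<close> times \<open>e k * x\<close>. Hence y -> t(y x) is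
  t(x) times \<open>\<chi> i\<close>, and nondegeneracy identifies \<open>x\<close>.\<close>

lemma soc_unique:
  assumes i: "i \<in> I" and x: "x * e i = x" "\<And>a. a \<in> rad \<Longrightarrow> a * x = 0"
  shows "x = scale (t x) (soc i)"
proof -
  have "x - scale (t x) (soc i) = 0"
  proof (rule t_nondeg)
    fix y
    have "t (y * x) = (\<Sum>k\<in>I. t (y * e k * x))"
      by (subst sum_e_right[of y]) (simp add: sum_distrib_right t_sum)
    also have "\<dots> = (\<Sum>k\<in>I. if k = i then \<chi> i y * t x else 0)"
    proof (rule sum.cong[OF refl])
      fix k assume k: "k \<in> I"
      have "(y * e k - scale (\<chi> k y) (e k)) * x = 0" by (intro x(2) sub_chi_mult_e k)
      then have ye: "y * e k * x = scale (\<chi> k y) (e k * x)" by (simp add: left_diff_distrib scale_mult_left)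
      have "t (e k * x) = t (x * e k)" by (rule t_comm)
      moreover have "x * e k = x * (e i * e k)" using x(1) by (simp flip: mult.assoc)
      ultimately have "t (e k * x) = (if k = i then t x else 0)" using e_mult[of i k] i k x(1) by (auto simp: mult.assoc)
      with ye show "t (y * e k * x) = (if k = i then \<chi> i y * t x else 0)" by (simp add: t_scale)
    qed
    also have "\<dots> = \<chi> i y * t x" using i finite_I by simp
    finally show "t (y * (x - scale (t x) (soc i))) = 0"
      using i by (simp add: right_diff_distrib t_diff scale_mult_right t_scale t_soc)
  qed
  then show ?thesis by simp
qed

section \<open>Chains of left ideals between socle and radical\<close>

definition socle :: "'i \<Rightarrow> 'a set" where
  "socle i = {scale c (soc i) | c. True}"

definition rad_at :: "'i \<Rightarrow> 'a set" where
  "rad_at i = {x \<in> rad. x * e i = x}"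

text \<open>The preimage in the algebra of a uniserial module with composition factors
  \<open>ks\<close> from the top; left ideals above \<open>Z\<close> replace quotient modules. The
  last clause is uniseriality of \<open>C 0\<close> modulo \<open>Z\<close>.\<close>

definition chain :: "'a set \<Rightarrow> (nat \<Rightarrow> 'a set) \<Rightarrow> 'i list \<Rightarrow> bool" where
  "chain Z C ks \<longleftrightarrow> (\<forall>k\<le>length ks. submod (C k) regular_module \<and> Z \<subseteq> C k) \<and> C (length ks) = Z \<and>
     (\<forall>k<length ks. C (Suc k) \<subseteq> C k \<and>
       (\<exists>x\<in>C k. x \<notin> C (Suc k) \<and> e (ks ! k) * x = x \<and> (\<forall>y\<in>C k. \<exists>c. y - scale c x \<in> C (Suc k))) \<and>
       (\<forall>a\<in>rad. \<forall>y\<in>C k. a * y \<in> C (Suc k))) \<and>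
     (\<forall>N N'. submod N regular_module \<and> submod N' regular_module \<and> Z \<subseteq> N \<and> Z \<subseteq> N' \<and> N \<subseteq> C 0 \<and> N' \<subseteq> C 0 \<longrightarrow>
       N \<subseteq> N' \<or> N' \<subseteq> N)"

lemma (in -) left_module_ideal: "submod K regular_module \<Longrightarrow> left_module (ideal_module K)"
  unfolding ideal_module_def by (rule left_module.left_module_restr[OF left_module_regular])

lemma (in -) submod_ideal_iff: "submod K regular_module \<Longrightarrow> submod L (ideal_module K) \<longleftrightarrow> submod L regular_module \<and> L \<subseteq> K"
  unfolding ideal_module_def by (rule left_module.submod_restr_iff[OF left_module_regular])

text \<open>Pull the composition series back along \<pi>. Each layer becomes a line annihilated by
  the radical because its simple factor is a line with action through a character.\<close>

lemma uniserial_chain: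
  fixes H :: "('a, 'b) module" and S :: "'i \<Rightarrow> ('a, 'c) module"
  assumes K: "submod K regular_module" and H: "left_module H"
    and \<pi>: "\<pi> \<in> mod_hom (ideal_module K) H" "\<pi> ` K = carrier H" and Z: "\<And>y. y \<in> K \<Longrightarrow> \<pi> y = \<zero>\<^bsub>H\<^esub> \<longleftrightarrow> y \<in> Z" "Z \<subseteq> K"
    and U: "submod U H" and us: "uniserial (restr H U)"
    and cf: "composition_factors_from_top (restr H U) (map S ks)"
    and ks: "\<And>k. k \<in> set ks \<Longrightarrow> k \<in> I \<and> has_char (S k) k"
  shows "\<exists>C. chain Z C ks \<and> C 0 = {y \<in> K. \<pi> y \<in> U}"
proof -
  interpret H: left_module H by fact
  interpret K: left_module "ideal_module K" by (rule left_module_ideal[OF K])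
  interpret p: module_hom' "ideal_module K" H \<pi> using \<pi> by unfold_locales
  interpret U: left_module "restr H U" by (rule H.left_module_restr[OF U])
  obtain C where C: "C 0 = U" "C (length ks) = {\<zero>\<^bsub>H\<^esub>}" "\<And>i. i \<le> length ks \<Longrightarrow> submod (C i) (restr H U)"
    and cs: "\<And>i. i < length ks \<Longrightarrow> C (Suc i) \<subseteq> C i"
    and ci: "\<And>i. i < length ks \<Longrightarrow> mod_iso (quot (restr H (C i)) (C (Suc i))) (S (ks ! i))"
    using cf unfolding composition_factors_from_top_def by auto
  have CH: "submod (C i) H" if "i \<le> length ks" for i
    using C(3)[OF that] H.submod_restr_iff[OF U] by blast
  define D where "D i = {y \<in> K. \<pi> y \<in> C i}" for i
  have pre: "submod {y \<in> K. \<pi> y \<in> X} regular_module" if "submod X H" for X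
    using p.submod_vimage[OF that] submod_ideal_iff[OF K] by simp
  have "C i \<subseteq> carrier H" if "i \<le> length ks" for i using H.submodD(1)[OF CH[OF that]] .
  have ZD: "Z \<subseteq> D i" if "i \<le> length ks" for i
  proof
    fix y assume "y \<in> Z"
    then have "y \<in> K" "\<pi> y = \<zero>\<^bsub>H\<^esub>" using Z by auto
    then show "y \<in> D i" using H.submodD(2)[OF CH[OF that]] by (simp add: D_def)
  qed
  have "chain Z D ks"
    unfolding chain_def
  proof (intro conjI allI impI)
    fix i assume "i \<le> length ks"
    then show "submod (D i) regular_module" "Z \<subseteq> D i" using pre CH ZD by (auto simp: D_def)
  next
    show "D (length ks) = Z" using C(2) Z by (auto simp: D_def)
  next
    fix i assume i: "i < length ks"
    then show "D (Suc i) \<subseteq> D i" using cs by (auto simp: D_def)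
    let ?k = "ks ! i" and ?M = "restr H (C i)"
    have k: "?k \<in> I" "has_char (S ?k) ?k" using ks i by auto
    interpret S: left_module "S ?k" using k(2) by (simp add: has_char_def)
    have Ci: "submod (C i) H" and CSi: "submod (C (Suc i)) H" using CH i by auto
    interpret M: left_module ?M by (rule H.left_module_restr[OF Ci])
    have N: "submod (C (Suc i)) ?M" using H.submod_restr_iff[OF Ci] CSi cs[OF i] by blast
    obtain f where f: "f \<in> mod_hom (quot ?M (C (Suc i))) (S ?k)" "bij_betw f (carrier (quot ?M (C (Suc i)))) (carrier (S ?k))"
      using ci[OF i] by (auto simp: mod_iso_def)
    interpret Q: left_module "quot ?M (C (Suc i))" by (rule M.left_module_quot[OF N])
    interpret f: module_hom' "quot ?M (C (Suc i))" "S ?k" f using f by unfold_locales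
    \<comment> \<open>The composite of \<pi>, the quotient map and the isomorphism with the simple
      factor; on \<open>D i\<close> its kernel is \<open>D (Suc i)\<close>.\<close>
    define \<rho> where "\<rho> y = f (C (Suc i) +>\<^bsub>?M\<^esub> \<pi> y)" for y
    have Dc: "\<pi> y \<in> carrier ?M" "y \<in> K" if "y \<in> D i" for y using that by (auto simp: D_def)
    have qc: "C (Suc i) +>\<^bsub>?M\<^esub> x \<in> carrier (quot ?M (C (Suc i)))" if "x \<in> carrier ?M" for x
      using M.carrier_quot[OF N] that by blast
    have \<rho>_smult: "\<rho> (a * y) = a \<odot>\<^bsub>S ?k\<^esub> \<rho> y" if "y \<in> D i" for a y
      using f.smult[OF qc[OF Dc(1)[OF that]], of a] M.coset_smult[OF N Dc(1)[OF that], of a] p.smult[of y a] Dc(2)[OF that]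
      by (simp add: \<rho>_def)
    have \<rho>_zero: "\<rho> y = \<zero>\<^bsub>S ?k\<^esub> \<longleftrightarrow> y \<in> D (Suc i)" if "y \<in> D i" for y
    proof -
      have "\<rho> y = \<zero>\<^bsub>S ?k\<^esub> \<longleftrightarrow> C (Suc i) +>\<^bsub>?M\<^esub> \<pi> y = \<zero>\<^bsub>quot ?M (C (Suc i))\<^esub>"
        unfolding \<rho>_def using f(2) f.inj_iff f.zero qc[OF Dc(1)[OF that]] by (auto simp: bij_betw_def)
      also have "\<dots> \<longleftrightarrow> \<pi> y \<in> C (Suc i)" by (rule M.coset_zero_iff[OF N Dc(1)[OF that]])
      finally show ?thesis using Dc(2)[OF that] by (simp add: D_def)
    qed
    have \<rho>_in: "\<rho> y \<in> carrier (S ?k)" if "y \<in> D i" for y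
      unfolding \<rho>_def by (rule f.closed[OF qc[OF Dc(1)[OF that]]])
    have D_sub: "submod (D i) regular_module" using pre Ci by (simp add: D_def)
    have Dm: "a * y \<in> D i" if "y \<in> D i" for a y using D_sub that by (auto simp: submod_regular)
    have char: "a \<odot>\<^bsub>S ?k\<^esub> x = scale (\<chi> ?k a) 1 \<odot>\<^bsub>S ?k\<^esub> x" if "x \<in> carrier (S ?k)" for a x
      using k(2) that unfolding has_char_def by blast
    show "\<forall>a\<in>rad. \<forall>y\<in>D i. a * y \<in> D (Suc i)"
    proof (intro ballI)
      fix a y assume a: "a \<in> rad" and y: "y \<in> D i"
      have "\<rho> (a * y) = scale 0 1 \<odot>\<^bsub>S ?k\<^esub> \<rho> y"
        using \<rho>_smult[OF y] char[OF \<rho>_in[OF y], of a] a k(1) by (simp add: rad_def)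
      then have "\<rho> (a * y) = \<zero>\<^bsub>S ?k\<^esub>" using \<rho>_in[OF y] by simp
      then show "a * y \<in> D (Suc i)" using \<rho>_zero[OF Dm[OF y]] by blast
    qed
    obtain w where w: "w \<in> carrier (S ?k)" "w \<noteq> \<zero>\<^bsub>S ?k\<^esub>" using k(2) S.zero_closed unfolding has_char_def by blast
    have "w \<in> f ` carrier (quot ?M (C (Suc i)))" using f(2) w(1) by (simp add: bij_betw_def)
    then obtain X where X: "w = f X" "X \<in> carrier (quot ?M (C (Suc i)))" by (rule imageE)
    obtain x where x: "x \<in> C i" "X = C (Suc i) +>\<^bsub>?M\<^esub> x" using X(2) M.carrier_quot[OF N] by auto
    have "x \<in> carrier H" using x(1) H.submodD(1)[OF Ci] by blast
    then obtain y where y: "y \<in> K" "\<pi> y = x" using \<pi>(2) by (metis imageE)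
    have yD: "y \<in> D i" using y x by (simp add: D_def)
    have ry: "\<rho> y = w" unfolding \<rho>_def y(2) x(2)[symmetric] X(1) ..
    \<comment> \<open>The idempotent acts as the identity on its own simple module, so
      \<open>y\<close> may be replaced by \<open>e ?k * y\<close> without changing the
      image.\<close>
    let ?z = "e ?k * y"
    have z: "?z \<in> D i" by (rule Dm[OF yD])
    have rz: "\<rho> ?z = w" using \<rho>_smult[OF yD] char[OF w(1), of "e ?k"] k(1) ry S.smult_one[OF w(1)] by (simp add: chi_e)
    have "\<exists>c. v - scale c ?z \<in> D (Suc i)" if v: "v \<in> D i" for v
    proof -
      obtain c where c: "\<rho> v = scale c 1 \<odot>\<^bsub>S ?k\<^esub> w" using k(2) w \<rho>_in[OF v] unfolding has_char_def by blast
      have cz: "scale c ?z \<in> D i" using Dm[OF z, of "scale c 1"] by (simp add: scale_one_mult)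
      have d: "v - scale c ?z \<in> D i" using D_sub v Dm[OF cz, of "-1"] unfolding submod_regular by (metis add_uminus_conv_diff mult_minus1)
      have "\<rho> v = \<rho> ((v - scale c ?z) + scale c ?z)" by simp
      also have "\<dots> = \<rho> (v - scale c ?z) \<oplus>\<^bsub>S ?k\<^esub> \<rho> (scale c ?z)"
        using p.add[of "v - scale c ?z" "scale c ?z"] Dc[OF d] Dc[OF cz] M.coset_add[OF N Dc(1)[OF d] Dc(1)[OF cz]]
          f.add[OF qc[OF Dc(1)[OF d]] qc[OF Dc(1)[OF cz]]]
        unfolding \<rho>_def by (simp add: quot_def)
      also have "\<rho> (scale c ?z) = \<rho> v" using \<rho>_smult[OF z, of "scale c 1"] rz c by (simp add: scale_one_mult)
      finally have "\<rho> (v - scale c ?z) = \<zero>\<^bsub>S ?k\<^esub>"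
        using \<rho>_in[OF d] \<rho>_in[OF v] S.add.r_cancel_one' by metis
      then show ?thesis using \<rho>_zero[OF d] by blast
    qed
    moreover have "?z \<notin> D (Suc i)" using \<rho>_zero[OF z] rz w(2) by simp
    moreover have "e ?k * ?z = ?z" using e_mult[of ?k ?k] k(1) by (simp flip: mult.assoc)
    ultimately show "\<exists>x\<in>D i. x \<notin> D (Suc i) \<and> e (ks ! i) * x = x \<and> (\<forall>y\<in>D i. \<exists>c. y - scale c x \<in> D (Suc i))"
      using z by blast
  next
    fix N N' assume *: "submod N regular_module \<and> submod N' regular_module \<and> Z \<subseteq> N \<and> Z \<subseteq> N' \<and> N \<subseteq> D 0 \<and> N' \<subseteq> D 0"
    have sub: "N \<subseteq> K" "N' \<subseteq> K" using * by (auto simp: D_def)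
    have im: "submod (\<pi> ` X) (restr H U)" if "submod X regular_module" "X \<subseteq> D 0" for X
    proof -
      have "submod X (ideal_module K)" using that submod_ideal_iff[OF K] by (auto simp: D_def)
      then show ?thesis using p.submod_image H.submod_restr_iff[OF U] that(2) C(1) by (auto simp: D_def)
    qed
    \<comment> \<open>A left ideal containing the kernel \<open>Z\<close> of \<pi> is determined by
      its image.\<close>
    have lift: "X \<subseteq> Y" if "\<pi> ` X \<subseteq> \<pi> ` Y" "submod Y regular_module" "Z \<subseteq> Y" "X \<subseteq> K" "Y \<subseteq> K" for X Y
    proof
      fix x assume x: "x \<in> X"
      then have "\<pi> x \<in> \<pi> ` Y" using that(1) by (auto dest: subsetD)
      then obtain y where y: "\<pi> x = \<pi> y" "y \<in> Y" by (rule imageE)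
      have xy: "x \<in> K" "y \<in> K" using x y that by auto
      have m: "x - y \<in> K" using K xy unfolding submod_regular by (metis add_uminus_conv_diff mult_minus1)
      have "\<pi> x = \<pi> (x - y) \<oplus>\<^bsub>H\<^esub> \<pi> y" using p.add[of "x - y" y] m xy by simp
      then have "\<pi> (x - y) = \<zero>\<^bsub>H\<^esub>" using y(1) p.closed m xy H.add.r_cancel_one' by (metis ideal_module_simps(1))
      then have "x - y \<in> Y" using Z(1)[OF m] that(3) by blast
      then have "(x - y) + y \<in> Y" using that(2) y(2) unfolding submod_regular by blast
      then show "x \<in> Y" by simp
    qed
    have "\<And>A B. submod A (restr H U) \<Longrightarrow> submod B (restr H U) \<Longrightarrow> A \<subseteq> B \<or> B \<subseteq> A"
      using us by (simp add: uniserial_def)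
    from this[OF im im, of N N'] * have "\<pi> ` N \<subseteq> \<pi> ` N' \<or> \<pi> ` N' \<subseteq> \<pi> ` N" by simp
    then show "N \<subseteq> N' \<or> N' \<subseteq> N"
      using lift[of N N'] lift[of N' N] * sub by (elim disjE) simp_all
  qed
  then show ?thesis using C(1) by (auto simp: D_def)
qed

end

context idem_algebra
begin

lemma projective_cover_iso:
  fixes P :: "('a, 'b) module" and S :: "('a, 'c) module"
  assumes i: "i \<in> I" and S: "has_char S i" and pc: "projective_cover P S"
  shows "\<exists>u\<in>carrier P. (\<lambda>y. y \<odot>\<^bsub>P\<^esub> u) \<in> mod_hom (peirce (e i)) P \<and>
    bij_betw (\<lambda>y. y \<odot>\<^bsub>P\<^esub> u) {x. x * e i = x} (carrier P)"
proof -
  have P: "projective P" using pc by (simp add: projective_cover_def)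
  interpret P: left_module P using P by (simp add: projective_def)
  interpret S: left_module S using S by (simp add: has_char_def)
  obtain f where f: "f \<in> mod_hom P S" "f ` carrier P = carrier S"
    and sup: "\<And>N. submod N P \<Longrightarrow> N <+>\<^bsub>P\<^esub> a_kernel P S f = carrier P \<Longrightarrow> N = carrier P"
    using pc unfolding projective_cover_def by metis
  interpret f: module_hom' P S f using f by unfold_locales
  obtain w where w: "w \<in> carrier S" "w \<noteq> \<zero>\<^bsub>S\<^esub>" using S S.zero_closed unfolding has_char_def by blast
  have char: "a \<odot>\<^bsub>S\<^esub> x = scale (\<chi> i a) 1 \<odot>\<^bsub>S\<^esub> x" if "x \<in> carrier S" for a x
    using S that unfolding has_char_def by blast
  have "w \<in> f ` carrier P" using f(2) w(1) by simp
  then obtain p where p: "w = f p" "p \<in> carrier P" by (rule imageE)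
  define u where "u = e i \<odot>\<^bsub>P\<^esub> p"
  have u: "u \<in> carrier P" "e i \<odot>\<^bsub>P\<^esub> u = u"
    using p P.smult_closed P.smult_assoc[OF p(2), of "e i" "e i"] e_mult i by (auto simp: u_def)
  have fu: "f u = w" using f.smult[OF p(2), of "e i"] p(1) char[OF w(1), of "e i"] S.smult_one[OF w(1)] i by (simp add: u_def chi_e)
  let ?N = "{x \<in> carrier P. f x = \<zero>\<^bsub>S\<^esub>}"
  have N: "submod ?N P" using f.submod_vimage[OF S.submod_zero] by simp
  have rN: "x \<odot>\<^bsub>P\<^esub> m \<in> ?N" if "x \<in> rad" "m \<in> carrier P" for x m
    using that f.smult[of m x] char[OF f.closed, of m x] i f.closed[of m] P.smult_closed by (auto simp: rad_def)
  obtain h where h: "h \<in> mod_hom P (peirce (e i))" "h u = e i"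
    using projective_hom_onto_peirce[OF P i u N rN] fu w(2) by auto
  interpret h: module_hom' P "peirce (e i)" h using h left_module_peirce by (simp add: module_hom'_def module_hom'_axioms_def P.left_module_axioms)
  have g: "(\<lambda>y. y \<odot>\<^bsub>P\<^esub> u) \<in> mod_hom (peirce (e i)) P"
    using u P.smult_closed P.smult_l_distr P.smult_assoc by (auto simp: mod_hom_def)
  interpret g: module_hom' "peirce (e i)" P "\<lambda>y. y \<odot>\<^bsub>P\<^esub> u"
    using g left_module_peirce by (simp add: module_hom'_def module_hom'_axioms_def P.left_module_axioms)
  have hg: "h (y \<odot>\<^bsub>P\<^esub> u) = y" if "y * e i = y" for y using h.smult[OF u(1), of y] h(2) that by simp
  let ?G = "(\<lambda>y. y \<odot>\<^bsub>P\<^esub> u) ` {x. x * e i = x}"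
  have G: "submod ?G P" using g.submod_image[OF left_module.submod_carrier[OF left_module_peirce]] by simp
  have "?G <+>\<^bsub>P\<^esub> a_kernel P S f = carrier P"
  proof (intro equalityI subsetI)
    fix x assume x: "x \<in> carrier P"
    obtain c where c: "f x = scale c 1 \<odot>\<^bsub>S\<^esub> w" using S w f.closed[OF x] unfolding has_char_def by blast
    let ?a = "scale c (e i) \<odot>\<^bsub>P\<^esub> u"
    have a: "?a \<in> carrier P" "?a \<in> ?G" using u P.smult_closed e_mult i by (auto simp: scale_mult_left)
    have "?a = scale c 1 \<odot>\<^bsub>P\<^esub> u" using P.smult_assoc[OF u(1), of "scale c 1" "e i"] u(2) by (simp add: scale_one_mult)
    then have "f ?a = f x" using f.smult[OF u(1)] fu c by simp
    then have "x \<ominus>\<^bsub>P\<^esub> ?a \<in> a_kernel P S f"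
      using f.minus[OF x a(1)] f.closed[OF x] x a by (simp add: a_kernel_def kernel_def S.minus_eq_zero_iff)
    moreover have "x = ?a \<oplus>\<^bsub>P\<^esub> (x \<ominus>\<^bsub>P\<^esub> ?a)" using x a by (simp add: a_minus_def P.a_lcomm P.r_neg)
    ultimately show "x \<in> ?G <+>\<^bsub>P\<^esub> a_kernel P S f" using a(2) unfolding set_add_eq by blast
  next
    fix x assume "x \<in> ?G <+>\<^bsub>P\<^esub> a_kernel P S f"
    then show "x \<in> carrier P" using u P.smult_closed by (auto simp: set_add_eq a_kernel_def kernel_def)
  qed
  then have "?G = carrier P" by (rule sup[OF G])
  moreover have "inj_on (\<lambda>y. y \<odot>\<^bsub>P\<^esub> u) {x. x * e i = x}" by (rule inj_on_inverseI[of _ h]) (use hg in simp)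
  ultimately show ?thesis using g u(1) by (intro bexI[of _ u]) (simp_all add: bij_betw_def)
qed

end

context sym_idem_algebra
begin

lemma rad_at_submod: "submod (rad_at i) regular_module"
  using subspace_0[OF subspace_rad] subspace_add[OF subspace_rad] rad_mult(1)
  by (auto simp: submod_regular rad_at_def distrib_right mult.assoc)

lemma mult_soc: "i \<in> I \<Longrightarrow> a * soc i = scale (\<chi> i a) (soc i)"
proof -
  assume i: "i \<in> I"
  have "(a * e i - scale (\<chi> i a) (e i)) * soc i = 0" by (rule rad_soc[OF i sub_chi_mult_e[OF i]])
  then show ?thesis using e_soc[OF i i] by (simp add: left_diff_distrib scale_mult_left mult.assoc)
qed

lemma socle_submod:
  assumes i: "i \<in> I"
  shows "submod (socle i) regular_module"
  unfolding submod_regular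
proof (intro conjI ballI allI)
  show "0 \<in> socle i" unfolding socle_def by (rule CollectI, rule exI[of _ 0]) simp
  fix x assume "x \<in> socle i"
  then obtain c where x: "x = scale c (soc i)" by (auto simp: socle_def)
  show "a * x \<in> socle i" for a unfolding x socle_def using mult_soc[OF i, of a]
    by (auto simp: scale_mult_right)
  fix y assume "y \<in> socle i"
  then obtain d where "y = scale d (soc i)" by (auto simp: socle_def)
  then show "x + y \<in> socle i" using x by (auto simp: socle_def simp flip: scale_left_distrib)
qed

lemma socle_at: "i \<in> I \<Longrightarrow> x \<in> socle i \<Longrightarrow> x * e i = x"
  by (auto simp: socle_def scale_mult_left soc_e)

text \<open>Identify the projective cover with \<open>A (e i)\<close>. Its radical then corresponds
  to \<open>rad_at i\<close> and its socle to the line through \<open>soc i\<close>, so the two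
  uniserial summands pull back to chains that together fill \<open>rad_at i\<close>.\<close>

lemma edge_chains:
  fixes P :: "('a, 'b) module" and T :: "('a, 'c) module" and S :: "'i \<Rightarrow> ('a, 'c) module"
  assumes i: "i \<in> I" and T: "has_char T i" and pc: "projective_cover P T" and sr: "mod_soc P \<subseteq> mod_rad P"
    and ds: "internal_direct_sum (quot (restr P (mod_rad P)) (mod_soc P)) U W"
    and U: "uniserial (restr (quot (restr P (mod_rad P)) (mod_soc P)) U)"
      "composition_factors_from_top (restr (quot (restr P (mod_rad P)) (mod_soc P)) U) (map S ks)"
    and W: "uniserial (restr (quot (restr P (mod_rad P)) (mod_soc P)) W)"
      "composition_factors_from_top (restr (quot (restr P (mod_rad P)) (mod_soc P)) W) (map S ls)"
    and ks: "\<And>k. k \<in> set ks \<Longrightarrow> k \<in> I \<and> has_char (S k) k" and ls: "\<And>k. k \<in> set ls \<Longrightarrow> k \<in> I \<and> has_char (S k) k"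
  shows "soc i \<in> rad \<and> (\<exists>C D. chain (socle i) C ks \<and> chain (socle i) D ls \<and> C 0 \<subseteq> rad_at i \<and> D 0 \<subseteq> rad_at i \<and>
    (\<forall>x\<in>rad_at i. \<exists>a\<in>C 0. \<exists>b\<in>D 0. x = a + b))"
proof -
  obtain u where u: "u \<in> carrier P" and g: "(\<lambda>y. y \<odot>\<^bsub>P\<^esub> u) \<in> mod_hom (peirce (e i)) P"
    and bij: "bij_betw (\<lambda>y. y \<odot>\<^bsub>P\<^esub> u) {x. x * e i = x} (carrier P)"
    using projective_cover_iso[OF i T pc] by (elim bexE conjE)
  interpret P: left_module P using pc by (simp add: projective_cover_def projective_def)
  define \<gamma> where "\<gamma> = (\<lambda>y. y \<odot>\<^bsub>P\<^esub> u)"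
  let ?A = "{x. x * e i = x}"
  have g: "\<gamma> \<in> mod_hom (peirce (e i)) P" and bij: "bij_betw \<gamma> ?A (carrier P)" using g bij by (simp_all add: \<gamma>_def)
  interpret A: left_module "peirce (e i)" by (rule left_module_peirce)
  interpret g: module_hom' "peirce (e i)" P \<gamma> using g by unfold_locales
  have gA: "\<gamma> x \<in> carrier P" if "x \<in> ?A" for x using g.closed that by simp
  have inj: "x = y" if "\<gamma> x = \<gamma> y" "x \<in> ?A" "y \<in> ?A" for x y using bij that by (auto simp: bij_betw_def inj_on_def)
  have gs: "\<gamma> (a * x) = a \<odot>\<^bsub>P\<^esub> \<gamma> x" if "x \<in> ?A" for a x using g.smult[of x a] that by simp
  have pre: "\<exists>L. submod L regular_module \<and> L \<subseteq> ?A \<and> N = \<gamma> ` L" if N: "submod N P" for N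
  proof -
    let ?L = "{x \<in> carrier (peirce (e i)). \<gamma> x \<in> N}"
    have "submod ?L (peirce (e i))" by (rule g.submod_vimage[OF N])
    then have "submod ?L regular_module" using submod_peirce_iff by blast
    moreover have "N = \<gamma> ` ?L"
      using P.submodD(1)[OF N] bij unfolding bij_betw_def by (auto simp: image_iff subset_iff) 
    moreover have "?L \<subseteq> ?A" by auto
    ultimately show ?thesis by blast
  qed
  have im: "submod (\<gamma> ` L) P" if "submod L regular_module" "L \<subseteq> ?A" for L
    by (rule g.submod_image) (use that submod_peirce_iff[of L "e i"] in auto)
  have iA: "e i \<in> ?A" using e_mult i by simp
  have rA: "rad_at i \<subseteq> ?A" and sA: "socle i \<subseteq> ?A" using socle_at[OF i] by (auto simp: rad_at_def)
  have e_rad: "e i \<notin> rad" 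
  proof
    assume "e i \<in> rad"
    then have "\<chi> i (e i) = 0" using i by (simp add: rad_def)
    then show False using chi_e[OF i i] by simp
  qed
  \<comment> \<open>An element of \<open>A (e i)\<close> outside the radical becomes a unit of the
    corner after multiplication by \<open>e i\<close>, so the ideal contains \<open>e i\<close>.
    Hence \<open>rad_at i\<close> is the only maximal submodule.\<close>
  have big: "L = ?A" if L: "submod L regular_module" "L \<subseteq> ?A" "\<not> L \<subseteq> rad_at i" for L
  proof -
    obtain y where y: "y \<in> L" "y \<notin> rad" "y * e i = y" using L by (auto simp: rad_at_def)
    have "\<exists>k\<in>I. \<chi> k y \<noteq> 0" using y(2) by (auto simp: rad_def)
    then obtain k where k: "k \<in> I" "\<chi> k y \<noteq> 0" by blast
    have "\<chi> k y = \<chi> k y * \<chi> k (e i)" using arg_cong[OF y(3), of "\<chi> k"] k(1) by (simp add: chi_mult)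
    then have "k = i" using k i chi_e by (auto split: if_splits)
    then have "\<chi> i (e i * y) \<noteq> 0" using k i by (simp add: chi_mult chi_e)
    moreover have "e i * (e i * y) = e i * y" using e_mult i by (simp flip: mult.assoc)
    moreover have "(e i * y) * e i = e i * y" by (simp add: mult.assoc y(3))
    ultimately obtain z where "z * (e i * y) = e i" using corner_unit[OF i, of "e i * y"] by blast
    then have "(z * e i) * y = e i" by (simp add: mult.assoc)
    then have "e i \<in> L" using L(1) y(1) unfolding submod_regular by metis
    then have "x \<in> L" if "x * e i = x" for x using L(1) that unfolding submod_regular by metis
    then show ?thesis using L(2) by blast
  qed
  have R: "submod (\<gamma> ` rad_at i) P" by (rule im[OF rad_at_submod rA])
  have subset_iff: "\<gamma> ` L \<subseteq> \<gamma> ` L' \<longleftrightarrow> L \<subseteq> L'" if "L \<subseteq> ?A" "L' \<subseteq> ?A" for L L'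
  proof
    assume h: "\<gamma> ` L \<subseteq> \<gamma> ` L'"
    show "L \<subseteq> L'"
    proof
      fix x assume x: "x \<in> L"
      then have "\<gamma> x \<in> \<gamma> ` L'" using h by (auto dest: subsetD)
      then obtain y where "\<gamma> x = \<gamma> y" "y \<in> L'" by (rule imageE)
      then show "x \<in> L'" using inj[of x y] that x by auto
    qed
  qed (rule image_mono)
  have gA_eq: "\<gamma> ` ?A = carrier P" using bij by (simp add: bij_betw_def)
  have Rne: "\<gamma> ` rad_at i \<noteq> carrier P"
  proof
    assume "\<gamma> ` rad_at i = carrier P"
    then have "\<gamma> ` ?A \<subseteq> \<gamma> ` rad_at i" using gA_eq by simp
    then have "?A \<subseteq> rad_at i" using subset_iff[OF subset_refl rA] by blast
    then show False using iA e_rad by (auto simp: rad_at_def)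
  qed
  have small: "N \<subseteq> \<gamma> ` rad_at i" if N: "submod N P" "N \<noteq> carrier P" for N
  proof -
    obtain L where L: "submod L regular_module" "L \<subseteq> ?A" "N = \<gamma> ` L" using pre[OF N(1)] by blast
    have "L \<subseteq> rad_at i" using big[OF L(1,2)] L(3) N(2) gA_eq by blast
    then show ?thesis using L(3) by blast
  qed
  have "maximal_submod N P \<longleftrightarrow> N = \<gamma> ` rad_at i" for N
  proof
    assume m: "maximal_submod N P"
    then have "N \<subseteq> \<gamma> ` rad_at i" using small by (simp add: maximal_submod_def)
    then show "N = \<gamma> ` rad_at i" using m R Rne unfolding maximal_submod_def by metis
  next
    assume "N = \<gamma> ` rad_at i"
    then show "maximal_submod N P" using R Rne small unfolding maximal_submod_def by blast
  qed
  then have mr: "mod_rad P = \<gamma> ` rad_at i"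
    using P.submodD(1)[OF R] by (auto simp: mod_rad_def)
  have Sm: "submod (\<gamma> ` socle i) P" by (rule im[OF socle_submod[OF i] sA])
  \<comment> \<open>On a simple submodule the radical acts as zero, so its elements are multiples of
    \<open>soc i\<close> by \<open>soc_unique\<close>.\<close>
  have cover: "X \<subseteq> \<gamma> ` socle i" if X: "submod X P" "simple_mod (restr P X)" for X
  proof -
    obtain L where L: "submod L regular_module" "L \<subseteq> ?A" "X = \<gamma> ` L" using pre[OF X(1)] by blast
    obtain k where k: "k \<in> I" "has_char (restr P X) k" using simple_has_char[OF X(2)] by blast
    have "y \<in> socle i" if y: "y \<in> L" for y
    proof -
      have "a * y = 0" if a: "a \<in> rad" for a
      proof -
        have yX: "\<gamma> y \<in> X" using L(3) y by blast
        have "a \<odot>\<^bsub>restr P X\<^esub> \<gamma> y = scale (\<chi> k a) 1 \<odot>\<^bsub>restr P X\<^esub> \<gamma> y"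
          using k(2) yX unfolding has_char_def restr_simps(1) by blast
        then have "a \<odot>\<^bsub>P\<^esub> \<gamma> y = scale (\<chi> k a) 1 \<odot>\<^bsub>P\<^esub> \<gamma> y" unfolding restr_simps(4) .
        also have "\<dots> = \<zero>\<^bsub>P\<^esub>" using a k(1) gA[of y] y L(2) by (auto simp: rad_def)
        finally have "\<gamma> (a * y) = \<gamma> 0" using gs[of y a] y L(2) g.zero by auto
        then show ?thesis using inj y L(2) by (auto simp: mult.assoc)
      qed
      then have "y = scale (t y) (soc i)" using y L(2) by (intro soc_unique i) auto
      then show ?thesis unfolding socle_def by blast
    qed
    then show ?thesis using L(3) by blast
  qed
  have simple: "simple_mod (restr P (\<gamma> ` socle i))"
    unfolding simple_mod_def
  proof (intro conjI allI impI)
    show "left_module (restr P (\<gamma> ` socle i))" by (rule P.left_module_restr[OF Sm])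
    have ss: "soc i \<in> socle i" unfolding socle_def by (rule CollectI, rule exI[of _ 1]) simp
    have "\<gamma> (soc i) \<noteq> \<gamma> 0"
    proof
      assume "\<gamma> (soc i) = \<gamma> 0"
      then have "soc i = 0" using ss sA by (intro inj) auto
      then show False using soc_ne_0[OF i] by simp
    qed
    then have "\<gamma> (soc i) \<noteq> \<zero>\<^bsub>P\<^esub>" using g.zero by simp
    then show "carrier (restr P (\<gamma> ` socle i)) \<noteq> {\<zero>\<^bsub>restr P (\<gamma> ` socle i)\<^esub>}" using ss by auto
    fix N assume "submod N (restr P (\<gamma> ` socle i))"
    then have N: "submod N P" "N \<subseteq> \<gamma> ` socle i" using P.submod_restr_iff[OF Sm] by auto
    obtain L where L: "submod L regular_module" "L \<subseteq> ?A" "N = \<gamma> ` L" using pre[OF N(1)] by blast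
    have LS: "L \<subseteq> socle i" using N(2) L(3) subset_iff[OF L(2) sA] by blast
    show "N = {\<zero>\<^bsub>restr P (\<gamma> ` socle i)\<^esub>} \<or> N = carrier (restr P (\<gamma> ` socle i))"
    proof (cases "L \<subseteq> {0}")
      case True
      then have "L = {0}" using L(1) by (auto simp: submod_regular)
      then show ?thesis using L(3) g.zero by simp
    next
      case False
      then obtain y where y: "y \<in> L" "y \<noteq> 0" by blast
      obtain c where c: "y = scale c (soc i)" using LS y(1) by (auto simp: socle_def)
      have "c \<noteq> 0" using y(2) c by auto
      have "scale d (soc i) \<in> L" for d
      proof -
        have "scale (d / c) 1 * y = scale d (soc i)" using \<open>c \<noteq> 0\<close> by (simp add: c scale_one_mult)
        then show ?thesis using L(1) y(1) unfolding submod_regular by metis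
      qed
      then have "socle i \<subseteq> L" by (auto simp: socle_def)
      then show ?thesis using L(3) LS by auto
    qed
  qed
  have ms: "mod_soc P = \<gamma> ` socle i"
    unfolding mod_soc_def
  proof (intro equalityI subsetI InterI)
    fix x assume "x \<in> \<Inter> {N. submod N P \<and> (\<forall>T. submod T P \<and> simple_mod (restr P T) \<longrightarrow> T \<subseteq> N)}"
    then show "x \<in> \<gamma> ` socle i" using Sm cover by blast
  next
    fix x N assume "x \<in> \<gamma> ` socle i" "N \<in> {N. submod N P \<and> (\<forall>T. submod T P \<and> simple_mod (restr P T) \<longrightarrow> T \<subseteq> N)}"
    then show "x \<in> N" using Sm simple by blast
  qed
  \<comment> \<open>Here simple projectives are excluded: for them \<open>soc i\<close> would be a
    multiple of \<open>e i\<close> and lie outside the radical.\<close>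
  have SR: "socle i \<subseteq> rad_at i" using sr subset_iff[OF sA rA] by (simp add: mr ms)
  have "soc i \<in> socle i" unfolding socle_def by (rule CollectI, rule exI[of _ 1]) simp
  then have socr: "soc i \<in> rad" using SR by (auto simp: rad_at_def)
  let ?K = "restr P (\<gamma> ` rad_at i)" and ?Z = "\<gamma> ` socle i"
  let ?H = "quot ?K ?Z"
  interpret K: left_module ?K by (rule P.left_module_restr[OF R])
  have ZK: "submod ?Z ?K" using P.submod_restr_iff[OF R] Sm SR by blast
  have H: "left_module ?H" by (rule K.left_module_quot[OF ZK])
  interpret H: left_module ?H by (rule H)
  define \<pi> where "\<pi> y = ?Z +>\<^bsub>?K\<^esub> \<gamma> y" for y
  have "\<gamma> \<in> mod_hom (ideal_module (rad_at i)) ?K"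
    using g by (auto simp: mod_hom_def rad_at_def)
  then have \<pi>: "\<pi> \<in> mod_hom (ideal_module (rad_at i)) ?H"
    unfolding \<pi>_def by (rule mod_hom_compose[OF _ K.quot_hom[OF ZK]])
  have \<pi>s: "\<pi> ` rad_at i = carrier ?H" using K.carrier_quot[OF ZK] by (auto simp: \<pi>_def)
  have \<pi>z: "\<pi> y = \<zero>\<^bsub>?H\<^esub> \<longleftrightarrow> y \<in> socle i" if "y \<in> rad_at i" for y
  proof -
    have "\<pi> y = \<zero>\<^bsub>?H\<^esub> \<longleftrightarrow> \<gamma> y \<in> ?Z" unfolding \<pi>_def by (rule K.coset_zero_iff[OF ZK]) (use that in simp)
    also have "\<dots> \<longleftrightarrow> y \<in> socle i" using inj sA rA that by (auto simp: subset_iff)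
    finally show ?thesis .
  qed
  note ds = ds[unfolded mr ms] and U = U[unfolded mr ms] and W = W[unfolded mr ms]
  have sUW: "submod U ?H" "submod W ?H" using ds by (auto simp: internal_direct_sum_def)
  obtain C where C: "chain (socle i) C ks" "C 0 = {y \<in> rad_at i. \<pi> y \<in> U}"
    using uniserial_chain[OF rad_at_submod H \<pi> \<pi>s \<pi>z SR sUW(1) U ks] by blast
  obtain D where D: "chain (socle i) D ls" "D 0 = {y \<in> rad_at i. \<pi> y \<in> W}"
    using uniserial_chain[OF rad_at_submod H \<pi> \<pi>s \<pi>z SR sUW(2) W ls] by blast
  interpret p: module_hom' "ideal_module (rad_at i)" ?H \<pi>
    using \<pi> H left_module_ideal[OF rad_at_submod] by (simp add: module_hom'_def module_hom'_axioms_def)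
  have UW: "U <+>\<^bsub>?H\<^esub> W = carrier ?H" using ds by (auto simp: internal_direct_sum_def)
  have "\<exists>a\<in>C 0. \<exists>b\<in>D 0. x = a + b" if x: "x \<in> rad_at i" for x
  proof -
    have "\<pi> x \<in> U <+>\<^bsub>?H\<^esub> W" using x \<pi>s UW by blast
    then obtain a b where ab: "a \<in> U" "b \<in> W" "\<pi> x = a \<oplus>\<^bsub>?H\<^esub> b" by (auto simp: set_add_eq)
    have "a \<in> \<pi> ` rad_at i" using ab(1) H.submodD(1)[OF sUW(1)] \<pi>s by blast
    then obtain a' where a': "a = \<pi> a'" "a' \<in> rad_at i" by (rule imageE)
    have b: "b \<in> carrier ?H" using ab(2) H.submodD(1)[OF sUW(2)] by blast
    have m: "x - a' \<in> rad_at i" using rad_at_submod x a'(2) unfolding submod_regular by (metis add_uminus_conv_diff mult_minus1)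
    have "\<pi> x = \<pi> (x - a') \<oplus>\<^bsub>?H\<^esub> \<pi> a'" using p.add[of "x - a'" a'] m a'(2) by simp
    then have "b \<oplus>\<^bsub>?H\<^esub> a = \<pi> (x - a') \<oplus>\<^bsub>?H\<^esub> a" using ab a' b p.closed H.a_comm by simp
    then have "b = \<pi> (x - a')" using b p.closed m a' H.add.right_cancel by simp
    then have "x - a' \<in> D 0" using D(2) m ab(2) by simp
    moreover have "a' \<in> C 0" using C(2) a' ab(1) by simp
    moreover have "x = a' + (x - a')" by simp
    ultimately show ?thesis by blast
  qed
  then show ?thesis using socr C D by blast
qed

end


section \<open>Combinatorics of the cyclic orderings\<close>

lemma cyclic_on_orbit_eq: "cyclic_on f S \<Longrightarrow> x \<in> S \<Longrightarrow> S = orbit f x"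
  by (simp add: cyclic_on_alldef)

lemma cyclic_on_period:
  assumes c: "cyclic_on f S" and x: "x \<in> S"
  shows "(f ^^ card S) x = x" and "0 < card S" and "\<And>k. 0 < k \<Longrightarrow> k < card S \<Longrightarrow> (f ^^ k) x \<noteq> x"
proof -
  have S: "S = orbit f x" by (rule cyclic_on_orbit_eq[OF c x])
  then have xo: "x \<in> orbit f x" using x by simp
  let ?d = "funpow_dist1 f x x"
  have inj: "inj_on (\<lambda>n. (f ^^ n) x) {0..<?d}" by (rule inj_on_funpow_dist1[OF xo])
  have "card S = ?d"
    unfolding S orbit_conv_funpow_dist1[OF xo] using inj by (subst card_image) simp_all
  moreover have "(f ^^ ?d) x = x" using funpow_dist1_prop[OF xo] .
  ultimately show "(f ^^ card S) x = x" "0 < card S" by simp_all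
  fix k assume "0 < k" "k < card S"
  then show "(f ^^ k) x \<noteq> x" using inj \<open>card S = ?d\<close> inj_onD[OF inj, of k 0] by auto
qed

context brauer_tree
begin

abbreviation nx :: "'v \<Rightarrow> 'v set \<Rightarrow> 'v set" where "nx \<equiv> next_edge \<Gamma>"

definition val :: "'v \<Rightarrow> nat" where "val v = card (incident \<Gamma> v)"

text \<open>The length of a maximal path around \<open>v\<close>: as many full turns as the
  multiplicity of the vertex.\<close>

definition per :: "'v \<Rightarrow> nat" where "per v = vertex_mult \<Gamma> v * val v"

lemma edge_cases:
  assumes "j \<in> edges \<Gamma>" "u \<in> j"
  obtains w where "w \<noteq> u" "j = {u, w}" "u \<in> vertices \<Gamma>" "w \<in> vertices \<Gamma>"
proof -
  obtain v x where v: "v \<in> vertices \<Gamma>" "x \<in> vertices \<Gamma>" "v \<noteq> x" "j = {v, x}"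
    using edge_ends[OF assms(1)] by blast
  then consider "u = v" | "u = x" using assms(2) by blast
  then show thesis
  proof cases
    case 1
    then show ?thesis using v by (intro that[of x]) auto
  next
    case 2
    then show ?thesis using v by (intro that[of v]) auto
  qed
qed

lemma edge_eqI: "i \<in> edges \<Gamma> \<Longrightarrow> j \<in> edges \<Gamma> \<Longrightarrow> u \<in> i \<Longrightarrow> w \<in> i \<Longrightarrow> u \<in> j \<Longrightarrow> w \<in> j \<Longrightarrow> u \<noteq> w \<Longrightarrow> i = j"
  using edge_ends[of i] edge_ends[of j] by fastforce

lemma edge_vertex: "j \<in> edges \<Gamma> \<Longrightarrow> u \<in> j \<Longrightarrow> u \<in> vertices \<Gamma>"
  using edge_ends by blast

lemma finite_edges: "finite (edges \<Gamma>)"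
  by (rule finite_subset[of _ "Pow (vertices \<Gamma>)"]) (use edge_vertex finite_vertices in auto)

lemma vertex_cyclic: "j \<in> edges \<Gamma> \<Longrightarrow> u \<in> j \<Longrightarrow> cyclic_on (nx u) (incident \<Gamma> u) \<and> j \<in> incident \<Gamma> u"
  using cyclic_ordering edge_vertex by (auto simp: incident_def)

lemma nx_incident: "j \<in> edges \<Gamma> \<Longrightarrow> u \<in> j \<Longrightarrow> (nx u ^^ k) j \<in> edges \<Gamma> \<and> u \<in> (nx u ^^ k) j"
  using cyclic_on_funpow_in[of "nx u" "incident \<Gamma> u" j k] vertex_cyclic[of j u] by (auto simp: incident_def)

lemma nx_in: "j \<in> edges \<Gamma> \<Longrightarrow> u \<in> j \<Longrightarrow> nx u j \<in> edges \<Gamma>" "j \<in> edges \<Gamma> \<Longrightarrow> u \<in> j \<Longrightarrow> u \<in> nx u j"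
  using nx_incident[of j u 1] by auto

lemma val_pos: "j \<in> edges \<Gamma> \<Longrightarrow> u \<in> j \<Longrightarrow> 0 < val u"
  using cyclic_on_period(2)[of "nx u" "incident \<Gamma> u" j] vertex_cyclic[of j u] by (simp add: val_def)

lemma nx_val: "j \<in> edges \<Gamma> \<Longrightarrow> u \<in> j \<Longrightarrow> (nx u ^^ val u) j = j"
  using cyclic_on_period(1)[of "nx u" "incident \<Gamma> u" j] vertex_cyclic[of j u] by (simp add: val_def)

lemma nx_less_val: "j \<in> edges \<Gamma> \<Longrightarrow> u \<in> j \<Longrightarrow> 0 < k \<Longrightarrow> k < val u \<Longrightarrow> (nx u ^^ k) j \<noteq> j"
  using cyclic_on_period(3)[of "nx u" "incident \<Gamma> u" j k] vertex_cyclic[of j u] by (simp add: val_def)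

lemma mult_pos: "0 < vertex_mult \<Gamma> u"
  using multiplicity_pos by (simp add: vertex_mult_def)

lemma per_pos: "j \<in> edges \<Gamma> \<Longrightarrow> u \<in> j \<Longrightarrow> 0 < per u"
  using val_pos mult_pos by (simp add: per_def)

lemma nx_per: "j \<in> edges \<Gamma> \<Longrightarrow> u \<in> j \<Longrightarrow> (nx u ^^ per u) j = j"
  using funpow_mod_eq[OF nx_val, of j u "per u"] by (simp add: per_def)

lemma mult_unique: "1 < vertex_mult \<Gamma> u \<Longrightarrow> 1 < vertex_mult \<Gamma> w \<Longrightarrow> u = w"
  by (auto simp: vertex_mult_def split: if_splits)

lemma val_less_per: "val u < per u \<Longrightarrow> 1 < vertex_mult \<Gamma> u"
  using mult_pos[of u] by (cases "vertex_mult \<Gamma> u = 1") (auto simp: per_def)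

text \<open>The edges within one turn are distinct, so a return before the end of the maximal path
  needs a second turn. Applied at two different vertices this contradicts
  \<open>mult_unique\<close>.\<close>

lemma nx_fix_imp_mult:
  assumes "j \<in> edges \<Gamma>" "u \<in> j" "0 < k" "k < per u" "(nx u ^^ k) j = j"
  shows "1 < vertex_mult \<Gamma> u"
proof -
  have "\<not> k < val u" using nx_less_val assms by blast
  then show ?thesis using assms(4) val_less_per by simp
qed

lemma length_factor_edges: "length (factor_edges \<Gamma> j u) = per u - 1"
  by (simp add: factor_edges_def per_def val_def)

lemma nth_factor_edges: "k < per u - 1 \<Longrightarrow> factor_edges \<Gamma> j u ! k = (nx u ^^ Suc k) j"
  by (simp add: factor_edges_def per_def val_def)

end

section \<open>Paths around a vertex and the standard presentation\<close>

fun path :: "('v set \<Rightarrow> 'a) \<Rightarrow> ('v \<Rightarrow> 'v set \<Rightarrow> 'a) \<Rightarrow> ('v \<Rightarrow> 'v set \<Rightarrow> 'v set) \<Rightarrow> 'v \<Rightarrow> 'v set \<Rightarrow> nat \<Rightarrow> 'a::ring_1" where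
  "path e a nxt u j 0 = e j"
| "path e a nxt u j (Suc k) = a u ((nxt u ^^ k) j) * path e a nxt u j k"

text \<open>The arrow \<open>a u j\<close> leads from \<open>j\<close> to its successor around
  \<open>u\<close>. Products are read from right to left, so a path starting at \<open>j\<close>
  lies in \<open>A (e j)\<close>.\<close>

locale arrow_family = brauer_tree \<Gamma> for \<Gamma> :: "'v brauer_tree" +
  fixes e :: "'v set \<Rightarrow> 'a::ring_1" and a :: "'v \<Rightarrow> 'v set \<Rightarrow> 'a"
  assumes e_idem: "j \<in> edges \<Gamma> \<Longrightarrow> e j * e j = e j"
    and a_left: "j \<in> edges \<Gamma> \<Longrightarrow> u \<in> j \<Longrightarrow> e (next_edge \<Gamma> u j) * a u j = a u j"
    and a_right: "j \<in> edges \<Gamma> \<Longrightarrow> u \<in> j \<Longrightarrow> a u j * e j = a u j"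
begin

abbreviation b :: "'v \<Rightarrow> 'v set \<Rightarrow> nat \<Rightarrow> 'a" where "b \<equiv> path e a nx"

lemma b_left: "j \<in> edges \<Gamma> \<Longrightarrow> u \<in> j \<Longrightarrow> e ((nx u ^^ k) j) * b u j k = b u j k"
  using a_left[of "(nx u ^^ (k - 1)) j" u] nx_incident[of j u "k - 1"] e_idem[of j]
  by (cases k) (simp_all flip: mult.assoc)

lemma b_right: "j \<in> edges \<Gamma> \<Longrightarrow> u \<in> j \<Longrightarrow> b u j k * e j = b u j k"
  using e_idem[of j] by (induction k) (simp_all add: mult.assoc)

lemma b_Suc_right:
  assumes j: "j \<in> edges \<Gamma>" "u \<in> j"
  shows "b u j (Suc k) = b u (nx u j) k * a u j"
proof (induction k)
  case 0
  then show ?case using a_left[OF j] a_right[OF j] by simp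
next
  case (Suc k)
  have "b u j (Suc (Suc k)) = a u ((nx u ^^ Suc k) j) * (b u (nx u j) k * a u j)" using Suc by simp
  also have "(nx u ^^ Suc k) j = (nx u ^^ k) (nx u j)" by (simp only: funpow_Suc_right comp_apply)
  finally show ?case by (simp add: mult.assoc)
qed

end

text \<open>Every pair of an edge and one of its ends carries an arrow, also where
  \<open>per u = 1\<close>. There the arrow is itself the maximal path, so the relation
  \<open>path_top\<close> has one form at all vertices.\<close>

locale brauer_system = arrow_family \<Gamma> e a + fd_algebra scale
  for \<Gamma> :: "'v brauer_tree" and scale :: "'k::field \<Rightarrow> 'a::ring_1 \<Rightarrow> 'a"
    and e :: "'v set \<Rightarrow> 'a" and a :: "'v \<Rightarrow> 'v set \<Rightarrow> 'a" +
  assumes e_orth: "i \<in> edges \<Gamma> \<Longrightarrow> j \<in> edges \<Gamma> \<Longrightarrow> e i * e j = (if i = j then e i else 0)"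
    and e_one: "(\<Sum>j\<in>edges \<Gamma>. e j) = 1"
    and a_zero: "j \<in> edges \<Gamma> \<Longrightarrow> u \<in> j \<Longrightarrow> w \<in> next_edge \<Gamma> u j \<Longrightarrow> w \<noteq> u \<Longrightarrow> a w (next_edge \<Gamma> u j) * a u j = 0"
    and path_top: "j \<in> edges \<Gamma> \<Longrightarrow> u \<in> j \<Longrightarrow> w \<in> j \<Longrightarrow> b u j (per u) = b w j (per w)"
    and path_top_ne: "j \<in> edges \<Gamma> \<Longrightarrow> u \<in> j \<Longrightarrow> b u j (per u) \<noteq> 0"
    and path_span: "span {b u j k | u j k. j \<in> edges \<Gamma> \<and> u \<in> j \<and> k \<le> per u} = UNIV"

section \<open>The two chains belonging to the ends of an edge\<close>

locale brauer_chains = brauer_tree \<Gamma> + sym_idem_algebra scale "edges \<Gamma>" \<chi> e t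
  for \<Gamma> :: "'v brauer_tree" and scale :: "'k::field \<Rightarrow> 'a::ring_1 \<Rightarrow> 'a" and \<chi> e t +
  fixes C :: "'v set \<Rightarrow> 'v \<Rightarrow> nat \<Rightarrow> 'a set"
  assumes soc_in_rad: "j \<in> edges \<Gamma> \<Longrightarrow> soc j \<in> rad"
    and C_chain: "j \<in> edges \<Gamma> \<Longrightarrow> u \<in> j \<Longrightarrow> chain (socle j) (C j u) (factor_edges \<Gamma> j u)"
    and C_rad: "j \<in> edges \<Gamma> \<Longrightarrow> u \<in> j \<Longrightarrow> C j u 0 \<subseteq> rad_at j"
    and C_sum: "j \<in> edges \<Gamma> \<Longrightarrow> u \<in> j \<Longrightarrow> w \<in> j \<Longrightarrow> u \<noteq> w \<Longrightarrow> x \<in> rad_at j \<Longrightarrow> \<exists>y\<in>C j u 0. \<exists>z\<in>C j w 0. x = y + z"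
begin

lemma C_sub:
  assumes "j \<in> edges \<Gamma>" "u \<in> j" "k \<le> per u - 1"
  shows "submod (C j u k) regular_module" "socle j \<subseteq> C j u k"
  using C_chain[OF assms(1,2)] assms(3) by (auto simp: chain_def length_factor_edges)

lemma C_ops:
  assumes "j \<in> edges \<Gamma>" "u \<in> j" "k \<le> per u - 1" "x \<in> C j u k" "y \<in> C j u k"
  shows "x + y \<in> C j u k" "b * x \<in> C j u k" "x - y \<in> C j u k" "scale c x \<in> C j u k"
proof -
  have s: "submod (C j u k) regular_module" by (rule C_sub[OF assms(1-3)])
  show "x + y \<in> C j u k" "b * x \<in> C j u k" using s assms unfolding submod_regular by blast+
  show "x - y \<in> C j u k" using s assms unfolding submod_regular by (metis add_uminus_conv_diff mult_minus1)
  show "scale c x \<in> C j u k" using s assms unfolding submod_regular by (metis scale_one_mult(1))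
qed

lemma C_last: "j \<in> edges \<Gamma> \<Longrightarrow> u \<in> j \<Longrightarrow> C j u (per u - 1) = socle j"
  using C_chain[of j u] by (simp add: chain_def length_factor_edges)

lemma C_step:
  assumes "j \<in> edges \<Gamma>" "u \<in> j" "k < per u - 1"
  shows "C j u (Suc k) \<subseteq> C j u k" "b \<in> rad \<Longrightarrow> y \<in> C j u k \<Longrightarrow> b * y \<in> C j u (Suc k)"
    "\<exists>x\<in>C j u k. x \<notin> C j u (Suc k) \<and> e ((nx u ^^ Suc k) j) * x = x \<and> (\<forall>y\<in>C j u k. \<exists>c. y - scale c x \<in> C j u (Suc k))"
  unfolding nth_factor_edges[OF assms(3), of j, symmetric]
  using C_chain[OF assms(1,2)] assms(3) unfolding chain_def length_factor_edges by blast+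

lemma C_uniserial:
  assumes "j \<in> edges \<Gamma>" "u \<in> j" "submod N regular_module" "submod N' regular_module" "socle j \<subseteq> N" "socle j \<subseteq> N'"
    "N \<subseteq> C j u 0" "N' \<subseteq> C j u 0"
  shows "N \<subseteq> N' \<or> N' \<subseteq> N"
  using C_chain[OF assms(1,2)] assms(3-) unfolding chain_def by simp

lemma C_mono: "j \<in> edges \<Gamma> \<Longrightarrow> u \<in> j \<Longrightarrow> k \<le> per u - 1 \<Longrightarrow> C j u k \<subseteq> C j u 0"
proof (induction k)
  case (Suc k)
  then show ?case using C_step(1)[of j u k] by simp
qed simp

text \<open>Layer \<open>k\<close> is spanned by an element fixed on the left by the idempotent of
  the (k+1)-st successor of \<open>j\<close>. If that edge is not \<open>i\<close>, multiplication
  by \<open>e i\<close> pushes \<open>y\<close> into the next layer; being outside the socle,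
  \<open>y\<close> must stop at some layer.\<close>

lemma C_support:
  assumes ju: "j \<in> edges \<Gamma>" "u \<in> j" and k: "k \<le> per u - 1" and y: "y \<in> C j u k" "y \<notin> socle j" "e i * y = y" and i: "i \<in> edges \<Gamma>"
  shows "\<exists>l. k < l \<and> l < per u \<and> i = (nx u ^^ l) j"
  using k y
proof (induction "per u - 1 - k" arbitrary: k)
  case 0
  then have "k = per u - 1" by simp
  then show ?case using 0 C_last[OF ju] by simp
next
  case (Suc n)
  then have k: "k < per u - 1" by simp
  show ?case
  proof (cases "i = (nx u ^^ Suc k) j")
    case True
    then show ?thesis using k by (intro exI[of _ "Suc k"]) auto
  next
    case False
    obtain x where x: "e ((nx u ^^ Suc k) j) * x = x" "\<And>y. y \<in> C j u k \<Longrightarrow> \<exists>c. y - scale c x \<in> C j u (Suc k)"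
      using C_step(3)[OF ju k] by blast
    obtain c where c: "y - scale c x \<in> C j u (Suc k)" using x(2) Suc.prems by blast
    have "e i * x = (e i * e ((nx u ^^ Suc k) j)) * x" using x(1) by (simp add: mult.assoc del: funpow.simps)
    also have "\<dots> = 0" using e_mult[OF i, of "(nx u ^^ Suc k) j"] nx_incident[OF ju, of "Suc k"] False by (simp del: funpow.simps)
    finally have "e i * (y - scale c x) = y" using Suc.prems by (simp add: right_diff_distrib scale_mult_right)
    moreover have "e i * (y - scale c x) \<in> C j u (Suc k)" using C_ops(2)[OF ju _ c c] k by simp
    ultimately have "y \<in> C j u (Suc k)" by simp
    moreover have "n = per u - 1 - Suc k" using Suc.hyps(2) by simp
    ultimately have "\<exists>l>Suc k. l < per u \<and> i = (nx u ^^ l) j"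
      using k Suc.prems(3,4) by (intro Suc.hyps(1)) simp_all
    then obtain l where "Suc k < l" "l < per u" "i = (nx u ^^ l) j" by blast
    then show ?thesis by (intro exI[of _ l]) simp
  qed
qed

text \<open>The layer is a line, so any element outside the next layer can replace the given
  generator.\<close>

lemma C_generator:
  assumes ju: "j \<in> edges \<Gamma>" "u \<in> j" and k: "k < per u - 1" and x: "x \<in> C j u k" "x \<notin> C j u (Suc k)" and y: "y \<in> C j u k"
  shows "\<exists>c. y - scale c x \<in> C j u (Suc k)"
proof -
  obtain z where z: "\<And>y. y \<in> C j u k \<Longrightarrow> \<exists>c. y - scale c z \<in> C j u (Suc k)" using C_step(3)[OF ju k] by blast
  obtain c d where c: "x - scale c z \<in> C j u (Suc k)" and d: "y - scale d z \<in> C j u (Suc k)" using z x(1) y by blast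
  have k': "Suc k \<le> per u - 1" using k by simp
  have "c \<noteq> 0" using c x(2) by auto
  then have "y - scale (d / c) x = (y - scale d z) - scale (d / c) (x - scale c z)"
    by (simp add: scale_right_diff_distrib)
  then show ?thesis using C_ops(3)[OF ju k' d C_ops(4)[OF ju k' c c]] by metis
qed

text \<open>Otherwise \<open>i\<close> would occur around both ends, hence contain both vertices and
  equal \<open>j\<close>. Then \<open>j\<close> recurs around \<open>u\<close> and around
  \<open>w\<close> before the end of the maximal path, and both would have multiplicity above
  1.\<close>

lemma C_disjoint_support:
  assumes j: "j \<in> edges \<Gamma>" "u \<in> j" "w \<in> j" "u \<noteq> w" and i: "i \<in> edges \<Gamma>"
    and x: "x \<in> C j u 0" "x \<notin> socle j" "e i * x = x" and y: "y \<in> C j w 0" "e i * y = y"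
  shows "y \<in> socle j"
proof (rule ccontr)
  assume n: "y \<notin> socle j"
  obtain k where k: "0 < k" "k < per u" "i = (nx u ^^ k) j" using C_support[OF j(1,2) _ x i] by auto
  obtain l where l: "0 < l" "l < per w" "i = (nx w ^^ l) j" using C_support[OF j(1,3) _ y(1) n y(2) i] by auto
  have "u \<in> i" "w \<in> i" using nx_incident[OF j(1,2)] nx_incident[OF j(1,3)] k l by auto
  then have "i = j" using edge_eqI i j by blast
  then have "1 < vertex_mult \<Gamma> u" "1 < vertex_mult \<Gamma> w" using nx_fix_imp_mult j k l by metis+
  then show False using mult_unique j(4) by blast
qed

text \<open>In y = p + q along the two chains, \<open>e i * q\<close> falls into the socle by
  \<open>C_disjoint_support\<close>, so \<open>y\<close> stays in the chain at \<open>u\<close>.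
  This locates homogeneous components although the chains are not known to be homogeneous.\<close>

lemma rad_at_support:
  assumes j: "j \<in> edges \<Gamma>" "u \<in> j" and i: "i \<in> edges \<Gamma>" and x: "x \<in> C j u 0" "x \<notin> socle j" "e i * x = x"
    and y: "y \<in> rad_at j" "e i * y = y"
  shows "y \<in> C j u 0"
proof -
  obtain w where w: "w \<noteq> u" "j = {u, w}" using edge_cases[OF j] by metis
  have wj: "w \<in> j" using w by simp
  obtain p q where pq: "p \<in> C j u 0" "q \<in> C j w 0" "y = p + q" using C_sum[OF j wj w(1)[symmetric] y(1)] by blast
  have q: "e i * q \<in> C j w 0" "e i * (e i * q) = e i * q"
    using C_ops(2)[OF j(1) wj _ pq(2) pq(2)] e_mult[OF i i] by (simp_all flip: mult.assoc)
  have "e i * q \<in> socle j" by (rule C_disjoint_support[OF j wj w(1)[symmetric] i x q])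
  then have "e i * q \<in> C j u 0" using C_sub(2)[OF j, of 0] by auto
  moreover have "e i * p \<in> C j u 0" using C_ops(2)[OF j _ pq(1) pq(1)] by simp
  ultimately have "e i * p + e i * q \<in> C j u 0" using C_ops(1)[OF j, of 0] by simp
  then show ?thesis using y(2) pq(3) by (simp add: distrib_left)
qed

end


section \<open>Arrows and paths\<close>

context brauer_chains
begin

text \<open>A generator of the top layer of the chain at \<open>u\<close>. If
  \<open>per u = 1\<close> that chain is only the socle, and the socle element takes the role of the
  arrow.\<close>

definition arrow :: "'v \<Rightarrow> 'v set \<Rightarrow> 'a \<Rightarrow> bool" where
  "arrow u j x \<longleftrightarrow> x \<in> rad \<and> e (nx u j) * x = x \<and> x * e j = x \<and>
     (if per u = 1 then x = soc j else x \<in> C j u 0 \<and> x \<notin> C j u 1)"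

lemma nx_per_1: "j \<in> edges \<Gamma> \<Longrightarrow> u \<in> j \<Longrightarrow> per u = 1 \<Longrightarrow> nx u j = j"
  using nx_per[of j u] by simp

text \<open>The radical is homogeneous, so it kills every homogeneous component of
  \<open>soc j\<close>; by \<open>soc_unique\<close> a nonzero component is then a multiple of
  \<open>soc j\<close>.\<close>

lemma soc_homogeneous:
  assumes "graded_algebra scale G" and e0: "\<And>i. i \<in> edges \<Gamma> \<Longrightarrow> e i \<in> G 0" and j: "j \<in> edges \<Gamma>"
  shows "\<exists>d. soc j \<in> G d"
proof -
  interpret G: graded_algebra scale G by fact
  have "\<exists>d. G.hcomp (soc j) d \<noteq> 0"
  proof (rule ccontr)
    assume "\<not> ?thesis"
    then have "soc j = 0" using G.comp_sum[of "soc j"] by simp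
    then show False using soc_ne_0[OF j] by simp
  qed
  then obtain d where d: "G.hcomp (soc j) d \<noteq> 0" by blast
  have "G.hcomp (soc j) d * e j = G.hcomp (soc j) d"
    using G.comp_mult_right[OF e0[OF j], of "soc j" d] soc_e[OF j j] by simp
  moreover have "y * G.hcomp (soc j) d = 0" if y: "y \<in> rad" for y
  proof -
    have "G.hcomp y m * G.hcomp (soc j) d = 0" for m
      using G.comp_mult_left[OF G.comp_in, of y m "soc j" "d + m"] rad_soc[OF j hcomp_rad[OF assms(1) y, of m]] by simp
    then show ?thesis
      by (subst G.comp_sum[of y]) (simp add: sum_distrib_right)
  qed
  ultimately have eq: "G.hcomp (soc j) d = scale (t (G.hcomp (soc j) d)) (soc j)" by (rule soc_unique[OF j])
  define c where "c = t (G.hcomp (soc j) d)"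
  have "c \<noteq> 0" using eq d by (auto simp: c_def)
  then have "soc j = scale (inverse c) (G.hcomp (soc j) d)" using eq by (metis c_def scale_one scale_scale left_inverse)
  then have "soc j \<in> G d" using G.G_scale[OF G.comp_in[of "soc j" d], of "inverse c"] by simp
  then show ?thesis by blast
qed

text \<open>Some homogeneous component of a generator lies outside \<open>C j u 1\<close>, since
  this ideal is closed under sums. That it lies in \<open>C j u 0\<close> is due to
  \<open>rad_at_support\<close>.\<close>

lemma ex_homogeneous_arrow:
  assumes G: "graded_algebra scale G" and e0: "\<And>i. i \<in> edges \<Gamma> \<Longrightarrow> e i \<in> G 0" and j: "j \<in> edges \<Gamma>" "u \<in> j"
  shows "\<exists>x d. arrow u j x \<and> x \<in> G d"
proof (cases "per u = 1")
  case True
  then have "arrow u j (soc j)" using nx_per_1[OF j] e_soc[OF j(1) j(1)] soc_e[OF j(1) j(1)] soc_in_rad[OF j(1)] by (simp add: arrow_def)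
  then show ?thesis using soc_homogeneous[OF G e0 j(1)] by blast
next
  case False
  interpret G: graded_algebra scale G by fact
  have k: "0 < per u - 1" using False per_pos[OF j] by simp
  then have k1: "1 \<le> per u - 1" by simp
  let ?i = "nx u j"
  have i: "?i \<in> edges \<Gamma>" by (rule nx_in(1)[OF j])
  obtain x where x: "x \<in> C j u 0" "x \<notin> C j u 1" "e ?i * x = x" using C_step(3)[OF j k] by auto
  have xr: "x \<in> rad_at j" using x(1) C_rad[OF j] by blast
  have xs: "x \<notin> socle j" using C_sub(2)[OF j k1] x(2) by blast
  have "\<exists>d. G.hcomp x d \<notin> C j u 1"
  proof (rule ccontr)
    assume "\<not> ?thesis"
    then have h: "G.hcomp x d \<in> C j u 1" for d by blast
    have "(\<Sum>d\<in>S. G.hcomp x d) \<in> C j u 1" for S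
    proof (induction S rule: infinite_finite_induct)
      case (insert y F)
      then show ?case using C_ops(1)[OF j k1 h[of y] insert.IH] by simp
    qed (use C_sub(1)[OF j k1] in \<open>auto simp: submod_regular\<close>)
    then show False using x(2) G.comp_sum[of x] by metis
  qed
  then obtain d where d: "G.hcomp x d \<notin> C j u 1" by blast
  let ?y = "G.hcomp x d"
  have y: "e ?i * ?y = ?y" "?y * e j = ?y"
    using G.comp_mult_left[OF e0[OF i], of x d] G.comp_mult_right[OF e0[OF j(1)], of x d] x(3) xr by (auto simp: rad_at_def)
  have yr: "?y \<in> rad" using hcomp_rad[OF G, of x d] xr by (simp add: rad_at_def)
  then have "?y \<in> C j u 0" using rad_at_support[OF j i x(1) xs x(3)] y by (simp add: rad_at_def)
  then have "arrow u j ?y" using y yr d False by (simp add: arrow_def)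
  then show ?thesis using G.comp_in by blast
qed

end

section \<open>Relations between the chosen arrows\<close>

locale brauer_arrows = brauer_chains \<Gamma> scale \<chi> e t C
  for \<Gamma> :: "'v brauer_tree" and scale :: "'k::field \<Rightarrow> 'a::ring_1 \<Rightarrow> 'a" and \<chi> e t C +
  fixes a
  assumes arrow_a: "j \<in> edges \<Gamma> \<Longrightarrow> u \<in> j \<Longrightarrow> arrow u j (a u j)"
begin

lemma a_props:
  assumes "j \<in> edges \<Gamma>" "u \<in> j"
  shows "a u j \<in> rad" "e (nx u j) * a u j = a u j" "a u j * e j = a u j" "per u = 1 \<Longrightarrow> a u j = soc j"
    "per u \<noteq> 1 \<Longrightarrow> a u j \<in> C j u 0" "per u \<noteq> 1 \<Longrightarrow> a u j \<notin> C j u 1"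
  using arrow_a[OF assms] by (auto simp: arrow_def)

sublocale arrow_family \<Gamma> e a
  by unfold_locales (use e_mult a_props in auto)

lemma b_rad: "j \<in> edges \<Gamma> \<Longrightarrow> u \<in> j \<Longrightarrow> b u j (Suc k) \<in> rad"
  using a_props(1) nx_incident rad_mult(2) by simp

text \<open>A nonzero product ends at an edge \<open>?h\<close> through \<open>w\<close>. Outside
  the socle, \<open>?h\<close> also occurs around \<open>u\<close>, so it contains \<open>u\<close>
  and \<open>w\<close> and equals the middle edge, which then recurs around both. Inside the socle,
  \<open>?h\<close> is \<open>j\<close>, which contains both vertices too, and all three edges
  coincide. Either way both vertices would have multiplicity above 1.\<close>

lemma a_zero:
  assumes j: "j \<in> edges \<Gamma>" "u \<in> j" and w: "w \<in> nx u j" "w \<noteq> u"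
  shows "a w (nx u j) * a u j = 0"
proof (rule ccontr)
  assume nz: "\<not> ?thesis"
  let ?i = "nx u j" and ?z = "a w (nx u j) * a u j"
  let ?h = "nx w (nx u j)"
  have i: "?i \<in> edges \<Gamma>" "u \<in> ?i" using nx_in[OF j] by auto
  have h: "?h \<in> edges \<Gamma>" "w \<in> ?h" using nx_in[OF i(1) w(1)] by auto
  note au = a_props[OF j] and aw = a_props[OF i(1) w(1)]
  \<comment> \<open>An arrow with \<open>per\<close> equal to 1 is a socle element, which the
    radical annihilates from either side.\<close>
  have pu: "per u \<noteq> 1" using nz au(4) rad_soc[OF j(1) aw(1)] by auto
  have pw: "per w \<noteq> 1" using nz aw(4) soc_rad[OF i(1) au(1)] by auto
  have k: "0 < per u - 1" using pu per_pos[OF j] by simp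
  have zh: "e ?h * ?z = ?z" using aw(2) by (simp flip: mult.assoc)
  have zC: "?z \<in> C j u 1" using C_step(2)[OF j k aw(1) au(5)[OF pu]] by simp
  have loop_w: "1 < vertex_mult \<Gamma> w" if "?h = ?i"
    using nx_fix_imp_mult[OF i(1) w(1), of 1] that pw per_pos[OF i(1) w(1)] by simp
  show False
  proof (cases "?z \<in> socle j")
    case False
    obtain l where l: "1 < l" "l < per u" "?h = (nx u ^^ l) j"
    proof -
      have "1 \<le> per u - 1" using k by simp
      from C_support[OF j this zC False zh h(1)] show thesis using that by blast
    qed
    have "u \<in> ?h" using nx_incident[OF j, of l] l(3) by simp
    then have hi: "?h = ?i" using edge_eqI[OF h(1) i(1) _ h(2) i(2) w(1)] w(2) by auto
    obtain m where m: "l = Suc m" using l(1) by (cases l) auto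
    have "(nx u ^^ m) ?i = (nx u ^^ l) j" by (simp only: m funpow_Suc_right comp_apply)
    then have "(nx u ^^ m) ?i = ?i" using l(3) hi by simp
    then have "1 < vertex_mult \<Gamma> u" using nx_fix_imp_mult[OF i, of m] l m by simp
    then show False using mult_unique loop_w[OF hi] w(2) by blast
  next
    case True
    then obtain c where c: "?z = scale c (soc j)" by (auto simp: socle_def)
    have "e ?h * soc j \<noteq> 0" using zh c nz by (auto simp: scale_mult_right)
    then have hj: "?h = j" using e_soc[OF j(1) h(1)] by (auto split: if_splits)
    then have "w \<in> j" using h(2) by simp
    then have ji: "j = ?i" using edge_eqI[OF j(1) i(1) j(2) _ i(2) w(1)] w(2) by auto
    have "1 < vertex_mult \<Gamma> u" using nx_fix_imp_mult[OF j, of 1] ji pu per_pos[OF j] by simp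
    moreover have "?h = ?i" using hj ji by simp
    ultimately show False using mult_unique loop_w w(2) by blast
  qed
qed

text \<open>By uniseriality the left ideal generated by the arrow and the socle is comparable with
  \<open>C j u 1\<close>. It contains the arrow, which is outside \<open>C j u 1\<close>, so it
  contains \<open>C j u 1\<close> and then all of \<open>C j u 0\<close>.\<close>

lemma C_subset_gen:
  assumes j: "j \<in> edges \<Gamma>" "u \<in> j" and y: "y \<in> C j u 0"
  shows "\<exists>p c. y = p * a u j + scale c (soc j)"
proof (cases "per u = 1")
  case True
  then have "y \<in> socle j" using C_last[OF j] y by simp
  then obtain c where "y = scale c (soc j)" by (auto simp: socle_def)
  then show ?thesis by (intro exI[of _ 0] exI[of _ c]) simp
next
  case False
  then have k: "0 < per u - 1" "1 \<le> per u - 1" using per_pos[OF j] by simp_all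
  note au = a_props(5,6)[OF j False]
  let ?N = "{p * a u j + z | p z. z \<in> socle j}"
  have sm: "0 \<in> socle j" "\<And>x y. x \<in> socle j \<Longrightarrow> y \<in> socle j \<Longrightarrow> x + y \<in> socle j" "\<And>x y. y \<in> socle j \<Longrightarrow> x * y \<in> socle j"
    using socle_submod[OF j(1)] by (auto simp: submod_regular)
  have N: "submod ?N regular_module"
    unfolding submod_regular
  proof (intro conjI ballI allI)
    show "0 \<in> ?N" using sm(1) by (intro CollectI exI[of _ 0]) simp
    fix x assume "x \<in> ?N"
    then obtain p z where x: "x = p * a u j + z" "z \<in> socle j" by blast
    show "r * x \<in> ?N" for r
      using x sm(3)[of z r] by (intro CollectI exI[of _ "r * p"] exI[of _ "r * z"]) (simp add: distrib_left mult.assoc)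
    fix y assume "y \<in> ?N"
    then obtain q v where y: "y = q * a u j + v" "v \<in> socle j" by blast
    show "x + y \<in> ?N"
      using x y sm(2)[of z v] by (intro CollectI exI[of _ "p + q"] exI[of _ "z + v"]) (simp add: distrib_right)
  qed
  have sN: "socle j \<subseteq> ?N"
  proof
    fix x assume "x \<in> socle j"
    then show "x \<in> ?N" by (intro CollectI exI[of _ 0] exI[of _ x]) simp
  qed
  have NC: "?N \<subseteq> C j u 0"
    using C_ops(1,2)[OF j, of 0] au(1) C_sub(2)[OF j, of 0] by auto
  have aN: "a u j \<in> ?N" using sm(1) by (intro CollectI exI[of _ 1] exI[of _ 0]) simp
  have "?N \<subseteq> C j u 1 \<or> C j u 1 \<subseteq> ?N"
    by (rule C_uniserial[OF j N C_sub(1)[OF j k(2)] sN C_sub(2)[OF j k(2)] NC C_mono[OF j k(2)]])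
  then have "C j u 1 \<subseteq> ?N" using aN au(2) by blast
  moreover obtain c where "y - scale c (a u j) \<in> C j u 1" using C_generator[OF j k(1) au(1) _ y] au(2) by auto
  ultimately obtain p z where pz: "y - scale c (a u j) = p * a u j + z" "z \<in> socle j" by blast
  then obtain d where "z = scale d (soc j)" by (auto simp: socle_def)
  then have "y = (scale c 1 + p) * a u j + scale d (soc j)" using pz(1) by (simp add: distrib_right scale_one_mult algebra_simps)
  then show ?thesis by blast
qed

lemma rad_gen:
  assumes j: "j \<in> edges \<Gamma>" "u \<in> j" "w \<in> j" "u \<noteq> w" and y: "y \<in> rad"
  shows "\<exists>p q c. y * e j = p * a u j + q * a w j + scale c (soc j)"
proof -
  have "y * e j \<in> rad_at j" using rad_mult(2)[OF y] e_mult[OF j(1) j(1)] by (simp add: rad_at_def mult.assoc)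
  then obtain v x where "v \<in> C j u 0" "x \<in> C j w 0" "y * e j = v + x" using C_sum[OF j] by blast
  moreover then obtain p c q d where "v = p * a u j + scale c (soc j)" "x = q * a w j + scale d (soc j)"
    using C_subset_gen j by meson
  ultimately have "y * e j = p * a u j + q * a w j + scale (c + d) (soc j)"
    by (simp add: scale_left_distrib algebra_simps)
  then show ?thesis by blast
qed

text \<open>At the edge where the path ends, a radical element is a combination of the two arrows
  starting there and the socle element. Continuing around the other vertex gives 0 by
  \<open>a_zero\<close>, and the socle element kills the path.\<close>

lemma rad_mult_b:
  assumes j: "j \<in> edges \<Gamma>" "u \<in> j" and y: "y \<in> rad"
  shows "\<exists>p. y * b u j (Suc k) = p * b u j (Suc (Suc k))"
proof -
  let ?h = "(nx u ^^ k) j" and ?i = "(nx u ^^ Suc k) j"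
  have i: "?i \<in> edges \<Gamma>" "u \<in> ?i" and h: "?h \<in> edges \<Gamma>" "u \<in> ?h"
    using nx_incident[OF j, of k] nx_incident[OF j, of "Suc k"] by blast+
  obtain w where w: "w \<noteq> u" "?i = {u, w}" using edge_cases[OF i] by metis
  have wi: "w \<in> ?i" using w by simp
  obtain p q c where pq: "y * e ?i = p * a u ?i + q * a w ?i + scale c (soc ?i)"
    using rad_gen[OF i wi w(1)[symmetric] y] by blast
  have "y * b u j (Suc k) = (y * e ?i) * b u j (Suc k)" using b_left[OF j, of "Suc k"] by (simp only: mult.assoc)
  also have "\<dots> = p * (a u ?i * b u j (Suc k)) + q * ((a w ?i * a u ?h) * b u j k) + scale c (soc ?i * b u j (Suc k))"
    unfolding pq by (simp add: distrib_right mult.assoc scale_mult_left)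
  also have "a w ?i * a u ?h = 0" using a_zero[OF h, of w] wi w(1) by simp
  also have "soc ?i * b u j (Suc k) = 0" by (rule soc_rad[OF i(1) b_rad[OF j]])
  finally have "y * b u j (Suc k) = p * b u j (Suc (Suc k))" by simp
  then show ?thesis by blast
qed

text \<open>On \<open>x\<close>, fixed by \<open>e i\<close>, the algebra acts by scalars up to the
  radical, and the radical sends \<open>x\<close> into \<open>C j u k\<close>.\<close>

lemma C_line_submod:
  assumes j: "j \<in> edges \<Gamma>" "u \<in> j" and k: "k \<le> per u - 1" and i: "i \<in> edges \<Gamma>" and x: "e i * x = x"
    and r: "\<And>y. y \<in> rad \<Longrightarrow> y * x \<in> C j u k"
  shows "submod {scale c x + z | c z. z \<in> C j u k} regular_module"
  unfolding submod_regular
proof (intro conjI ballI allI)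
  have z: "0 \<in> C j u k" using C_sub(1)[OF j k] by (simp add: submod_regular)
  let ?N = "{scale c x + z | c z. z \<in> C j u k}"
  show "0 \<in> ?N" using z by (intro CollectI exI[of _ 0]) simp
  fix v assume "v \<in> ?N"
  then obtain c z where v: "v = scale c x + z" "z \<in> C j u k" by blast
  show "r * v \<in> ?N" for r
  proof -
    have m: "(r * e i - scale (\<chi> i r) (e i)) * x \<in> C j u k" by (rule assms(6)[OF sub_chi_mult_e[OF i]])
    have "r * x = scale (\<chi> i r) x + (r * e i - scale (\<chi> i r) (e i)) * x"
      using x by (simp add: left_diff_distrib scale_mult_left mult.assoc)
    then have "r * v = scale (c * \<chi> i r) x + (scale c ((r * e i - scale (\<chi> i r) (e i)) * x) + r * z)"
      unfolding v by (simp add: distrib_left scale_mult_right scale_right_distrib add.assoc)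
    moreover have "scale c ((r * e i - scale (\<chi> i r) (e i)) * x) + r * z \<in> C j u k"
      by (intro C_ops(1)[OF j k] C_ops(4)[OF j k m m] C_ops(2)[OF j k v(2) v(2)])
    ultimately show ?thesis by blast
  qed
  fix w assume "w \<in> ?N"
  then obtain d z' where w: "w = scale d x + z'" "z' \<in> C j u k" by blast
  have "v + w = scale (c + d) x + (z + z')" using v w by (simp add: scale_left_distrib algebra_simps)
  then show "v + w \<in> ?N" using C_ops(1)[OF j k v(2) w(2)] by blast
qed

text \<open>Each further arrow descends exactly one layer. If it descended two, the radical would
  send the shorter path into layer k+2, so this path and a generator of layer k+1 would each span a
  left ideal over layer k+2. Uniseriality makes the two comparable, which forces the shorter path
  into layer k+1, against the induction hypothesis.\<close>

lemma b_in_C: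
  assumes j: "j \<in> edges \<Gamma>" "u \<in> j" and k: "Suc k < per u"
  shows "b u j (Suc k) \<in> C j u k \<and> b u j (Suc k) \<notin> C j u (Suc k)"
  using k
proof (induction k)
  case 0
  then have "per u \<noteq> 1" by simp
  then show ?case using a_props(3,5,6)[OF j] by simp
next
  case (Suc k)
  then have IH: "b u j (Suc k) \<in> C j u k" "b u j (Suc k) \<notin> C j u (Suc k)" by auto
  let ?i = "(nx u ^^ Suc k) j" and ?x = "b u j (Suc k)"
  have i: "?i \<in> edges \<Gamma>" "u \<in> ?i" using nx_incident[OF j, of "Suc k"] by auto
  have k: "k < per u - 1" "Suc k < per u - 1" "Suc (Suc k) \<le> per u - 1" "Suc k \<le> per u - 1" using Suc.prems by auto
  have mem: "b u j (Suc (Suc k)) \<in> C j u (Suc k)"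
    using C_step(2)[OF j k(1) a_props(1)[OF i] IH(1)] by simp
  moreover have "b u j (Suc (Suc k)) \<notin> C j u (Suc (Suc k))"
  proof
    assume bad: "b u j (Suc (Suc k)) \<in> C j u (Suc (Suc k))"
    have r: "y * ?x \<in> C j u (Suc (Suc k))" if y: "y \<in> rad" for y
      using rad_mult_b[OF j y, of k] C_ops(2)[OF j k(3) bad bad] by metis
    obtain x' where x': "x' \<in> C j u (Suc k)" "x' \<notin> C j u (Suc (Suc k))" "e ((nx u ^^ Suc (Suc k)) j) * x' = x'"
      using C_step(3)[OF j k(2)] by blast
    have r': "y * x' \<in> C j u (Suc (Suc k))" if y: "y \<in> rad" for y by (rule C_step(2)[OF j k(2) y x'(1)])
    have i': "(nx u ^^ Suc (Suc k)) j \<in> edges \<Gamma>" using nx_incident[OF j, of "Suc (Suc k)"] by blast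
    let ?N = "{scale c ?x + z | c z. z \<in> C j u (Suc (Suc k))}" and ?N' = "{scale c x' + z | c z. z \<in> C j u (Suc (Suc k))}"
    have N: "submod ?N regular_module" by (rule C_line_submod[OF j k(3) i(1) b_left[OF j] r])
    have N': "submod ?N' regular_module" by (rule C_line_submod[OF j k(3) i' x'(3) r'])
    have CN': "C j u (Suc (Suc k)) \<subseteq> {scale c v + z | c z. z \<in> C j u (Suc (Suc k))}" for v
    proof
      fix x assume "x \<in> C j u (Suc (Suc k))"
      then show "x \<in> {scale c v + z | c z. z \<in> C j u (Suc (Suc k))}" by (intro CollectI exI[of _ 0] exI[of _ x]) simp
    qed
    note CN = CN'[of ?x] CN'[of x']
    have mono: "C j u (Suc (Suc k)) \<subseteq> C j u (Suc k)" "C j u (Suc k) \<subseteq> C j u k" using C_step(1)[OF j] k by auto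
    have "?N \<subseteq> C j u k" using C_ops(1)[OF j, of k] C_ops(4)[OF j _ IH(1) IH(1)] mono k by auto
    moreover have N'k: "?N' \<subseteq> C j u (Suc k)" using C_ops(1)[OF j k(4)] C_ops(4)[OF j k(4) x'(1) x'(1)] mono by auto
    ultimately have N0: "?N \<subseteq> C j u 0" "?N' \<subseteq> C j u 0" using C_mono[OF j, of k] C_mono[OF j k(4)] k by auto
    have s: "socle j \<subseteq> ?N" "socle j \<subseteq> ?N'" using CN C_sub(2)[OF j k(3)] by blast+
    have z: "0 \<in> C j u (Suc (Suc k))" using C_sub(1)[OF j k(3)] by (simp add: submod_regular)
    have xN: "?x \<in> ?N" "x' \<in> ?N'" using z by (intro CollectI exI[of _ 1] exI[of _ 0], simp)+
    consider "?N \<subseteq> ?N'" | "?N' \<subseteq> ?N" using C_uniserial[OF j N N' s N0] by blast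
    then show False
    proof cases
      case 1
      then show False using xN(1) N'k IH(2) by blast
    next
      case 2
      then obtain c y where c: "x' = scale c ?x + y" "y \<in> C j u (Suc (Suc k))" using xN(2) by blast
      have "c \<noteq> 0" using c x'(2) by auto
      then have "?x = scale (inverse c) (x' - y)" using c(1) by simp
      moreover have "scale (inverse c) (x' - y) \<in> C j u (Suc k)"
        using c(2) mono x'(1) by (intro C_ops(4)[OF j k(4)] C_ops(3)[OF j k(4)]) auto
      ultimately show False using IH(2) by simp
    qed
  qed
  ultimately show ?case by blast
qed

text \<open>The path one arrow shorter lies outside the socle, so by \<open>soc_unique\<close> some
  radical element does not annihilate it. By \<open>rad_mult_b\<close> this product is a multiple of
  the maximal path, which is therefore nonzero.\<close>

lemma b_per:
  assumes j: "j \<in> edges \<Gamma>" "u \<in> j"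
  shows "\<exists>c. c \<noteq> 0 \<and> b u j (per u) = scale c (soc j)"
proof (cases "per u = 1")
  case True
  then have "b u j (per u) = scale 1 (soc j)" using a_props(4)[OF j True] soc_e[OF j(1) j(1)] by simp
  then show ?thesis by (intro exI[of _ 1]) simp
next
  case False
  then obtain m where m: "per u = Suc (Suc m)" using per_pos[OF j] by (metis One_nat_def not0_implies_Suc less_irrefl)
  have B: "b u j (Suc m) \<in> C j u m" "b u j (Suc m) \<notin> C j u (Suc m)" using b_in_C[OF j, of m] m by auto
  have ns: "b u j (Suc m) \<notin> socle j" using B(2) C_last[OF j] m by simp
  have "\<exists>y\<in>rad. y * b u j (Suc m) \<noteq> 0"
  proof (rule ccontr)
    assume "\<not> ?thesis"
    then have "b u j (Suc m) = scale (t (b u j (Suc m))) (soc j)" by (intro soc_unique[OF j(1) b_right[OF j]]) blast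
    then show False using ns unfolding socle_def by blast
  qed
  then obtain y where y: "y \<in> rad" "y * b u j (Suc m) \<noteq> 0" by blast
  have ne: "b u j (per u) \<noteq> 0" using rad_mult_b[OF j y(1), of m] y(2) m by auto
  have i: "(nx u ^^ Suc m) j \<in> edges \<Gamma>" "u \<in> (nx u ^^ Suc m) j" using nx_incident[OF j, of "Suc m"] by auto
  have "a u ((nx u ^^ Suc m) j) * b u j (Suc m) \<in> C j u (Suc m)" using C_step(2)[OF j _ a_props(1)[OF i] B(1)] m by simp
  then have "b u j (per u) \<in> socle j" using C_last[OF j] m by simp
  then obtain c where "b u j (per u) = scale c (soc j)" by (auto simp: socle_def)
  then show ?thesis using ne by (intro exI[of _ c]) auto
qed

text \<open>Up to a multiple of \<open>e j\<close>, the element \<open>x * e j\<close> lies in the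
  radical and splits along the two chains. Each layer is spanned modulo the next by a path, and the
  socle by a maximal one.\<close>

lemma b_span: "span {b u j k | u j k. j \<in> edges \<Gamma> \<and> u \<in> j \<and> k \<le> per u} = UNIV"
proof -
  let ?B = "{b u j k | u j k. j \<in> edges \<Gamma> \<and> u \<in> j \<and> k \<le> per u}"
  have base: "b u j k \<in> span ?B" if "j \<in> edges \<Gamma>" "u \<in> j" "k \<le> per u" for u j k
    using that by (intro span_base) blast
  have ex_u: "\<exists>u. u \<in> j" if "j \<in> edges \<Gamma>" for j using edge_ends[OF that] by blast
  have soc_span: "scale c (soc j) \<in> span ?B" if j: "j \<in> edges \<Gamma>" for c j
  proof -
    obtain u where u: "u \<in> j" using ex_u[OF j] by blast
    obtain d where d: "d \<noteq> 0" "b u j (per u) = scale d (soc j)" using b_per[OF j u] by blast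
    have eq: "scale c (soc j) = scale (c / d) (b u j (per u))" using d by simp
    show ?thesis unfolding eq by (rule span_scale[OF base[OF j u order_refl]])
  qed
  have C_span: "y \<in> span ?B" if j: "j \<in> edges \<Gamma>" "u \<in> j" and k: "k \<le> per u - 1" and y: "y \<in> C j u k" for j u k y
    using k y
  proof (induction "per u - 1 - k" arbitrary: k y)
    case 0
    then have "k = per u - 1" by simp
    then have "y \<in> socle j" using 0 C_last[OF j] by simp
    then show ?case using soc_span[OF j(1)] by (auto simp: socle_def)
  next
    case (Suc n)
    then have k: "k < per u - 1" by simp
    then have k': "Suc k < per u" "Suc k \<le> per u - 1" "n = per u - 1 - Suc k" using Suc.hyps(2) by auto
    have B: "b u j (Suc k) \<in> C j u k" "b u j (Suc k) \<notin> C j u (Suc k)" using b_in_C[OF j k'(1)] by auto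
    obtain c where "y - scale c (b u j (Suc k)) \<in> C j u (Suc k)" using C_generator[OF j k B Suc.prems(2)] by blast
    then have "y - scale c (b u j (Suc k)) \<in> span ?B" by (intro Suc.hyps(1)[OF k'(3) k'(2)])
    moreover have "scale c (b u j (Suc k)) \<in> span ?B" using k' by (intro span_scale base j) simp
    ultimately have "(y - scale c (b u j (Suc k))) + scale c (b u j (Suc k)) \<in> span ?B" by (rule span_add)
    then show ?case by simp
  qed
  have "x * e j \<in> span ?B" if j: "j \<in> edges \<Gamma>" for x j
  proof -
    obtain u where u: "u \<in> j" using ex_u[OF j] by blast
    obtain w where w: "w \<noteq> u" "j = {u, w}" using edge_cases[OF j u] by metis
    then have wj: "w \<in> j" by simp
    have "x * e j - scale (\<chi> j x) (e j) \<in> rad_at j"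
      using sub_chi_mult_e[OF j, of x] e_mult[OF j j] by (simp add: rad_at_def left_diff_distrib scale_mult_left mult.assoc)
    then obtain y z where yz: "y \<in> C j u 0" "z \<in> C j w 0" "x * e j - scale (\<chi> j x) (e j) = y + z"
      using C_sum[OF j u wj w(1)[symmetric]] by blast
    have "scale (\<chi> j x) (e j) \<in> span ?B" using span_scale[OF base[OF j u, of 0]] by simp
    moreover have "y + z \<in> span ?B" using C_span[OF j u _ yz(1)] C_span[OF j wj _ yz(2)] by (simp add: span_add)
    ultimately have "scale (\<chi> j x) (e j) + (y + z) \<in> span ?B" by (rule span_add)
    then show ?thesis using yz(3) by (simp add: algebra_simps)
  qed
  then have sm: "(\<Sum>j\<in>edges \<Gamma>. x * e j) \<in> span ?B" for x by (intro span_sum) blast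
  have "x \<in> span ?B" for x by (subst sum_e_right[of x]) (rule sm)
  then show ?thesis by blast
qed

text \<open>Rotating a maximal path by one arrow gives the maximal path at the next edge, and a
  symmetric form does not see rotations.\<close>

lemma t_b_nx:
  assumes j: "j \<in> edges \<Gamma>" "u \<in> j"
  shows "t (b u (nx u j) (per u)) = t (b u j (per u))"
proof -
  obtain m where m: "per u = Suc m" using per_pos[OF j] by (cases "per u") auto
  have "(nx u ^^ m) (nx u j) = (nx u ^^ Suc m) j" by (simp only: funpow_Suc_right comp_apply)
  also have "\<dots> = j" using nx_per[OF j] m by simp
  finally have "b u (nx u j) (per u) = a u j * b u (nx u j) m" by (simp add: m)
  moreover have "b u j (per u) = b u (nx u j) m * a u j" using b_Suc_right[OF j, of m] m by simp
  ultimately show ?thesis using t_comm by metis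
qed

lemma t_b_const:
  assumes j: "j \<in> edges \<Gamma>" "u \<in> j" and i: "i \<in> edges \<Gamma>" "u \<in> i"
  shows "t (b u i (per u)) = t (b u j (per u))"
proof -
  have "t (b u ((nx u ^^ k) j) (per u)) = t (b u j (per u))" for k
    using t_b_nx nx_incident[OF j] by (induction k) simp_all
  moreover have "i \<in> orbit (nx u) j" using cyclic_on_orbit_eq[of "nx u" "incident \<Gamma> u" j] vertex_cyclic[OF j] vertex_cyclic[OF i] by simp
  then obtain k where "i = (nx u ^^ k) j" by (auto simp: orbit_altdef)
  ultimately show ?thesis by metis
qed

end

text \<open>By \<open>t_b_const\<close> the factor between a maximal path and the socle element
  depends on the vertex alone. Multiplying all arrows at \<open>u\<close> by a root of order
  \<open>per u\<close> of its inverse makes every maximal path equal to \<open>soc j\<close>, and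
  homogeneous arrows keep their degrees.\<close>

lemma brauer_arrows_system:
  fixes scale :: "'k::alg_closed_field \<Rightarrow> 'a::ring_1 \<Rightarrow> 'a"
  assumes "brauer_arrows \<Gamma> scale \<chi> e t C a"
  shows "\<exists>\<nu>. brauer_system \<Gamma> scale e (\<lambda>u j. scale (\<nu> u) (a u j))"
proof -
  interpret brauer_arrows \<Gamma> scale \<chi> e t C a by fact
  have "\<exists>c. c \<noteq> 0 \<and> (\<forall>j\<in>edges \<Gamma>. u \<in> j \<longrightarrow> b u j (per u) = scale c (soc j))" for u
  proof (cases "\<exists>j\<in>edges \<Gamma>. u \<in> j")
    case True
    then obtain j where j: "j \<in> edges \<Gamma>" "u \<in> j" by blast
    obtain c where c: "c \<noteq> 0" "b u j (per u) = scale c (soc j)" using b_per[OF j] by blast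
    have "b u i (per u) = scale c (soc i)" if i: "i \<in> edges \<Gamma>" "u \<in> i" for i
    proof -
      obtain d where d: "b u i (per u) = scale d (soc i)" using b_per[OF i] by blast
      then show ?thesis using t_b_const[OF j i] c d by (simp add: t_scale t_soc_1 j i)
    qed
    then show ?thesis using c by blast
  qed (auto intro: exI[of _ 1])
  then obtain c where c: "\<And>u. c u \<noteq> 0" "\<And>u j. j \<in> edges \<Gamma> \<Longrightarrow> u \<in> j \<Longrightarrow> b u j (per u) = scale (c u) (soc j)" by metis
  \<comment> \<open>Elements \<open>u\<close> of the vertex type that lie on no edge have
    \<open>per u = 0\<close>; there is no root to take.\<close>
  have "\<exists>x. 0 < per u \<longrightarrow> x ^ per u = inverse (c u)" for u using nth_root_exists[of "per u" "inverse (c u)"] by (cases "0 < per u") auto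
  then obtain \<nu> where \<nu>: "\<And>u. 0 < per u \<Longrightarrow> \<nu> u ^ per u = inverse (c u)" by metis
  let ?a = "\<lambda>u j. scale (\<nu> u) (a u j)"
  have p: "path e ?a nx u j k = scale (\<nu> u ^ k) (b u j k)" for u j k
    by (induction k) (simp_all add: scale_mult_left scale_mult_right mult.commute)
  have top: "path e ?a nx u j (per u) = soc j" if "j \<in> edges \<Gamma>" "u \<in> j" for u j
    using \<nu>[OF per_pos[OF that]] c(1)[of u] c(2)[OF that] by (simp add: p)
  have nz: "\<nu> u \<noteq> 0" if "j \<in> edges \<Gamma>" "u \<in> j" for u j
    using \<nu>[OF per_pos[OF that]] c(1)[of u] per_pos[OF that] by (auto simp: power_0_left)
  have "span {b u j k | u j k. j \<in> edges \<Gamma> \<and> u \<in> j \<and> k \<le> per u} \<subseteq> span {path e ?a nx u j k | u j k. j \<in> edges \<Gamma> \<and> u \<in> j \<and> k \<le> per u}"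
  proof (rule span_minimal, clarify)
    fix u j k assume j: "j \<in> edges \<Gamma>" "u \<in> j" and k: "k \<le> per u"
    have eq: "b u j k = scale (inverse (\<nu> u ^ k)) (path e ?a nx u j k)" using nz[OF j] by (simp add: p)
    have m: "path e ?a nx u j k \<in> span {path e ?a nx u j k | u j k. j \<in> edges \<Gamma> \<and> u \<in> j \<and> k \<le> per u}"
      using j k by (intro span_base) blast
    show "b u j k \<in> span {path e ?a nx u j k | u j k. j \<in> edges \<Gamma> \<and> u \<in> j \<and> k \<le> per u}"
      by (subst eq) (rule span_scale[OF m])
  qed simp
  then have sp: "span {path e ?a nx u j k | u j k. j \<in> edges \<Gamma> \<and> u \<in> j \<and> k \<le> per u} = UNIV" using b_span by blast
  have "brauer_system \<Gamma> scale e ?a"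
    by unfold_locales
      (use e_mult e_sum a_props a_zero top soc_ne_0 sp in \<open>simp_all add: scale_mult_left scale_mult_right\<close>)
  then show ?thesis by blast
qed


section \<open>The path basis\<close>

locale family_basis = fd_algebra scale for scale :: "'k::field \<Rightarrow> 'a::ring_1 \<Rightarrow> 'a" +
  fixes X :: "'x set" and \<beta> :: "'x \<Rightarrow> 'a"
  assumes finite_X: "finite X"
    and indep: "(\<Sum>i\<in>X. scale (c i) (\<beta> i)) = 0 \<Longrightarrow> i \<in> X \<Longrightarrow> c i = 0"
    and span_X: "span (\<beta> ` X) = UNIV"
begin

lemma ex_coord: "\<exists>c. x = (\<Sum>i\<in>X. scale (c i) (\<beta> i))"
proof -
  have "x \<in> span (\<beta> ` X)" by (simp add: span_X)
  then show ?thesis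
  proof (induction rule: span_induct_alt)
    case base
    show ?case by (intro exI[of _ "\<lambda>_. 0"]) simp
  next
    case (step d y z)
    obtain j where j: "j \<in> X" "y = \<beta> j" using step(1) by blast
    obtain c where "z = (\<Sum>i\<in>X. scale (c i) (\<beta> i))" using step(2) by blast
    moreover have "scale d y = (\<Sum>i\<in>X. scale (if i = j then d else 0) (\<beta> i))"
      using j finite_X by (simp add: if_distrib if_distribR sum.delta cong: if_cong)
    ultimately have "scale d y + z = (\<Sum>i\<in>X. scale ((if i = j then d else 0) + c i) (\<beta> i))"
      by (simp add: scale_left_distrib sum.distrib)
    then show ?case by (intro exI[of _ "\<lambda>i. (if i = j then d else 0) + c i"])
  qed
qed

definition coord :: "'a \<Rightarrow> 'x \<Rightarrow> 'k" where
  "coord x = (SOME c. x = (\<Sum>i\<in>X. scale (c i) (\<beta> i)))"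

lemma coord_sum: "x = (\<Sum>i\<in>X. scale (coord x i) (\<beta> i))"
  unfolding coord_def by (rule someI_ex[OF ex_coord])

lemma coord_unique:
  assumes x: "x = (\<Sum>i\<in>X. scale (c i) (\<beta> i))" and i: "i \<in> X"
  shows "coord x i = c i"
proof -
  have "(\<Sum>i\<in>X. scale (coord x i - c i) (\<beta> i)) = 0"
    using coord_sum[of x] x by (simp add: scale_left_diff_distrib sum_subtractf)
  from indep[OF this i] show ?thesis by simp
qed

lemma coord_add: "i \<in> X \<Longrightarrow> coord (x + y) i = coord x i + coord y i"
  using coord_sum[of x] coord_sum[of y]
  by (intro coord_unique) (simp_all add: scale_left_distrib sum.distrib)

lemma coord_scale: "i \<in> X \<Longrightarrow> coord (scale d x) i = d * coord x i"
  using arg_cong[OF coord_sum[of x], of "scale d"]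
  by (intro coord_unique) (simp_all add: scale_sum_right)

lemma coord_0: "i \<in> X \<Longrightarrow> coord 0 i = 0"
  by (rule coord_unique) simp_all

lemma coord_sum_distrib: "i \<in> X \<Longrightarrow> coord (\<Sum>s\<in>S. g s) i = (\<Sum>s\<in>S. coord (g s) i)"
  by (induction S rule: infinite_finite_induct) (simp_all add: coord_0 coord_add)

lemma coord_basis: "i \<in> X \<Longrightarrow> j \<in> X \<Longrightarrow> coord (\<beta> j) i = (if i = j then 1 else 0)"
  by (rule coord_unique) (use finite_X in \<open>simp_all add: if_distrib if_distribR sum.delta cong: if_cong\<close>)

lemma coord_eqI: "(\<And>i. i \<in> X \<Longrightarrow> coord x i = coord y i) \<Longrightarrow> x = y"
  using coord_sum[of x] coord_sum[of y] by simp

definition ext :: "('x \<Rightarrow> 'a) \<Rightarrow> 'a \<Rightarrow> 'a" where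
  "ext \<gamma> x = (\<Sum>i\<in>X. scale (coord x i) (\<gamma> i))"

lemma ext_add: "ext \<gamma> (x + y) = ext \<gamma> x + ext \<gamma> y"
  by (simp add: ext_def coord_add scale_left_distrib sum.distrib)

lemma ext_scale: "ext \<gamma> (scale d x) = scale d (ext \<gamma> x)"
  by (simp add: ext_def coord_scale scale_sum_right)

lemma ext_0: "ext \<gamma> 0 = 0"
  by (simp add: ext_def coord_0)

lemma ext_sum: "ext \<gamma> (\<Sum>s\<in>S. g s) = (\<Sum>s\<in>S. ext \<gamma> (g s))"
  by (induction S rule: infinite_finite_induct) (simp_all add: ext_0 ext_add)

lemma ext_basis: "j \<in> X \<Longrightarrow> ext \<gamma> (\<beta> j) = \<gamma> j"
  using finite_X by (simp add: ext_def coord_basis if_distrib if_distribR sum.delta cong: if_cong)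

definition homog :: "('x \<Rightarrow> int) \<Rightarrow> int \<Rightarrow> 'a set" where
  "homog deg l = {x. \<forall>i\<in>X. deg i \<noteq> l \<longrightarrow> coord x i = 0}"

lemma basis_homog: "j \<in> X \<Longrightarrow> \<beta> j \<in> homog deg (deg j)"
  by (auto simp: homog_def coord_basis)

lemma subspace_homog: "subspace (homog deg l)"
  by (auto simp: subspace_def homog_def coord_0 coord_add coord_scale)

lemma homog_0: "0 \<in> homog deg l"
  using subspace_0[OF subspace_homog] .

text \<open>Declaring basis elements homogeneous always decomposes the space; compatibility with
  products is a condition on pairs of basis elements.\<close>

lemma grading_homog:
  assumes m: "\<And>i j. i \<in> X \<Longrightarrow> j \<in> X \<Longrightarrow> \<beta> i * \<beta> j \<in> homog deg (deg i + deg j)"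
  shows "grading scale (homog deg)"
  unfolding grading_def
proof (intro conjI allI ballI)
  fix l show "subspace (homog deg l)" by (rule subspace_homog)
next
  fix x
  define f where "f l = (\<Sum>i\<in>{i\<in>X. deg i = l}. scale (coord x i) (\<beta> i))" for l
  have fc: "coord (f l) i = (if deg i = l then coord x i else 0)" if "i \<in> X" for i l
  proof -
    have "coord (f l) i = (\<Sum>k\<in>{k\<in>X. deg k = l}. if k = i then coord x i else 0)"
      unfolding f_def using that by (simp add: coord_sum_distrib coord_scale coord_basis if_distrib eq_commute cong: if_cong)
    then show ?thesis using that finite_X by (simp add: sum.delta)
  qed
  have f0: "f l = 0" if "l \<notin> deg ` X" for l
  proof -
    have "{i \<in> X. deg i = l} = {}" using that by auto
    then show ?thesis unfolding f_def by (simp only: sum.empty)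
  qed
  have fin: "finite {i. f i \<noteq> 0}" by (rule finite_subset[of _ "deg ` X"]) (use f0 finite_X in auto)
  show "\<exists>!f. (\<forall>i. f i \<in> homog deg i) \<and> finite {i. f i \<noteq> 0} \<and> x = (\<Sum>i | f i \<noteq> 0. f i)"
  proof (rule ex1I[of _ f], intro conjI allI)
    show "f i \<in> homog deg i" for i using fc by (simp add: homog_def)
    show "finite {i. f i \<noteq> 0}" by (rule fin)
    have "coord (\<Sum>i | f i \<noteq> 0. f i) k = coord x k" if k: "k \<in> X" for k
    proof -
      have "coord (\<Sum>i | f i \<noteq> 0. f i) k = (\<Sum>i | f i \<noteq> 0. if deg k = i then coord x k else 0)"
        using k by (simp add: coord_sum_distrib fc)
      also have "\<dots> = (if f (deg k) \<noteq> 0 then coord x k else 0)" using fin by (simp add: sum.delta)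
      also have "\<dots> = coord x k" using fc[OF k, of "deg k"] coord_0[OF k] by auto
      finally show ?thesis .
    qed
    then show "x = (\<Sum>i | f i \<noteq> 0. f i)" by (intro coord_eqI) simp
  next
    fix g assume g: "(\<forall>i. g i \<in> homog deg i) \<and> finite {i. g i \<noteq> 0} \<and> x = (\<Sum>i | g i \<noteq> 0. g i)"
    have xs: "x = (\<Sum>i | g i \<noteq> 0. g i)" using g by blast
    have "coord (g l) k = coord (f l) k" if k: "k \<in> X" for l k
    proof -
      have gk: "coord (g i) k = (if i = deg k then coord (g (deg k)) k else 0)" for i
        using g k by (auto simp: homog_def)
      have "coord x k = (\<Sum>i | g i \<noteq> 0. coord (g i) k)" by (subst xs) (rule coord_sum_distrib[OF k])
      also have "\<dots> = (\<Sum>i | g i \<noteq> 0. if i = deg k then coord (g (deg k)) k else 0)"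
        by (intro sum.cong refl) (rule gk)
      also have "\<dots> = (if g (deg k) \<noteq> 0 then coord (g (deg k)) k else 0)" using g by (simp add: sum.delta')
      also have "\<dots> = coord (g (deg k)) k" using coord_0[OF k] by auto
      finally have e: "coord x k = coord (g (deg k)) k" .
      show ?thesis
      proof (cases "l = deg k")
        case True
        then show ?thesis using e fc[OF k, of l] by simp
      next
        case False
        then have "coord (g l) k = 0" using g k by (auto simp: homog_def)
        then show ?thesis using False fc[OF k, of l] by simp
      qed
    qed
    then show "g = f" by (intro ext coord_eqI)
  qed
next
  fix l l' x y assume x: "x \<in> homog deg l" and y: "y \<in> homog deg l'"
  have "x * y = (\<Sum>i\<in>X. \<Sum>j\<in>X. scale (coord x i * coord y j) (\<beta> i * \<beta> j))"
    by (subst coord_sum[of x], subst coord_sum[of y])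
      (simp add: sum_product scale_mult_left scale_mult_right mult.commute)
  also have "\<dots> \<in> homog deg (l + l')"
  proof (intro subspace_sum subspace_homog)
    fix i j assume i: "i \<in> X" "j \<in> X"
    show "scale (coord x i * coord y j) (\<beta> i * \<beta> j) \<in> homog deg (l + l')"
    proof (cases "deg i = l \<and> deg j = l'")
      case True
      then show ?thesis using m[OF i] by (auto intro: subspace_scale[OF subspace_homog])
    next
      case False
      then have "coord x i * coord y j = 0" using x y i by (auto simp: homog_def)
      then have "scale (coord x i * coord y j) (\<beta> i * \<beta> j) = 0" by (simp only: scale_zero_left)
      then show ?thesis by (simp only: homog_0)
    qed
  qed
  finally show "x * y \<in> homog deg (l + l')" .
qed

end

section \<open>Degrees of paths\<close>

context brauer_tree
begin

definition pdeg :: "('v \<Rightarrow> 'v set \<Rightarrow> int) \<Rightarrow> 'v \<Rightarrow> 'v set \<Rightarrow> nat \<Rightarrow> int" where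
  "pdeg \<delta> u j k = (\<Sum>i<k. \<delta> u ((nx u ^^ i) j))"

lemma pdeg_add: "pdeg \<delta> u j (k + l) = pdeg \<delta> u ((nx u ^^ l) j) k + pdeg \<delta> u j l"
proof (induction k)
  case (Suc k)
  have "(nx u ^^ k) ((nx u ^^ l) j) = (nx u ^^ (k + l)) j" by (simp add: funpow_add)
  then show ?case using Suc by (simp add: pdeg_def)
qed (simp add: pdeg_def)

text \<open>The maximal paths at the two ends of an edge are equal in the algebra, so degrees of
  arrows coming from a grading satisfy this condition. Conversely it suffices for a grading on the
  path basis.\<close>

definition balanced :: "('v \<Rightarrow> 'v set \<Rightarrow> int) \<Rightarrow> bool" where
  "balanced \<delta> \<longleftrightarrow> (\<forall>j\<in>edges \<Gamma>. \<forall>u\<in>j. \<forall>w\<in>j. pdeg \<delta> u j (per u) = pdeg \<delta> w j (per w))"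

end

section \<open>Path basis and multiplication table\<close>

context brauer_system
begin

text \<open>Replace the maximal path around \<open>u\<close> by the one around the other end
  \<open>w\<close>. The next arrow around \<open>u\<close> then follows an arrow around
  \<open>w\<close>, and such products vanish.\<close>

lemma b_beyond:
  assumes j: "j \<in> edges \<Gamma>" "u \<in> j" and k: "per u < k"
  shows "b u j k = 0"
proof -
  obtain w where w: "w \<noteq> u" "j = {u, w}" using edge_cases[OF j] by metis
  have wj: "w \<in> j" using w by simp
  obtain m where m: "per w = Suc m" using per_pos[OF j(1) wj] by (cases "per w") auto
  let ?i = "(nx w ^^ m) j"
  have i: "?i \<in> edges \<Gamma>" "w \<in> ?i" using nx_incident[OF j(1) wj, of m] by auto
  have ij: "nx w ?i = j" using nx_per[OF j(1) wj] m by simp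
  have "b u j (Suc (per u)) = a u j * b w j (per w)" using nx_per[OF j] path_top[OF j wj] by simp
  also have "\<dots> = (a u (nx w ?i) * a w ?i) * b w j m" using m ij by (simp add: mult.assoc)
  also have "\<dots> = 0" using a_zero[OF i, of u] j(2) ij w(1) by simp
  finally have z: "b u j (Suc (per u)) = 0" .
  have "b u j (Suc (per u) + n) = 0" for n by (induction n) (use z in simp_all)
  from this[of "k - Suc (per u)"] show ?thesis using k by simp
qed

lemma b_add:
  assumes j: "j \<in> edges \<Gamma>" "u \<in> j"
  shows "b u ((nx u ^^ l) j) k * b u j l = b u j (k + l)"
proof (induction k)
  case 0
  then show ?case using b_left[OF j] by simp
next
  case (Suc k)
  have "(nx u ^^ k) ((nx u ^^ l) j) = (nx u ^^ (k + l)) j" by (simp add: funpow_add)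
  then show ?case using Suc by (simp add: mult.assoc)
qed

text \<open>The table refers to the tree alone, which makes any two Brauer systems on one tree
  comparable. Lengths are unrestricted; paths beyond the maximal length are 0 by
  \<open>b_beyond\<close>.\<close>

lemma b_mult:
  assumes j: "j \<in> edges \<Gamma>" "u \<in> j" and i: "i \<in> edges \<Gamma>" "v \<in> i"
  shows "b u j k * b v i l = (if (nx v ^^ l) i = j then if k = 0 then b v i l else if l = 0 then b u j k
    else if u = v then b u i (k + l) else 0 else 0)"
proof -
  let ?h = "(nx v ^^ l) i"
  have h: "?h \<in> edges \<Gamma>" "v \<in> ?h" using nx_incident[OF i, of l] by auto
  have *: "b u j k * b v i l = b u j k * (e j * e ?h) * b v i l"
    using b_right[OF j, of k] b_left[OF i, of l] by (metis mult.assoc)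
  show ?thesis
  proof (cases "?h = j")
    case False
    then show ?thesis using * e_orth[OF j(1) h(1)] by simp
  next
    case hj: True
    show ?thesis
    proof (cases "k = 0 \<or> l = 0 \<or> u = v")
      case True
      then show ?thesis using hj b_left[OF i, of l] b_right[OF j, of k] b_add[OF i, of l k] by auto
    next
      case False
      obtain k' l' where kl: "k = Suc k'" "l = Suc l'" using False by (metis not0_implies_Suc)
      let ?g = "(nx v ^^ l') i"
      have g: "?g \<in> edges \<Gamma>" "v \<in> ?g" using nx_incident[OF i, of l'] by auto
      have gj: "nx v ?g = j" using hj kl by simp
      have "b u j k * b v i l = b u (nx u j) k' * (a u (nx v ?g) * a v ?g) * b v i l'"
        unfolding kl b_Suc_right[OF j] using gj by (simp add: mult.assoc)
      also have "\<dots> = 0" using a_zero[OF g, of u] gj j(2) False by simp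
      finally show ?thesis using False by auto
    qed
  qed
qed

definition endp :: "'v set \<Rightarrow> 'v" where "endp j = (SOME u. u \<in> j)"

lemma endp: "j \<in> edges \<Gamma> \<Longrightarrow> endp j \<in> j"
  unfolding endp_def by (rule someI_ex) (use edge_ends in blast)

text \<open>The empty path and the maximal path at an edge are the same elements seen from either
  end, so they are listed once, at the chosen end \<open>endp j\<close>.\<close>

definition idx :: "('v \<times> 'v set \<times> nat) set" where
  "idx = {(u, j, k). j \<in> edges \<Gamma> \<and> u \<in> j \<and> k \<le> per u \<and> (k = 0 \<or> k = per u \<longrightarrow> u = endp j)}"

definition bas :: "'v \<times> 'v set \<times> nat \<Rightarrow> 'a" where
  "bas = (\<lambda>(u, j, k). b u j k)"

definition canon :: "'v \<Rightarrow> 'v set \<Rightarrow> nat \<Rightarrow> 'v \<times> 'v set \<times> nat" where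
  "canon u j k = (if k = 0 then (endp j, j, 0) else if k = per u then (endp j, j, per (endp j)) else (u, j, k))"

lemma canon:
  assumes j: "j \<in> edges \<Gamma>" "u \<in> j" and k: "k \<le> per u"
  shows "canon u j k \<in> idx" "bas (canon u j k) = b u j k"
  using assms endp[OF j(1)] path_top[OF j(1) endp[OF j(1)] j(2)] by (auto simp: canon_def idx_def bas_def)

lemma finite_idx: "finite idx"
proof (rule finite_subset)
  let ?M = "Max (per ` vertices \<Gamma>)"
  show "idx \<subseteq> vertices \<Gamma> \<times> edges \<Gamma> \<times> {..?M}"
  proof
    fix x assume "x \<in> idx"
    then obtain u j k where x: "x = (u, j, k)" "j \<in> edges \<Gamma>" "u \<in> j" "k \<le> per u" by (auto simp: idx_def)
    have u: "u \<in> vertices \<Gamma>" by (rule edge_vertex[OF x(2,3)])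
    then have "per u \<le> ?M" using finite_vertices by (intro Max_ge) auto
    then show "x \<in> vertices \<Gamma> \<times> edges \<Gamma> \<times> {..?M}" using x u by simp
  qed
  show "finite (vertices \<Gamma> \<times> edges \<Gamma> \<times> {..?M})" using finite_vertices finite_edges by simp
qed

text \<open>Multiplying a vanishing combination by the complement of a shortest non-socle path in its
  support turns that path into the socle element and kills all other terms.\<close>

lemma bas_indep:
  assumes s: "(\<Sum>x\<in>idx. scale (c x) (bas x)) = 0" and x: "x \<in> idx"
  shows "c x = 0"
proof (rule ccontr)
  assume cx: "c x \<noteq> 0"
  have key: False if x0: "x0 \<in> idx" "c x0 \<noteq> 0" and ne: "y * bas x0 * z \<noteq> 0"
    and van: "\<And>x. x \<in> idx \<Longrightarrow> c x \<noteq> 0 \<Longrightarrow> x \<noteq> x0 \<Longrightarrow> y * bas x * z = 0" for x0 y z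
  proof -
    have "0 = y * (\<Sum>x\<in>idx. scale (c x) (bas x)) * z" using s by simp
    also have "\<dots> = (\<Sum>x\<in>idx. scale (c x) (y * bas x * z))"
      by (simp add: sum_distrib_left sum_distrib_right scale_mult_left scale_mult_right)
    also have "\<dots> = (\<Sum>x\<in>idx. if x = x0 then scale (c x0) (y * bas x0 * z) else 0)"
    proof (rule sum.cong[OF refl])
      fix x assume "x \<in> idx"
      then show "scale (c x) (y * bas x * z) = (if x = x0 then scale (c x0) (y * bas x0 * z) else 0)"
        using van[of x] by (cases "x = x0"; cases "c x = 0") simp_all
    qed
    also have "\<dots> = scale (c x0) (y * bas x0 * z)" using x0(1) finite_idx by simp
    finally show False using x0(2) ne by simp
  qed
  define Q where "Q k \<longleftrightarrow> (\<exists>u j. (u, j, k) \<in> idx \<and> c (u, j, k) \<noteq> 0 \<and> k < per u)" for k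
  show False
  proof (cases "\<exists>k. Q k")
    case True
    then obtain k where k: "Q k" and min: "\<And>k'. Q k' \<Longrightarrow> k \<le> k'" using LeastI_ex[of Q] Least_le[of Q] by metis
    obtain u j where x0: "(u, j, k) \<in> idx" "c (u, j, k) \<noteq> 0" "k < per u" using k by (auto simp: Q_def)
    have j: "j \<in> edges \<Gamma>" "u \<in> j" and k0: "k = 0 \<Longrightarrow> u = endp j" using x0(1) by (auto simp: idx_def)
    let ?h = "(nx u ^^ k) j"
    have h: "?h \<in> edges \<Gamma>" "u \<in> ?h" using nx_incident[OF j, of k] by auto
    let ?y = "b u ?h (per u - k)"
    show False
    proof (rule key[OF x0(1,2), of ?y "e j"])
      have "?y * bas (u, j, k) * e j = b u j (per u)"
        using b_add[OF j, of k "per u - k"] b_right[OF j, of "per u"] x0(3) by (simp add: bas_def mult.assoc)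
      then show "?y * bas (u, j, k) * e j \<noteq> 0" using path_top_ne[OF j] by simp
    next
      fix x assume x: "x \<in> idx" "c x \<noteq> 0" "x \<noteq> (u, j, k)"
      obtain u' j' k' where x': "x = (u', j', k')" by (cases x)
      have j': "j' \<in> edges \<Gamma>" "u' \<in> j'" "k' \<le> per u'" and k0': "k' = 0 \<Longrightarrow> u' = endp j'" using x(1) x' by (auto simp: idx_def)
      have "b u' j' k' * e j = b u' j' k' * (e j' * e j)" using b_right[OF j'(1,2), of k'] by (metis mult.assoc)
      then have r: "bas x * e j = (if j' = j then b u' j' k' else 0)"
        using e_orth[OF j'(1) j(1)] b_right[OF j'(1,2), of k'] by (auto simp: bas_def x')
      show "?y * bas x * e j = 0"
      proof (cases "j' = j \<and> (nx u' ^^ k') j' = ?h \<and> (k' = 0 \<or> u = u')")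
        case False
        have "?y * b u' j' k' = 0" if jj: "j' = j"
        proof (cases "(nx u' ^^ k') j' = ?h")
          case N: False
          show ?thesis unfolding b_mult[OF h j'(1,2)] by (rule if_not_P[OF N])
        next
          case T: True
          then have "k' \<noteq> 0" "u \<noteq> u'" using False jj by simp_all
          then show ?thesis unfolding b_mult[OF h j'(1,2)] using x0(3) by simp
        qed
        then have "?y * (bas x * e j) = 0" by (simp add: r)
        then show ?thesis by (simp only: mult.assoc)
      next
        case T: True
        \<comment> \<open>As \<open>k\<close> is the least length of a non-maximal path in the
          support, any other path passing the filters is longer, and its product with the complement
          exceeds the maximal length.\<close>
        have "k' < per u' \<Longrightarrow> k \<le> k'" using x x' min by (auto simp: Q_def)
        moreover have "k' = 0 \<Longrightarrow> k' < per u'" using per_pos[OF j'(1,2)] by simp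
        ultimately have uu: "u = u'" using T k0 k0' by (cases "k' = 0") auto
        then have "k \<noteq> k'" using x(3) x' T by auto
        then have "k < k'" using \<open>k' < per u' \<Longrightarrow> k \<le> k'\<close> x0(3) uu j'(3) by (cases "k' < per u'") auto
        then have "?y * b u' j' k' = 0"
          using b_mult[OF h j'(1,2), of "per u - k" k'] T uu x0(3) b_beyond[OF j'(1,2), of "per u - k + k'"] by simp
        then show ?thesis using r T by (simp add: mult.assoc)
      qed
    qed
  next
    case False
    \<comment> \<open>Only maximal paths remain in the support, one for each edge; right
      multiplication by \<open>e j\<close> separates them.\<close>
    obtain u j k where x': "x = (u, j, k)" by (cases x)
    have top: "k' = per u' \<and> u' = endp j'" if "(u', j', k') \<in> idx" "c (u', j', k') \<noteq> 0" for u' j' k'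
      using that False by (auto simp: Q_def idx_def)
    have j: "j \<in> edges \<Gamma>" "u \<in> j" using x x' by (auto simp: idx_def)
    show False
    proof (rule key[OF x cx, of 1 "e j"])
      have "1 * bas x * e j = b u j (per u)" using top x cx x' b_right[OF j] by (simp add: bas_def)
      then show "1 * bas x * e j \<noteq> 0" using path_top_ne[OF j] by simp
    next
      fix x2 assume x2: "x2 \<in> idx" "c x2 \<noteq> 0" "x2 \<noteq> x"
      obtain u' j' k' where x2': "x2 = (u', j', k')" by (cases x2)
      have j': "j' \<in> edges \<Gamma>" "u' \<in> j'" using x2(1) x2' by (auto simp: idx_def)
      have "j' \<noteq> j" using top x2 x2' x cx x' by blast
      then have "b u' j' k' * (e j' * e j) = 0" using e_orth[OF j'(1) j(1)] by simp
      then show "1 * bas x2 * e j = 0" using b_right[OF j', of k'] by (simp add: bas_def x2' flip: mult.assoc)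
    qed
  qed
qed

lemma bas_span: "span (bas ` idx) = UNIV"
proof -
  have "{b u j k | u j k. j \<in> edges \<Gamma> \<and> u \<in> j \<and> k \<le> per u} \<subseteq> bas ` idx"
  proof clarify
    fix u j k assume "j \<in> edges \<Gamma>" "u \<in> j" "k \<le> per u"
    then show "b u j k \<in> bas ` idx" using canon[of j u k] by (intro image_eqI[of _ _ "canon u j k"]) auto
  qed
  from span_mono[OF this] have "UNIV \<subseteq> span (bas ` idx)" unfolding path_span .
  then show ?thesis by (rule top.extremum_uniqueI)
qed

sublocale fb: family_basis scale idx bas
  by unfold_locales (use finite_idx bas_indep bas_span in auto)

text \<open>The arrow \<open>a u j\<close> gets degree \<open>c * \<delta> u j\<close>. Keeping the
  factor as a parameter makes the trivial grading the case \<open>c = 0\<close> and rescaling the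
  passage from \<open>c\<close> to 1.\<close>

definition path_grading :: "('v \<Rightarrow> 'v set \<Rightarrow> int) \<Rightarrow> int \<Rightarrow> int \<Rightarrow> 'a set" where
  "path_grading \<delta> c = fb.homog (\<lambda>(u, j, k). c * pdeg \<delta> u j k)"

text \<open>Empty and maximal paths are indexed at \<open>endp j\<close> only; balancedness ensures
  that their degree is the same seen from \<open>u\<close>.\<close>

lemma b_homog:
  assumes "balanced \<delta>" and j: "j \<in> edges \<Gamma>" "u \<in> j"
  shows "b u j k \<in> path_grading \<delta> c (c * pdeg \<delta> u j k)"
proof (cases "k \<le> per u")
  case True
  have "(case canon u j k of (u, j, k) \<Rightarrow> c * pdeg \<delta> u j k) = c * pdeg \<delta> u j k"
  proof (cases "k = 0 \<or> k \<noteq> per u")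
    case True
    then show ?thesis by (cases "k = 0") (simp_all add: canon_def pdeg_def)
  next
    case False
    have "pdeg \<delta> (endp j) j (per (endp j)) = pdeg \<delta> u j (per u)"
      using assms(1) endp[OF j(1)] j unfolding balanced_def by blast
    then show ?thesis using False by (simp add: canon_def)
  qed
  then show ?thesis
    using fb.basis_homog[OF canon(1)[OF j True], of "\<lambda>(u, j, k). c * pdeg \<delta> u j k"] canon(2)[OF j True]
    by (simp add: path_grading_def)
next
  case False
  then show ?thesis using b_beyond[OF j] fb.homog_0 by (simp add: path_grading_def)
qed

lemma grading_path_grading:
  assumes "balanced \<delta>"
  shows "grading scale (path_grading \<delta> c)"
  unfolding path_grading_def
proof (rule fb.grading_homog)
  fix x y assume xy: "x \<in> idx" "y \<in> idx"
  obtain u j k v i l where x: "x = (u, j, k)" and y: "y = (v, i, l)" by (cases x, cases y)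
  have j: "j \<in> edges \<Gamma>" "u \<in> j" and i: "i \<in> edges \<Gamma>" "v \<in> i" using xy x y by (auto simp: idx_def)
  let ?d = "\<lambda>(u, j, k). c * pdeg \<delta> u j k"
  have h: "b u j k \<in> fb.homog ?d (c * pdeg \<delta> u j k)" "b v i m \<in> fb.homog ?d (c * pdeg \<delta> v i m)" for m
    using b_homog[OF assms j, of k c] b_homog[OF assms i, of m c] unfolding path_grading_def by blast+
  have "b u j k * b v i l \<in> fb.homog ?d (c * pdeg \<delta> u j k + c * pdeg \<delta> v i l)"
  proof (cases "(nx v ^^ l) i = j")
    case True
    consider "k = 0" | "k \<noteq> 0" "l = 0" | "k \<noteq> 0" "l \<noteq> 0" "u = v" | "k \<noteq> 0" "l \<noteq> 0" "u \<noteq> v" by blast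
    then show ?thesis
    proof cases
      case 1
      then show ?thesis using h(2)[of l] b_mult[OF j i, of k l] True by (simp add: pdeg_def)
    next
      case 2
      then show ?thesis using h(1) b_mult[OF j i, of k l] True by (simp add: pdeg_def)
    next
      case 3
      then show ?thesis using h(2)[of "k + l"] b_mult[OF j i, of k l] True pdeg_add[of \<delta> v i k l] by (simp add: distrib_left)
    next
      case 4
      then show ?thesis using b_mult[OF j i, of k l] True fb.homog_0 by simp
    qed
  next
    case False
    then show ?thesis using b_mult[OF j i, of k l] fb.homog_0 by simp
  qed
  then show "bas x * bas y \<in> fb.homog ?d (?d x + ?d y)" by (simp add: x y bas_def)
qed

lemma path_grading_0: "path_grading \<delta> 0 = trivial_grading"
proof
  fix l show "path_grading \<delta> 0 l = trivial_grading l"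
    using fb.coord_eqI[of _ 0] fb.coord_0 by (auto simp: path_grading_def fb.homog_def trivial_grading_def)
qed

lemma rescaling_path_grading: "c \<noteq> 0 \<Longrightarrow> rescaling c (path_grading \<delta> c) (path_grading \<delta> 1)"
proof -
  assume c: "c \<noteq> 0"
  have "path_grading \<delta> c i = {0}" if "\<not> c dvd i" for i
  proof -
    have "(case x of (u, j, k) \<Rightarrow> c * pdeg \<delta> u j k) \<noteq> i" for x using that by (cases x) auto
    then show ?thesis using fb.coord_eqI[of _ 0] fb.coord_0 by (auto simp: path_grading_def fb.homog_def)
  qed
  moreover have "path_grading \<delta> 1 i = path_grading \<delta> c (c * i)" for i
    using c by (auto simp: path_grading_def fb.homog_def)
  ultimately show ?thesis using c by (simp add: rescaling_def)
qed

end

section \<open>Two Brauer systems on the same tree\<close>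

locale two_systems = S: brauer_system \<Gamma> scale e a + T: brauer_system \<Gamma> scale e' a'
  for \<Gamma> :: "'v brauer_tree" and scale :: "'k::field \<Rightarrow> 'a::ring_1 \<Rightarrow> 'a" and e a e' a'
begin

definition \<theta> :: "'a \<Rightarrow> 'a" where "\<theta> = S.fb.ext T.bas"

lemma theta_path:
  assumes j: "j \<in> edges \<Gamma>" "u \<in> j"
  shows "\<theta> (S.b u j k) = T.b u j k"
proof (cases "k \<le> S.per u")
  case True
  have "\<theta> (S.b u j k) = T.bas (S.canon u j k)"
    using S.fb.ext_basis[OF S.canon(1)[OF j True]] S.canon(2)[OF j True] by (simp add: \<theta>_def)
  also have "\<dots> = T.b u j k" using T.path_top[OF j(1) S.endp[OF j(1)] j(2)] by (auto simp: S.canon_def T.bas_def)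
  finally show ?thesis .
next
  case False
  then show ?thesis using S.b_beyond[OF j] T.b_beyond[OF j] by (simp add: \<theta>_def S.fb.ext_0)
qed

lemma theta_0: "\<theta> 0 = 0"
  by (simp add: \<theta>_def S.fb.ext_0)

text \<open>By \<open>b_mult\<close> both path bases multiply by the same rule, and \<theta> matches
  them; the rest is bilinearity.\<close>

lemma theta_mult: "\<theta> (x * y) = \<theta> x * \<theta> y"
proof -
  let ?c = S.fb.coord
  have bas: "\<theta> (S.bas i * S.bas k) = \<theta> (S.bas i) * \<theta> (S.bas k)" if ik: "i \<in> S.idx" "k \<in> S.idx" for i k
  proof -
    obtain u j p v h q where i: "i = (u, j, p)" and k: "k = (v, h, q)" by (cases i, cases k)
    have j: "j \<in> edges \<Gamma>" "u \<in> j" and h: "h \<in> edges \<Gamma>" "v \<in> h" using ik i k by (auto simp: S.idx_def)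
    show ?thesis
      using theta_path[OF j, of p] theta_path[OF h] theta_0
      by (simp add: i k S.bas_def S.b_mult[OF j h, of p q] T.b_mult[OF j h, of p q])
  qed
  have "x * y = (\<Sum>i\<in>S.idx. \<Sum>k\<in>S.idx. scale (?c x i * ?c y k) (S.bas i * S.bas k))"
    by (subst S.fb.coord_sum[of x], subst S.fb.coord_sum[of y])
      (simp add: sum_product S.scale_mult_left S.scale_mult_right mult.commute)
  then have "\<theta> (x * y) = (\<Sum>i\<in>S.idx. \<Sum>k\<in>S.idx. scale (?c x i * ?c y k) (\<theta> (S.bas i * S.bas k)))"
    by (simp add: \<theta>_def S.fb.ext_sum S.fb.ext_scale)
  also have "\<dots> = (\<Sum>i\<in>S.idx. \<Sum>k\<in>S.idx. scale (?c x i * ?c y k) (T.bas i * T.bas k))"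
    by (intro sum.cong refl) (simp add: bas, simp add: \<theta>_def S.fb.ext_basis)
  also have "\<dots> = \<theta> x * \<theta> y"
    by (simp add: \<theta>_def S.fb.ext_def sum_product S.scale_mult_left S.scale_mult_right mult.commute)
  finally show ?thesis .
qed

lemma theta_add: "\<theta> (x + y) = \<theta> x + \<theta> y" and theta_scale: "\<theta> (scale c x) = scale c (\<theta> x)"
  and theta_sum: "\<theta> (\<Sum>s\<in>Y. g s) = (\<Sum>s\<in>Y. \<theta> (g s))"
  by (simp_all add: \<theta>_def S.fb.ext_add S.fb.ext_scale S.fb.ext_sum)

lemma theta_one: "\<theta> 1 = 1"
proof -
  have "\<theta> (e j) = e' j" if "j \<in> edges \<Gamma>" for j using theta_path[OF that S.endp[OF that], of 0] by simp
  then have "(\<Sum>j\<in>edges \<Gamma>. \<theta> (e j)) = (\<Sum>j\<in>edges \<Gamma>. e' j)" by simp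
  then show ?thesis using S.e_one T.e_one theta_sum[of e "edges \<Gamma>"] by simp
qed

lemma theta_homog:
  assumes H: "\<And>u j k. j \<in> edges \<Gamma> \<Longrightarrow> u \<in> j \<Longrightarrow> T.b u j k \<in> H (c * S.pdeg \<delta> u j k)"
    and sub: "\<And>l. S.subspace (H l)" and x: "x \<in> S.path_grading \<delta> c l"
  shows "\<theta> x \<in> H l"
  unfolding \<theta>_def S.fb.ext_def
proof (intro S.subspace_sum[OF sub])
  fix i assume i: "i \<in> S.idx"
  obtain u j k where i': "i = (u, j, k)" by (cases i)
  have j: "j \<in> edges \<Gamma>" "u \<in> j" using i i' by (auto simp: S.idx_def)
  show "scale (S.fb.coord x i) (T.bas i) \<in> H l"
  proof (cases "c * S.pdeg \<delta> u j k = l")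
    case True
    then show ?thesis using H[OF j, of k] S.subspace_scale[OF sub] by (auto simp: i' T.bas_def)
  next
    case False
    then have "S.fb.coord x i = 0" using x i i' by (auto simp: S.path_grading_def S.fb.homog_def)
    then show ?thesis using S.subspace_0[OF sub] by simp
  qed
qed

end

lemma two_systems_inverse:
  assumes "two_systems \<Gamma> scale e a e' a'"
  shows "two_systems.\<theta> \<Gamma> scale e' a' e a (two_systems.\<theta> \<Gamma> scale e a e' a' x) = x"
proof -
  interpret A: two_systems \<Gamma> scale e a e' a' by fact
  interpret B: two_systems \<Gamma> scale e' a' e a
    using assms by (simp add: two_systems_def)
  have "B.\<theta> (A.\<theta> (A.S.bas i)) = A.S.bas i" if "i \<in> A.S.idx" for i
  proof -
    obtain u j k where i: "i = (u, j, k)" by (cases i)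
    have "j \<in> edges \<Gamma>" "u \<in> j" using that i by (auto simp: A.S.idx_def)
    then show ?thesis using A.theta_path B.theta_path by (simp add: i A.S.bas_def)
  qed
  then have "B.\<theta> (A.\<theta> (\<Sum>i\<in>A.S.idx. scale (A.S.fb.coord x i) (A.S.bas i))) = (\<Sum>i\<in>A.S.idx. scale (A.S.fb.coord x i) (A.S.bas i))"
    by (simp add: A.theta_sum A.theta_scale B.theta_sum B.theta_scale)
  then show ?thesis using A.S.fb.coord_sum[of x] by simp
qed


section \<open>Degrees and potentials on the tree\<close>

context brauer_tree
begin

lemma connected_const:
  assumes f: "\<And>u w. {u, w} \<in> edges \<Gamma> \<Longrightarrow> f u = f w" and uw: "u \<in> vertices \<Gamma>" "w \<in> vertices \<Gamma>"
  shows "f u = f w"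
proof -
  obtain p where p: "walk \<Gamma> p" "hd p = u" "last p = w" using connected[OF uw] by blast
  have "f (hd p) = f (last p)" if "p \<noteq> []" "successively (\<lambda>x y. {x, y} \<in> edges \<Gamma>) p" for p
    using that
  proof (induction p)
    case (Cons x p)
    note IH = Cons.IH and prems = Cons.prems
    show ?case
    proof (cases p)
      case (Cons y q)
      then have "f x = f y" using prems by (intro f) simp
      then show ?thesis using Cons IH prems by simp
    qed simp
  qed simp
  then show ?thesis using p by (auto simp: walk_def)
qed

lemma pdeg_period:
  assumes j: "j \<in> edges \<Gamma>" "u \<in> j"
  shows "pdeg \<delta> u j (q * val u) = int q * pdeg \<delta> u j (val u)"
proof (induction q)
  case (Suc q)
  have "(nx u ^^ (q * val u)) j = j" using funpow_mod_eq[OF nx_val[OF j], of "q * val u"] by simp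
  then show ?case using Suc pdeg_add[of \<delta> u j "val u" "q * val u"] by (simp add: algebra_simps)
qed (simp add: pdeg_def)

lemma pdeg_val_const:
  assumes j: "j \<in> edges \<Gamma>" "u \<in> j" and i: "i \<in> edges \<Gamma>" "u \<in> i"
  shows "pdeg \<delta> u i (val u) = pdeg \<delta> u j (val u)"
proof -
  have c: "pdeg \<delta> u ((nx u ^^ k) j) (val u) = pdeg \<delta> u j (val u)" for k
    using pdeg_add[of \<delta> u j "val u" k] pdeg_add[of \<delta> u j k "val u"] nx_val[OF j] by (simp add: add.commute)
  have "i \<in> orbit (nx u) j" using cyclic_on_orbit_eq[of "nx u" "incident \<Gamma> u" j] vertex_cyclic[OF j] vertex_cyclic[OF i] by simp
  then obtain k where k: "i = (nx u ^^ k) j" by (auto simp: orbit_altdef)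
  show ?thesis unfolding k by (rule c)
qed

text \<open>Two lengths leading to the same edge differ by full turns, which contribute nothing. So
  \<open>pdeg\<close> descends to a function on the edges at \<open>u\<close>, a local
  potential.\<close>

lemma pdeg_closed:
  assumes j: "j \<in> edges \<Gamma>" "u \<in> j" and z: "pdeg \<delta> u j (val u) = 0" and kl: "(nx u ^^ k) j = (nx u ^^ l) j"
  shows "pdeg \<delta> u j k = pdeg \<delta> u j l"
proof -
  have *: "pdeg \<delta> u j k = pdeg \<delta> u j (k + m)" if "(nx u ^^ m) ((nx u ^^ k) j) = (nx u ^^ k) j" for k m
  proof -
    let ?h = "(nx u ^^ k) j"
    have h: "?h \<in> edges \<Gamma>" "u \<in> ?h" using nx_incident[OF j, of k] by auto
    have "(nx u ^^ (m mod val u)) ?h = ?h" using funpow_mod_eq[OF nx_val[OF h], of m] that by simp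
    then have "m mod val u = 0" using nx_less_val[OF h, of "m mod val u"] val_pos[OF h] by (metis gr0I mod_less_divisor)
    then have "m = m div val u * val u" by auto
    then have "pdeg \<delta> u ?h m = 0" using pdeg_period[OF h, of \<delta> "m div val u"] pdeg_val_const[OF j h, of \<delta>] z by simp
    then show ?thesis using pdeg_add[of \<delta> u j m k] by (simp add: add.commute)
  qed
  show ?thesis
  proof (cases "k \<le> l")
    case True
    then have "(nx u ^^ (l - k)) ((nx u ^^ k) j) = (nx u ^^ k) j"
      using kl funpow_add[of "l - k" k "nx u"] by (simp add: comp_def fun_eq_iff)
    from *[OF this] show ?thesis using True by simp
  next
    case False
    then have "(nx u ^^ (k - l)) ((nx u ^^ l) j) = (nx u ^^ l) j"
      using kl funpow_add[of "k - l" l "nx u"] by (simp add: comp_def fun_eq_iff)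
    from *[OF this] show ?thesis using False by simp
  qed
qed

text \<open>Paths stay in \<open>W\<close> and repeat no vertex, so that adding a vertex outside
  \<open>W\<close> adjacent to both ends produces a \<open>graph_cycle\<close>.\<close>

definition path_connected :: "'v set \<Rightarrow> bool" where
  "path_connected W \<longleftrightarrow> (\<forall>a\<in>W. \<forall>b\<in>W. \<exists>p. p \<noteq> [] \<and> distinct p \<and> set p \<subseteq> W \<and> hd p = a \<and> last p = b \<and>
     successively (\<lambda>x y. {x, y} \<in> edges \<Gamma>) p)"

lemma path_connected_insert:
  assumes W: "path_connected W" and u: "u \<in> W" and x: "x \<notin> W" "{u, x} \<in> edges \<Gamma>"
  shows "path_connected (insert x W)"
  unfolding path_connected_def
proof (intro ballI)
  let ?s = "successively (\<lambda>x y. {x, y} \<in> edges \<Gamma>)"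
  fix a b assume ab: "a \<in> insert x W" "b \<in> insert x W"
  have to_x: "\<exists>p. p \<noteq> [] \<and> distinct p \<and> set p \<subseteq> insert x W \<and> hd p = a \<and> last p = x \<and> ?s p" if aW: "a \<in> W" for a
  proof -
    obtain p where p: "p \<noteq> []" "distinct p" "set p \<subseteq> W" "hd p = a" "last p = u" "?s p"
      using W[unfolded path_connected_def, rule_format, OF aW u] by (elim exE conjE)
    then show ?thesis using x by (intro exI[of _ "p @ [x]"]) (auto simp: successively_append_iff)
  qed
  show "\<exists>p. p \<noteq> [] \<and> distinct p \<and> set p \<subseteq> insert x W \<and> hd p = a \<and> last p = b \<and> ?s p"
  proof (cases "a = x"; cases "b = x")
    assume "a = x" "b = x"
    then show ?thesis by (intro exI[of _ "[x]"]) auto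
  next
    assume "a \<noteq> x" "b = x"
    then show ?thesis using to_x[of a] ab by auto
  next
    assume ax: "a = x" "b \<noteq> x"
    then obtain p where p: "p \<noteq> []" "distinct p" "set p \<subseteq> insert x W" "hd p = b" "last p = x" "?s p" using to_x[of b] ab by auto
    have "successively (\<lambda>x y. {y, x} \<in> edges \<Gamma>) p"
      using p(6) by (rule successively_mono) (simp add: insert_commute)
    then have "?s (rev p)" by (simp only: successively_rev)
    then show ?thesis using p ax by (intro exI[of _ "rev p"]) (auto simp: hd_rev last_rev)
  next
    assume "a \<noteq> x" "b \<noteq> x"
    then have "a \<in> W" "b \<in> W" using ab by auto
    from W[unfolded path_connected_def, rule_format, OF this]
    obtain p where "p \<noteq> []" "distinct p" "set p \<subseteq> W" "hd p = a" "last p = b" "?s p" by (elim exE conjE)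
    then show ?thesis by (intro exI[of _ p]) auto
  qed
qed

text \<open>Two edges from \<open>x\<close> into \<open>W\<close> would close a cycle with a path
  inside \<open>W\<close> between their ends.\<close>

lemma unique_attachment:
  assumes W: "path_connected W" "W \<subseteq> vertices \<Gamma>" and x: "x \<notin> W" and u: "u \<in> W" "{u, x} \<in> edges \<Gamma>" and w: "w \<in> W" "{w, x} \<in> edges \<Gamma>"
  shows "w = u"
proof (rule ccontr)
  assume ne: "w \<noteq> u"
  obtain p where p: "p \<noteq> []" "distinct p" "set p \<subseteq> W" "hd p = u" "last p = w" "successively (\<lambda>x y. {x, y} \<in> edges \<Gamma>) p"
    using W(1)[unfolded path_connected_def, rule_format, OF u(1) w(1)] by (elim exE conjE)
  have xv: "x \<in> vertices \<Gamma>" using edge_vertex[OF u(2)] by simp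
  have "length p \<ge> 2" using p(1,4,5) ne by (cases p rule: remdups_adj.cases) auto
  then have "graph_cycle \<Gamma> (p @ [x])"
    using p w u xv x W(2) by (auto simp: graph_cycle_def walk_def successively_append_iff insert_commute)
  then show False using acyclic by blast
qed

text \<open>The potential is built along a growing subtree. Each new vertex is attached by exactly one edge,
  and the remaining edges at it have not been constrained before.\<close>

lemma ex_potential:
  assumes z: "\<And>j u. j \<in> edges \<Gamma> \<Longrightarrow> u \<in> j \<Longrightarrow> pdeg \<epsilon> u j (val u) = 0"
  shows "\<exists>d. \<forall>j\<in>edges \<Gamma>. \<forall>u\<in>j. d (nx u j) = d j + \<epsilon> u j"
proof -
  let ?P = "\<lambda>W d. W \<subseteq> vertices \<Gamma> \<and> W \<noteq> {} \<and> path_connected W \<and> (\<forall>u\<in>W. \<forall>j\<in>edges \<Gamma>. u \<in> j \<longrightarrow> d (nx u j) = d j + \<epsilon> u j)"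
  have extend: "\<exists>W' d'. ?P W' d' \<and> W \<subset> W'" if P: "?P W d" and u: "u \<in> W" and x: "x \<notin> W" "{u, x} \<in> edges \<Gamma>" for W d u x
  proof -
    let ?j = "{u, x}"
    have xj: "x \<in> ?j" by simp
    note jx = x(2) xj
    \<comment> \<open>Going around \<open>x\<close> from the attaching edge prescribes the potential
      on all edges at \<open>x\<close>; this is consistent because a full turn contributes
      0.\<close>
    define D where "D k = d ?j + pdeg \<epsilon> x ?j k" for k
    have DD: "D k = D l" if "(nx x ^^ k) ?j = (nx x ^^ l) ?j" for k l
      using pdeg_closed[OF jx z[OF jx] that] by (simp add: D_def)
    define d' where "d' i = (if x \<in> i then D (SOME k. (nx x ^^ k) ?j = i) else d i)" for i
    have orb: "\<exists>k. (nx x ^^ k) ?j = i" if i: "i \<in> edges \<Gamma>" "x \<in> i" for i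
    proof -
      have "i \<in> orbit (nx x) ?j" using cyclic_on_orbit_eq[of "nx x" "incident \<Gamma> x" ?j] vertex_cyclic[OF jx] vertex_cyclic[OF i] by simp
      then show ?thesis by (auto simp: orbit_altdef)
    qed
    have dk: "d' ((nx x ^^ k) ?j) = D k" for k
    proof -
      have "x \<in> (nx x ^^ k) ?j" using nx_incident[OF jx] by blast
      then have e1: "d' ((nx x ^^ k) ?j) = D (SOME l. (nx x ^^ l) ?j = (nx x ^^ k) ?j)" by (simp add: d'_def)
      have "(nx x ^^ (SOME l. (nx x ^^ l) ?j = (nx x ^^ k) ?j)) ?j = (nx x ^^ k) ?j"
        by (rule someI[of _ k]) simp
      from DD[OF this] show ?thesis unfolding e1 .
    qed
    \<comment> \<open>The only edge at \<open>x\<close> that meets \<open>W\<close> is the attaching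
      one, and there the old and the new value agree.\<close>
    have d'd: "d' i = d i" if i: "i \<in> edges \<Gamma>" "v \<in> i" and v: "v \<in> W" for i v
    proof (cases "x \<in> i")
      case True
      have "i = {v, x}"
      proof -
        obtain y where "y \<noteq> x" "i = {x, y}" using edge_cases[OF i(1) True] by metis
        then show ?thesis using i(2) v x(1) by auto
      qed
      then have "v = u" using unique_attachment[of W x u v] P x u v i by simp
      then have "i = (nx x ^^ 0) ?j" using \<open>i = {v, x}\<close> by simp
      then show ?thesis using dk[of 0] by (simp add: D_def pdeg_def)
    qed (simp add: d'_def)
    have "d' (nx v i) = d' i + \<epsilon> v i" if v: "v \<in> insert x W" and i: "i \<in> edges \<Gamma>" "v \<in> i" for v i
    proof (cases "v = x")
      case True
      obtain k where k: "(nx x ^^ k) ?j = i" using orb i True by blast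
      then have "nx x i = (nx x ^^ Suc k) ?j" by simp
      then have "d' (nx x i) = D (Suc k)" using dk by metis
      then show ?thesis using dk[of k] k True by (simp add: D_def pdeg_def)
    next
      case False
      then have vW: "v \<in> W" using v by simp
      then show ?thesis using d'd[OF i vW] d'd[OF nx_in[OF i] vW] P i by simp
    qed
    moreover have "path_connected (insert x W)" using path_connected_insert[of W u x] P u x by blast
    moreover have "x \<in> vertices \<Gamma>" using edge_vertex[OF jx] .
    ultimately have "?P (insert x W) d'" using P by auto
    moreover have "W \<subset> insert x W" using x(1) by blast
    ultimately have "?P (insert x W) d' \<and> W \<subset> insert x W" by (rule conjI)
    then show ?thesis by (intro exI)
  qed
  have start: "?P {v} d" if "v \<in> vertices \<Gamma>" and d: "\<And>j. j \<in> edges \<Gamma> \<Longrightarrow> v \<in> j \<Longrightarrow> d (nx v j) = d j + \<epsilon> v j" for v d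
  proof -
    have "path_connected {v}" unfolding path_connected_def by (intro ballI exI[of _ "[v]"]) auto
    then show ?thesis using that by auto
  qed
  obtain v where v: "v \<in> vertices \<Gamma>" using exceptional_vertex by blast
  have "\<exists>d. \<forall>j\<in>edges \<Gamma>. v \<in> j \<longrightarrow> d (nx v j) = d j + \<epsilon> v j"
  proof -
    obtain j where j: "j \<in> edges \<Gamma>" "v \<in> j" using cyclic_ordering[OF v] by (auto simp: cyclic_on_def incident_def)
    define d where "d i = pdeg \<epsilon> v j (SOME k. (nx v ^^ k) j = i)" for i
    have dk: "d ((nx v ^^ k) j) = pdeg \<epsilon> v j k" for k
    proof -
      have "(nx v ^^ (SOME l. (nx v ^^ l) j = (nx v ^^ k) j)) j = (nx v ^^ k) j" by (rule someI[of _ k]) simp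
      from pdeg_closed[OF j z[OF j] this] show ?thesis by (simp add: d_def)
    qed
    have "d (nx v i) = d i + \<epsilon> v i" if i: "i \<in> edges \<Gamma>" "v \<in> i" for i
    proof -
      have "i \<in> orbit (nx v) j" using cyclic_on_orbit_eq[of "nx v" "incident \<Gamma> v" j] vertex_cyclic[OF j] vertex_cyclic[OF i] by simp
      then obtain k where k: "i = (nx v ^^ k) j" by (auto simp: orbit_altdef)
      have "d (nx v i) = pdeg \<epsilon> v j (Suc k)" using dk[of "Suc k"] k by simp
      then show ?thesis using dk[of k] k by (simp add: pdeg_def)
    qed
    then show ?thesis by blast
  qed
  then obtain d0 where "\<forall>j\<in>edges \<Gamma>. v \<in> j \<longrightarrow> d0 (nx v j) = d0 j + \<epsilon> v j" by (rule exE)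
  then have "?P {v} d0" by (intro start[OF v]) simp
  \<comment> \<open>Among the vertex sets carrying such a potential one of largest cardinality is
    taken; connectedness of the tree allows an extension unless it contains every vertex.\<close>
  define R where "R W \<longleftrightarrow> (\<exists>d. ?P W d)" for W
  have R1: "R {v}" unfolding R_def using \<open>?P {v} d0\<close> by (intro exI[of _ d0])
  have R2: "\<forall>W. R W \<longrightarrow> card W < Suc (card (vertices \<Gamma>))"
  proof (intro allI impI)
    fix W assume "R W"
    then have "W \<subseteq> vertices \<Gamma>" unfolding R_def by (elim exE conjE)
    then show "card W < Suc (card (vertices \<Gamma>))" using card_mono[OF finite_vertices] by (simp add: less_Suc_eq_le)
  qed
  obtain W where W0: "R W \<and> (\<forall>y. R y \<longrightarrow> card y \<le> card W)" using ex_has_greatest_nat[OF R1 R2] by (rule exE)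
  have max: "card W' \<le> card W" if "R W'" for W' using W0 that by simp
  obtain d where d: "?P W d" using W0 unfolding R_def by (elim conjE) (rule exE)
  have all: "W = vertices \<Gamma>"
  proof (rule ccontr)
    assume "W \<noteq> vertices \<Gamma>"
    then obtain y where y: "y \<in> vertices \<Gamma>" "y \<notin> W" using d by blast
    obtain w where w: "w \<in> W" using d by blast
    have "\<exists>u x. u \<in> W \<and> x \<notin> W \<and> {u, x} \<in> edges \<Gamma>"
    proof (rule ccontr)
      assume n: "\<not> ?thesis"
      have n': "b \<in> W" if "a \<in> W" "{a, b} \<in> edges \<Gamma>" for a b using n that by blast
      have h: "(a \<in> W) = (b \<in> W)" if "{a, b} \<in> edges \<Gamma>" for a b
        using n'[of a b] n'[of b a] that insert_commute[of a b "{}"] by auto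
      have "w \<in> vertices \<Gamma>" using w d by blast
      then have "(w \<in> W) = (y \<in> W)" using connected_const[of "\<lambda>u. u \<in> W", OF h] y(1) by blast
      then show False using w y by simp
    qed
    then obtain u x where "u \<in> W" "x \<notin> W" "{u, x} \<in> edges \<Gamma>" by blast
    from extend[OF d this] obtain W' d' where W': "?P W' d'" "W \<subset> W'" by (elim exE conjE) simp
    have "card W < card W'" using W' finite_subset[OF _ finite_vertices] by (intro psubset_card_mono) auto
    moreover have "card W' \<le> card W" by (rule max) (unfold R_def, rule exI, rule W'(1))
    ultimately show False by simp
  qed
  show ?thesis using d edge_vertex unfolding all by blast
qed

text \<open>At each vertex the degree of a full turn is put on one chosen edge. The values 1 at the
  exceptional vertex and the multiplicity elsewhere give every maximal path the same degree, namely
  the multiplicity.\<close>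

definition base_deg :: "'v \<Rightarrow> 'v set \<Rightarrow> int" where
  "base_deg u j = (if j = (SOME i. i \<in> edges \<Gamma> \<and> u \<in> i) then if u = exceptional \<Gamma> then 1 else int (multiplicity \<Gamma>) else 0)"

lemma pdeg_base_val:
  assumes j: "j \<in> edges \<Gamma>" "u \<in> j"
  shows "pdeg base_deg u j (val u) = (if u = exceptional \<Gamma> then 1 else int (multiplicity \<Gamma>))"
proof -
  define i where "i = (SOME i. i \<in> edges \<Gamma> \<and> u \<in> i)"
  have "i \<in> edges \<Gamma> \<and> u \<in> i" unfolding i_def by (rule someI[of _ j]) (use j in simp)
  then have i: "i \<in> edges \<Gamma>" "u \<in> i" by auto
  let ?D = "if u = exceptional \<Gamma> then 1 else int (multiplicity \<Gamma>)"
  obtain m where m: "val u = Suc m" using val_pos[OF j] by (cases "val u") auto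
  have "pdeg base_deg u i (val u) = (\<Sum>k<Suc m. if k = 0 then ?D else 0)"
    unfolding pdeg_def m
  proof (rule sum.cong[OF refl])
    fix k assume "k \<in> {..<Suc m}"
    then have "(nx u ^^ k) i = i \<longleftrightarrow> k = 0" using nx_less_val[OF i, of k] m by auto
    then show "base_deg u ((nx u ^^ k) i) = (if k = 0 then ?D else 0)" by (simp add: base_deg_def i_def[symmetric])
  qed
  also have "\<dots> = ?D" by (subst sum.delta) simp_all
  finally show ?thesis using pdeg_val_const[OF j i] by simp
qed

lemma pdeg_base_per: "j \<in> edges \<Gamma> \<Longrightarrow> u \<in> j \<Longrightarrow> pdeg base_deg u j (per u) = int (multiplicity \<Gamma>)"
  using pdeg_period[of j u base_deg "vertex_mult \<Gamma> u"] pdeg_base_val[of j u]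
  by (simp add: per_def vertex_mult_def)

lemma balanced_base: "balanced base_deg"
  by (auto simp: balanced_def pdeg_base_per)

text \<open>Let \<open>D u\<close> be the degree of a full turn. Balancedness equates vertex
  multiplicity times \<open>D u\<close> at the two ends of each edge, so this product is constant on
  the tree. With \<open>c\<close> the value of \<open>D\<close> at the exceptional vertex,
  \<open>c * base_deg - \<delta>\<close> sums to 0 around every vertex, and its potential
  \<open>d\<close> provides the shifts.\<close>

lemma balanced_potential:
  assumes \<delta>: "balanced \<delta>"
  shows "\<exists>c d. \<forall>j\<in>edges \<Gamma>. \<forall>u\<in>j. \<forall>k. pdeg \<delta> u j k + d ((nx u ^^ k) j) - d j = c * pdeg base_deg u j k"
proof -
  define D where "D u = pdeg \<delta> u (SOME i. i \<in> edges \<Gamma> \<and> u \<in> i) (val u)" for u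
  have D: "pdeg \<delta> u j (val u) = D u" if j: "j \<in> edges \<Gamma>" "u \<in> j" for u j
  proof -
    let ?i = "SOME i. i \<in> edges \<Gamma> \<and> u \<in> i"
    have "?i \<in> edges \<Gamma> \<and> u \<in> ?i" by (rule someI[of _ j]) (use j in simp)
    then show ?thesis using pdeg_val_const[OF j, of ?i \<delta>] by (simp add: D_def)
  qed
  let ?e = "exceptional \<Gamma>"
  have "int (vertex_mult \<Gamma> u) * D u = int (vertex_mult \<Gamma> w) * D w" if j: "{u, w} \<in> edges \<Gamma>" for u w
  proof -
    have "pdeg \<delta> u {u, w} (per u) = pdeg \<delta> w {u, w} (per w)" using \<delta> j unfolding balanced_def by blast
    then show ?thesis using pdeg_period[OF j, of u \<delta> "vertex_mult \<Gamma> u"] pdeg_period[OF j, of w \<delta> "vertex_mult \<Gamma> w"] D[OF j] by (simp add: per_def)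
  qed
  from connected_const[of "\<lambda>u. int (vertex_mult \<Gamma> u) * D u", OF this]
  have c: "int (vertex_mult \<Gamma> u) * D u = int (multiplicity \<Gamma>) * D ?e" if "u \<in> vertices \<Gamma>" for u
    using that exceptional_vertex by (metis vertex_mult_def)
  let ?c = "D ?e"
  define \<epsilon> where "\<epsilon> u j = ?c * base_deg u j - \<delta> u j" for u j
  have pe: "pdeg \<epsilon> u j k = ?c * pdeg base_deg u j k - pdeg \<delta> u j k" for u j k
    by (simp add: pdeg_def \<epsilon>_def sum_subtractf sum_distrib_left)
  have "pdeg \<epsilon> u j (val u) = 0" if j: "j \<in> edges \<Gamma>" "u \<in> j" for j u
    using c[OF edge_vertex[OF j]] D[OF j] pdeg_base_val[OF j] by (auto simp: pe vertex_mult_def)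
  from ex_potential[OF this] obtain d where d: "\<And>j u. j \<in> edges \<Gamma> \<Longrightarrow> u \<in> j \<Longrightarrow> d (nx u j) = d j + \<epsilon> u j" by blast
  have "d ((nx u ^^ k) j) = d j + pdeg \<epsilon> u j k" if j: "j \<in> edges \<Gamma>" "u \<in> j" for u j k
    using d nx_incident[OF j] by (induction k) (simp_all add: pdeg_def)
  then show ?thesis by (intro exI[of _ ?c] exI[of _ d]) (simp add: pe)
qed

end


section \<open>Graded endomorphism rings\<close>

lemma finsum_ideal_module:
  assumes L: "submod L regular_module" and f: "\<And>i. i \<in> S \<Longrightarrow> f i \<in> L"
  shows "finsum (ideal_module L) f S = (\<Sum>i\<in>S. f i)"
proof -
  interpret left_module "ideal_module L" by (rule left_module_ideal[OF L])
  show ?thesis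
    using f
  proof (induction S rule: infinite_finite_induct)
    case (insert x F)
    then show ?case by (subst finsum_insert) auto
  next
    case (infinite S)
    then show ?case by (simp add: finsum_infinite)
  qed simp
qed

lemma additive_subgroup_ideal_module:
  assumes L: "submod L regular_module" and N: "N \<subseteq> L" "0 \<in> N" "\<And>x y. x \<in> N \<Longrightarrow> y \<in> N \<Longrightarrow> x + y \<in> N"
    "\<And>x. x \<in> N \<Longrightarrow> - x \<in> N"
  shows "additive_subgroup N (ideal_module L)"
proof -
  interpret left_module "ideal_module L" by (rule left_module_ideal[OF L])
  show ?thesis
  proof (intro additive_subgroup.intro subgroup.intro)
    fix x assume x: "x \<in> N"
    then have "\<ominus>\<^bsub>ideal_module L\<^esub> x = - x"
      using minus_equality[of "- x" x] N by auto
    then show "inv\<^bsub>add_monoid (ideal_module L)\<^esub> x \<in> N" using N(4)[OF x] by (simp add: a_inv_def)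
  qed (use N in auto)
qed

section \<open>Graded indecomposable projective modules\<close>

locale graded_idem_algebra = idem_algebra scale I \<chi> e + G: graded_algebra scale G
  for scale :: "'k::field \<Rightarrow> 'a::ring_1 \<Rightarrow> 'a" and I :: "'i set" and \<chi> e G +
  assumes e_G0: "i \<in> I \<Longrightarrow> e i \<in> G 0"
begin

definition peirce_grading :: "'i \<Rightarrow> int \<Rightarrow> 'a set" where
  "peirce_grading i l = {x \<in> G l. x * e i = x}"

lemma module_grading_peirce:
  assumes i: "i \<in> I"
  shows "module_grading G (peirce (e i)) (peirce_grading i)"
  unfolding module_grading_def
proof (intro conjI allI ballI)
  show "left_module (peirce (e i))" by (rule left_module_peirce)
  fix l
  show "additive_subgroup (peirce_grading i l) (peirce (e i))"
    by (rule additive_subgroup_ideal_module[OF submod_peirce])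
      (use G.G_0 G.G_add subspace_neg[OF G.subspace_G] in \<open>auto simp: peirce_grading_def distrib_right\<close>)
next
  fix x assume "x \<in> carrier (peirce (e i))"
  then have x: "x * e i = x" by simp
  have c: "G.hcomp x l * e i = G.hcomp x l" for l
    using G.comp_mult_right[OF e_G0[OF i], of x l] x by simp
  have fs: "finsum (peirce (e i)) f S = (\<Sum>l\<in>S. f l)" if "\<And>l. f l \<in> peirce_grading i l" for f and S :: "int set"
    using that by (intro finsum_ideal_module submod_peirce) (auto simp: peirce_grading_def)
  show "\<exists>!f. (\<forall>l. f l \<in> peirce_grading i l) \<and> finite {l. f l \<noteq> \<zero>\<^bsub>peirce (e i)\<^esub>} \<and>
        x = (\<Oplus>\<^bsub>peirce (e i)\<^esub>l\<in>{l. f l \<noteq> \<zero>\<^bsub>peirce (e i)\<^esub>}. f l)"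
  proof (rule ex1I[of _ "G.hcomp x"])
    have h: "G.hcomp x l \<in> peirce_grading i l" for l using c G.comp_in by (simp add: peirce_grading_def)
    then show "(\<forall>l. G.hcomp x l \<in> peirce_grading i l) \<and> finite {l. G.hcomp x l \<noteq> \<zero>\<^bsub>peirce (e i)\<^esub>} \<and>
        x = (\<Oplus>\<^bsub>peirce (e i)\<^esub>l\<in>{l. G.hcomp x l \<noteq> \<zero>\<^bsub>peirce (e i)\<^esub>}. G.hcomp x l)"
      using fs[OF h] G.finite_comp[of x] G.comp_sum[of x] by simp
  next
    fix f assume f: "(\<forall>l. f l \<in> peirce_grading i l) \<and> finite {l. f l \<noteq> \<zero>\<^bsub>peirce (e i)\<^esub>} \<and>
        x = (\<Oplus>\<^bsub>peirce (e i)\<^esub>l\<in>{l. f l \<noteq> \<zero>\<^bsub>peirce (e i)\<^esub>}. f l)"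
    then have fp: "f l \<in> peirce_grading i l" for l by blast
    have "x = (\<Sum>l | f l \<noteq> 0. f l)" using f fs[OF fp] by simp
    then show "f = G.hcomp x"
      using f fp by (intro G.comp_unique[of f "{l. f l \<noteq> 0}", symmetric]) (auto simp: peirce_grading_def)
  qed
next
  fix l m b x assume "b \<in> G l" "x \<in> peirce_grading i m"
  then show "b \<odot>\<^bsub>peirce (e i)\<^esub> x \<in> peirce_grading i (l + m)"
    using G.G_mult by (auto simp: peirce_grading_def mult.assoc)
qed

lemma homogeneous_in_rad: "x \<in> G l \<Longrightarrow> l \<noteq> 0 \<Longrightarrow> x \<in> rad"
  using chi_nilp[OF _ G.homogeneous_nilp] by (simp add: rad_def)

text \<open>Elements of nonzero degree lie in the radical. If such an \<open>x\<close> were outside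
  a maximal submodule \<open>N\<close>, then e i = y + b x with \<open>y\<close> in
  \<open>N\<close>; as \<open>\<chi> i y = 1\<close>, the element \<open>y\<close> generates
  \<open>A (e i)\<close>, so \<open>N\<close> would be everything.\<close>

lemma top_in_degree_0_peirce:
  assumes i: "i \<in> I"
  shows "top_in_degree_0 (peirce (e i)) (peirce_grading i)"
  unfolding top_in_degree_0_def
proof (intro allI impI subsetI)
  fix l x assume l: "l \<noteq> 0" and "x \<in> peirce_grading i l"
  then have x: "x \<in> rad" "x * e i = x" using homogeneous_in_rad by (auto simp: peirce_grading_def)
  have "x \<in> N" if N: "maximal_submod N (peirce (e i))" for N
  proof (rule ccontr)
    assume xN: "x \<notin> N"
    have sN: "submod N regular_module" "\<And>y. y \<in> N \<Longrightarrow> y * e i = y"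
      using N by (auto simp: maximal_submod_def submod_peirce_iff)
    have ops: "0 \<in> N" "y + z \<in> N" "b * y \<in> N" if "y \<in> N" "z \<in> N" for b y z
      using sN(1) that by (auto simp: submod_regular)
    have N0: "0 \<in> N" using sN(1) by (simp add: submod_regular)
    let ?N' = "{y + b * x | y b. y \<in> N}"
    have sN': "submod ?N' (peirce (e i))"
      unfolding submod_peirce_iff submod_regular
    proof (intro conjI ballI allI)
      show "0 \<in> ?N'" using N0 by (intro CollectI exI[of _ 0]) simp
      fix u assume "u \<in> ?N'"
      then obtain y b where u: "u = y + b * x" "y \<in> N" by blast
      show "u * e i = u" using u sN(2) x(2) by (simp add: distrib_right mult.assoc)
      show "r * u \<in> ?N'" for r
        using u ops(3)[OF u(2) u(2), of r] by (intro CollectI exI[of _ "r * y"] exI[of _ "r * b"]) (simp add: distrib_left mult.assoc)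
      fix v assume "v \<in> ?N'"
      then obtain z c where v: "v = z + c * x" "z \<in> N" by blast
      show "u + v \<in> ?N'"
        using u v ops(2)[OF u(2) v(2)] by (intro CollectI exI[of _ "y + z"] exI[of _ "b + c"]) (simp add: distrib_right algebra_simps)
    qed
    have NN': "N \<subseteq> ?N'"
    proof
      fix y assume "y \<in> N"
      then show "y \<in> ?N'" by (intro CollectI exI[of _ y] exI[of _ 0]) simp
    qed
    have xN': "x \<in> ?N'" using N0 by (intro CollectI exI[of _ 0] exI[of _ 1]) simp
    have "?N' = N \<or> ?N' = carrier (peirce (e i))" using N sN' NN' unfolding maximal_submod_def by simp
    then have "?N' = carrier (peirce (e i))"
    proof
      assume "?N' = N"
      then show ?thesis using xN' xN by simp
    qed
    then have "e i \<in> ?N'" using e_mult i by simp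
    then obtain y b where y: "e i = y + b * x" "y \<in> N" by blast
    have "\<chi> i (b * x) = 0" using x(1) i by (simp add: chi_mult rad_def)
    then have "\<chi> i y = 1" using arg_cong[OF y(1), of "\<chi> i"] i by (simp add: chi_add chi_e)
    then have cy: "\<chi> i (e i * y) \<noteq> 0" using i by (simp add: chi_mult chi_e)
    have "e i * (e i * y) = e i * y" using e_mult i by (simp flip: mult.assoc)
    moreover have "(e i * y) * e i = e i * y" using sN(2)[OF y(2)] by (simp add: mult.assoc)
    ultimately obtain z where "z * (e i * y) = e i" using corner_unit[OF i, of "e i * y"] cy by blast
    then have "(z * e i) * y = e i" by (simp add: mult.assoc)
    then have eN: "e i \<in> N" using ops(3)[OF y(2) y(2)] by metis
    have "v \<in> N" if "v * e i = v" for v using ops(3)[OF eN eN, of v] that by simp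
    then have "N = carrier (peirce (e i))" using sN(2) by auto
    then show False using N by (simp add: maximal_submod_def)
  qed
  then show "x \<in> mod_rad (peirce (e i))" using x(2) by (auto simp: mod_rad_def)
qed

text \<open>The degree \<open>l\<close> part of the graded endomorphism ring of the shifted ideals
  \<open>A (e i)\<close>, carried over to the algebra by right multiplication: the shifts change the
  degrees on \<open>e i A e k\<close> by \<open>d i - d k\<close>.\<close>

definition shifted :: "('i \<Rightarrow> int) \<Rightarrow> int \<Rightarrow> 'a set" where
  "shifted d l = {x. \<forall>i\<in>I. \<forall>k\<in>I. e i * x * e k \<in> G (l + d k - d i)}"

lemma subspace_shifted: "subspace (shifted d l)"
  using G.G_0 G.G_add G.G_scale
  by (auto simp: subspace_def shifted_def distrib_left distrib_right scale_mult_left scale_mult_right)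

text \<open>Cut down to \<open>e i A e k\<close>, the summands lie in different degrees of
  \<open>G\<close>.\<close>

lemma shifted_disjoint:
  assumes "finite S" "\<And>l. l \<in> S \<Longrightarrow> f l \<in> shifted d l" "(\<Sum>l\<in>S. f l) = 0" "m \<in> S"
  shows "f m = 0"
proof -
  have "e i * f m * e k = 0" if ik: "i \<in> I" "k \<in> I" for i k
  proof -
    let ?h = "\<lambda>l. e i * f l * e k"
    have "(\<Sum>l\<in>S. ?h l) = 0" using assms(3) by (simp flip: sum_distrib_left sum_distrib_right)
    then have "0 = G.hcomp (\<Sum>l\<in>S. ?h l) (m + d k - d i)" by simp
    also have "\<dots> = (\<Sum>l\<in>S. if l = m then ?h m else 0)"
      unfolding G.comp_sum_distrib
    proof (rule sum.cong[OF refl])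
      fix l assume "l \<in> S"
      then have "?h l \<in> G (l + d k - d i)" using assms(2) ik by (simp add: shifted_def)
      then show "G.hcomp (?h l) (m + d k - d i) = (if l = m then ?h m else 0)"
        using G.comp_homogeneous[of "?h l" "l + d k - d i" "m + d k - d i"] by auto
    qed
    also have "\<dots> = ?h m" using assms(1,4) by simp
    finally show ?thesis by simp
  qed
  then have "(\<Sum>i\<in>I. \<Sum>k\<in>I. e i * f m * e k) = 0" by simp
  also have "(\<Sum>i\<in>I. \<Sum>k\<in>I. e i * f m * e k) = (\<Sum>i\<in>I. e i * f m)"
    by (intro sum.cong refl) (rule sum_e_right[symmetric])
  also have "\<dots> = f m" by (rule sum_e_left[symmetric])
  finally show ?thesis .
qed

section \<open>Endomorphisms as right multiplications\<close>

context
  fixes r :: nat and j :: "nat \<Rightarrow> 'i" and d :: "'i \<Rightarrow> int"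
  assumes j: "bij_betw j {..<r} I"
begin

abbreviation "P \<equiv> \<lambda>i. peirce (e (j i))"
abbreviation "M \<equiv> direct_sum r P"
abbreviation "R \<equiv> direct_sum_grading r (\<lambda>i. shift (peirce_grading (j i)) (d (j i)))"

definition tot :: "(nat \<Rightarrow> 'a) \<Rightarrow> 'a" where "tot y = (\<Sum>i<r. y i)"

text \<open>The map \<open>tot\<close> identifies the direct sum of the ideals
  \<open>A (e (j k))\<close> with the regular module; under it this is right multiplication by
  \<open>x\<close>.\<close>

definition rmul :: "'a \<Rightarrow> (nat \<Rightarrow> 'a) \<Rightarrow> nat \<Rightarrow> 'a" where
  "rmul x = (\<lambda>y\<in>carrier M. \<lambda>k\<in>{..<r}. tot y * x * e (j k))"

definition inc :: "nat \<Rightarrow> nat \<Rightarrow> 'a" where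
  "inc i = (\<lambda>k\<in>{..<r}. if k = i then e (j i) else 0)"

lemma jI: "i < r \<Longrightarrow> j i \<in> I" and j_inj: "i < r \<Longrightarrow> k < r \<Longrightarrow> j i = j k \<longleftrightarrow> i = k"
  using j by (auto simp: bij_betw_def inj_on_def)

lemma ejj: "i < r \<Longrightarrow> k < r \<Longrightarrow> e (j i) * e (j k) = (if i = k then e (j i) else 0)"
  using e_mult jI j_inj by simp

lemma sum_ej: "(\<Sum>i<r. e (j i)) = 1"
  using sum.reindex_bij_betw[OF j, of e] e_sum by simp

lemma M_carrier: "y \<in> carrier M \<longleftrightarrow> y \<in> extensional {..<r} \<and> (\<forall>i<r. y i * e (j i) = y i)"
  by (auto simp: direct_sum_def PiE_iff)

lemma M_ops: "y \<oplus>\<^bsub>M\<^esub> z = (\<lambda>k\<in>{..<r}. y k + z k)" "b \<odot>\<^bsub>M\<^esub> y = (\<lambda>k\<in>{..<r}. b * y k)" "\<zero>\<^bsub>M\<^esub> = (\<lambda>k\<in>{..<r}. 0)"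
  by (simp_all add: direct_sum_def)

lemma left_module_M: "left_module M"
  by (intro left_module_direct_sum left_module_peirce)

lemma inc_in: "i < r \<Longrightarrow> inc i \<in> carrier M"
  using ejj by (auto simp: M_carrier inc_def)

lemma tot_inc: "i < r \<Longrightarrow> tot (inc i) = e (j i)"
  by (simp add: tot_def inc_def)

lemma tot_e: "y \<in> carrier M \<Longrightarrow> i < r \<Longrightarrow> tot y * e (j i) = y i"
proof -
  assume y: "y \<in> carrier M" and i: "i < r"
  have "tot y * e (j i) = (\<Sum>k<r. y k * e (j k) * e (j i))" using y by (simp add: tot_def sum_distrib_right M_carrier)
  also have "\<dots> = (\<Sum>k<r. if k = i then y i else 0)"
  proof (rule sum.cong[OF refl])
    fix k assume "k \<in> {..<r}"
    then have "y k * e (j k) * e (j i) = y k * (if k = i then e (j k) else 0)"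
      using ejj[of k i] i by (simp only: mult.assoc lessThan_iff)
    then show "y k * e (j k) * e (j i) = (if k = i then y i else 0)"
      using i y by (auto simp: M_carrier)
  qed
  finally show ?thesis using i by simp
qed

lemma rmul_in: "y \<in> carrier M \<Longrightarrow> rmul x y \<in> carrier M"
  using ejj by (auto simp: rmul_def M_carrier mult.assoc)

lemma tot_rmul: "y \<in> carrier M \<Longrightarrow> tot (rmul x y) = tot y * x"
  by (simp add: rmul_def tot_def[of "\<lambda>k\<in>{..<r}. _ k"] sum_ej flip: sum_distrib_left)

lemma rmul_hom: "rmul x \<in> mod_hom M M \<inter> extensional (carrier M)"
proof -
  interpret left_module M by (rule left_module_M)
  have ta: "tot (y \<oplus>\<^bsub>M\<^esub> z) = tot y + tot z" and ts: "tot (b \<odot>\<^bsub>M\<^esub> y) = b * tot y" for y z b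
    by (simp_all add: tot_def M_ops sum.distrib sum_distrib_left)
  have r: "rmul x y = (\<lambda>k\<in>{..<r}. tot y * x * e (j k))" if "y \<in> carrier M" for y using that by (simp add: rmul_def)
  show ?thesis
    unfolding mod_hom_def
  proof (intro IntI CollectI conjI ballI allI)
    show "rmul x \<in> carrier M \<rightarrow> carrier M" using rmul_in by blast
    show "rmul x \<in> extensional (carrier M)" by (simp add: rmul_def)
    fix y assume y: "y \<in> carrier M"
    show "rmul x (b \<odot>\<^bsub>M\<^esub> y) = b \<odot>\<^bsub>M\<^esub> rmul x y" for b
      unfolding r[OF y] r[OF smult_closed[OF y]] ts unfolding M_ops(2) by (auto simp: mult.assoc intro!: restrict_ext)
    fix z assume z: "z \<in> carrier M"
    show "rmul x (y \<oplus>\<^bsub>M\<^esub> z) = rmul x y \<oplus>\<^bsub>M\<^esub> rmul x z"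
      unfolding r[OF y] r[OF z] r[OF a_closed[OF y z]] ta unfolding M_ops(1) by (auto simp: distrib_right intro!: restrict_ext)
  qed
qed

lemma rmul_inject: "rmul x = rmul y \<Longrightarrow> x = y"
proof -
  assume eq: "rmul x = rmul y"
  have "e (j i) * x * e (j k) = e (j i) * y * e (j k)" if "i < r" "k < r" for i k
    using fun_cong[OF fun_cong[OF eq, of "inc i"], of k] inc_in[OF that(1)] tot_inc[OF that(1)] that by (simp add: rmul_def)
  then have "(\<Sum>i<r. \<Sum>k<r. e (j i) * x * e (j k)) = (\<Sum>i<r. \<Sum>k<r. e (j i) * y * e (j k))" by simp
  then show "x = y"
    by (simp only: sum_distrib_left[symmetric] sum_distrib_right[symmetric] sum_ej mult_1_right mult_1_left)
qed

text \<open>An endomorphism is determined by the images of the generators \<open>inc i\<close>.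
  Their components are its matrix entries, lying in \<open>e (j i) A e (j k)\<close>, and
  \<open>x\<close> is the sum of all entries.\<close>

lemma rmul_surj:
  assumes f: "f \<in> mod_hom M M \<inter> extensional (carrier M)"
  shows "\<exists>x. f = rmul x"
proof -
  interpret left_module M by (rule left_module_M)
  have fa: "f (y \<oplus>\<^bsub>M\<^esub> z) = f y \<oplus>\<^bsub>M\<^esub> f z" "f (b \<odot>\<^bsub>M\<^esub> y) = b \<odot>\<^bsub>M\<^esub> f y" and fc: "f y \<in> carrier M"
    if "y \<in> carrier M" "z \<in> carrier M" for y z b using f that by (auto simp: mod_hom_def)
  interpret f: module_hom' M M f using f by (intro module_hom'.intro module_hom'_axioms.intro left_module_M) simp
  define x where "x = (\<Sum>i<r. \<Sum>k<r. f (inc i) k)"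
  have part: "f (\<lambda>i\<in>{..<r}. if i < m then y i else 0) = (\<lambda>k\<in>{..<r}. \<Sum>i<m. y i * f (inc i) k)"
    if y: "y \<in> carrier M" and m: "m \<le> r" for y m
    using m
  proof (induction m)
    case 0
    have e0: "(\<lambda>i\<in>{..<r}. if i < 0 then y i else 0) = \<zero>\<^bsub>M\<^esub>" by (simp add: M_ops)
    show ?case unfolding e0 f.zero by (simp add: M_ops)
  next
    case (Suc m)
    let ?y = "\<lambda>i\<in>{..<r}. if i < m then y i else 0"
    have yc: "?y \<in> carrier M" using y by (auto simp: M_carrier)
    have mr: "m < r" using Suc.prems by simp
    have "(\<lambda>i\<in>{..<r}. if i < Suc m then y i else 0) = ?y \<oplus>\<^bsub>M\<^esub> (y m \<odot>\<^bsub>M\<^esub> inc m)"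
      using y mr by (auto simp: M_ops inc_def less_Suc_eq M_carrier intro!: restrict_ext)
    then have "f (\<lambda>i\<in>{..<r}. if i < Suc m then y i else 0) = f ?y \<oplus>\<^bsub>M\<^esub> (y m \<odot>\<^bsub>M\<^esub> f (inc m))"
      using fa(1)[OF yc smult_closed[OF inc_in[OF mr]]] fa(2)[OF inc_in[OF mr] inc_in[OF mr]] by simp
    also have "\<dots> = (\<lambda>k\<in>{..<r}. \<Sum>i<Suc m. y i * f (inc i) k)"
    proof -
      have IH: "f ?y = (\<lambda>k\<in>{..<r}. \<Sum>i<m. y i * f (inc i) k)" by (rule Suc.IH) (use Suc.prems in simp)
      show ?thesis unfolding IH unfolding M_ops by (auto intro!: restrict_ext)
    qed
    finally show ?case .
  qed
  have fy: "f y = (\<lambda>k\<in>{..<r}. \<Sum>i<r. y i * f (inc i) k)" if y: "y \<in> carrier M" for y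
  proof -
    have "y = (\<lambda>i\<in>{..<r}. if i < r then y i else 0)" using y by (auto simp: M_carrier extensional_def fun_eq_iff)
    then show ?thesis using part[OF y order_refl] by metis
  qed
  have ef: "e (j i) * f (inc i') k = (if i = i' then f (inc i') k else 0)" if "i < r" "i' < r" "k < r" for i i' k
  proof -
    have "e (j i) \<odot>\<^bsub>M\<^esub> inc i' = (if i = i' then inc i' else \<zero>\<^bsub>M\<^esub>)"
      using that ejj by (auto simp: M_ops inc_def intro!: restrict_ext)
    then have "e (j i) \<odot>\<^bsub>M\<^esub> f (inc i') = (if i = i' then f (inc i') else \<zero>\<^bsub>M\<^esub>)"
      using fa(2)[OF inc_in inc_in, of i' i' "e (j i)"] that f.zero by auto
    from fun_cong[OF this, of k] show ?thesis using that by (auto simp: M_ops)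
  qed
  have fe: "f (inc i) k * e (j k') = (if k = k' then f (inc i) k else 0)" if "i < r" "k < r" "k' < r" for i k k'
  proof -
    have "f (inc i) k * e (j k) = f (inc i) k" using fc[OF inc_in inc_in] that by (simp add: M_carrier)
    then have "f (inc i) k * e (j k') = f (inc i) k * (e (j k) * e (j k'))" by (simp flip: mult.assoc)
    then show ?thesis using ejj that \<open>f (inc i) k * e (j k) = f (inc i) k\<close> by (cases "k = k'") auto
  qed
  have exe: "e (j i) * x * e (j k) = f (inc i) k" if "i < r" "k < r" for i k
  proof -
    have "e (j i) * x * e (j k) = (\<Sum>i'<r. \<Sum>k'<r. (e (j i) * f (inc i') k') * e (j k))"
      by (simp add: x_def sum_distrib_left sum_distrib_right)
    also have "\<dots> = (\<Sum>i'<r. \<Sum>k'<r. if i' = i then if k' = k then f (inc i) k else 0 else 0)"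
      using that ef fe by (intro sum.cong refl) auto
    also have "\<dots> = (\<Sum>i'<r. if i' = i then (\<Sum>k'<r. if k' = k then f (inc i) k else 0) else 0)"
      by (intro sum.cong refl) simp
    finally show ?thesis using that by simp
  qed
  have "f = rmul x"
  proof
    fix y show "f y = rmul x y"
    proof (cases "y \<in> carrier M")
      case True
      have "(\<Sum>i<r. y i * f (inc i) k) = tot y * x * e (j k)" if k: "k < r" for k
      proof -
        have "(\<Sum>i<r. y i * f (inc i) k) = (\<Sum>i<r. (y i * e (j i)) * x * e (j k))"
          using exe k by (intro sum.cong refl) (simp add: mult.assoc)
        also have "\<dots> = tot y * x * e (j k)" using True by (simp add: M_carrier tot_def sum_distrib_right)
        finally show ?thesis .
      qed
      then show ?thesis using fy[OF True] True by (auto simp: rmul_def intro!: restrict_ext)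
    next
      case False
      then show ?thesis using f by (simp add: rmul_def extensional_def)
    qed
  qed
  then show ?thesis by blast
qed

lemma R_iff: "y \<in> R m \<longleftrightarrow> y \<in> carrier M \<and> (\<forall>i<r. y i \<in> G (d (j i) + m))"
  by (auto simp: direct_sum_grading_def shift_def peirce_grading_def M_carrier PiE_iff)

text \<open>After the shift the generator \<open>inc i\<close> has degree \<open>- d (j i)\<close>;
  this is the source of the difference of shifts in \<open>shifted\<close>.\<close>

lemma rmul_degree: "rmul x \<in> endgr_degree M R l \<longleftrightarrow> x \<in> shifted d l"
proof
  assume "rmul x \<in> endgr_degree M R l"
  then have deg: "rmul x y \<in> R (l + m)" if "y \<in> R m" for y m
    using that by (auto simp: endgr_degree_def graded_hom_def shift_def)
  have "e (j i) * x * e (j k) \<in> G (l + d (j k) - d (j i))" if "i < r" "k < r" for i k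
  proof -
    have "inc i \<in> R (- d (j i))" using that inc_in e_G0 jI G.G_0 by (auto simp: R_iff inc_def)
    from deg[OF this] have "rmul x (inc i) k \<in> G (d (j k) + (l + - d (j i)))" using that by (simp add: R_iff)
    then show ?thesis using that inc_in tot_inc by (simp add: rmul_def algebra_simps)
  qed
  moreover have "\<exists>k<r. i = j k" if "i \<in> I" for i using j that by (auto simp: bij_betw_def)
  ultimately show "x \<in> shifted d l" unfolding shifted_def by blast
next
  assume x: "x \<in> shifted d l"
  have "rmul x y \<in> R (l + m)" if y: "y \<in> R m" for y m
  proof -
    have yc: "y \<in> carrier M" using y by (simp add: R_iff)
    have "tot y * x * e (j k) \<in> G (d (j k) + (l + m))" if k: "k < r" for k
    proof -
      have "tot y * x * e (j k) = (\<Sum>i<r. y i * (e (j i) * x * e (j k)))"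
        using yc by (simp add: tot_def M_carrier sum_distrib_right flip: mult.assoc)
      also have "\<dots> \<in> G (d (j k) + (l + m))"
      proof (intro G.G_sum)
        fix i assume "i \<in> {..<r}"
        then have "y i \<in> G (d (j i) + m)" "e (j i) * x * e (j k) \<in> G (l + d (j k) - d (j i))"
          using y x jI k by (auto simp: R_iff shifted_def)
        then have "y i * (e (j i) * x * e (j k)) \<in> G ((d (j i) + m) + (l + d (j k) - d (j i)))" by (rule G.G_mult)
        then show "y i * (e (j i) * x * e (j k)) \<in> G (d (j k) + (l + m))" by (simp add: algebra_simps)
      qed
      finally show ?thesis .
    qed
    then show ?thesis using rmul_in[OF yc] yc by (simp add: R_iff rmul_def)
  qed
  then show "rmul x \<in> endgr_degree M R l" using rmul_hom by (auto simp: endgr_degree_def graded_hom_def shift_def)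
qed

lemma rmul_add: "rmul (x + y) = (\<lambda>v\<in>carrier M. rmul x v \<oplus>\<^bsub>M\<^esub> rmul y v)"
  by (auto simp: rmul_def M_ops distrib_left distrib_right intro!: restrict_ext)

lemma finsum_rmul:
  assumes "finite L" "v \<in> carrier M"
  shows "(\<Oplus>\<^bsub>M\<^esub>l\<in>L. rmul (x l) v) = rmul (\<Sum>l\<in>L. x l) v"
proof -
  interpret left_module M by (rule left_module_M)
  show ?thesis
    using assms(1)
  proof (induction L rule: finite_induct)
    case empty
    show ?case using assms(2) by (simp add: rmul_def M_ops)
  next
    case (insert l L)
    have "(\<Oplus>\<^bsub>M\<^esub>l\<in>insert l L. rmul (x l) v) = rmul (x l) v \<oplus>\<^bsub>M\<^esub> (\<Oplus>\<^bsub>M\<^esub>l\<in>L. rmul (x l) v)"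
      using insert rmul_in[OF assms(2)] by (intro finsum_insert) auto
    then show ?case using insert assms(2) by (simp add: rmul_add)
  qed
qed

text \<open>The isomorphism is \<theta> followed by \<open>rmul\<close>: every endomorphism is a
  right multiplication, and composing right multiplications reverses the order, which the opposite
  algebra undoes.\<close>

lemma graded_morita_equivalentI:
  assumes G': "grading scale G'" and bij: "bij \<theta>" and add: "\<And>x y. \<theta> (x + y) = \<theta> x + \<theta> y"
    and mult: "\<And>x y. \<theta> (x * y) = \<theta> x * \<theta> y" and one: "\<theta> 1 = 1" and sc: "\<And>c x. \<theta> (scale c x) = scale c (\<theta> x)"
    and deg: "\<And>x l. x \<in> G' l \<Longrightarrow> \<theta> x \<in> shifted d l"
  shows "graded_morita_equivalent scale G G'"
proof -
  interpret H: graded_algebra scale G' using G' by unfold_locales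
  interpret M: left_module M by (rule left_module_M)
  have t0: "\<theta> 0 = 0" using add[of 0 0] by simp
  have ts: "\<theta> (\<Sum>s\<in>S. g s) = (\<Sum>s\<in>S. \<theta> (g s))" for g :: "int \<Rightarrow> 'a" and S
    by (induction S rule: infinite_finite_induct) (simp_all add: t0 add)
  \<comment> \<open>Only one inclusion is given. The homogeneous components of a preimage are mapped
    into the independent spaces \<open>shifted d m\<close>, so the images of all components except
    that of degree \<open>l\<close> vanish.\<close>
  have deg': "\<theta> ` G' l = shifted d l" for l
  proof (intro equalityI subsetI)
    fix z assume z: "z \<in> shifted d l"
    obtain x where x: "z = \<theta> x" using bij by (metis bij_pointE)
    let ?S = "insert l {m. H.hcomp x m \<noteq> 0}"
    have fin: "finite ?S" using H.finite_comp[of x] by simp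
    have "x = (\<Sum>m\<in>?S. H.hcomp x m)" by (rule H.comp_sum'[OF fin]) blast
    then have zs: "z = (\<Sum>m\<in>?S. \<theta> (H.hcomp x m))" using x ts[of "H.hcomp x" ?S] by simp
    let ?f = "\<lambda>m. \<theta> (H.hcomp x m) - (if m = l then z else 0)"
    have "\<theta> (H.hcomp x m) = 0" if m: "m \<noteq> l" "m \<in> ?S" for m
    proof -
      have "?f m = 0"
      proof (rule shifted_disjoint[OF fin, of ?f d m])
        show "?f k \<in> shifted d k" for k
          using deg[OF H.comp_in, of x k] z subspace_diff[OF subspace_shifted] subspace_0[OF subspace_shifted] by auto
        show "(\<Sum>m\<in>?S. ?f m) = 0" using zs fin by (simp add: sum_subtractf)
      qed (use m in simp)
      then show ?thesis using m by simp
    qed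
    then have "z = (\<Sum>m\<in>?S. if m = l then \<theta> (H.hcomp x l) else 0)"
      by (subst zs) (intro sum.cong refl, auto)
    then have "z = \<theta> (H.hcomp x l)" using fin by (simp add: sum.delta)
    then show "z \<in> \<theta> ` G' l" using H.comp_in by blast
  qed (use deg in auto)
  let ?E = "op_algebra (endgr scale M R)"
  define \<phi> where "\<phi> x = rmul (\<theta> x)" for x
  have E: "carrier ?E = carrier (endgr scale M R)" "\<And>f g. f \<otimes>\<^bsub>?E\<^esub> g = compose (carrier M) g f"
    "\<And>f g. f \<oplus>\<^bsub>?E\<^esub> g = (\<lambda>x\<in>carrier M. f x \<oplus>\<^bsub>M\<^esub> g x)" "\<one>\<^bsub>?E\<^esub> = (\<lambda>x\<in>carrier M. x)"
    "\<And>c f. c \<odot>\<^bsub>?E\<^esub> f = (\<lambda>x\<in>carrier M. scale c 1 \<odot>\<^bsub>M\<^esub> f x)"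
    by (simp_all add: op_algebra_def endgr_def)
  have \<phi>E: "\<phi> x \<in> carrier ?E" for x
  proof -
    let ?L = "{m. H.hcomp x m \<noteq> 0}" and ?h = "\<lambda>m. rmul (\<theta> (H.hcomp x m))"
    have "\<forall>v\<in>carrier M. rmul (\<theta> x) v = (\<Oplus>\<^bsub>M\<^esub>l\<in>?L. ?h l v)"
    proof
      fix v assume v: "v \<in> carrier M"
      have "\<theta> x = (\<Sum>m\<in>?L. \<theta> (H.hcomp x m))" using ts[of "H.hcomp x" ?L] H.comp_sum[of x] by simp
      then show "rmul (\<theta> x) v = (\<Oplus>\<^bsub>M\<^esub>l\<in>?L. ?h l v)" using finsum_rmul[OF H.finite_comp v, of "\<lambda>m. \<theta> (H.hcomp x m)" x] by simp
    qed
    moreover have "?h m \<in> graded_hom M R M (shift R m)" for m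
      using rmul_degree[of "\<theta> (H.hcomp x m)" m] deg[OF H.comp_in] by (simp add: endgr_degree_def)
    ultimately have "\<exists>L h. finite L \<and> (\<forall>l\<in>L. h l \<in> graded_hom M R M (shift R l)) \<and> (\<forall>v\<in>carrier M. rmul (\<theta> x) v = (\<Oplus>\<^bsub>M\<^esub>l\<in>L. h l v))"
      using H.finite_comp[of x] by (intro exI[of _ ?L] exI[of _ ?h]) simp
    then show ?thesis unfolding E(1) \<phi>_def using rmul_hom[of "\<theta> x"] by (simp add: endgr_def)
  qed
  have inj: "inj \<phi>"
    using rmul_inject bij unfolding \<phi>_def by (auto intro!: injI dest!: rmul_inject simp: bij_def inj_eq)
  have surj: "\<exists>x. f = \<phi> x" if f: "f \<in> mod_hom M M \<inter> extensional (carrier M)" for f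
  proof -
    obtain z where z: "f = rmul z" using rmul_surj[OF f] by blast
    obtain x where "z = \<theta> x" using bij by (metis bij_pointE)
    then show ?thesis using z by (auto simp: \<phi>_def)
  qed
  have bijE: "bij_betw \<phi> UNIV (carrier ?E)"
    unfolding bij_betw_def
  proof (intro conjI equalityI subsetI)
    fix f assume "f \<in> carrier ?E"
    then have "f \<in> mod_hom M M \<inter> extensional (carrier M)" unfolding E(1) by (simp add: endgr_def)
    then show "f \<in> range \<phi>" using surj by blast
  qed (use inj \<phi>E in auto)
  have "\<phi> \<in> ring_hom (algebra_of scale) ?E"
  proof (rule ring_hom_memI)
    show "\<phi> x \<in> carrier ?E" for x by (rule \<phi>E)
    fix x y
    have "rmul (\<theta> y) (rmul (\<theta> x) v) = rmul (\<theta> x * \<theta> y) v" if "v \<in> carrier M" for v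
      using tot_rmul[OF that, of "\<theta> x"] rmul_in[OF that, of "\<theta> x"] that by (simp add: rmul_def[of "\<theta> y"] rmul_def[of "\<theta> x * \<theta> y"] mult.assoc)
    then show "\<phi> (x \<otimes>\<^bsub>algebra_of scale\<^esub> y) = \<phi> x \<otimes>\<^bsub>?E\<^esub> \<phi> y"
      unfolding E(2) \<phi>_def using rmul_hom[of "\<theta> x * \<theta> y"]
      by (intro ext) (auto simp: algebra_of_def mult compose_def extensional_def)
    show "\<phi> (x \<oplus>\<^bsub>algebra_of scale\<^esub> y) = \<phi> x \<oplus>\<^bsub>?E\<^esub> \<phi> y"
      unfolding E(3) \<phi>_def by (simp add: algebra_of_def add rmul_add)
  next
    have "(\<lambda>k\<in>{..<r}. tot v * 1 * e (j k)) = v" if "v \<in> carrier M" for v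
      using tot_e[OF that] that by (auto simp: M_carrier extensional_def fun_eq_iff)
    then show "\<phi> \<one>\<^bsub>algebra_of scale\<^esub> = \<one>\<^bsub>?E\<^esub>"
      unfolding E(4) \<phi>_def by (auto simp: algebra_of_def one rmul_def intro!: restrict_ext)
  qed
  then have "\<phi> \<in> ring_iso (algebra_of scale) ?E" using bijE by (simp add: ring_iso_def algebra_of_def)
  moreover have "\<phi> (c \<odot>\<^bsub>algebra_of scale\<^esub> x) = c \<odot>\<^bsub>?E\<^esub> \<phi> x" for c x
    unfolding E(5) \<phi>_def
    by (auto simp: algebra_of_def sc rmul_def M_ops scale_one_mult scale_mult_left scale_mult_right intro!: restrict_ext)
  moreover have "\<phi> ` G' l = endgr_degree M R l" for l
  proof (intro equalityI subsetI)
    fix f assume "f \<in> \<phi> ` G' l"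
    then show "f \<in> endgr_degree M R l" using deg by (auto simp: \<phi>_def rmul_degree)
  next
    fix f assume f: "f \<in> endgr_degree M R l"
    then have "f \<in> mod_hom M M \<inter> extensional (carrier M)" by (simp add: endgr_degree_def graded_hom_def)
    then obtain z where z: "f = rmul z" using rmul_surj by blast
    then have "z \<in> \<theta> ` G' l" using f rmul_degree deg' by simp
    then show "f \<in> \<phi> ` G' l" using z by (auto simp: \<phi>_def)
  qed
  ultimately have "graded_algebra_iso (algebra_of scale) G' ?E (endgr_degree M R)"
    unfolding graded_algebra_iso_def by blast
  then show ?thesis
    unfolding graded_morita_equivalent_def Let_def
    using projective_indecomposables_peirce[OF j] module_grading_peirce[OF jI] top_in_degree_0_peirce[OF jI]
    by (intro exI[of _ r] exI[of _ P] exI[of _ "\<lambda>i. peirce_grading (j i)"] exI[of _ "\<lambda>i. d (j i)"]) simp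
qed

end

text \<open>Multiplication by a homogeneous central element of nonzero degree is an endomorphism of nonzero
  degree, whereas everything has degree \<open>0\<close> in a grading equivalent to the trivial one.\<close>

lemma not_equivalent_trivial:
  assumes z: "z \<in> G s" "s \<noteq> 0" "\<And>x. z * x = x * z" and i: "i \<in> I" "z * e i \<noteq> 0"
  shows "\<not> graded_morita_equivalent scale G trivial_grading"
proof
  assume "graded_morita_equivalent scale G trivial_grading"
  then obtain r and P :: "nat \<Rightarrow> ('a, 'a) module" and Q and d :: "nat \<Rightarrow> int"
    where A: "projective_indecomposables r P \<and> (\<forall>i<r. module_grading G (P i) (Q i) \<and> top_in_degree_0 (P i) (Q i)) \<and>
      graded_algebra_iso (algebra_of scale) trivial_grading
        (op_algebra (endgr scale (direct_sum r P) (direct_sum_grading r (\<lambda>i. shift (Q i) (d i)))))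
        (endgr_degree (direct_sum r P) (direct_sum_grading r (\<lambda>i. shift (Q i) (d i))))"
    unfolding graded_morita_equivalent_def Let_def by (elim exE)
  note P = A[THEN conjunct1] and iso = A[THEN conjunct2, THEN conjunct2]
  have Q: "module_grading G (P i) (Q i)" if "i < r" for i using A that by simp
  let ?M = "direct_sum r P" and ?R = "direct_sum_grading r (\<lambda>i. shift (Q i) (d i))"
  have lP: "left_module (P i)" if "i < r" for i using Q[OF that] by (simp add: module_grading_def)
  interpret M: left_module ?M by (rule left_module_direct_sum[OF lP])
  obtain \<phi> where ring: "\<phi> \<in> ring_iso (algebra_of scale) (op_algebra (endgr scale ?M ?R))"
    and deg: "\<And>l. \<phi> ` trivial_grading l = endgr_degree ?M ?R l"
    using iso by (auto simp: graded_algebra_iso_def)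
  have h: "\<phi> \<in> ring_hom (algebra_of scale) (op_algebra (endgr scale ?M ?R))" using ring by (simp add: ring_iso_def)
  have c: "0 \<in> carrier (algebra_of scale)" by (simp add: algebra_of_def)
  \<comment> \<open>The endomorphism ring enters here as a bare record, so the image of 0 is
    identified as the zero map from 0 + 0 = 0 and additivity.\<close>
  have phi_eq: "\<phi> 0 = (\<lambda>x\<in>carrier ?M. \<phi> 0 x \<oplus>\<^bsub>?M\<^esub> \<phi> 0 x)"
    using ring_hom_add[OF h c c] by (simp add: algebra_of_def op_algebra_def endgr_def)
  have phi0: "\<phi> 0 x = \<phi> 0 x \<oplus>\<^bsub>?M\<^esub> \<phi> 0 x" if "x \<in> carrier ?M" for x
    using trans[OF fun_cong[OF phi_eq] restrict_apply'[OF that]] .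
  define f where "f = (\<lambda>x\<in>carrier ?M. z \<odot>\<^bsub>?M\<^esub> x)"
  have fh: "f \<in> mod_hom ?M ?M \<inter> extensional (carrier ?M)"
    using M.smult_closed M.smult_r_distr M.smult_assoc[symmetric] z(3) M.a_closed by (auto simp: f_def mod_hom_def)
  have "f y \<in> ?R (s + m)" if y: "y \<in> ?R m" for y m
  proof -
    have Qc: "Q i l \<subseteq> carrier (P i)" if "i < r" for i l
      using Q[OF that] additive_subgroup.a_subset unfolding module_grading_def by blast
    have yc: "y \<in> carrier ?M" using y Qc by (auto simp: direct_sum_grading_def shift_def direct_sum_def PiE_iff)
    have "z \<odot>\<^bsub>P i\<^esub> y i \<in> Q i (d i + (s + m))" if i: "i < r" for i
    proof -
      have "y i \<in> Q i (d i + m)" using y i by (auto simp: direct_sum_grading_def shift_def PiE_iff)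
      then have "z \<odot>\<^bsub>P i\<^esub> y i \<in> Q i (s + (d i + m))" using Q[OF i] z(1) unfolding module_grading_def by blast
      then show ?thesis by (simp add: algebra_simps)
    qed
    then show ?thesis using yc by (auto simp: f_def direct_sum_def direct_sum_grading_def shift_def)
  qed
  then have "f \<in> endgr_degree ?M ?R s" using fh by (auto simp: endgr_degree_def graded_hom_def shift_def)
  then have "f \<in> \<phi> ` {0}" using deg[of s] z(2) by (simp add: trivial_grading_def)
  then have "f x = f x \<oplus>\<^bsub>?M\<^esub> f x" if "x \<in> carrier ?M" for x using phi0[OF that] by simp
  then have f0: "f x = \<zero>\<^bsub>?M\<^esub>" if "x \<in> carrier ?M" for x
    using that fh M.add.l_cancel_one[of "f x" "f x"] by (auto simp: mod_hom_def)
  have zP: "z \<odot>\<^bsub>P k\<^esub> p = \<zero>\<^bsub>P k\<^esub>" if k: "k < r" and p: "p \<in> carrier (P k)" for k p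
  proof -
    let ?x = "\<lambda>i\<in>{..<r}. if i = k then p else \<zero>\<^bsub>P i\<^esub>"
    have "\<zero>\<^bsub>P i\<^esub> \<in> carrier (P i)" if "i < r" for i
    proof -
      interpret left_module "P i" by (rule lP[OF that])
      show ?thesis by simp
    qed
    then have x: "?x \<in> carrier ?M" using p by (auto simp: direct_sum_def)
    from fun_cong[OF f0[OF x], of k] show ?thesis using x k by (auto simp: f_def direct_sum_def)
  qed
  \<comment> \<open>The ideal \<open>A (e i)\<close> is isomorphic to one of the \<open>P k\<close>,
    on which \<open>z\<close> acts as zero; this forces z e i = 0.\<close>
  have "e i * e i = e i" using e_mult[OF i(1) i(1)] by simp
  from projective_peirce[OF this] prim_idem_imp_indecomposable[OF prim_e[OF i(1)]]
  have "projective (peirce (e i))" "indecomposable (peirce (e i))" .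
  then obtain k where k: "k < r" "mod_iso (peirce (e i)) (P k)"
    using P unfolding projective_indecomposables_def by blast
  obtain g where g: "g \<in> mod_hom (peirce (e i)) (P k)" "bij_betw g (carrier (peirce (e i))) (carrier (P k))"
    using k(2) by (auto simp: mod_iso_def)
  interpret g: module_hom' "peirce (e i)" "P k" g
    using g(1) left_module_peirce lP[OF k(1)] by (simp add: module_hom'_def module_hom'_axioms_def)
  have ei: "e i \<in> carrier (peirce (e i))" using e_mult i(1) by simp
  have "g (z * e i) = \<zero>\<^bsub>P k\<^esub>" using g.smult[OF ei, of z] zP[OF k(1) g.closed[OF ei]] by simp
  moreover have "z * e i \<in> carrier (peirce (e i))" using ei by (simp add: mult.assoc)
  ultimately have "z * e i = 0" using g.inj_iff g(2) by (auto simp: bij_betw_def)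
  then show False using i(2) by simp
qed

end


section \<open>Uniqueness of the grading\<close>

text \<open>Each \<open>S j\<close> is a line for some character. Different edges give different
  characters because such a module is determined by its character, and every character occurs
  because the \<open>S j\<close> are complete. So the edges can index the characters.\<close>

lemma ex_edge_characters:
  fixes scale :: "'k::alg_closed_field \<Rightarrow> 'a::ring_1 \<Rightarrow> 'a" and S :: "'i \<Rightarrow> ('a, 'a set) module"
  assumes basic: "basic_algebra scale"
    and simple: "\<And>j. j \<in> J \<Longrightarrow> simple_mod (S j)"
    and noniso: "\<And>i j. i \<in> J \<Longrightarrow> j \<in> J \<Longrightarrow> mod_iso (S i) (S j) \<Longrightarrow> i = j"
    and complete: "\<And>T :: ('a, 'a set) module. simple_mod T \<Longrightarrow> \<exists>j\<in>J. mod_iso T (S j)"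
  shows "\<exists>\<chi>. split_algebra scale J \<chi> \<and> (\<forall>e. idem_algebra scale J \<chi> e \<longrightarrow> (\<forall>j\<in>J. idem_algebra.has_char scale \<chi> (S j) j))"
proof -
  obtain r :: nat and f where "basic_idems scale {..<r} f" using basic_algebra_idems[OF basic] by blast
  then interpret B: basic_idems scale "{..<r}" f .
  interpret split_algebra scale "{..<r}" B.ch by (rule B.split_algebra)
  obtain e0 where "idem_family e0" using ex_idempotents by (auto simp: idem_family_def)
  then interpret A: idem_algebra scale "{..<r}" B.ch e0 by unfold_locales
  have "\<exists>i<r. A.has_char (S j) i" if "j \<in> J" for j using A.simple_has_char[OF simple[OF that]] by auto
  then obtain g where g: "\<And>j. j \<in> J \<Longrightarrow> g j < r \<and> A.has_char (S j) (g j)" by metis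
  have "bij_betw g J {..<r}"
    unfolding bij_betw_def
  proof (intro conjI inj_onI equalityI subsetI)
    fix i j assume ij: "i \<in> J" "j \<in> J" "g i = g j"
    have "A.has_char (S i) (g i)" "A.has_char (S j) (g i)" using g[OF ij(1)] g[OF ij(2)] ij(3) by simp_all
    then have "mod_iso (S i) (S j)" by (rule A.has_char_iso)
    then show "i = j" using noniso ij by simp
  next
    fix i assume i: "i \<in> {..<r}"
    obtain T :: "('a, 'a set) module" where T: "simple_mod T" "A.has_char T i" using A.ex_simple_with_char[OF i] by blast
    obtain j where j: "j \<in> J" "mod_iso T (S j)" using complete[OF T(1)] by blast
    have "i = g j" using A.has_char_iso_unique[OF T(2) _ i _ j(2), of "g j"] g[OF j(1)] by simp
    then show "i \<in> g ` J" using j(1) by blast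
  qed (use g in auto)
  then have sp: "split_algebra scale J (\<lambda>j. B.ch (g j))" by (rule split_algebra_reindex[OF split_algebra_axioms])
  have "idem_algebra.has_char scale (\<lambda>j. B.ch (g j)) (S j) j" if e: "idem_algebra scale J (\<lambda>j. B.ch (g j)) e" and j: "j \<in> J" for e j
  proof -
    interpret E: idem_algebra scale J "\<lambda>j. B.ch (g j)" e by fact
    \<comment> \<open>The property refers to the characters alone, so it is the same for every
      idempotent family.\<close>
    have "E.has_char (S j) j \<longleftrightarrow> A.has_char (S j) (g j)" unfolding E.has_char_def A.has_char_def ..
    then show ?thesis using g[OF j] by simp
  qed
  then show ?thesis using sp by blast
qed

lemma ex_brauer_chains:
  fixes scale :: "'k::field \<Rightarrow> 'a::ring_1 \<Rightarrow> 'a" and \<Gamma> :: "'v brauer_tree"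
    and S :: "'v set \<Rightarrow> ('a, 'a set) module" and P :: "'v set \<Rightarrow> ('a, 'a) module"
  assumes \<Gamma>: "brauer_tree \<Gamma>" and A: "sym_idem_algebra scale (edges \<Gamma>) \<chi> e t"
    and S: "\<And>j. j \<in> edges \<Gamma> \<Longrightarrow> idem_algebra.has_char scale \<chi> (S j) j"
    and P: "\<And>j. j \<in> edges \<Gamma> \<Longrightarrow> projective_cover (P j) (S j) \<and> mod_soc (P j) \<subseteq> mod_rad (P j) \<and>
         (let H = quot (restr (P j) (mod_rad (P j))) (mod_soc (P j)) in
          \<forall>v w. j = {v, w} \<longrightarrow>
            (\<exists>U. internal_direct_sum H (U v) (U w) \<and>
              (\<forall>u\<in>{v, w}. uniserial (restr H (U u)) \<and>
                composition_factors_from_top (restr H (U u)) (map S (factor_edges \<Gamma> j u)))))"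
  shows "\<exists>C. brauer_chains \<Gamma> scale \<chi> e t C"
proof -
  interpret \<Gamma>: brauer_tree \<Gamma> by fact
  interpret A: sym_idem_algebra scale "edges \<Gamma>" \<chi> e t by fact
  have "\<exists>C. A.soc j \<in> A.rad \<and> (\<forall>u\<in>j. A.chain (A.socle j) (C u) (factor_edges \<Gamma> j u) \<and> C u 0 \<subseteq> A.rad_at j) \<and>
    (\<forall>u\<in>j. \<forall>w\<in>j. u \<noteq> w \<longrightarrow> (\<forall>x\<in>A.rad_at j. \<exists>y\<in>C u 0. \<exists>z\<in>C w 0. x = y + z))"
    if j: "j \<in> edges \<Gamma>" for j
  proof -
    obtain u where "u \<in> j" using \<Gamma>.edge_ends[OF j] by blast
    then obtain w where w: "w \<noteq> u" "j = {u, w}" using \<Gamma>.edge_cases[OF j] by metis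
    let ?H = "quot (restr (P j) (mod_rad (P j))) (mod_soc (P j))"
    obtain U where ds: "internal_direct_sum ?H (U u) (U w)"
      and U: "\<And>v. v \<in> {u, w} \<Longrightarrow> uniserial (restr ?H (U v)) \<and> composition_factors_from_top (restr ?H (U v)) (map S (factor_edges \<Gamma> j v))"
      using P[OF j] w(2) unfolding Let_def by blast
    have fe: "k \<in> edges \<Gamma> \<and> A.has_char (S k) k" if "k \<in> set (factor_edges \<Gamma> j v)" "v \<in> j" for k v
      using that S \<Gamma>.nx_incident[OF j that(2)] by (auto simp: factor_edges_def)
    have uj: "u \<in> j" "w \<in> j" using w(2) by auto
    have U2: "uniserial (restr ?H (U u))" "composition_factors_from_top (restr ?H (U u)) (map S (factor_edges \<Gamma> j u))"
      "uniserial (restr ?H (U w))" "composition_factors_from_top (restr ?H (U w)) (map S (factor_edges \<Gamma> j w))"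
      using U[of u] U[of w] by simp_all
    have pc: "projective_cover (P j) (S j)" "mod_soc (P j) \<subseteq> mod_rad (P j)" using P[OF j] by auto
    from A.edge_chains[OF j S[OF j] pc ds U2 fe[OF _ uj(1)] fe[OF _ uj(2)]]
    obtain C D where soc: "A.soc j \<in> A.rad" and C: "A.chain (A.socle j) C (factor_edges \<Gamma> j u)" "C 0 \<subseteq> A.rad_at j"
      and D: "A.chain (A.socle j) D (factor_edges \<Gamma> j w)" "D 0 \<subseteq> A.rad_at j"
      and sum: "\<And>x. x \<in> A.rad_at j \<Longrightarrow> \<exists>a\<in>C 0. \<exists>b\<in>D 0. x = a + b"
      by blast
    \<comment> \<open>\<open>C_sub\<close> concerns one end at a time, whereas \<open>C_sum\<close>
      asks for the decomposition with the two ends in either order.\<close>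
    have sum': "\<exists>b\<in>D 0. \<exists>a\<in>C 0. x = b + a" if "x \<in> A.rad_at j" for x using sum[OF that] add.commute by metis
    show ?thesis
      by (rule exI[of _ "\<lambda>v. if v = u then C else D"]) (use soc C D sum sum' w in auto)
  qed
  then obtain C where C: "\<And>j. j \<in> edges \<Gamma> \<Longrightarrow> A.soc j \<in> A.rad \<and> (\<forall>u\<in>j. A.chain (A.socle j) (C j u) (factor_edges \<Gamma> j u) \<and> C j u 0 \<subseteq> A.rad_at j) \<and>
    (\<forall>u\<in>j. \<forall>w\<in>j. u \<noteq> w \<longrightarrow> (\<forall>x\<in>A.rad_at j. \<exists>y\<in>C j u 0. \<exists>z\<in>C j w 0. x = y + z))"
    by metis
  have "brauer_chains \<Gamma> scale \<chi> e t C"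
    by unfold_locales (use C in blast)+
  then show ?thesis by blast
qed

lemma (in fd_algebra) grading_trivial: "grading scale trivial_grading"
  unfolding grading_def
proof (intro conjI allI ballI)
  show "subspace (trivial_grading i)" for i by (auto simp: trivial_grading_def subspace_def)
  fix x :: 'a
  let ?f = "\<lambda>i :: int. if i = 0 then x else 0"
  have f: "{i. ?f i \<noteq> 0} \<subseteq> {0}" by auto
  show "\<exists>!f. (\<forall>i. f i \<in> trivial_grading i) \<and> finite {i. f i \<noteq> 0} \<and> x = (\<Sum>i | f i \<noteq> 0. f i)"
  proof (rule ex1I[of _ ?f])
    have "(\<Sum>i | ?f i \<noteq> 0. ?f i) = (\<Sum>i\<in>{0}. ?f i)" by (rule sum.mono_neutral_left) (use f in auto)
    then show "(\<forall>i. ?f i \<in> trivial_grading i) \<and> finite {i. ?f i \<noteq> 0} \<and> x = (\<Sum>i | ?f i \<noteq> 0. ?f i)"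
      using finite_subset[OF f] by (simp add: trivial_grading_def)
  next
    fix g :: "int \<Rightarrow> 'a"
    assume g: "(\<forall>i. g i \<in> trivial_grading i) \<and> finite {i. g i \<noteq> 0} \<and> x = (\<Sum>i | g i \<noteq> 0. g i)"
    then have g0: "g i = 0" if "i \<noteq> 0" for i using that by (metis singletonD trivial_grading_def)
    have "(\<Sum>i | g i \<noteq> 0. g i) = (\<Sum>i\<in>{0}. g i)" by (rule sum.mono_neutral_left) (use g0 in auto)
    then have "g 0 = x" using g by simp
    then show "g = ?f" using g0 by auto
  qed
next
  fix i j and x y :: 'a
  assume "x \<in> trivial_grading i" "y \<in> trivial_grading j"
  then show "x * y \<in> trivial_grading (i + j)" by (auto simp: trivial_grading_def split: if_splits)
qed

context brauer_system
begin

text \<open>A maximal path times a nonempty path is 0 on either side, and since it returns to its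
  starting edge, the idempotents act on it in the same way from both sides.\<close>

lemma socle_central:
  assumes j: "j \<in> edges \<Gamma>" "u \<in> j"
  shows "b u j (per u) * x = x * b u j (per u)"
proof -
  let ?s = "b u j (per u)"
  have *: "?s * b v i k = b v i k * ?s" if i: "i \<in> edges \<Gamma>" "v \<in> i" for v i k
  proof -
    have p: "per u \<noteq> 0" using per_pos[OF j] by simp
    have "?s * b v i k = (if k = 0 \<and> i = j then ?s else 0)"
      using b_mult[OF j i, of "per u" k] p b_beyond[OF i, of "per u + k"] by (cases "k = 0") auto
    moreover have "b v i k * ?s = (if k = 0 \<and> i = j then ?s else 0)"
      using b_mult[OF i j, of k "per u"] p nx_per[OF j] b_beyond[OF j, of "k + per u"] by (cases "k = 0") auto
    ultimately show ?thesis by simp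
  qed
  have "x \<in> span {b u j k | u j k. j \<in> edges \<Gamma> \<and> u \<in> j \<and> k \<le> per u}" using path_span by simp
  then show ?thesis
  proof (induction rule: span_induct_alt)
    case (step c y z)
    then obtain v i k where "y = b v i k" "i \<in> edges \<Gamma>" "v \<in> i" by blast
    then have "?s * y = y * ?s" using * by simp
    then show ?case using step(2) by (simp add: distrib_left distrib_right scale_mult_left scale_mult_right)
  qed simp
qed

lemma b_degree:
  assumes G: "graded_algebra scale G" and e0: "\<And>j. j \<in> edges \<Gamma> \<Longrightarrow> e j \<in> G 0"
    and a: "\<And>j u. j \<in> edges \<Gamma> \<Longrightarrow> u \<in> j \<Longrightarrow> a u j \<in> G (\<delta> u j)" and j: "j \<in> edges \<Gamma>" "u \<in> j"
  shows "b u j k \<in> G (pdeg \<delta> u j k)"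
proof (induction k)
  case 0
  then show ?case using e0[OF j(1)] by (simp add: pdeg_def)
next
  case (Suc k)
  interpret G: graded_algebra scale G by fact
  have "a u ((nx u ^^ k) j) \<in> G (\<delta> u ((nx u ^^ k) j))" using a nx_incident[OF j, of k] by blast
  from G.G_mult[OF this Suc] show ?case by (simp add: pdeg_def add.commute)
qed

lemma balanced_degree:
  assumes G: "graded_algebra scale G" and e0: "\<And>j. j \<in> edges \<Gamma> \<Longrightarrow> e j \<in> G 0"
    and a: "\<And>j u. j \<in> edges \<Gamma> \<Longrightarrow> u \<in> j \<Longrightarrow> a u j \<in> G (\<delta> u j)"
  shows "balanced \<delta>"
  unfolding balanced_def
proof (intro ballI)
  interpret G: graded_algebra scale G by fact
  fix j u w assume j: "j \<in> edges \<Gamma>" "u \<in> j" "w \<in> j"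
  have "b u j (per u) \<in> G (pdeg \<delta> u j (per u))" by (rule b_degree[OF G e0 a j(1,2)])
  moreover have "b u j (per u) \<in> G (pdeg \<delta> w j (per w))"
    using b_degree[OF G e0 a j(1,3), of "per w"] path_top[OF j] by simp
  ultimately show "pdeg \<delta> u j (per u) = pdeg \<delta> w j (per w)" using path_top_ne[OF j(1,2)] by (rule G.G_disjoint)
qed

text \<open>The obstruction is a maximal path: it is central, its degree is the multiplicity, hence
  nonzero, and \<open>e j\<close> does not kill it.\<close>

lemma path_grading_not_trivial:
  assumes "split_algebra scale (edges \<Gamma>) \<chi>" and idem: "split_algebra.idem_family (edges \<Gamma>) \<chi> e"
  shows "\<not> graded_morita_equivalent scale (path_grading base_deg 1) trivial_grading"
proof -
  have hom: "b u j k \<in> path_grading base_deg 1 (pdeg base_deg u j k)" if "j \<in> edges \<Gamma>" "u \<in> j" for u j k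
    using b_homog[OF balanced_base that, of k 1] by simp
  interpret split_algebra scale "edges \<Gamma>" \<chi> by fact
  interpret graded_idem_algebra scale "edges \<Gamma>" \<chi> e "path_grading base_deg 1"
    using idem grading_path_grading[OF balanced_base] hom[of _ _ 0] endp
    by unfold_locales (auto simp: pdeg_def)
  obtain j where j: "j \<in> edges \<Gamma>" using edges_nonempty by blast
  let ?z = "b (endp j) j (per (endp j))"
  note jj = j endp[OF j]
  have "?z \<in> path_grading base_deg 1 (int (multiplicity \<Gamma>))" using hom[OF jj, of "per (endp j)"] pdeg_base_per[OF jj] by simp
  moreover have "int (multiplicity \<Gamma>) \<noteq> 0" using multiplicity_pos by simp
  moreover have "?z * e j \<noteq> 0" using b_right[OF jj] path_top_ne[OF jj] by simp
  ultimately show ?thesis by (rule not_equivalent_trivial[OF _ _ socle_central[OF jj] j])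
qed

end

text \<open>The map \<theta> sends paths of the reference system to paths in arrows homogeneous for
  \<open>G\<close>. The potential from \<open>balanced_potential\<close> is exactly the shift that
  turns the \<open>G\<close>-degree of a path into \<open>c\<close> times its base degree.\<close>

lemma two_systems_equivalent:
  fixes scale :: "'k::field \<Rightarrow> 'a::ring_1 \<Rightarrow> 'a"
  assumes "two_systems \<Gamma> scale e0 a0 e a" and "graded_idem_algebra scale (edges \<Gamma>) \<chi> e G"
    and a: "\<And>j u. j \<in> edges \<Gamma> \<Longrightarrow> u \<in> j \<Longrightarrow> a u j \<in> G (\<delta> u j)"
  shows "\<exists>c. graded_morita_equivalent scale G (brauer_system.path_grading \<Gamma> scale e0 a0 (brauer_tree.base_deg \<Gamma>) c)"
proof -
  interpret W: two_systems \<Gamma> scale e0 a0 e a by fact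
  interpret W': two_systems \<Gamma> scale e a e0 a0 using assms(1) by (simp add: two_systems_def)
  interpret E: graded_idem_algebra scale "edges \<Gamma>" \<chi> e G by fact
  have deg: "W.T.b u j k \<in> G (W.S.pdeg \<delta> u j k)" if "j \<in> edges \<Gamma>" "u \<in> j" for u j k
    by (rule W.T.b_degree[OF E.G.graded_algebra_axioms E.e_G0 a that])
  have "W.S.balanced \<delta>" by (rule W.T.balanced_degree[OF E.G.graded_algebra_axioms E.e_G0 a])
  from W.S.balanced_potential[OF this]
  obtain c d where cd: "\<And>j u k. j \<in> edges \<Gamma> \<Longrightarrow> u \<in> j \<Longrightarrow>
      W.S.pdeg \<delta> u j k + d ((next_edge \<Gamma> u ^^ k) j) - d j = c * W.S.pdeg W.S.base_deg u j k" by blast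
  have sh: "W.T.b u j k \<in> E.shifted d (c * W.S.pdeg W.S.base_deg u j k)" if j: "j \<in> edges \<Gamma>" "u \<in> j" for u j k
    unfolding E.shifted_def
  proof (intro CollectI ballI)
    fix i i' assume i: "i \<in> edges \<Gamma>" "i' \<in> edges \<Gamma>"
    let ?h = "(next_edge \<Gamma> u ^^ k) j" and ?b = "W.T.b u j k"
    have h: "?h \<in> edges \<Gamma>" using W.S.nx_incident[OF j] by blast
    have "e i * ?b * e i' = (e i * e ?h) * ?b * (e j * e i')"
      using W.T.b_left[OF j, of k] W.T.b_right[OF j, of k] by (metis mult.assoc)
    then have eq: "e i * ?b * e i' = (if i = ?h \<and> i' = j then ?b else 0)"
      using E.e_mult[OF i(1) h] E.e_mult[OF j(1) i(2)] W.T.b_left[OF j, of k] W.T.b_right[OF j, of k] by auto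
    show "e i * ?b * e i' \<in> G (c * W.S.pdeg W.S.base_deg u j k + d i' - d i)"
    proof (cases "i = ?h \<and> i' = j")
      case True
      then have "c * W.S.pdeg W.S.base_deg u j k + d i' - d i = W.S.pdeg \<delta> u j k" using cd[OF j, of k] by simp
      then show ?thesis using deg[OF j, of k] eq True by simp
    next
      case False
      then show ?thesis using eq E.G.G_0 by auto
    qed
  qed
  obtain r and j :: "nat \<Rightarrow> 'b set" where j: "bij_betw j {..<r} (edges \<Gamma>)"
    using ex_bij_betw_nat_finite[OF W.S.finite_edges] by (auto simp: atLeast0LessThan)
  have bij: "bij W.\<theta>"
    by (rule o_bij[of W'.\<theta>]) (use two_systems_inverse[OF W.two_systems_axioms] two_systems_inverse[OF W'.two_systems_axioms] in \<open>auto simp: fun_eq_iff\<close>)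
  have "graded_morita_equivalent scale G (W.S.path_grading W.S.base_deg c)"
    by (rule E.graded_morita_equivalentI[OF j W.S.grading_path_grading[OF W.S.balanced_base] bij
          W.theta_add W.theta_mult W.theta_one W.theta_scale])
      (rule W.theta_homog[OF sh E.subspace_shifted])
  then show ?thesis by blast
qed

theorem theorem11p8:
  fixes scale :: "'k::alg_closed_field \<Rightarrow> 'a::ring_1 \<Rightarrow> 'a"
    and \<Gamma> :: "'v brauer_tree"
  assumes "CHAR('k) > 0"
    and "brauer_tree \<Gamma>"
    and "basic_algebra scale"
    and "brauer_tree_algebra scale \<Gamma>"
  shows "\<exists>G\<^sub>0. grading scale G\<^sub>0 \<and> \<not> graded_morita_equivalent scale G\<^sub>0 trivial_grading \<and>
    (\<forall>G. grading scale G \<and> \<not> graded_morita_equivalent scale G trivial_grading \<longrightarrow>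
      (\<exists>G' c. grading scale G' \<and> graded_morita_equivalent scale G G' \<and> rescaling c G' G\<^sub>0))"
proof -
  obtain S :: "'v set \<Rightarrow> ('a, 'a set) module" and P :: "'v set \<Rightarrow> ('a, 'a) module"
    where SP: "(\<forall>j\<in>edges \<Gamma>. simple_mod (S j)) \<and>
       (\<forall>i\<in>edges \<Gamma>. \<forall>j\<in>edges \<Gamma>. mod_iso (S i) (S j) \<longrightarrow> i = j) \<and>
       (\<forall>T :: ('a, 'a set) module. simple_mod T \<longrightarrow> (\<exists>j\<in>edges \<Gamma>. mod_iso T (S j))) \<and>
       (\<forall>j\<in>edges \<Gamma>. projective_cover (P j) (S j) \<and> mod_soc (P j) \<subseteq> mod_rad (P j) \<and>
         (let H = quot (restr (P j) (mod_rad (P j))) (mod_soc (P j)) in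
          \<forall>v w. j = {v, w} \<longrightarrow>
            (\<exists>U. internal_direct_sum H (U v) (U w) \<and>
              (\<forall>u\<in>{v, w}. uniserial (restr H (U u)) \<and>
                composition_factors_from_top (restr H (U u)) (map S (factor_edges \<Gamma> j u))))))"
    using assms(4)[unfolded brauer_tree_algebra_def, THEN conjunct2] by (elim exE)
  have sym: "symmetric_algebra scale" using assms(4) by (simp add: brauer_tree_algebra_def)
  note S1 = SP[THEN conjunct1] and S2 = SP[THEN conjunct2, THEN conjunct1]
    and S3 = SP[THEN conjunct2, THEN conjunct2, THEN conjunct1] and P1 = SP[THEN conjunct2, THEN conjunct2, THEN conjunct2]
  interpret \<Gamma>: brauer_tree \<Gamma> by fact
  obtain \<chi> where split: "split_algebra scale (edges \<Gamma>) \<chi>"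
    and char: "\<And>e j. idem_algebra scale (edges \<Gamma>) \<chi> e \<Longrightarrow> j \<in> edges \<Gamma> \<Longrightarrow> idem_algebra.has_char scale \<chi> (S j) j"
    using ex_edge_characters[OF assms(3), of "edges \<Gamma>" S] S1 S2 S3 by blast
  interpret split_algebra scale "edges \<Gamma>" \<chi> by (rule split)
  obtain t where t: "\<And>x y. t (x + y) = t x + t y" "\<And>c x. t (scale c x) = c * t x" "\<And>x y. t (x * y) = t (y * x)"
    "\<And>x. (\<And>y. t (y * x) = 0) \<Longrightarrow> x = 0" "\<And>f. Vector_Spaces.linear scale (*) f \<Longrightarrow> \<exists>x. \<forall>y. f y = t (y * x)"
    using symmetric_algebra_form[OF sym] by blast
  have system: "\<exists>e a \<delta>. brauer_system \<Gamma> scale e a \<and> graded_idem_algebra scale (edges \<Gamma>) \<chi> e G \<and>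
      (\<forall>j\<in>edges \<Gamma>. \<forall>u\<in>j. a u j \<in> G (\<delta> u j))" if G: "grading scale G" for G
  proof -
    have gG: "graded_algebra scale G" using G by unfold_locales
    then interpret G: graded_algebra scale G .
    obtain e where e: "idem_family e" "\<And>i. i \<in> edges \<Gamma> \<Longrightarrow> e i \<in> G 0" using homogeneous_idem_family[OF gG] by blast
    interpret E: sym_idem_algebra scale "edges \<Gamma>" \<chi> e t
      using e t by unfold_locales blast+
    obtain C where "brauer_chains \<Gamma> scale \<chi> e t C"
      using ex_brauer_chains[OF assms(2) E.sym_idem_algebra_axioms char[OF E.idem_algebra_axioms] bspec[OF P1]] by blast
    then interpret C: brauer_chains \<Gamma> scale \<chi> e t C .
    have "\<forall>u j. \<exists>x d. j \<in> edges \<Gamma> \<and> u \<in> j \<longrightarrow> C.arrow u j x \<and> x \<in> G d"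
      using C.ex_homogeneous_arrow[OF gG e(2)] by blast
    then obtain a \<delta> where a: "\<And>u j. j \<in> edges \<Gamma> \<Longrightarrow> u \<in> j \<Longrightarrow> C.arrow u j (a u j) \<and> a u j \<in> G (\<delta> u j)" by metis
    have "brauer_arrows \<Gamma> scale \<chi> e t C a" using a by unfold_locales blast
    then obtain \<nu> where \<nu>: "brauer_system \<Gamma> scale e (\<lambda>u j. scale (\<nu> u) (a u j))" using brauer_arrows_system by blast
    have "graded_idem_algebra scale (edges \<Gamma>) \<chi> e G" using e(2) by unfold_locales
    then show ?thesis using \<nu> a G.G_scale by blast
  qed
  \<comment> \<open>The reference system may come from any grading; the trivial one is always at
    hand.\<close>
  obtain e0 a0 where sys0: "brauer_system \<Gamma> scale e0 a0" and gi0: "graded_idem_algebra scale (edges \<Gamma>) \<chi> e0 trivial_grading"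
    using system[OF grading_trivial] by blast
  interpret Z: brauer_system \<Gamma> scale e0 a0 by (rule sys0)
  interpret Z0: graded_idem_algebra scale "edges \<Gamma>" \<chi> e0 trivial_grading by (rule gi0)
  let ?G0 = "Z.path_grading \<Gamma>.base_deg"
  show ?thesis
  proof (rule exI[of _ "?G0 1"], intro conjI allI impI)
    show "grading scale (?G0 1)" by (rule Z.grading_path_grading[OF \<Gamma>.balanced_base])
    show "\<not> graded_morita_equivalent scale (?G0 1) trivial_grading"
      by (rule Z.path_grading_not_trivial[OF split Z0.idem_family])
    fix G assume G: "grading scale G \<and> \<not> graded_morita_equivalent scale G trivial_grading"
    have "grading scale G" using G by (rule conjunct1)
    from system[OF this] obtain e a \<delta> where W: "brauer_system \<Gamma> scale e a \<and> graded_idem_algebra scale (edges \<Gamma>) \<chi> e G \<and>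
      (\<forall>j\<in>edges \<Gamma>. \<forall>u\<in>j. a u j \<in> G (\<delta> u j))" by (elim exE)
    note sys = W[THEN conjunct1] and gi = W[THEN conjunct2, THEN conjunct1]
    have a: "\<And>j u. j \<in> edges \<Gamma> \<Longrightarrow> u \<in> j \<Longrightarrow> a u j \<in> G (\<delta> u j)" using W by simp
    have "two_systems \<Gamma> scale e0 a0 e a" using sys0 sys by (simp add: two_systems_def)
    from two_systems_equivalent[OF this gi a]
    obtain c where c: "graded_morita_equivalent scale G (?G0 c)" by (rule exE)
    \<comment> \<open>For \<open>c = 0\<close> the equivalent grading would be the trivial
      one.\<close>
    have "c \<noteq> 0"
    proof
      assume "c = 0"
      then show False using c G Z.path_grading_0 by simp
    qed
    \<comment> \<open>The equivalence precedes the division by \<open>c\<close>, because the degrees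
      of \<open>G\<close> itself need not be multiples of \<open>c\<close>.\<close>
    then show "\<exists>G' c. grading scale G' \<and> graded_morita_equivalent scale G G' \<and> rescaling c G' (?G0 1)"
      using c Z.grading_path_grading[OF \<Gamma>.balanced_base] Z.rescaling_path_grading
      by (intro exI[of _ "?G0 c"] exI[of _ c]) simp
  qed
qed

end
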